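(* Let $\Lambda$ be a basic finite dimensional algebra over an algebraically closed field $K$ whose Jacobson radical $J$ satisfies $J^2=0$. Suppose $T=\bigoplus_{1\le i\le n}S_i^{t_i}$ is realizable with respect to the dimension vector $\mathbf d=(d_1,\dots,d_n)$, and let $P$ be the projective cover of $T$. If $JP=\bigoplus_{1\le i\le n}S_i^{p_i}$, then $\mathfrak{Grass}^T_{\mathbf d}$ is the following direct product of classical vector space Grassmannians: $$\mathfrak{Grass}^T_{\mathbf d}\ \cong\ \prod_{1\le i\le n}\operatorname{Gr}(d_i-t_i,K^{p_i}).$$
   Context: $S_1,\dots,S_n$ are the simple left $\Lambda$-modules up to isomorphism. A semisimple module $T$ is realizable with respect to $\mathbf d$ if there exists a $\Lambda$-module $M$ with $M/JM\cong T$ and dimension vector $\mathbf d$. $\mathfrak{Grass}^T_{\mathbf d}$ is the closed subvariety of the Grassmannian of $(\dim P-\sum_i d_i)$-dimensional subspaces of $P$ consisting of those subspaces $C$ which are $\Lambda$-submodules of $JP$ such that $P/C$ has dimension vector $\mathbf d$ (and hence top $T$). $\operatorname{Gr}(k,V)$ is the Grassmannian of $k$-dimensional subspaces of the vector space $V$; $\cong$ means isomorphism of varieties. *)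

theory Defs
  imports
    "Jordan_Normal_Form.VS_Connect"
    "Jordan_Normal_Form.DL_Submatrix"
    "HOL-Algebra.Generated_Groups"
    "HOL-Algebra.Ideal_Product"
    "HOL-Library.Poly_Mapping"
    "HOL-Analysis.Abstract_Topology"
begin

section \<open>Algebras and left modules\<close>

text \<open>A field \<open>K\<close> is a type of class \<^class>\<open>field\<close>; as a HOL-Algebra ring it is
  \<open>class_ring\<close>.  A \<open>K\<close>-algebra is a record carrying both a ring structure and a scalar
  multiplication.  (The library locale \<^locale>\<open>algebra\<close> only covers commutative algebras.)\<close>

locale fd_algebra = ring A for A :: "('k::field, 'a) module" (structure) +
  assumes vectorspace: "vectorspace class_ring A"
    and fin_dim: "vectorspace.fin_dim class_ring A"
    and smult_mult_left: "\<lbrakk>x \<in> carrier A; y \<in> carrier A\<rbrakk> \<Longrightarrow>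
          c \<odot>\<^bsub>A\<^esub> (x \<otimes> y) = (c \<odot>\<^bsub>A\<^esub> x) \<otimes> y"
    and smult_mult_right: "\<lbrakk>x \<in> carrier A; y \<in> carrier A\<rbrakk> \<Longrightarrow>
          c \<odot>\<^bsub>A\<^esub> (x \<otimes> y) = x \<otimes> (c \<odot>\<^bsub>A\<^esub> y)"

text \<open>Left modules over a not necessarily commutative ring; the library locale
  \<^locale>\<open>module\<close> requires a commutative one.  The fields \<open>mult\<close> and \<open>one\<close> of the module
  record are never used.\<close>

locale left_module = R?: ring R + M?: abelian_group M
  for R :: "('a, 'y) ring_scheme" (structure)
    and M :: "('a, 'm, 'z) module_scheme" (structure) +
  assumes smult_closed: "\<lbrakk>a \<in> carrier R; x \<in> carrier M\<rbrakk> \<Longrightarrow> a \<odot>\<^bsub>M\<^esub> x \<in> carrier M"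
    and smult_l_distr: "\<lbrakk>a \<in> carrier R; b \<in> carrier R; x \<in> carrier M\<rbrakk> \<Longrightarrow>
          (a \<oplus> b) \<odot>\<^bsub>M\<^esub> x = a \<odot>\<^bsub>M\<^esub> x \<oplus>\<^bsub>M\<^esub> b \<odot>\<^bsub>M\<^esub> x"
    and smult_r_distr: "\<lbrakk>a \<in> carrier R; x \<in> carrier M; y \<in> carrier M\<rbrakk> \<Longrightarrow>
          a \<odot>\<^bsub>M\<^esub> (x \<oplus>\<^bsub>M\<^esub> y) = a \<odot>\<^bsub>M\<^esub> x \<oplus>\<^bsub>M\<^esub> a \<odot>\<^bsub>M\<^esub> y"
    and smult_assoc: "\<lbrakk>a \<in> carrier R; b \<in> carrier R; x \<in> carrier M\<rbrakk> \<Longrightarrow>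
          (a \<otimes> b) \<odot>\<^bsub>M\<^esub> x = a \<odot>\<^bsub>M\<^esub> (b \<odot>\<^bsub>M\<^esub> x)"
    and smult_one: "x \<in> carrier M \<Longrightarrow> \<one> \<odot>\<^bsub>M\<^esub> x = x"

definition regular_module :: "('a, 'z) ring_scheme \<Rightarrow> ('a, 'a) module" where
  "regular_module R = \<lparr>carrier = carrier R, monoid.mult = monoid.mult R, one = one R,
     zero = zero R, add = add R, smult = monoid.mult R\<rparr>"

definition restrict_scalars ::
    "('k::field, 'a) module \<Rightarrow> ('a, 'm) module \<Rightarrow> ('k, 'm) module" where
  "restrict_scalars A M = \<lparr>carrier = carrier M, monoid.mult = monoid.mult M, one = one M,
     zero = zero M, add = add M, smult = (\<lambda>c x. (c \<odot>\<^bsub>A\<^esub> \<one>\<^bsub>A\<^esub>) \<odot>\<^bsub>M\<^esub> x)\<rparr>"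

definition module_iso ::
    "('a, 'z) ring_scheme \<Rightarrow> ('a, 'm) module \<Rightarrow> ('a, 'n) module \<Rightarrow> bool" where
  "module_iso R M N \<longleftrightarrow> (\<exists>f \<in> LinearCombinations.module_hom R M N. bij_betw f (carrier M) (carrier N))"

text \<open>On cosets, \<open>r \<odot> (N + x) = N + r \<odot> x\<close>; the union below avoids choosing \<open>x\<close>.\<close>

definition quotient_module :: "('a, 'm) module \<Rightarrow> 'm set \<Rightarrow> ('a, 'm set) module" where
  "quotient_module M N = \<lparr>carrier = a_rcosets\<^bsub>M\<^esub> N, monoid.mult = undefined, one = undefined,
     zero = N, add = set_add M, smult = (\<lambda>r X. \<Union>x\<in>X. N +>\<^bsub>M\<^esub> (r \<odot>\<^bsub>M\<^esub> x))\<rparr>"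

text \<open>Used for finite index sets only, where direct sum and direct product agree.\<close>

definition direct_sum :: "'i set \<Rightarrow> ('i \<Rightarrow> ('a, 'm) module) \<Rightarrow> ('a, 'i \<Rightarrow> 'm) module" where
  "direct_sum I M = \<lparr>carrier = (\<Pi>\<^sub>E i\<in>I. carrier (M i)), monoid.mult = undefined, one = undefined,
     zero = (\<lambda>i\<in>I. \<zero>\<^bsub>M i\<^esub>), add = (\<lambda>x y. \<lambda>i\<in>I. x i \<oplus>\<^bsub>M i\<^esub> y i),
     smult = (\<lambda>r x. \<lambda>i\<in>I. r \<odot>\<^bsub>M i\<^esub> x i)\<rparr>"

definition semisimple_sum ::
    "nat \<Rightarrow> (nat \<Rightarrow> ('a, 's) module) \<Rightarrow> (nat \<Rightarrow> nat) \<Rightarrow> ('a, nat \<times> nat \<Rightarrow> 's) module" where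
  "semisimple_sum n S t = direct_sum {(i, j). i < n \<and> j < t i} (\<lambda>(i, j). S i)"

text \<open>\<open>I M\<close>: all finite sums of products \<open>a \<odot> x\<close> with \<open>a \<in> I\<close> and \<open>x \<in> M\<close>.\<close>

definition ideal_smult :: "'a set \<Rightarrow> ('a, 'm) module \<Rightarrow> 'm set" where
  "ideal_smult I M =
     generate (add_monoid M) {a \<odot>\<^bsub>M\<^esub> x | a x. a \<in> I \<and> x \<in> carrier M}"

definition maximal_left_ideal :: "'a set \<Rightarrow> ('a, 'z) ring_scheme \<Rightarrow> bool" where
  "maximal_left_ideal I R \<longleftrightarrow>
     Module.submodule I R (regular_module R) \<and> I \<noteq> carrier R \<and>
     (\<forall>I'. Module.submodule I' R (regular_module R) \<and> I \<subseteq> I' \<longrightarrow> I' = I \<or> I' = carrier R)"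

definition jacobson_radical :: "('a, 'z) ring_scheme \<Rightarrow> 'a set" where
  "jacobson_radical R = carrier R \<inter> \<Inter>{I. maximal_left_ideal I R}"

definition simple_module :: "('a, 'z) ring_scheme \<Rightarrow> ('a, 'm) module \<Rightarrow> bool" where
  "simple_module R M \<longleftrightarrow>
     left_module R M \<and> carrier M \<noteq> {\<zero>\<^bsub>M\<^esub>} \<and>
     (\<forall>N. Module.submodule N R M \<longrightarrow> N = {\<zero>\<^bsub>M\<^esub>} \<or> N = carrier M)"

definition idempotent :: "('a, 'z) ring_scheme \<Rightarrow> 'a \<Rightarrow> bool" where
  "idempotent R e \<longleftrightarrow> e \<in> carrier R \<and> e \<otimes>\<^bsub>R\<^esub> e = e"

definition primitive_idempotent :: "('a, 'z) ring_scheme \<Rightarrow> 'a \<Rightarrow> bool" where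
  "primitive_idempotent R e \<longleftrightarrow>
     idempotent R e \<and> e \<noteq> \<zero>\<^bsub>R\<^esub> \<and>
     (\<forall>f g. idempotent R f \<and> idempotent R g \<and> f \<otimes>\<^bsub>R\<^esub> g = \<zero>\<^bsub>R\<^esub> \<and> g \<otimes>\<^bsub>R\<^esub> f = \<zero>\<^bsub>R\<^esub> \<and>
        e = f \<oplus>\<^bsub>R\<^esub> g \<longrightarrow> f = \<zero>\<^bsub>R\<^esub> \<or> g = \<zero>\<^bsub>R\<^esub>)"

definition principal_module :: "('a, 'z) ring_scheme \<Rightarrow> 'a \<Rightarrow> ('a, 'a) module" where
  "principal_module R e = (regular_module R)\<lparr>carrier := {r \<otimes>\<^bsub>R\<^esub> e | r. r \<in> carrier R}\<rparr>"

text \<open>There is a complete set of primitive orthogonal idempotents \<open>e\<^sub>i\<close>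
  whose indecomposable projective modules \<open>R e\<^sub>i\<close> are pairwise non-isomorphic.\<close>

definition basic_ring :: "('a, 'z) ring_scheme \<Rightarrow> bool" where
  "basic_ring R \<longleftrightarrow>
     (\<exists>(m::nat) e. (\<forall>i<m. primitive_idempotent R (e i)) \<and>
        (\<forall>i<m. \<forall>j<m. i \<noteq> j \<longrightarrow> e i \<otimes>\<^bsub>R\<^esub> e j = \<zero>\<^bsub>R\<^esub>) \<and>
        finsum R e {..<m} = \<one>\<^bsub>R\<^esub> \<and>
        (\<forall>i<m. \<forall>j<m. i \<noteq> j \<longrightarrow>
           \<not> module_iso R (principal_module R (e i)) (principal_module R (e j))))"

text \<open>In the next definitions quantification over modules ranges over modules with elements
  in \<open>'k vec\<close>.  Every finite dimensional module is isomorphic to one of these, and all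
  simple modules over a finite dimensional algebra are finite dimensional.\<close>

definition simples_up_to_iso ::
    "('k::field, 'a) module \<Rightarrow> nat \<Rightarrow> (nat \<Rightarrow> ('a, 's) module) \<Rightarrow> bool" where
  "simples_up_to_iso A n S \<longleftrightarrow>
     (\<forall>i<n. simple_module A (S i)) \<and>
     (\<forall>i<n. \<forall>j<n. i \<noteq> j \<longrightarrow> \<not> module_iso A (S i) (S j)) \<and>
     (\<forall>N :: ('a, 'k vec) module. simple_module A N \<longrightarrow> (\<exists>i<n. module_iso A N (S i)))"

text \<open>\<open>d i\<close> is the multiplicity of \<open>S i\<close> in a composition series of \<open>M\<close>.\<close>

definition has_dimension_vector ::
    "('a, 'z) ring_scheme \<Rightarrow> nat \<Rightarrow> (nat \<Rightarrow> ('a, 's) module) \<Rightarrow> ('a, 'm) module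
      \<Rightarrow> (nat \<Rightarrow> nat) \<Rightarrow> bool" where
  "has_dimension_vector R n S M d \<longleftrightarrow>
     (\<exists>(l::nat) N. N 0 = {\<zero>\<^bsub>M\<^esub>} \<and> N l = carrier M \<and>
        (\<forall>j\<le>l. Module.submodule (N j) R M) \<and>
        (\<forall>j<l. N j \<subseteq> N (Suc j) \<and>
           simple_module R (quotient_module (M\<lparr>carrier := N (Suc j)\<rparr>) (N j))) \<and>
        (\<forall>i<n. d i = card {j. j < l \<and>
           module_iso R (quotient_module (M\<lparr>carrier := N (Suc j)\<rparr>) (N j)) (S i)}))"

definition realizable ::
    "('k::field, 'a) module \<Rightarrow> nat \<Rightarrow> (nat \<Rightarrow> ('a, 's) module) \<Rightarrow> ('a, 't) module
      \<Rightarrow> (nat \<Rightarrow> nat) \<Rightarrow> bool" where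
  "realizable A n S T d \<longleftrightarrow>
     (\<exists>M :: ('a, 'k vec) module. left_module A M \<and>
        module_iso A (quotient_module M (ideal_smult (jacobson_radical A) M)) T \<and>
        has_dimension_vector A n S M d)"

text \<open>For finitely generated \<open>P\<close> over a finite dimensional algebra, lifting along
  surjections of finite dimensional modules is enough for projectivity (lift the identity of
  \<open>P\<close> to a free module of finite rank).  A projective cover of a finite dimensional module
  is finitely generated, because its kernel is superfluous.\<close>

definition projective_module :: "('k::field, 'a) module \<Rightarrow> ('a, 'p) module \<Rightarrow> bool" where
  "projective_module A P \<longleftrightarrow>
     left_module A P \<and>
     (\<forall>(M :: ('a, 'k vec) module) (N :: ('a, 'k vec) module) g f.
        left_module A M \<and> left_module A N \<and>
        g \<in> LinearCombinations.module_hom A M N \<and> g ` carrier M = carrier N \<and> f \<in> LinearCombinations.module_hom A P N \<longrightarrow>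
        (\<exists>h \<in> LinearCombinations.module_hom A P M. \<forall>x \<in> carrier P. g (h x) = f x))"

definition superfluous :: "('a, 'z) ring_scheme \<Rightarrow> ('a, 'm) module \<Rightarrow> 'm set \<Rightarrow> bool" where
  "superfluous R M N \<longleftrightarrow>
     Module.submodule N R M \<and>
     (\<forall>X. Module.submodule X R M \<and> N <+>\<^bsub>M\<^esub> X = carrier M \<longrightarrow> X = carrier M)"

definition projective_cover ::
    "('k::field, 'a) module \<Rightarrow> ('a, 'p) module \<Rightarrow> ('a, 't) module \<Rightarrow> bool" where
  "projective_cover A P T \<longleftrightarrow>
     projective_module A P \<and>
     (\<exists>f \<in> LinearCombinations.module_hom A P T. f ` carrier P = carrier T \<and>
        superfluous A P {x \<in> carrier P. f x = \<zero>\<^bsub>T\<^esub>})"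


section \<open>Varieties with homogeneous coordinates\<close>

text \<open>A polynomial in variables from \<open>'v\<close> is an element of
  \<open>('v \<Rightarrow>\<^sub>0 nat) \<Rightarrow>\<^sub>0 'k\<close>.\<close>

definition poly_eval :: "(('v \<Rightarrow>\<^sub>0 nat) \<Rightarrow>\<^sub>0 'k::field) \<Rightarrow> ('v \<Rightarrow> 'k) \<Rightarrow> 'k" where
  "poly_eval F x = (\<Sum>m\<in>Poly_Mapping.keys F. Poly_Mapping.lookup F m *
     (\<Prod>v\<in>Poly_Mapping.keys m. x v ^ Poly_Mapping.lookup m v))"

definition homogeneous :: "nat \<Rightarrow> (('v \<Rightarrow>\<^sub>0 nat) \<Rightarrow>\<^sub>0 'k::field) \<Rightarrow> bool" where
  "homogeneous e F \<longleftrightarrow> (\<forall>m\<in>Poly_Mapping.keys F.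
     (\<Sum>v\<in>Poly_Mapping.keys m. Poly_Mapping.lookup m v) = e)"

text \<open>A variety embedded in projective space: \<open>coords X x\<close> is a representative of the
  homogeneous coordinates of the point \<open>x\<close>.  Only homogeneous polynomials are ever
  evaluated at it, so its scaling is irrelevant.  The type \<open>'v\<close> of coordinate indices may be
  infinite; in all instances below only finitely many coordinates are not identically zero.\<close>

record ('x, 'v, 'k) pvariety =
  points :: "'x set"
  coords :: "'x \<Rightarrow> 'v \<Rightarrow> 'k"

definition zariski :: "('x, 'v, 'k::field) pvariety \<Rightarrow> 'x topology" where
  "zariski X = topology_generated_by
     {{x \<in> points X. poly_eval F (coords X x) \<noteq> 0} | F. \<exists>e. homogeneous e F}"

definition regular_on :: "('x, 'v, 'k::field) pvariety \<Rightarrow> 'x set \<Rightarrow> ('x \<Rightarrow> 'k) \<Rightarrow> bool" where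
  "regular_on X U h \<longleftrightarrow>
     (\<forall>x\<in>U. \<exists>V e F G. openin (zariski X) V \<and> x \<in> V \<and> V \<subseteq> U \<and>
        homogeneous e F \<and> homogeneous e G \<and>
        (\<forall>y\<in>V. poly_eval G (coords X y) \<noteq> 0 \<and>
           h y = poly_eval F (coords X y) / poly_eval G (coords X y)))"

definition variety_morphism ::
    "('x, 'v, 'k::field) pvariety \<Rightarrow> ('y, 'w, 'k) pvariety \<Rightarrow> ('x \<Rightarrow> 'y) \<Rightarrow> bool" where
  "variety_morphism X Y \<phi> \<longleftrightarrow>
     continuous_map (zariski X) (zariski Y) \<phi> \<and>
     (\<forall>U h. openin (zariski Y) U \<and> regular_on Y U h \<longrightarrow>
        regular_on X {x \<in> points X. \<phi> x \<in> U} (h \<circ> \<phi>))"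

definition variety_iso ::
    "('x, 'v, 'k::field) pvariety \<Rightarrow> ('y, 'w, 'k) pvariety \<Rightarrow> bool" (infix \<open>\<cong>\<^sub>v\<^sub>a\<^sub>r\<close> 50) where
  "X \<cong>\<^sub>v\<^sub>a\<^sub>r Y \<longleftrightarrow>
     (\<exists>\<phi> \<psi>. variety_morphism X Y \<phi> \<and> variety_morphism Y X \<psi> \<and>
        (\<forall>x\<in>points X. \<psi> (\<phi> x) = x) \<and> (\<forall>y\<in>points Y. \<phi> (\<psi> y) = y))"

text \<open>The product of \<open>X 0, \<dots>, X (n - 1)\<close>, in the Segre embedding.\<close>

definition product_variety ::
    "nat \<Rightarrow> (nat \<Rightarrow> ('x, 'v, 'k::field) pvariety) \<Rightarrow> (nat \<Rightarrow> 'x, nat \<Rightarrow> 'v, 'k) pvariety" where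
  "product_variety n X = \<lparr>points = (\<Pi>\<^sub>E i\<in>{..<n}. points (X i)),
     coords = (\<lambda>x J. if J \<in> extensional {..<n} then \<Prod>i<n. coords (X i) (x i) (J i) else 0)\<rparr>"


section \<open>Grassmannians\<close>

definition ordered_basis :: "('k::field, 'v) module \<Rightarrow> 'v list \<Rightarrow> bool" where
  "ordered_basis V bs \<longleftrightarrow> distinct bs \<and> vectorspace.basis class_ring V (set bs)"

text \<open>The rows of \<open>B\<close> are the coordinates, with respect to the basis \<open>bs\<close> of \<open>V\<close>, of the
  members of a basis of \<open>W\<close>.\<close>

definition represents_subspace ::
    "('k::field, 'v) module \<Rightarrow> 'v list \<Rightarrow> 'v set \<Rightarrow> 'k mat \<Rightarrow> bool" where
  "represents_subspace V bs W B \<longleftrightarrow>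
     (\<exists>ws. ordered_basis (V\<lparr>carrier := W\<rparr>) ws \<and> B \<in> carrier_mat (length ws) (length bs) \<and>
        (\<forall>r<length ws. ws ! r = (\<Oplus>\<^bsub>V\<^esub>c\<in>{..<length bs}. B $$ (r, c) \<odot>\<^bsub>V\<^esub> bs ! c)))"

text \<open>\<open>Gr(k, V)\<close> for a finite dimensional \<open>V\<close>, in the Pluecker embedding with respect to a
  basis of \<open>V\<close>: the coordinate with index \<open>I\<close> is the \<open>k \<times> k\<close> minor on the columns in \<open>I\<close>.
  Another basis of \<open>W\<close> rescales these coordinates by a determinant, another basis of \<open>V\<close>
  changes them by an invertible linear substitution.\<close>

definition grassmannian ::
    "nat \<Rightarrow> ('k::field, 'v) module \<Rightarrow> ('v set, nat set, 'k) pvariety" where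
  "grassmannian k V =
     (let bs = (SOME bs. ordered_basis V bs) in
      \<lparr>points = {W. VectorSpace.subspace class_ring W V \<and>
                    vectorspace.dim class_ring (V\<lparr>carrier := W\<rparr>) = k},
       coords = (\<lambda>W I. if I \<subseteq> {..<length bs} \<and> card I = k
                   then det (submatrix (SOME B. represents_subspace V bs W B) UNIV I) else 0)\<rparr>)"

definition grass_top_dim ::
    "('k::field, 'a) module \<Rightarrow> nat \<Rightarrow> (nat \<Rightarrow> ('a, 's) module) \<Rightarrow> ('a, 'p) module
      \<Rightarrow> (nat \<Rightarrow> nat) \<Rightarrow> ('p set, nat set, 'k) pvariety" where
  "grass_top_dim A n S P d =
     (let V = restrict_scalars A P;
          G = grassmannian (vectorspace.dim class_ring V - (\<Sum>i<n. d i)) V in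
      G\<lparr>points := {C \<in> points G.
          Module.submodule C A P \<and> C \<subseteq> ideal_smult (jacobson_radical A) P \<and>
          has_dimension_vector A n S (quotient_module P C) d}\<rparr>)"

end

theory Submission
  imports Defs
begin

text \<open>As the algebra is basic, it acts on each simple module \<open>S\<^sub>i\<close> by a character, and multiplicities of
  \<open>S\<^sub>i\<close> are dimensions of the subspaces fixed by the corresponding primitive idempotent. In suitable
  coordinates \<open>J P\<close> is \<open>\<Oplus>\<^sub>i K^(p i)\<close> with the algebra acting on the \<open>i\<close>-th block by the \<open>i\<close>-th character, so
  its submodules are the direct sums of arbitrary subspaces \<open>W\<^sub>i\<close> of \<open>K^(p i)\<close>. The kernel of the projective
  cover is \<open>J P\<close>, hence \<open>S\<^sub>i\<close> has multiplicity \<open>t i + p i\<close> in \<open>P\<close>, and \<open>P/C\<close> has dimension vector \<open>d\<close> if and only if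
  \<open>dim W\<^sub>i = p i - (d i - t i)\<close>; realizability gives \<open>t i \<le> d i\<close>.

  The Pluecker coordinates of \<open>\<Oplus>\<^sub>i W\<^sub>i\<close> are linear combinations of the products of the minors of the \<open>W\<^sub>i\<close>, that
  is, of the Segre coordinates of \<open>(W\<^sub>i)\<^sub>i\<close>, and conversely. Annihilators turn the \<open>W\<^sub>i\<close> into
  subspaces of dimension \<open>d i - t i\<close>, and by Jacobi's formula this permutes minors up to sign and a
  common factor. So both the bijection and its inverse are given by linear forms.\<close>

section \<open>Homogeneous forms and linear morphisms\<close>

text \<open>Homogeneous coordinates come from arbitrary choices of bases, so coordinates of
  corresponding points match linear forms only up to a factor that varies with the point in an
  uncontrolled way. The criterion \<open>variety_morphism_linear\<close> tolerates this, since
  numerator and denominator of a regular function have equal degree. The price is uniformity: the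
  forms must not depend on the point. Hence the statements about minors fix signs and coefficients
  before quantifying over matrices.

  Annihilators are needed because d_i - t_i is the codimension of W_i, not its dimension. The
  ambient Grassmannian fits because dim P is the sum of all p_i + t_i, so dim P minus the sum of the
  d_i is the sum of the dim W_i. If d_i - t_i > p_i for some i, both sides are empty.

  Algebraic closure makes each element of the corner ring e A e of a primitive idempotent e a
  multiple of e plus a nilpotent element. As the A e are pairwise non-isomorphic, only one of the
  idempotents acts nontrivially on a given simple module, which is therefore a line.\<close>

definition monom_eval :: "('v \<Rightarrow>\<^sub>0 nat) \<Rightarrow> ('v \<Rightarrow> 'k::field) \<Rightarrow> 'k" where
  "monom_eval m x = (\<Prod>v\<in>Poly_Mapping.keys m. x v ^ Poly_Mapping.lookup m v)"

definition monom_deg :: "('v \<Rightarrow>\<^sub>0 nat) \<Rightarrow> nat" where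
  "monom_deg m = (\<Sum>v\<in>Poly_Mapping.keys m. Poly_Mapping.lookup m v)"

text \<open>Over a common finite superset of the supports, the exponents of different monomials can
  be combined variable by variable.\<close>

lemma monom_eval_superset:
  assumes "finite A" "Poly_Mapping.keys m \<subseteq> A"
  shows "monom_eval m x = (\<Prod>v\<in>A. x v ^ Poly_Mapping.lookup m v)"
  unfolding monom_eval_def using assms
  by (intro prod.mono_neutral_left) (auto simp: in_keys_iff)

lemma monom_deg_superset:
  assumes "finite A" "Poly_Mapping.keys m \<subseteq> A"
  shows "monom_deg m = (\<Sum>v\<in>A. Poly_Mapping.lookup m v)"
  unfolding monom_deg_def using assms
  by (intro sum.mono_neutral_left) (auto simp: in_keys_iff)

lemma monom_eval_add: "monom_eval (m + m') x = monom_eval m x * monom_eval m' x"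
proof -
  let ?A = "Poly_Mapping.keys m \<union> Poly_Mapping.keys m'"
  have "finite ?A" "Poly_Mapping.keys (m + m') \<subseteq> ?A"
    by (auto dest: subsetD[OF Poly_Mapping.keys_add])
  then show ?thesis
    using monom_eval_superset[of ?A "m + m'" x] monom_eval_superset[of ?A m x]
      monom_eval_superset[of ?A m' x]
    by (simp add: lookup_add power_add prod.distrib)
qed

lemma monom_deg_add: "monom_deg (m + m') = monom_deg m + monom_deg m'"
proof -
  let ?A = "Poly_Mapping.keys m \<union> Poly_Mapping.keys m'"
  have "finite ?A" "Poly_Mapping.keys (m + m') \<subseteq> ?A"
    by (auto dest: subsetD[OF Poly_Mapping.keys_add])
  then show ?thesis
    using monom_deg_superset[of ?A "m + m'"] monom_deg_superset[of ?A m]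
      monom_deg_superset[of ?A m']
    by (simp add: lookup_add sum.distrib)
qed

lemma poly_eval_monom_eval:
  "poly_eval F x = (\<Sum>m\<in>Poly_Mapping.keys F. Poly_Mapping.lookup F m * monom_eval m x)"
  by (simp add: poly_eval_def monom_eval_def)

lemma poly_eval_superset:
  assumes "finite A" "Poly_Mapping.keys F \<subseteq> A"
  shows "poly_eval F x = (\<Sum>m\<in>A. Poly_Mapping.lookup F m * monom_eval m x)"
  unfolding poly_eval_monom_eval using assms
  by (intro sum.mono_neutral_left) (auto simp: in_keys_iff)

lemma homogeneous_monom_deg:
  "homogeneous e F \<longleftrightarrow> (\<forall>m\<in>Poly_Mapping.keys F. monom_deg m = e)"
  by (simp add: homogeneous_def monom_deg_def)

text \<open>Forms are functions rather than polynomials: closure under sums, products and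
  substitution then needs only an evaluation formula, not an operation that substitutes into a
  \<open>poly_mapping\<close>.\<close>

definition forms :: "nat \<Rightarrow> (('v \<Rightarrow> 'k::field) \<Rightarrow> 'k) set" where
  "forms e = {f. \<exists>F. homogeneous e F \<and> (\<forall>x. f x = poly_eval F x)}"

lemma forms_zero: "(\<lambda>x. 0) \<in> forms e"
  unfolding forms_def by (auto intro!: exI[of _ 0] simp: homogeneous_def poly_eval_def)

lemma forms_add:
  assumes "f \<in> forms e" "g \<in> forms e"
  shows "(\<lambda>x. f x + g x) \<in> forms e"
proof -
  obtain F G where FG: "homogeneous e F" "homogeneous e G"
    "\<And>x. f x = poly_eval F x" "\<And>x. g x = poly_eval G x"
    using assms unfolding forms_def by auto
  let ?A = "Poly_Mapping.keys F \<union> Poly_Mapping.keys G"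
  have A: "finite ?A" "Poly_Mapping.keys (F + G) \<subseteq> ?A"
    by (auto dest: subsetD[OF Poly_Mapping.keys_add])
  have "homogeneous e (F + G)"
    using FG(1,2) A(2) unfolding homogeneous_monom_deg by blast
  moreover have "f x + g x = poly_eval (F + G) x" for x
    using poly_eval_superset[OF A] poly_eval_superset[of ?A F x] poly_eval_superset[of ?A G x] FG A
    by (simp add: lookup_add sum.distrib distrib_right)
  ultimately show ?thesis unfolding forms_def by auto
qed

lemma forms_sum:
  assumes "\<And>i. i \<in> I \<Longrightarrow> f i \<in> forms e"
  shows "(\<lambda>x. \<Sum>i\<in>I. f i x) \<in> forms e"
proof (cases "finite I")
  case True
  then show ?thesis using assms
    by (induction I) (auto intro!: forms_zero forms_add)
qed (simp add: forms_zero)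

lemma forms_monom:
  assumes "monom_deg m = e"
  shows "(\<lambda>x. c * monom_eval m x) \<in> forms e"
proof -
  have "homogeneous e (Poly_Mapping.single m c)"
    using assms by (auto simp: homogeneous_monom_deg)
  moreover have "c * monom_eval m x = poly_eval (Poly_Mapping.single m c) x" for x
    by (simp add: poly_eval_superset[of "{m}"])
  ultimately show ?thesis unfolding forms_def by auto
qed

lemma forms_mult:
  assumes "f \<in> forms e" "g \<in> forms e'"
  shows "(\<lambda>x. f x * g x) \<in> forms (e + e')"
proof -
  obtain F G where FG: "homogeneous e F" "homogeneous e' G"
    "\<And>x. f x = poly_eval F x" "\<And>x. g x = poly_eval G x"
    using assms unfolding forms_def by auto
  have "(\<lambda>x. f x * g x) = (\<lambda>x. \<Sum>m\<in>Poly_Mapping.keys F. \<Sum>m'\<in>Poly_Mapping.keys G.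
      (Poly_Mapping.lookup F m * Poly_Mapping.lookup G m') * monom_eval (m + m') x)"
    by (rule ext) (simp add: FG poly_eval_monom_eval sum_product monom_eval_add mult_ac)
  also have "\<dots> \<in> forms (e + e')"
    using FG(1,2) by (intro forms_sum forms_monom) (auto simp: homogeneous_monom_deg monom_deg_add)
  finally show ?thesis .
qed

lemma forms_const: "(\<lambda>x. c) \<in> forms 0"
  using forms_monom[of 0 0 c] by (simp add: monom_deg_def monom_eval_def)

lemma forms_cmult: "f \<in> forms e \<Longrightarrow> (\<lambda>x. c * f x) \<in> forms e"
  using forms_mult[OF forms_const, of f e c] by simp

lemma forms_var: "(\<lambda>x. x v) \<in> forms 1"
  using forms_monom[of "Poly_Mapping.single v 1" 1 1]
  by (simp add: monom_deg_superset[of "{v}"] monom_eval_superset[of "{v}"])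

lemma forms_power: "f \<in> forms e \<Longrightarrow> (\<lambda>x. f x ^ k) \<in> forms (k * e)"
  by (induction k) (auto intro: forms_const forms_mult)

lemma forms_prod:
  assumes "finite I" "\<And>i. i \<in> I \<Longrightarrow> f i \<in> forms (e i)"
  shows "(\<lambda>x. \<Prod>i\<in>I. f i x) \<in> forms (\<Sum>i\<in>I. e i)"
  using assms by (induction I) (auto intro: forms_const forms_mult)

text \<open>A monomial of degree \<open>e\<close> turns into a product of \<open>e\<close> linear
  forms, so the degree survives the substitution.\<close>

lemma forms_linear_substitution:
  assumes F: "homogeneous e F" and L: "\<And>w. L w \<in> forms 1"
  shows "(\<lambda>x. poly_eval F (\<lambda>w. L w x)) \<in> forms e"
  unfolding poly_eval_monom_eval
proof (intro forms_sum forms_cmult)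
  fix m assume m: "m \<in> Poly_Mapping.keys F"
  have "(\<lambda>x. \<Prod>v\<in>Poly_Mapping.keys m. L v x ^ Poly_Mapping.lookup m v)
      \<in> forms (\<Sum>v\<in>Poly_Mapping.keys m. Poly_Mapping.lookup m v * 1)"
    by (intro forms_prod forms_power L) auto
  then show "(\<lambda>x. monom_eval m (\<lambda>w. L w x)) \<in> forms e"
    using F m unfolding monom_eval_def homogeneous_def by simp
qed

text \<open>Every monomial of degree \<open>e\<close> contributes the factor \<open>c ^ e\<close>.
  For nonzero \<open>c\<close>, therefore, neither the vanishing of a form nor a quotient of two
  forms of equal degree depends on the representative.\<close>

lemma poly_eval_scale:
  assumes "homogeneous e F"
  shows "poly_eval F (\<lambda>v. c * x v) = c ^ e * poly_eval F x"
proof -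
  have "monom_eval m (\<lambda>v. c * x v) = c ^ monom_deg m * monom_eval m x" for m
    by (simp add: monom_eval_def monom_deg_def power_mult_distrib prod.distrib power_sum)
  then show ?thesis
    using assms unfolding poly_eval_monom_eval homogeneous_monom_deg sum_distrib_left
    by (intro sum.cong) (auto simp: mult_ac)
qed

text \<open>The constant 1 is a form of degree 0, so \<open>points X\<close> itself is one of the
  generating open sets.\<close>

lemma topspace_zariski: "topspace (zariski X) = points X"
proof -
  obtain F :: "('b \<Rightarrow>\<^sub>0 nat) \<Rightarrow>\<^sub>0 'c" where "homogeneous 0 F" "\<And>x. poly_eval F x = 1"
    using forms_const[of 1] unfolding forms_def by auto
  then have "points X \<in> {{x \<in> points X. poly_eval F (coords X x) \<noteq> 0} | F. \<exists>e. homogeneous e F}"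
    by (auto intro!: exI[of _ F])
  then have "points X \<subseteq> topspace (zariski X)"
    unfolding zariski_def topology_generated_by_topspace by (rule Union_upper)
  moreover have "topspace (zariski X) \<subseteq> points X"
    unfolding zariski_def topology_generated_by_topspace by (rule Union_least) auto
  ultimately show ?thesis by (rule equalityI[rotated])
qed

lemma openin_zariski_nonvanishing:
  "homogeneous e F \<Longrightarrow> openin (zariski X) {x \<in> points X. poly_eval F (coords X x) \<noteq> 0}"
  unfolding zariski_def by (rule topology_generated_by_Basis) auto

text \<open>Pulling a form of degree \<open>e\<close> back along \<phi> gives another form of degree
  \<open>e\<close>, up to the factor \<open>lam x ^ e\<close>. This factor does not affect
  nonvanishing and cancels in quotients, so \<open>lam\<close> may be any nowhere vanishing
  function, without any regularity.\<close>

proposition variety_morphism_linear: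
  fixes X :: "('x, 'v, 'k::field) pvariety" and Y :: "('y, 'w, 'k) pvariety"
  assumes pts: "\<And>x. x \<in> points X \<Longrightarrow> \<phi> x \<in> points Y"
    and L: "\<And>w. L w \<in> forms 1"
    and lam: "\<And>x. x \<in> points X \<Longrightarrow> lam x \<noteq> 0"
    and crd: "\<And>x w. x \<in> points X \<Longrightarrow> coords Y (\<phi> x) w = lam x * L w (coords X x)"
  shows "variety_morphism X Y \<phi>"
proof -
  \<comment> \<open>A relation instead of a function, because the substituted polynomial
    \<open>F'\<close> is known only through its values.\<close>
  define sub where "sub F F' \<longleftrightarrow> (\<forall>x. poly_eval F' x = poly_eval F (\<lambda>w. L w x))"
    for F :: "('w \<Rightarrow>\<^sub>0 nat) \<Rightarrow>\<^sub>0 'k" and F' :: "('v \<Rightarrow>\<^sub>0 nat) \<Rightarrow>\<^sub>0 'k"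
  have ex: "\<exists>F'. homogeneous e F' \<and> sub F F'" if hF: "homogeneous e F" for e F
  proof -
    have "(\<lambda>x. poly_eval F (\<lambda>w. L w x)) \<in> forms e"
      by (rule forms_linear_substitution[OF hF]) (rule L)
    then obtain F' where "homogeneous e F'" "\<And>x. poly_eval F (\<lambda>w. L w x) = poly_eval F' x"
      unfolding forms_def by auto
    then show ?thesis unfolding sub_def by auto
  qed
  have ev: "poly_eval F (coords Y (\<phi> x)) = lam x ^ e * poly_eval F' (coords X x)"
    if "x \<in> points X" "homogeneous e F" "sub F F'" for x e F F'
  proof -
    have "coords Y (\<phi> x) = (\<lambda>w. lam x * L w (coords X x))" using crd[OF that(1)] by auto
    then show ?thesis using poly_eval_scale[OF that(2)] that(3) by (simp add: sub_def)
  qed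
  have cont: "continuous_map (zariski X) (zariski Y) \<phi>"
  proof (unfold zariski_def[of Y], rule continuous_on_generated_topo)
    fix U assume "U \<in> {{x \<in> points Y. poly_eval F (coords Y x) \<noteq> 0} | F. \<exists>e. homogeneous e F}"
    then obtain F e where U: "U = {x \<in> points Y. poly_eval F (coords Y x) \<noteq> 0}" "homogeneous e F"
      by auto
    obtain F' where F': "homogeneous e F'" "sub F F'" using ex[OF U(2)] by auto
    have "\<phi> -` U \<inter> topspace (zariski X) = {x \<in> points X. poly_eval F' (coords X x) \<noteq> 0}"
      unfolding topspace_zariski U(1) using pts lam ev[OF _ U(2) F'(2)] by auto
    then show "openin (zariski X) (\<phi> -` U \<inter> topspace (zariski X))"
      using openin_zariski_nonvanishing[OF F'(1)] by simp
  next
    show "\<phi> ` topspace (zariski X)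
        \<subseteq> \<Union> {{x \<in> points Y. poly_eval F (coords Y x) \<noteq> 0} | F. \<exists>e. homogeneous e F}"
      using topspace_zariski[of Y, symmetric] pts
      unfolding topspace_zariski[of X] zariski_def topology_generated_by_topspace
      by (auto simp only:)
  qed
  moreover have "regular_on X {x \<in> points X. \<phi> x \<in> U} (h \<circ> \<phi>)"
    if U: "openin (zariski Y) U" "regular_on Y U h" for U h
    unfolding regular_on_def
  proof
    fix x assume x: "x \<in> {x \<in> points X. \<phi> x \<in> U}"
    then obtain V e F G where V: "openin (zariski Y) V" "\<phi> x \<in> V" "V \<subseteq> U"
      and FG: "homogeneous e F" "homogeneous e G"
      and h: "\<And>y. y \<in> V \<Longrightarrow> poly_eval G (coords Y y) \<noteq> 0 \<and>
         h y = poly_eval F (coords Y y) / poly_eval G (coords Y y)"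
      using U(2) x unfolding regular_on_def mem_Collect_eq by metis
    obtain F' G' where FG': "homogeneous e F'" "sub F F'" "homogeneous e G'" "sub G G'"
      using ex[OF FG(1)] ex[OF FG(2)] by auto
    let ?V = "{x \<in> points X. \<phi> x \<in> V}"
    have "openin (zariski X) ?V"
      using openin_continuous_map_preimage[OF cont V(1)] unfolding topspace_zariski .
    moreover have "\<forall>y\<in>?V. poly_eval G' (coords X y) \<noteq> 0 \<and>
        (h \<circ> \<phi>) y = poly_eval F' (coords X y) / poly_eval G' (coords X y)"
    proof
      fix y assume y: "y \<in> ?V"
      have "poly_eval G (coords Y (\<phi> y)) = lam y ^ e * poly_eval G' (coords X y)"
        "poly_eval F (coords Y (\<phi> y)) = lam y ^ e * poly_eval F' (coords X y)"
        using ev[OF _ FG(1) FG'(2)] ev[OF _ FG(2) FG'(4)] y by auto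
      then show "poly_eval G' (coords X y) \<noteq> 0 \<and>
          (h \<circ> \<phi>) y = poly_eval F' (coords X y) / poly_eval G' (coords X y)"
        using h[of "\<phi> y"] y lam[of y] by auto
    qed
    ultimately show "\<exists>V e F G. openin (zariski X) V \<and> x \<in> V \<and> V \<subseteq> {x \<in> points X. \<phi> x \<in> U} \<and>
        homogeneous e F \<and> homogeneous e G \<and>
        (\<forall>y\<in>V. poly_eval G (coords X y) \<noteq> 0 \<and>
           (h \<circ> \<phi>) y = poly_eval F (coords X y) / poly_eval G (coords X y))"
      using x V FG' by (intro exI[of _ ?V] exI[of _ e] exI[of _ F'] exI[of _ G']) auto
  qed
  ultimately show ?thesis unfolding variety_morphism_def by blast
qed

section \<open>Minors\<close>

text \<open>The columns are listed by a map and not by a set: expanding a minor of a product yields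
  column lists with repetitions and in any order.\<close>

definition minor :: "nat \<Rightarrow> 'k::comm_ring_1 mat \<Rightarrow> (nat \<Rightarrow> nat) \<Rightarrow> 'k" where
  "minor k B f = det (mat k k (\<lambda>(r, c). B $$ (r, f c)))"

lemma minor_cong: "(\<And>c. c < k \<Longrightarrow> f c = g c) \<Longrightarrow> minor k B f = minor k B g"
  unfolding minor_def by (intro arg_cong[of _ _ det] eq_matI) auto

lemma minor_mult_left:
  assumes "G \<in> carrier_mat k k" "B \<in> carrier_mat k N" "\<And>c. c < k \<Longrightarrow> f c < N"
  shows "minor k (G * B) f = det G * minor k B f"
proof -
  have "mat k k (\<lambda>(r, c). (G * B) $$ (r, f c)) = G * mat k k (\<lambda>(r, c). B $$ (r, f c))"
    using assms by (intro eq_matI) (auto simp: scalar_prod_def)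
  then show ?thesis unfolding minor_def using det_mult[OF assms(1)] by simp
qed

lemma minor_transpose:
  "minor k B f = det (mat k k (\<lambda>(c, r). B $$ (r, f c)))"
proof -
  have "(mat k k (\<lambda>(r, c). B $$ (r, f c)))\<^sup>T = mat k k (\<lambda>(c, r). B $$ (r, f c))"
    by (intro eq_matI) auto
  then show ?thesis unfolding minor_def
    by (metis det_transpose mat_carrier)
qed

text \<open>The identity outside \<open>{0..<k}\<close> is a normalization that makes the set
  finite; it is the index set of the sum in \<open>det_linear_rows_sum\<close>.\<close>

definition index_maps :: "nat \<Rightarrow> nat \<Rightarrow> (nat \<Rightarrow> nat) set" where
  "index_maps k N = {g. (\<forall>i\<in>{0..<k}. g i \<in> {0..<N}) \<and> (\<forall>i. i \<notin> {0..<k} \<longrightarrow> g i = i)}"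

text \<open>The Cauchy-Binet formula before terms with the same column set are collected. Each
  column of \<open>B * Q\<close> is a combination of columns of \<open>B\<close>; the determinant is
  expanded multilinearly, after transposing so that columns become rows.\<close>

lemma minor_mult_right:
  assumes B: "B \<in> carrier_mat k N" and Q: "Q \<in> carrier_mat N N'"
    and f: "\<And>c. c < k \<Longrightarrow> f c < N'"
  shows "minor k (B * Q) f = (\<Sum>g\<in>index_maps k N. (\<Prod>c = 0..<k. Q $$ (g c, f c)) * minor k B g)"
proof -
  let ?a = "\<lambda>c m. Q $$ (m, f c) \<cdot>\<^sub>v col B m"
  have a: "?a \<in> {0..<k} \<rightarrow> {0..<N} \<rightarrow> carrier_vec k" using B by auto
  have "minor k (B * Q) f = det (mat k k (\<lambda>(c, r). (B * Q) $$ (r, f c)))"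
    by (rule minor_transpose)
  also have "mat k k (\<lambda>(c, r). (B * Q) $$ (r, f c))
      = mat\<^sub>r k k (\<lambda>c. finsum_vec TYPE('a) k (?a c) {0..<N})"
  proof (intro eq_matI)
    fix c r assume cr: "c < dim_row (mat\<^sub>r k k (\<lambda>c. finsum_vec TYPE('a) k (?a c) {0..<N}))"
      "r < dim_col (mat\<^sub>r k k (\<lambda>c. finsum_vec TYPE('a) k (?a c) {0..<N}))"
    then have cr: "c < k" "r < k" by auto
    have "finsum_vec TYPE('a) k (?a c) {0..<N} $ r = (\<Sum>m = 0..<N. ?a c m $ r)"
      using B cr by (intro index_finsum_vec) auto
    then show "mat k k (\<lambda>(c, r). (B * Q) $$ (r, f c)) $$ (c, r)
        = mat\<^sub>r k k (\<lambda>c. finsum_vec TYPE('a) k (?a c) {0..<N}) $$ (c, r)"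
      using B Q cr f[OF cr(1)] by (auto simp: scalar_prod_def mult.commute intro!: sum.cong)
  qed auto
  also have "det \<dots> = (\<Sum>g\<in>index_maps k N. det (mat\<^sub>r k k (\<lambda>c. ?a c (g c))))"
    unfolding index_maps_def by (rule det_linear_rows_sum[OF _ a]) simp
  also have "\<dots> = (\<Sum>g\<in>index_maps k N. (\<Prod>c = 0..<k. Q $$ (g c, f c)) * minor k B g)"
  proof (rule sum.cong[OF refl])
    fix g assume "g \<in> index_maps k N"
    then have g: "\<And>c. c < k \<Longrightarrow> g c < N" unfolding index_maps_def by auto
    have "det (mat\<^sub>r k k (\<lambda>c. ?a c (g c))) = (\<Prod>c = 0..<k. Q $$ (g c, f c)) * det (mat\<^sub>r k k (\<lambda>c. col B (g c)))"
      using B by (intro det_rows_mul) auto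
    also have "mat\<^sub>r k k (\<lambda>c. col B (g c)) = mat k k (\<lambda>(c, r). B $$ (r, g c))"
      using B g by (intro eq_matI) auto
    finally show "det (mat\<^sub>r k k (\<lambda>c. ?a c (g c))) = (\<Prod>c = 0..<k. Q $$ (g c, f c)) * minor k B g"
      by (simp add: minor_transpose)
  qed
  finally show ?thesis .
qed

lemma minor_not_inj:
  assumes "\<not> inj_on f {0..<k}"
  shows "minor k B f = 0"
proof -
  obtain c c' where c: "c < k" "c' < k" "c \<noteq> c'" "f c = f c'"
    using assms unfolding inj_on_def by auto
  show ?thesis unfolding minor_def
    by (rule det_identical_columns[of _ k c c']) (use c in \<open>auto intro!: eq_vecI\<close>)
qed

lemma minor_permute:
  assumes "p permutes {0..<k}"
  shows "minor k B (\<lambda>c. f (p c)) = of_int (sign p) * minor k B f"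
proof -
  let ?A = "mat k k (\<lambda>(c, r). B $$ (r, f c))"
  have "mat k k (\<lambda>(i, j). ?A $$ (p i, j)) = mat k k (\<lambda>(c, r). B $$ (r, f (p c)))"
    using permutes_in_image[OF assms] by (intro eq_matI) auto
  then show ?thesis
    using det_permute_rows[OF _ assms, of ?A] by (simp add: minor_transpose)
qed

lemma sign_eq_pm1: "(of_int (sign p) :: 'k::comm_ring_1) * of_int (sign p) = 1"
  by (simp add: sign_def)

text \<open>The two column lists differ by a permutation, and \<open>s\<close> is its sign. What
  matters is that \<open>s\<close> is chosen before \<open>B\<close>: it can then serve as a
  coefficient of a linear form.\<close>

lemma minor_same_image:
  assumes f: "inj_on f {0..<k}" and g: "inj_on g {0..<k}" and fg: "f ` {0..<k} = g ` {0..<k}"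
  shows "\<exists>s. s * s = 1 \<and> (\<forall>B :: 'k::comm_ring_1 mat. minor k B f = s * minor k B g)"
proof -
  define p where "p c = (if c < k then inv_into {0..<k} g (f c) else c)" for c
  have in_im: "f c \<in> g ` {0..<k}" if "c < k" for c using that fg by auto
  have gp: "g (p c) = f c" "p c < k" if "c < k" for c
    using f_inv_into_f[OF in_im[OF that]] inv_into_into[OF in_im[OF that]] that by (auto simp: p_def)
  have inj: "inj_on p {0..<k}"
    using f by (intro inj_onI) (metis atLeastLessThan_iff gp(1) inj_onD)
  moreover have "p ` {0..<k} = {0..<k}" by (rule endo_inj_surj) (use gp(2) inj in auto)
  ultimately have "bij_betw p {0..<k} {0..<k}" by (simp add: bij_betw_def)
  then have p: "p permutes {0..<k}" by (rule bij_imp_permutes) (simp add: p_def)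
  have "minor k B f = of_int (sign p) * minor k B g" for B :: "'k mat"
    using minor_permute[OF p, of B g] minor_cong[of k "\<lambda>c. g (p c)" f B] gp by auto
  then show ?thesis using sign_eq_pm1 by blast
qed

lemma pick_image:
  assumes "finite I" "card I = k"
  shows "pick I ` {0..<k} = I" "inj_on (pick I) {0..<k}"
proof -
  show inj: "inj_on (pick I) {0..<k}"
    by (rule linorder_inj_onI) (use assms pick_mono_le[of _ I] in force)+
  have "pick I ` {0..<k} \<subseteq> I" using assms pick_in_set_le by auto
  then show "pick I ` {0..<k} = I"
    using assms card_image[OF inj] by (intro card_subset_eq) auto
qed

text \<open>The factor is a sign if \<open>f\<close> is injective and 0 if a column is repeated,
  hence independent of \<open>B\<close>.\<close>

lemma minor_pick:
  "\<exists>s. \<forall>B :: 'k::comm_ring_1 mat. minor k B f = s * minor k B (pick (f ` {0..<k}))"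
proof (cases "inj_on f {0..<k}")
  case True
  then have "card (f ` {0..<k}) = k" by (simp add: card_image)
  then show ?thesis
    using minor_same_image[OF True pick_image(2)[of "f ` {0..<k}" k]] pick_image(1)[of "f ` {0..<k}" k]
    by auto
next
  case False
  then show ?thesis by (intro exI[of _ 0]) (simp add: minor_not_inj)
qed

lemma det_submatrix:
  assumes "B \<in> carrier_mat k N" "I \<subseteq> {..<N}" "card I = k"
  shows "det (submatrix B UNIV I) = minor k B (pick I)"
proof -
  have "{j. j < N \<and> j \<in> I} = I" using assms(2) by auto
  then show ?thesis using assms unfolding submatrix_def minor_def
    by (intro arg_cong[of _ _ det] eq_matI) (auto simp: pick_UNIV)
qed

text \<open>Jacobi's formula for complementary minors: multiply \<open>M\<close> by the matrix whose first columns
  are the unit vectors indexed by \<open>I\<close> and whose last columns are those of \<open>M\<close> inverse.\<close>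

lemma minor_complementary:
  assumes I: "I \<subseteq> {..<k + q}" "card I = k"
  shows "\<exists>s. s * s = 1 \<and> (\<forall>M M' :: 'k::field mat. M \<in> carrier_mat (k + q) (k + q) \<longrightarrow>
    M' \<in> carrier_mat (k + q) (k + q) \<longrightarrow> M * M' = 1\<^sub>m (k + q) \<longrightarrow>
    minor k M (pick I) = s * det M *
      minor q (mat q (k + q) (\<lambda>(r, c). M' $$ (c, k + r))) (pick ({..<k + q} - I)))"
proof -
  let ?p = "k + q" and ?Ic = "{..<k + q} - I"
  have fin: "finite I" using I(1) finite_subset by blast
  have cIc: "card ?Ic = q" using I fin by (simp add: card_Diff_subset)
  note pI = pick_image[OF fin I(2)] and pIc = pick_image[OF _ cIc, OF finite_Diff[OF finite_lessThan]]
  \<comment> \<open>The permutation that lists \<open>I\<close> in increasing order, followed by its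
    complement; its sign is the required \<open>s\<close>.\<close>
  define h where "h c = (if c < k then pick I c else if c < ?p then pick ?Ic (c - k) else c)" for c
  have h1: "h c = pick I c" "h c \<in> I" if "c < k" for c
    using that pick_in_set_le[of c I] I by (auto simp: h_def)
  have h2: "h (k + c) = pick ?Ic c" "h (k + c) \<in> ?Ic" if "c < q" for c
    using that pick_in_set_le[of c ?Ic] cIc by (auto simp: h_def)
  have hp: "h c < ?p" if "c < ?p" for c
    using h1[of c] h2[of "c - k"] that I(1) by (cases "c < k") auto
  have inj: "inj_on h {0..<?p}"
  proof (rule inj_onI)
    fix a b assume ab: "a \<in> {0..<?p}" "b \<in> {0..<?p}" "h a = h b"
    show "a = b"
    proof (cases "a < k"; cases "b < k")
      assume "a < k" "b < k"
      then show ?thesis using ab h1 inj_onD[OF pI(2)] by auto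
    next
      assume "a < k" "\<not> b < k"
      moreover from this have "b - k < q" "k + (b - k) = b" using ab by auto
      ultimately show ?thesis using ab h1(2)[of a] h2(2)[of "b - k"] by simp
    next
      assume "\<not> a < k" "b < k"
      moreover from this have "a - k < q" "k + (a - k) = a" using ab by auto
      ultimately show ?thesis using ab h1(2)[of b] h2(2)[of "a - k"] by simp
    next
      assume ge: "\<not> a < k" "\<not> b < k"
      then have "pick ?Ic (a - k) = pick ?Ic (b - k)" using ab unfolding h_def by simp
      moreover have "a - k \<in> {0..<q}" "b - k \<in> {0..<q}" using ab(1,2) ge by auto
      ultimately have "a - k = b - k" using inj_onD[OF pIc(2)] by simp
      then show ?thesis using ge by simp
    qed
  qed
  moreover have "h ` {0..<?p} = {0..<?p}" by (rule endo_inj_surj) (use hp inj in auto)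
  ultimately have "bij_betw h {0..<?p} {0..<?p}" by (simp add: bij_betw_def)
  then have h: "h permutes {0..<?p}" by (rule bij_imp_permutes) (auto simp: h_def)
  have "minor k M (pick I) = of_int (sign h) * det M *
      minor q (mat q ?p (\<lambda>(r, c). M' $$ (c, k + r))) (pick ?Ic)"
    if M: "M \<in> carrier_mat ?p ?p" "M' \<in> carrier_mat ?p ?p" "M * M' = 1\<^sub>m ?p" for M M' :: "'k mat"
  proof -
    define E where "E = mat ?p ?p (\<lambda>(r, c). if c < k then (if r = pick I c then 1 else 0) else M' $$ (r, c))"
    let ?Y = "mat q ?p (\<lambda>(r, c). M' $$ (c, k + r))"
    have E: "E \<in> carrier_mat ?p ?p" by (simp add: E_def)
    have MM': "(\<Sum>m = 0..<?p. M $$ (r, m) * M' $$ (m, c)) = (if r = c then 1 else 0)"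
      if "r < ?p" "c < ?p" for r c
      using arg_cong[OF M(3), of "\<lambda>A. A $$ (r, c)"] M(1,2) that by (simp add: scalar_prod_def)
    \<comment> \<open>Since \<open>M * M'\<close> is the identity, the last \<open>q\<close> columns
      of \<open>M * E\<close> are unit vectors, so the determinant of the product is the wanted
      minor of \<open>M\<close>.\<close>
    have ME: "M * E = four_block_mat (mat k k (\<lambda>(r, c). M $$ (r, pick I c))) (0\<^sub>m k q)
        (mat q k (\<lambda>(r, c). M $$ (k + r, pick I c))) (1\<^sub>m q)" (is "_ = ?R")
    proof (rule eq_matI)
      fix r c assume "r < dim_row ?R" "c < dim_col ?R"
      then have rc: "r < ?p" "c < ?p" by auto
      have "(M * E) $$ (r, c) = (\<Sum>m = 0..<?p. M $$ (r, m) * E $$ (m, c))"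
        using M E rc by (simp add: scalar_prod_def)
      also have "\<dots> = (if c < k then M $$ (r, pick I c) else if r = c then 1 else 0)"
      proof (cases "c < k")
        case True
        then have "pick I c < ?p" using h1[of c] I by auto
        moreover have "(\<Sum>m = 0..<?p. M $$ (r, m) * E $$ (m, c)) =
            (\<Sum>m = 0..<?p. if m = pick I c then M $$ (r, m) else 0)"
          using True rc by (intro sum.cong) (auto simp: E_def)
        ultimately show ?thesis using True by simp
      next
        case False
        then have "(\<Sum>m = 0..<?p. M $$ (r, m) * E $$ (m, c)) = (\<Sum>m = 0..<?p. M $$ (r, m) * M' $$ (m, c))"
          using rc by (intro sum.cong) (auto simp: E_def)
        then show ?thesis using MM'[OF rc] False by simp
      qed
      finally show "(M * E) $$ (r, c) = ?R $$ (r, c)" using rc by auto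
    qed (use M E in auto)
    have a: "minor k M (pick I) = det M * det E"
      using det_mult[OF M(1) E] unfolding ME minor_def
      by (subst (asm) det_four_block_mat_upper_right_zero[where n = k and m = q]) auto
    \<comment> \<open>Reading the rows of \<open>E\<close> in the order \<open>h\<close> puts an
      identity block in the upper left corner over zeros; the lower right block is the complementary
      minor of the inverse.\<close>
    have b: "minor q ?Y (pick ?Ic) = of_int (sign h) * det E"
    proof -
      have "mat ?p ?p (\<lambda>(i, j). E $$ (h i, j)) = four_block_mat (1\<^sub>m k)
          (mat k q (\<lambda>(r, c). M' $$ (pick I r, k + c))) (0\<^sub>m q k)
          (mat q q (\<lambda>(c, r). ?Y $$ (r, pick ?Ic c)))" (is "?L = ?R")
      proof (rule eq_matI)
        fix r c assume "r < dim_row ?R" "c < dim_col ?R"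
        then have rc: "r < ?p" "c < ?p" by auto
        show "?L $$ (r, c) = ?R $$ (r, c)"
        proof (cases "r < k")
          case True
          then show ?thesis using rc h1[OF True] hp[of r] inj_onD[OF pI(2), of r c]
            by (auto simp: E_def)
        next
          case False
          then have "h r = pick ?Ic (r - k)" "h r \<in> ?Ic" "h r < ?p"
            using h2[of "r - k"] rc by auto
          moreover have "pick I c \<in> I" if "c < k" using h1[OF that] by simp
          ultimately show ?thesis using False rc by (auto simp: E_def)
        qed
      qed auto
      then have "of_int (sign h) * det E = det (four_block_mat (1\<^sub>m k)
          (mat k q (\<lambda>(r, c). M' $$ (pick I r, k + c))) (0\<^sub>m q k)
          (mat q q (\<lambda>(c, r). ?Y $$ (r, pick ?Ic c))))"
        using det_permute_rows[OF E h] by simp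
      also have "\<dots> = minor q ?Y (pick ?Ic)"
        unfolding minor_transpose[of q ?Y]
        by (subst det_four_block_mat_lower_left_zero[where n = k and m = q]) auto
      finally show ?thesis ..
    qed
    have "of_int (sign h) * det M * minor q ?Y (pick ?Ic)
        = (of_int (sign h) * of_int (sign h)) * minor k M (pick I)"
      unfolding a b by (simp only: mult_ac)
    then show ?thesis unfolding sign_eq_pm1 by simp
  qed
  then show ?thesis using sign_eq_pm1[of h] by (intro exI[of _ "of_int (sign h)"]) auto
qed

section \<open>Block decompositions of index ranges, and minors of block diagonal matrices\<close>

definition offset :: "(nat \<Rightarrow> nat) \<Rightarrow> nat \<Rightarrow> nat" where
  "offset k i = (\<Sum>j<i. k j)"

lemma offset_0 [simp]: "offset k 0 = 0" and offset_Suc: "offset k (Suc i) = offset k i + k i"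
  by (simp_all add: offset_def)

lemma offset_mono: "i \<le> j \<Longrightarrow> offset k i \<le> offset k j"
  unfolding offset_def by (rule sum_mono2) auto

lemma offset_less:
  assumes "i < n" "r < k i" shows "offset k i + r < offset k n"
  using assms offset_mono[of "Suc i" n k] by (simp add: offset_Suc)

lemma offset_unique:
  assumes "offset k i + r = offset k j + r'" "r < k i" "r' < k j"
  shows "i = j \<and> r = r'"
proof (cases i j rule: linorder_cases)
  case less then show ?thesis using offset_less[of i j r k] assms by simp
next
  case equal then show ?thesis using assms by simp
next
  case greater then show ?thesis using offset_less[of j i r' k] assms by simp
qed

lemma offset_between:
  assumes "offset k j \<le> offset k i + r" "offset k i + r < offset k j + k j" "r < k i"
  shows "j = i"
proof -
  obtain r' where "offset k i + r = offset k j + r'" using assms(1) le_Suc_ex by blast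
  then show ?thesis using offset_unique[of k i r j r'] assms by auto
qed

lemma offset_cases:
  assumes "x < offset k n"
  obtains i r where "i < n" "r < k i" "x = offset k i + r"
proof -
  have "\<exists>i r. i < n \<and> r < k i \<and> x = offset k i + r" using assms
  proof (induction n)
    case (Suc n)
    show ?case
    proof (cases "x < offset k n")
      case True
      then show ?thesis using Suc.IH less_Suc_eq by blast
    next
      case False
      then show ?thesis using Suc.prems
        by (intro exI[of _ n] exI[of _ "x - offset k n"]) (auto simp: offset_Suc)
    qed
  qed simp
  then show ?thesis using that by blast
qed

text \<open>The ranges of the blocks are disjoint, so at most one summand is nonzero: the sum is a
  case distinction that avoids choosing the block of an index.\<close>

definition block_diag :: "nat \<Rightarrow> (nat \<Rightarrow> nat) \<Rightarrow> (nat \<Rightarrow> nat) \<Rightarrow> (nat \<Rightarrow> 'k::comm_ring_1 mat) \<Rightarrow> 'k mat" where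
  "block_diag n k p B = mat (offset k n) (offset p n) (\<lambda>(x, y). \<Sum>i<n.
     if offset k i \<le> x \<and> x < offset k i + k i \<and> offset p i \<le> y \<and> y < offset p i + p i
     then B i $$ (x - offset k i, y - offset p i) else 0)"

lemma block_diag_carrier [simp]: "block_diag n k p B \<in> carrier_mat (offset k n) (offset p n)"
  by (simp add: block_diag_def)

lemma block_diag_index:
  assumes "i < n" "j < n" "r < k i" "c < p j"
  shows "block_diag n k p B $$ (offset k i + r, offset p j + c) = (if i = j then B i $$ (r, c) else 0)"
proof -
  have "block_diag n k p B $$ (offset k i + r, offset p j + c) =
    (\<Sum>i'<n. if i' = i \<and> i' = j then B i $$ (r, c) else 0)"
    unfolding block_diag_def using assms offset_less[of i n r k] offset_less[of j n c p]
  proof (simp, intro sum.cong refl)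
    fix i' assume "i' \<in> {..<n}"
    have *: "i' = i" if "offset k i' \<le> offset k i + r" "offset k i + r < offset k i' + k i'"
      using offset_between[OF that] assms by auto
    have **: "i' = j" if "offset p i' \<le> offset p j + c" "offset p j + c < offset p i' + p i'"
      using offset_between[OF that] assms by auto
    show "(if offset k i' \<le> offset k i + r \<and> offset k i + r < offset k i' + k i' \<and>
            offset p i' \<le> offset p j + c \<and> offset p j + c < offset p i' + p i'
         then B i' $$ (offset k i + r - offset k i', offset p j + c - offset p i') else 0) =
        (if i' = i \<and> i' = j then B i $$ (r, c) else 0)"
      using * ** assms by auto
  qed
  also have "\<dots> = (if i = j then B i $$ (r, c) else 0)"
    using assms by (cases "i = j") (auto intro!: sum.neutral)
  finally show ?thesis .
qed

text \<open>Induction on \<open>n\<close> splits off the last block. \<open>A\<close> is a function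
  of two indices rather than a matrix, so that the induction hypothesis applies to it
  unchanged.\<close>

lemma det_blocks:
  fixes A :: "nat \<Rightarrow> nat \<Rightarrow> 'k::field"
  assumes "\<And>i j r c. i < n \<Longrightarrow> j < n \<Longrightarrow> i \<noteq> j \<Longrightarrow> r < k i \<Longrightarrow> c < k j \<Longrightarrow>
    A (offset k i + r) (offset k j + c) = 0"
  shows "det (mat (offset k n) (offset k n) (\<lambda>(x, y). A x y)) =
    (\<Prod>i<n. det (mat (k i) (k i) (\<lambda>(r, c). A (offset k i + r) (offset k i + c))))"
  using assms
proof (induction n)
  case 0
  then show ?case by (simp add: det_def)
next
  case (Suc n)
  let ?o = "offset k n"
  have z: "A x (?o + c) = 0" "A (?o + c) x = 0" if x: "x < ?o" and c: "c < k n" for x c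
  proof -
    obtain i r where "i < n" "r < k i" "x = offset k i + r" using offset_cases[OF x] .
    then show "A x (?o + c) = 0" "A (?o + c) x = 0" using Suc.prems[of i n r c] Suc.prems[of n i c r] c by auto
  qed
  have z': "A x y = 0" "A y x = 0" if "x < ?o" "\<not> y < ?o" "y < ?o + k n" for x y
    using z[of x "y - ?o"] that by auto
  have "mat (offset k (Suc n)) (offset k (Suc n)) (\<lambda>(x, y). A x y) =
    four_block_mat (mat ?o ?o (\<lambda>(x, y). A x y)) (0\<^sub>m ?o (k n)) (0\<^sub>m (k n) ?o)
      (mat (k n) (k n) (\<lambda>(r, c). A (?o + r) (?o + c)))"
    using z' by (intro eq_matI) (auto simp: offset_Suc)
  then show ?case
    using Suc.IH Suc.prems
    by (simp, subst det_four_block_mat_lower_left_zero[where n = ?o and m = "k n"]) auto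
qed

text \<open>If \<open>f\<close> takes exactly \<open>k i\<close> columns from the
  \<open>i\<close>-th block, in block order, the selected square matrix is again block
  diagonal.\<close>

lemma minor_block_diag:
  fixes B :: "nat \<Rightarrow> 'k::field mat"
  assumes h: "\<And>i r. i < n \<Longrightarrow> r < k i \<Longrightarrow> h i r < p i"
    and f: "\<And>i r. i < n \<Longrightarrow> r < k i \<Longrightarrow> f (offset k i + r) = offset p i + h i r"
  shows "minor (offset k n) (block_diag n k p B) f = (\<Prod>i<n. minor (k i) (B i) (h i))"
proof -
  have "minor (offset k n) (block_diag n k p B) f =
    (\<Prod>i<n. det (mat (k i) (k i) (\<lambda>(r, c). block_diag n k p B $$ (offset k i + r, f (offset k i + c)))))"
    unfolding minor_def by (rule det_blocks) (simp add: f h block_diag_index)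
  also have "\<dots> = (\<Prod>i<n. minor (k i) (B i) (h i))"
  proof (rule prod.cong[OF refl])
    fix i assume "i \<in> {..<n}"
    then have "mat (k i) (k i) (\<lambda>(r, c). block_diag n k p B $$ (offset k i + r, f (offset k i + c)))
        = mat (k i) (k i) (\<lambda>(r, c). B i $$ (r, h i c))"
      by (intro eq_matI) (auto simp: f h block_diag_index)
    then show "det (mat (k i) (k i) (\<lambda>(r, c). block_diag n k p B $$ (offset k i + r, f (offset k i + c))))
        = minor (k i) (B i) (h i)" unfolding minor_def by simp
  qed
  finally show ?thesis .
qed

text \<open>A minor on a set of columns which does not meet some block in the right number of columns
  vanishes: no term of the Leibniz expansion survives.\<close>

lemma minor_block_diag_pick:
  assumes R: "R \<subseteq> {..<offset p n}" "card R = offset k n"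
  defines "Ri \<equiv> \<lambda>i. {c. c < p i \<and> offset p i + c \<in> R}"
  shows "\<exists>s. \<forall>B :: nat \<Rightarrow> 'k::field mat. minor (offset k n) (block_diag n k p B) (pick R) =
    s * (if \<forall>i<n. card (Ri i) = k i then \<Prod>i<n. minor (k i) (B i) (pick (Ri i)) else 0)"
proof -
  let ?K = "offset k n"
  have fR: "finite R" using R(1) finite_subset by blast
  have fRi: "finite (Ri i)" for i unfolding Ri_def by auto
  note pR = pick_image[OF fR R(2)]
  show ?thesis
  proof (cases "\<forall>i<n. card (Ri i) = k i")
    case True
    \<comment> \<open>\<open>f\<close> lists the columns of \<open>R\<close> block by block. Its
      image is that of \<open>pick R\<close>, so the two minors differ by a fixed sign.\<close>
    define f where "f x = (let i = (SOME i. i < n \<and> offset k i \<le> x \<and> x < offset k i + k i)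
      in offset p i + pick (Ri i) (x - offset k i))" for x
    have f: "f (offset k i + r) = offset p i + pick (Ri i) r" if "i < n" "r < k i" for i r
    proof -
      have "(SOME j. j < n \<and> offset k j \<le> offset k i + r \<and> offset k i + r < offset k j + k j) = i"
      proof (rule some_equality)
        fix j assume "j < n \<and> offset k j \<le> offset k i + r \<and> offset k i + r < offset k j + k j"
        then show "j = i" using offset_between that by blast
      qed (use that in auto)
      then show ?thesis by (simp add: f_def)
    qed
    have pRi: "pick (Ri i) r \<in> Ri i" if "i < n" "r < k i" for i r
      using True that by (intro pick_in_set_le) auto
    have inj: "inj_on f {0..<?K}"
    proof (rule inj_onI)
      fix x y assume xy: "x \<in> {0..<?K}" "y \<in> {0..<?K}" "f x = f y"
      obtain i r where i: "i < n" "r < k i" "x = offset k i + r" using offset_cases[of x k n] xy(1) by auto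
      obtain j s where j: "j < n" "s < k j" "y = offset k j + s" using offset_cases[of y k n] xy(2) by auto
      have "offset p i + pick (Ri i) r = offset p j + pick (Ri j) s" using xy(3) i j f by simp
      then have ij: "i = j" "pick (Ri i) r = pick (Ri j) s"
        using offset_unique[of p i _ j] pRi[OF i(1,2)] pRi[OF j(1,2)] unfolding Ri_def by blast+
      then have "r = s"
        using inj_onD[OF pick_image(2)[OF fRi, of i "k i"], of r s] True i j by auto
      then show "x = y" using i j ij by simp
    qed
    have "f ` {0..<?K} \<subseteq> R"
    proof safe
      fix x assume "x \<in> {0..<?K}"
      then obtain i r where i: "i < n" "r < k i" "x = offset k i + r" using offset_cases[of x k n] by auto
      then show "f x \<in> R" using f[OF i(1,2)] pRi[OF i(1,2)] unfolding Ri_def by auto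
    qed
    then have "f ` {0..<?K} = R" using fR card_image[OF inj] R(2) by (intro card_subset_eq) auto
    then have "pick R ` {0..<?K} = f ` {0..<?K}" using pR(1) by simp
    from minor_same_image[OF pR(2) inj this]
    obtain s where "\<And>B :: 'k mat. minor ?K B (pick R) = s * minor ?K B f" by blast
    moreover have "minor ?K (block_diag n k p B) f = (\<Prod>i<n. minor (k i) (B i) (pick (Ri i)))"
      for B :: "nat \<Rightarrow> 'k mat"
      using pRi f by (intro minor_block_diag) (auto simp: Ri_def)
    ultimately show ?thesis using True by auto
  next
    case False
    \<comment> \<open>The translates of the sets \<open>Ri i\<close> partition \<open>R\<close>, so
      their sizes add up to the number of rows. If one size is wrong, some \<open>Ri i\<close> must
      be too small.\<close>
    have "(\<Sum>i<n. card (Ri i)) = card (\<Union>i<n. (\<lambda>c. offset p i + c) ` Ri i)"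
    proof (subst card_UN_disjoint)
      show "\<forall>i\<in>{..<n}. \<forall>j\<in>{..<n}. i \<noteq> j \<longrightarrow> (\<lambda>c. offset p i + c) ` Ri i \<inter> (\<lambda>c. offset p j + c) ` Ri j = {}"
      proof (intro ballI impI, rule ccontr)
        fix i j assume "i \<noteq> j" "(\<lambda>c. offset p i + c) ` Ri i \<inter> (\<lambda>c. offset p j + c) ` Ri j \<noteq> {}"
        then obtain c c' where "c < p i" "c' < p j" "offset p i + c = offset p j + c'"
          unfolding Ri_def by auto
        then show False using offset_unique \<open>i \<noteq> j\<close> by metis
      qed
      show "(\<Sum>i<n. card (Ri i)) = (\<Sum>i<n. card ((\<lambda>c. offset p i + c) ` Ri i))"
        by (intro sum.cong refl) (simp add: card_image)
    qed (use fRi in auto)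
    also have "(\<Union>i<n. (\<lambda>c. offset p i + c) ` Ri i) = R"
    proof
      show "R \<subseteq> (\<Union>i<n. (\<lambda>c. offset p i + c) ` Ri i)"
      proof
        fix y assume y: "y \<in> R"
        then obtain i c where "i < n" "c < p i" "y = offset p i + c"
          using offset_cases[of y p n] R(1) by auto
        then show "y \<in> (\<Union>i<n. (\<lambda>c. offset p i + c) ` Ri i)" using y unfolding Ri_def by auto
      qed
    qed (auto simp: Ri_def)
    finally have sum: "(\<Sum>i<n. card (Ri i)) = (\<Sum>i<n. k i)" using R(2) by (simp add: offset_def)
    have "\<exists>i<n. card (Ri i) < k i"
    proof (rule ccontr)
      assume neg: "\<not> (\<exists>i<n. card (Ri i) < k i)"
      have ge: "k i \<le> card (Ri i)" if "i < n" for i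
      proof (rule leI, rule notI)
        assume "card (Ri i) < k i"
        then show False using neg that by blast
      qed
      obtain i where i: "i < n" "card (Ri i) \<noteq> k i" using False by blast
      have "k i < card (Ri i)" using ge[OF i(1)] i(2) by (rule le_neq_trans[OF _ not_sym])
      then have "(\<Sum>i<n. k i) < (\<Sum>i<n. card (Ri i))"
        using i(1) ge by (intro sum_strict_mono_ex1 bexI[of _ i] ballI) (simp_all only: lessThan_iff finite_lessThan)
      then show False unfolding sum by (rule less_irrefl[THEN notE])
    qed
    then obtain i where i: "i < n" "card (Ri i) < k i" by blast
    have "minor ?K (block_diag n k p B) (pick R) = 0" for B :: "nat \<Rightarrow> 'k mat"
    proof -
      let ?A = "mat ?K ?K (\<lambda>(r, c). block_diag n k p B $$ (r, pick R c))"
      \<comment> \<open>A permutation with nonzero term would send the \<open>k i\<close> rows of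
        block \<open>i\<close> injectively to columns in \<open>Ri i\<close>, which has fewer than
        \<open>k i\<close> elements.\<close>
      have "(\<Prod>x = 0..<?K. ?A $$ (x, \<pi> x)) = 0" if \<pi>: "\<pi> permutes {0..<?K}" for \<pi>
      proof (rule ccontr)
        assume nz: "(\<Prod>x = 0..<?K. ?A $$ (x, \<pi> x)) \<noteq> 0"
        let ?g = "\<lambda>r. pick R (\<pi> (offset k i + r)) - offset p i"
        have mem: "?g r \<in> Ri i \<and> pick R (\<pi> (offset k i + r)) = offset p i + ?g r" if r: "r < k i" for r
        proof -
          let ?x = "offset k i + r"
          have x: "?x < ?K" using offset_less[of i n r k] i(1) r by simp
          then have px: "\<pi> ?x < ?K" using permutes_in_image[OF \<pi>, of ?x] by auto
          then have pk: "pick R (\<pi> ?x) \<in> R" using R(2) by (intro pick_in_set_le) simp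
          then have "pick R (\<pi> ?x) < offset p n" using R(1) by blast
          then obtain j c where j: "j < n" "c < p j" "pick R (\<pi> ?x) = offset p j + c"
            by (rule offset_cases)
          have "?A $$ (?x, \<pi> ?x) \<noteq> 0"
            using nz x prod_zero[of "{0..<?K}" "\<lambda>x. ?A $$ (x, \<pi> x)"] by fastforce
          moreover have "?A $$ (?x, \<pi> ?x) = block_diag n k p B $$ (?x, pick R (\<pi> ?x))"
            using x px by simp
          ultimately have "block_diag n k p B $$ (?x, offset p j + c) \<noteq> 0" unfolding j(3) by simp
          then have ij: "i = j" using block_diag_index[of i n j r k c p B, OF i(1) j(1) r j(2)] by metis
          have "?g r = c" using j(3) unfolding ij by simp
          moreover have "c \<in> Ri i" using pk j unfolding Ri_def ij by (simp only: mem_Collect_eq)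
          ultimately show ?thesis using j(3) ij by (simp only:)
        qed
        have "inj_on ?g {0..<k i}"
        proof (rule inj_onI)
          fix r s assume rs: "r \<in> {0..<k i}" "s \<in> {0..<k i}" "?g r = ?g s"
          have lt: "r < k i" "s < k i" using rs(1,2) by auto
          have "pick R (\<pi> (offset k i + r)) = pick R (\<pi> (offset k i + s))"
            by (rule trans[OF mem[OF lt(1), THEN conjunct2]
              trans[OF arg_cong[OF rs(3), of "(+) (offset p i)"] mem[OF lt(2), THEN conjunct2, symmetric]]])
          moreover have "\<pi> (offset k i + r) < ?K" "\<pi> (offset k i + s) < ?K"
            using permutes_in_image[OF \<pi>] offset_less[OF i(1), where k = k] lt by force+
          ultimately have "\<pi> (offset k i + r) = \<pi> (offset k i + s)"
            using inj_onD[OF pR(2)] by simp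
          then have "offset k i + r = offset k i + s" by (rule injD[OF permutes_inj[OF \<pi>]])
          then show "r = s" by simp
        qed
        then have "card {0..<k i} \<le> card (Ri i)"
          by (rule card_inj_on_le[OF _ image_subsetI fRi]) (rule conjunct1[OF mem], simp)
        then show False using i(2) by simp
      qed
      then have "(\<Sum>\<pi> | \<pi> permutes {0..<?K}. signof \<pi> * (\<Prod>x = 0..<?K. ?A $$ (x, \<pi> x))) = 0"
        by (intro sum.neutral ballI) simp
      then have "det ?A = 0" using det_def'[of ?A ?K] by simp
      then show ?thesis by (simp add: minor_def)
    qed
    then show ?thesis using False by auto
  qed
qed

section \<open>Linear coordinates\<close>

text \<open>Linear isomorphisms \<open>K\<^sup>N \<rightarrow> V\<close> play the role of ordered bases.\<close>

definition coordinatization :: "('k::field, 'v, 'z) module_scheme \<Rightarrow> nat \<Rightarrow> ('k vec \<Rightarrow> 'v) \<Rightarrow> bool" where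
  "coordinatization V N \<beta> \<longleftrightarrow> \<beta> \<in> LinearCombinations.module_hom class_ring (module_vec TYPE('k) N) V \<and>
     bij_betw \<beta> (carrier_vec N) (carrier V)"

lemma class_ring_sel [simp]: "carrier class_ring = UNIV" "add class_ring = (+)"
  "monoid.mult class_ring = (*)" "one class_ring = 1" "zero class_ring = 0"
  by simp_all

lemma hom_vecD:
  assumes "f \<in> LinearCombinations.module_hom class_ring (module_vec TYPE('k::field) N) V"
  shows "v \<in> carrier_vec N \<Longrightarrow> f v \<in> carrier V"
    "v \<in> carrier_vec N \<Longrightarrow> w \<in> carrier_vec N \<Longrightarrow> f (v + w) = f v \<oplus>\<^bsub>V\<^esub> f w"
    "v \<in> carrier_vec N \<Longrightarrow> f (c \<cdot>\<^sub>v v) = c \<odot>\<^bsub>V\<^esub> f v"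
  using assms by (auto simp: LinearCombinations.module_hom_def module_vec_simps)

lemma hom_vecI:
  assumes "\<And>v. v \<in> carrier_vec N \<Longrightarrow> f v \<in> carrier V"
    "\<And>v w. v \<in> carrier_vec N \<Longrightarrow> w \<in> carrier_vec N \<Longrightarrow> f (v + w) = f v \<oplus>\<^bsub>V\<^esub> f w"
    "\<And>c v. v \<in> carrier_vec N \<Longrightarrow> f (c \<cdot>\<^sub>v v) = c \<odot>\<^bsub>V\<^esub> f v"
  shows "f \<in> LinearCombinations.module_hom class_ring (module_vec TYPE('k::field) N) V"
  using assms by (auto simp: LinearCombinations.module_hom_def module_vec_simps)

lemma linear_mapI:
  assumes "vectorspace K V" "vectorspace K W" "f \<in> LinearCombinations.module_hom K V W"
  shows "linear_map K V W f"
  using assms by (auto simp: linear_map_def mod_hom_def mod_hom_axioms_def vectorspace_def)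

lemma hom_finsum:
  assumes V: "vectorspace K V" and W: "vectorspace K W"
    and T: "T \<in> LinearCombinations.module_hom K V W"
    and A: "finite A" "g \<in> A \<rightarrow> carrier V"
  shows "T (finsum V g A) = (\<Oplus>\<^bsub>W\<^esub>a\<in>A. T (g a))"
  using A
proof (induction A)
  case empty
  interpret linear_map K V W T by (rule linear_mapI[OF V W T])
  show ?case by simp
next
  case (insert a A)
  interpret V: vectorspace K V by (rule V)
  interpret W: vectorspace K W by (rule W)
  from insert have g: "g \<in> A \<rightarrow> carrier V" "g a \<in> carrier V" by auto
  then have "T (finsum V g (insert a A)) = T (g a) \<oplus>\<^bsub>W\<^esub> T (finsum V g A)"
    using insert.hyps by (simp add: V.finsum_insert LinearCombinations.module_hom_add[OF T] V.finsum_closed)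
  moreover have "(\<lambda>a. T (g a)) \<in> A \<rightarrow> carrier W" "T (g a) \<in> carrier W"
    using g LinearCombinations.module_hom_closed[OF T] by auto
  ultimately show ?case using insert g by (simp add: W.finsum_insert)
qed

lemma vec_carrier [simp]: "carrier (module_vec TYPE('k::field) N) = carrier_vec N"
  by (simp add: module_vec_simps)

lemma hom_vec_expand:
  fixes V :: "('k::field, 'v, 'z) module_scheme"
  assumes V: "vectorspace class_ring V"
    and f: "f \<in> LinearCombinations.module_hom class_ring (module_vec TYPE('k) N) V"
    and v: "v \<in> carrier_vec N"
  shows "f v = (\<Oplus>\<^bsub>V\<^esub>c\<in>{..<N}. v $ c \<odot>\<^bsub>V\<^esub> f (unit_vec N c))"
proof -
  interpret U: vec_space "TYPE('k)" N .
  interpret VV: vectorspace class_ring V by (rule V)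
  interpret L: linear_map class_ring "module_vec TYPE('k) N" V f
    by (rule linear_mapI[OF vec_vs V f])
  have u: "(\<lambda>c. v $ c \<cdot>\<^sub>v unit_vec N c) \<in> {..<N} \<rightarrow> carrier_vec N" by auto
  have "v = finsum_vec TYPE('k) N (\<lambda>c. v $ c \<cdot>\<^sub>v unit_vec N c) {..<N}" (is "_ = ?s")
  proof (rule eq_vecI)
    have s: "?s \<in> carrier_vec N" by (rule finsum_vec_closed[OF u])
    show "dim_vec v = dim_vec ?s" using v unfolding carrier_vecD[OF s] by (rule carrier_vecD)
    fix i assume "i < dim_vec ?s"
    then have i: "i < N" unfolding carrier_vecD[OF s] .
    have "?s $ i = (\<Sum>c<N. (v $ c \<cdot>\<^sub>v unit_vec N c) $ i)"
      by (rule index_finsum_vec[OF finite_lessThan i u])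
    also have "\<dots> = (\<Sum>c<N. if c = i then v $ i else 0)"
      using i by (intro sum.cong) auto
    also have "\<dots> = v $ i" using i by simp
    finally show "v $ i = ?s $ i" ..
  qed
  then have "v = finsum (module_vec TYPE('k) N) (\<lambda>c. v $ c \<cdot>\<^sub>v unit_vec N c) {..<N}"
    by (simp only: U.finsum_vec)
  then have "f v = f (finsum (module_vec TYPE('k) N) (\<lambda>c. v $ c \<cdot>\<^sub>v unit_vec N c) {..<N})" by simp
  also have "\<dots> = (\<Oplus>\<^bsub>V\<^esub>c\<in>{..<N}. f (v $ c \<cdot>\<^sub>v unit_vec N c))"
    using u by (intro hom_finsum[OF vec_vs V f]) auto
  also have "\<dots> = (\<Oplus>\<^bsub>V\<^esub>c\<in>{..<N}. v $ c \<odot>\<^bsub>V\<^esub> f (unit_vec N c))"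
    using hom_vecD[OF f] by (intro VV.finsum_cong') auto
  finally show ?thesis .
qed

lemma hom_vec_ext:
  fixes V :: "('k::field, 'v, 'z) module_scheme"
  assumes V: "vectorspace class_ring V"
    and f: "f \<in> LinearCombinations.module_hom class_ring (module_vec TYPE('k) N) V"
    and g: "g \<in> LinearCombinations.module_hom class_ring (module_vec TYPE('k) N) V"
    and fg: "\<And>c. c < N \<Longrightarrow> f (unit_vec N c) = g (unit_vec N c)"
    and v: "v \<in> carrier_vec N"
  shows "f v = g v"
proof -
  interpret V: vectorspace class_ring V by (rule V)
  show ?thesis unfolding hom_vec_expand[OF V f v] hom_vec_expand[OF V g v]
    using fg hom_vecD(1)[OF g] by (intro V.finsum_cong') auto
qed

lemma mult_mat_vec_hom:
  assumes "A \<in> carrier_mat N k"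
  shows "(\<lambda>v. A *\<^sub>v v) \<in> LinearCombinations.module_hom class_ring (module_vec TYPE('k::field) k) (module_vec TYPE('k) N)"
  using assms by (intro hom_vecI)
    (auto simp: module_vec_simps mult_add_distrib_mat_vec mult_mat_vec)

lemma hom_comp:
  assumes "f \<in> LinearCombinations.module_hom R U V" "g \<in> LinearCombinations.module_hom R V W"
  shows "(\<lambda>x. g (f x)) \<in> LinearCombinations.module_hom R U W"
  using assms unfolding LinearCombinations.module_hom_def by (auto simp: Pi_iff)

lemma hom_vec_matrix:
  assumes f: "f \<in> LinearCombinations.module_hom class_ring (module_vec TYPE('k::field) k) (module_vec TYPE('k) N)"
  obtains A where "A \<in> carrier_mat N k" "\<And>v. v \<in> carrier_vec k \<Longrightarrow> f v = A *\<^sub>v v"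
proof -
  define A where "A = mat N k (\<lambda>(i, j). f (unit_vec k j) $ i)"
  have A: "A \<in> carrier_mat N k" by (simp add: A_def)
  have "f v = A *\<^sub>v v" if "v \<in> carrier_vec k" for v
  proof (rule hom_vec_ext[OF vec_vs f mult_mat_vec_hom[OF A] _ that])
    fix c assume c: "c < k"
    have "f (unit_vec k c) \<in> carrier_vec N" using hom_vecD(1)[OF f] by simp
    then show "f (unit_vec k c) = A *\<^sub>v unit_vec k c"
      using c A by (intro eq_vecI) (auto simp: A_def)
  qed
  then show ?thesis using that A by blast
qed

lemma coordinatization_dim:
  fixes V :: "('k::field, 'v, 'z) module_scheme"
  assumes V: "vectorspace class_ring V" and b: "coordinatization V N \<beta>"
  shows "vectorspace.fin_dim class_ring V" "vectorspace.dim class_ring V = N"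
proof -
  have hom: "\<beta> \<in> LinearCombinations.module_hom class_ring (module_vec TYPE('k) N) V"
    and bij: "bij_betw \<beta> (carrier_vec N) (carrier V)" using b by (auto simp: coordinatization_def)
  interpret U: vec_space "TYPE('k)" N .
  interpret L: linear_map class_ring "module_vec TYPE('k) N" V \<beta>
    by (rule linear_mapI[OF vec_vs V hom])
  have im: "\<beta> ` carrier (module_vec TYPE('k) N) = carrier V"
    and inj: "inj_on \<beta> (carrier (module_vec TYPE('k) N))"
    using bij by (auto simp: bij_betw_def)
  show "vectorspace.fin_dim class_ring V" using L.surj_fin_dim[OF U.fin_dim im] .
  show "vectorspace.dim class_ring V = N" using L.dim_eq[OF U.fin_dim inj im] U.dim_is_n by simp
qed

lemma ordered_basis_coordinatization:
  fixes V :: "('k::field, 'v) module"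
  assumes V: "vectorspace class_ring V" and bs: "ordered_basis V bs"
  shows "\<exists>\<beta>. coordinatization V (length bs) \<beta> \<and>
    (\<forall>r<length bs. \<beta> (unit_vec (length bs) r) = bs ! r)"
proof -
  interpret V: vectorspace class_ring V by (rule V)
  let ?N = "length bs"
  define \<beta> where "\<beta> v = (\<Oplus>\<^bsub>V\<^esub>c\<in>{..<?N}. v $ c \<odot>\<^bsub>V\<^esub> bs ! c)" for v
  have dist: "distinct bs" and basis: "V.basis (set bs)" using bs by (auto simp: ordered_basis_def)
  then have li: "V.lin_indpt (set bs)" and gen: "V.span (set bs) = carrier V" and sub: "set bs \<subseteq> carrier V"
    by (auto simp: V.basis_def)
  have bsc: "bs ! c \<in> carrier V" if "c < ?N" for c using sub that by auto
  have nth: "inj_on ((!) bs) {..<?N}" "(!) bs ` {..<?N} = set bs"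
    using dist by (auto simp: inj_on_def nth_eq_iff_index_eq set_conv_nth)
  have lc: "V.lincomb a (set bs) = (\<Oplus>\<^bsub>V\<^esub>c\<in>{..<?N}. a (bs ! c) \<odot>\<^bsub>V\<^esub> bs ! c)" for a
    unfolding V.lincomb_def nth(2)[symmetric]
    by (rule V.finsum_reindex[OF _ nth(1)]) (use sub nth(2) in \<open>auto intro!: V.smult_closed\<close>)
  have add: "\<beta> (v + w) = \<beta> v \<oplus>\<^bsub>V\<^esub> \<beta> w" if "v \<in> carrier_vec ?N" "w \<in> carrier_vec ?N" for v w
  proof -
    have "\<beta> (v + w) = (\<Oplus>\<^bsub>V\<^esub>c\<in>{..<?N}. v $ c \<odot>\<^bsub>V\<^esub> bs ! c \<oplus>\<^bsub>V\<^esub> w $ c \<odot>\<^bsub>V\<^esub> bs ! c)"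
      unfolding \<beta>_def using that bsc V.smult_l_distr by (intro V.finsum_cong') auto
    then show ?thesis unfolding \<beta>_def using bsc by (simp add: V.finsum_addf)
  qed
  have smult: "\<beta> (c \<cdot>\<^sub>v v) = c \<odot>\<^bsub>V\<^esub> \<beta> v" if "v \<in> carrier_vec ?N" for c v
  proof -
    have "\<beta> (c \<cdot>\<^sub>v v) = (\<Oplus>\<^bsub>V\<^esub>i\<in>{..<?N}. c \<odot>\<^bsub>V\<^esub> (v $ i \<odot>\<^bsub>V\<^esub> bs ! i))"
      unfolding \<beta>_def using that bsc V.smult_assoc1 by (intro V.finsum_cong') auto
    then show ?thesis unfolding \<beta>_def using bsc by (simp add: V.finsum_smult_ldistr)
  qed
  have hom: "\<beta> \<in> LinearCombinations.module_hom class_ring (module_vec TYPE('k) ?N) V"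
  proof (rule hom_vecI[OF _ add smult])
    show "\<beta> v \<in> carrier V" for v unfolding \<beta>_def using bsc by (intro V.finsum_closed) auto
  qed
  interpret L: linear_map class_ring "module_vec TYPE('k) ?N" V \<beta>
    by (rule linear_mapI[OF vec_vs V hom])
  have "\<beta> ` carrier_vec ?N = carrier V"
  proof
    show "\<beta> ` carrier_vec ?N \<subseteq> carrier V" using hom_vecD(1)[OF hom] by auto
    show "carrier V \<subseteq> \<beta> ` carrier_vec ?N"
    proof
      fix x assume "x \<in> carrier V"
      then obtain a where "x = V.lincomb a (set bs)"
        using gen V.finite_in_span[of "set bs" x] sub by auto
      also have "\<dots> = \<beta> (vec ?N (\<lambda>c. a (bs ! c)))"
        unfolding lc \<beta>_def using bsc by (intro V.finsum_cong') auto
      finally show "x \<in> \<beta> ` carrier_vec ?N" by auto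
    qed
  qed
  moreover have "inj_on \<beta> (carrier_vec ?N)"
  proof -
    have "v = 0\<^sub>v ?N" if v: "v \<in> carrier_vec ?N" "\<beta> v = \<zero>\<^bsub>V\<^esub>" for v
    proof (rule eq_vecI)
      fix i assume i: "i < dim_vec (0\<^sub>v ?N :: 'k vec)"
      \<comment> \<open>The entries of a kernel vector, read as coefficients on the basis vectors,
        form a linear relation between them.\<close>
      let ?a = "\<lambda>x. v $ inv_into {..<?N} ((!) bs) x"
      have inv: "inv_into {..<?N} ((!) bs) (bs ! c) = c" if "c < ?N" for c
        by (rule inv_into_f_f[OF nth(1)]) (use that in simp)
      have "V.lincomb ?a (set bs) = \<beta> v"
        unfolding lc \<beta>_def using bsc inv by (intro V.finsum_cong') auto
      then have "?a \<in> set bs \<rightarrow> {0}"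
        using V.not_lindepD[OF li, of "set bs" ?a] v(2) by simp
      then have "?a (bs ! i) = 0" using i by (auto simp: Pi_iff)
      then show "v $ i = 0\<^sub>v ?N $ i" using i inv by simp
    qed (use v in simp)
    then have "carrier (V\<lparr>carrier := {}\<rparr>) = {} \<Longrightarrow> mod_hom.ker (module_vec TYPE('k) ?N) V \<beta> = {\<zero>\<^bsub>module_vec TYPE('k) ?N\<^esub>}"
      unfolding L.ker_def using L.f0_is_0 by (auto simp: module_vec_simps)
    then show ?thesis using L.Ke0_imp_inj by simp
  qed
  ultimately have "coordinatization V ?N \<beta>" using hom by (simp add: coordinatization_def bij_betw_def)
  moreover have "\<beta> (unit_vec ?N r) = bs ! r" if r: "r < ?N" for r
  proof -
    have "\<beta> (unit_vec ?N r) = (\<Oplus>\<^bsub>V\<^esub>c\<in>{..<?N}. if r = c then bs ! c else \<zero>\<^bsub>V\<^esub>)"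
      unfolding \<beta>_def using r bsc V.lmult_0 V.smult_one by (intro V.finsum_cong') auto
    then show ?thesis using V.finsum_singleton[of r "{..<?N}" "(!) bs"] r bsc by auto
  qed
  ultimately show ?thesis by blast
qed

lemma fin_dim_ordered_basis:
  fixes V :: "('k::field, 'v) module"
  assumes V: "vectorspace class_ring V" and fd: "vectorspace.fin_dim class_ring V"
  shows "\<exists>bs. ordered_basis V bs"
proof -
  interpret V: vectorspace class_ring V by (rule V)
  obtain B where "finite B" "V.basis B" using V.finite_basis_exists[OF fd] by auto
  moreover obtain bs where "set bs = B" "distinct bs" using finite_distinct_list[OF \<open>finite B\<close>] by auto
  ultimately show ?thesis unfolding ordered_basis_def by blast
qed

lemma fin_dim_coordinatization:
  fixes V :: "('k::field, 'v) module"
  assumes V: "vectorspace class_ring V" and fd: "vectorspace.fin_dim class_ring V"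
  shows "\<exists>\<beta>. coordinatization V (vectorspace.dim class_ring V) \<beta>"
proof -
  obtain bs where "ordered_basis V bs" using fin_dim_ordered_basis[OF V fd] by blast
  then obtain \<beta> where "coordinatization V (length bs) \<beta>" using ordered_basis_coordinatization[OF V] by blast
  moreover from this have "vectorspace.dim class_ring V = length bs" by (rule coordinatization_dim(2)[OF V])
  ultimately show ?thesis by auto
qed

text \<open>Independent subsets of \<open>W\<close> stay independent in \<open>V\<close>, so their
  size is bounded by the dimension of \<open>V\<close>; a maximal one is a basis of
  \<open>W\<close>.\<close>

lemma subspace_fin_dim:
  fixes V :: "('k::field, 'v) module"
  assumes V: "vectorspace class_ring V" and fd: "vectorspace.fin_dim class_ring V"
    and W: "VectorSpace.subspace class_ring W V"
  shows "vectorspace.fin_dim class_ring (V\<lparr>carrier := W\<rparr>)"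
    "vectorspace.dim class_ring (V\<lparr>carrier := W\<rparr>) \<le> vectorspace.dim class_ring V"
proof -
  interpret V: vectorspace class_ring V by (rule V)
  interpret W: vectorspace class_ring "V\<lparr>carrier := W\<rparr>" by (rule V.subspace_is_vs[OF W])
  have sm: "LinearCombinations.submodule class_ring W V" using W by (rule V.is_module)
  then have WV: "W \<subseteq> carrier V" by (simp add: LinearCombinations.submodule_def)
  let ?P = "\<lambda>S. S \<subseteq> carrier (V\<lparr>carrier := W\<rparr>) \<and> W.lin_indpt S"
  have "\<exists>A. finite A \<and> maximal A ?P"
  proof (rule maximal_exists)
    fix A assume A: "?P A"
    then have "V.lin_indpt A" "A \<subseteq> carrier V" using V.span_li_not_depend(2)[OF _ sm, of A] WV by auto
    then show "finite A \<and> card A \<le> V.dim" using V.li_le_dim[OF fd] by auto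
  next
    show "?P {}" by (auto simp: W.lin_dep_def)
  qed
  then obtain A where A: "finite A" "maximal A ?P" by blast
  then have "W.basis A" by (intro W.max_li_is_basis)
  then show "W.fin_dim" unfolding W.fin_dim_def W.basis_def using A(1) by auto
  have "?P A" using A(2) by (simp add: maximal_def)
  then have "V.lin_indpt A" "A \<subseteq> carrier V" using V.span_li_not_depend(2)[OF _ sm, of A] WV by auto
  then have "card A \<le> V.dim" using V.li_le_dim[OF fd] by auto
  then show "W.dim \<le> V.dim" using W.dim_basis[OF A(1) \<open>W.basis A\<close>] by simp
qed

text \<open>The universal property of the standard basis; later it lifts bases along surjections and
  produces linear relations between powers.\<close>

lemma vec_family_hom:
  fixes V :: "('k::field, 'v) module"
  assumes V: "vectorspace class_ring V" and xs: "\<And>c. c < N \<Longrightarrow> xs c \<in> carrier V"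
  shows "\<exists>\<beta> \<in> LinearCombinations.module_hom class_ring (module_vec TYPE('k) N) V.
    \<forall>c<N. \<beta> (unit_vec N c) = xs c"
proof -
  interpret V: vectorspace class_ring V by (rule V)
  define \<beta> where "\<beta> v = (\<Oplus>\<^bsub>V\<^esub>c\<in>{..<N}. v $ c \<odot>\<^bsub>V\<^esub> xs c)" for v :: "'k vec"
  have add: "\<beta> (v + w) = \<beta> v \<oplus>\<^bsub>V\<^esub> \<beta> w" if "v \<in> carrier_vec N" "w \<in> carrier_vec N" for v w
  proof -
    have "\<beta> (v + w) = (\<Oplus>\<^bsub>V\<^esub>c\<in>{..<N}. v $ c \<odot>\<^bsub>V\<^esub> xs c \<oplus>\<^bsub>V\<^esub> w $ c \<odot>\<^bsub>V\<^esub> xs c)"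
      unfolding \<beta>_def using that xs V.smult_l_distr by (intro V.finsum_cong') auto
    then show ?thesis unfolding \<beta>_def using xs by (simp add: V.finsum_addf)
  qed
  have smult: "\<beta> (c \<cdot>\<^sub>v v) = c \<odot>\<^bsub>V\<^esub> \<beta> v" if "v \<in> carrier_vec N" for c v
  proof -
    have "\<beta> (c \<cdot>\<^sub>v v) = (\<Oplus>\<^bsub>V\<^esub>i\<in>{..<N}. c \<odot>\<^bsub>V\<^esub> (v $ i \<odot>\<^bsub>V\<^esub> xs i))"
      unfolding \<beta>_def using that xs V.smult_assoc1 by (intro V.finsum_cong') auto
    then show ?thesis unfolding \<beta>_def using xs by (simp add: V.finsum_smult_ldistr)
  qed
  have "\<beta> \<in> LinearCombinations.module_hom class_ring (module_vec TYPE('k) N) V"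
  proof (rule hom_vecI[OF _ add smult])
    show "\<beta> v \<in> carrier V" for v unfolding \<beta>_def using xs by (intro V.finsum_closed) auto
  qed
  moreover have "\<beta> (unit_vec N r) = xs r" if r: "r < N" for r
  proof -
    have "\<beta> (unit_vec N r) = (\<Oplus>\<^bsub>V\<^esub>c\<in>{..<N}. if r = c then xs c else \<zero>\<^bsub>V\<^esub>)"
      unfolding \<beta>_def using r xs V.lmult_0 V.smult_one by (intro V.finsum_cong') auto
    then show ?thesis using V.finsum_singleton[of r "{..<N}" xs] r xs by auto
  qed
  ultimately show ?thesis by blast
qed

section \<open>Dimensions in short exact sequences\<close>

lemma carrier_update_same [simp]: "(V :: ('k, 'v) module)\<lparr>carrier := carrier V\<rparr> = V"
  by simp

text \<open>Rank-nullity for a surjection. The kernel is written as a carrier update, the form in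
  which submodules and fixed spaces occur later.\<close>

lemma dim_exact:
  fixes V :: "('k::field, 'v) module" and W :: "('k, 'w) module"
  assumes V: "vectorspace class_ring V" and W: "vectorspace class_ring W"
    and fd: "vectorspace.fin_dim class_ring V"
    and T: "T \<in> LinearCombinations.module_hom class_ring V W" and surj: "T ` carrier V = carrier W"
  shows "vectorspace.fin_dim class_ring W"
    "vectorspace.dim class_ring V
      = vectorspace.dim class_ring (V\<lparr>carrier := {x \<in> carrier V. T x = \<zero>\<^bsub>W\<^esub>}\<rparr>) + vectorspace.dim class_ring W"
proof -
  interpret L: linear_map class_ring V W T by (rule linear_mapI[OF V W T])
  show "vectorspace.fin_dim class_ring W" by (rule L.rank_nullity_main(2)[OF fd surj])
  show "vectorspace.dim class_ring V
      = vectorspace.dim class_ring (V\<lparr>carrier := {x \<in> carrier V. T x = \<zero>\<^bsub>W\<^esub>}\<rparr>) + vectorspace.dim class_ring W"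
    using L.rank_nullity_main(1)[OF fd] unfolding L.im_def L.ker_def surj carrier_update_same
    by (simp only: add.commute)
qed

lemma kernel_subspace:
  fixes V :: "('k::field, 'v) module" and W :: "('k, 'w) module"
  assumes V: "vectorspace class_ring V" and W: "vectorspace class_ring W"
    and T: "T \<in> LinearCombinations.module_hom class_ring V W"
  shows "VectorSpace.subspace class_ring {x \<in> carrier V. T x = \<zero>\<^bsub>W\<^esub>} V"
proof -
  interpret L: linear_map class_ring V W T by (rule linear_mapI[OF V W T])
  show ?thesis using L.kerT_is_subspace unfolding L.ker_def .
qed

text \<open>Lift a basis of \<open>W\<close> to \<open>V\<close> and adjoin a basis of the kernel:
  subtracting from \<open>x\<close> the lift of its image leaves a kernel element, so the resulting
  map from \<open>K^(l + m)\<close> is onto. This is what gives finite dimension of a projective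
  cover, where only the kernel and the image are known to be finite dimensional.\<close>

lemma fin_dim_extension:
  fixes V :: "('k::field, 'v) module" and W :: "('k, 'w) module"
  assumes V: "vectorspace class_ring V" and W: "vectorspace class_ring W"
    and T: "T \<in> LinearCombinations.module_hom class_ring V W" and surj: "T ` carrier V = carrier W"
    and fdK: "vectorspace.fin_dim class_ring (V\<lparr>carrier := {x \<in> carrier V. T x = \<zero>\<^bsub>W\<^esub>}\<rparr>)"
    and fdW: "vectorspace.fin_dim class_ring W"
  shows "vectorspace.fin_dim class_ring V"
proof -
  interpret V: vectorspace class_ring V by (rule V)
  interpret W: vectorspace class_ring W by (rule W)
  interpret L: linear_map class_ring V W T by (rule linear_mapI[OF V W T])
  let ?K = "{x \<in> carrier V. T x = \<zero>\<^bsub>W\<^esub>}"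
  have Kvs: "vectorspace class_ring (V\<lparr>carrier := ?K\<rparr>)"
    by (rule V.subspace_is_vs[OF kernel_subspace[OF V W T]])
  obtain l \<kappa> where \<kappa>: "coordinatization (V\<lparr>carrier := ?K\<rparr>) l \<kappa>"
    using fin_dim_coordinatization[OF Kvs fdK] by blast
  obtain m \<omega> where \<omega>: "coordinatization W m \<omega>"
    using fin_dim_coordinatization[OF W fdW] by blast
  have \<omega>h: "\<omega> \<in> LinearCombinations.module_hom class_ring (module_vec TYPE('k) m) W"
    and \<omega>s: "\<omega> ` carrier_vec m = carrier W" using \<omega> by (auto simp: coordinatization_def bij_betw_def)
  have \<kappa>h: "\<kappa> \<in> LinearCombinations.module_hom class_ring (module_vec TYPE('k) l) V"
    and \<kappa>s: "\<kappa> ` carrier_vec l = ?K"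
    using \<kappa> by (auto simp: coordinatization_def bij_betw_def LinearCombinations.module_hom_def)
  define xs where "xs c = inv_into (carrier V) T (\<omega> (unit_vec m c))" for c
  have xs: "xs c \<in> carrier V" "T (xs c) = \<omega> (unit_vec m c)" for c
  proof -
    have "\<omega> (unit_vec m c) \<in> T ` carrier V" using hom_vecD(1)[OF \<omega>h unit_vec_carrier] surj by simp
    then show "xs c \<in> carrier V" "T (xs c) = \<omega> (unit_vec m c)"
      unfolding xs_def by (rule inv_into_into, rule f_inv_into_f)
  qed
  obtain \<alpha> where \<alpha>: "\<alpha> \<in> LinearCombinations.module_hom class_ring (module_vec TYPE('k) m) V"
    "\<And>c. c < m \<Longrightarrow> \<alpha> (unit_vec m c) = xs c"
    using vec_family_hom[where N = m and xs = xs, OF V xs(1)] by blast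
  have T\<alpha>: "T (\<alpha> v) = \<omega> v" if "v \<in> carrier_vec m" for v
    by (rule hom_vec_ext[OF W hom_comp[OF \<alpha>(1) T] \<omega>h _ that]) (simp add: \<alpha>(2) xs)
  let ?f = "\<lambda>v :: 'k vec. vec l (\<lambda>i. v $ i)" and ?g = "\<lambda>v :: 'k vec. vec m (\<lambda>i. v $ (l + i))"
  let ?\<gamma> = "\<lambda>v. \<kappa> (?f v) \<oplus>\<^bsub>V\<^esub> \<alpha> (?g v)"
  have \<gamma>: "?\<gamma> \<in> LinearCombinations.module_hom class_ring (module_vec TYPE('k) (l + m)) V"
  proof (rule hom_vecI)
    fix v w :: "'k vec" assume vw: "v \<in> carrier_vec (l + m)" "w \<in> carrier_vec (l + m)"
    have "?f (v + w) = ?f v + ?f w" "?g (v + w) = ?g v + ?g w" using vw by auto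
    then show "?\<gamma> (v + w) = ?\<gamma> v \<oplus>\<^bsub>V\<^esub> ?\<gamma> w"
      using hom_vecD(1,2)[OF \<kappa>h] hom_vecD(1,2)[OF \<alpha>(1)] by (simp add: V.a_ac)
  next
    fix c :: 'k and v :: "'k vec" assume v: "v \<in> carrier_vec (l + m)"
    have "?f (c \<cdot>\<^sub>v v) = c \<cdot>\<^sub>v ?f v" "?g (c \<cdot>\<^sub>v v) = c \<cdot>\<^sub>v ?g v" using v by auto
    then show "?\<gamma> (c \<cdot>\<^sub>v v) = c \<odot>\<^bsub>V\<^esub> ?\<gamma> v"
      using hom_vecD(1,3)[OF \<kappa>h] hom_vecD(1,3)[OF \<alpha>(1)] by (simp add: V.smult_r_distr)
  qed (use hom_vecD(1)[OF \<kappa>h] hom_vecD(1)[OF \<alpha>(1)] in simp)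
  have "?\<gamma> ` carrier_vec (l + m) = carrier V"
  proof
    show "?\<gamma> ` carrier_vec (l + m) \<subseteq> carrier V" using hom_vecD(1)[OF \<gamma>] by auto
    show "carrier V \<subseteq> ?\<gamma> ` carrier_vec (l + m)"
    proof
      fix x assume x: "x \<in> carrier V"
      then have "T x \<in> \<omega> ` carrier_vec m" using \<omega>s by simp
      then obtain w where w: "w \<in> carrier_vec m" "T x = \<omega> w" by auto
      have aw: "\<alpha> w \<in> carrier V" using hom_vecD(1)[OF \<alpha>(1) w(1)] .
      have "T (x \<ominus>\<^bsub>V\<^esub> \<alpha> w) = \<zero>\<^bsub>W\<^esub>"
        using x aw T\<alpha>[OF w(1)] w(2) hom_vecD(1)[OF \<omega>h w(1)] by (simp add: L.T_minus W.minus_eq W.r_neg)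
      then have "x \<ominus>\<^bsub>V\<^esub> \<alpha> w \<in> \<kappa> ` carrier_vec l" using \<kappa>s x aw by simp
      then obtain u where u: "u \<in> carrier_vec l" "x \<ominus>\<^bsub>V\<^esub> \<alpha> w = \<kappa> u" by auto
      have "?f (u @\<^sub>v w) = u" "?g (u @\<^sub>v w) = w" using u(1) w(1) by auto
      then have "?\<gamma> (u @\<^sub>v w) = (x \<ominus>\<^bsub>V\<^esub> \<alpha> w) \<oplus>\<^bsub>V\<^esub> \<alpha> w" using u(2) by simp
      also have "\<dots> = x" using x aw by (simp add: V.minus_eq V.a_assoc V.l_neg)
      finally show "x \<in> ?\<gamma> ` carrier_vec (l + m)" using u(1) w(1) by (intro image_eqI[of _ _ "u @\<^sub>v w"]) auto
    qed
  qed
  then have "?\<gamma> ` carrier (module_vec TYPE('k) (l + m)) = carrier V" by simp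
  then show ?thesis
    by (rule linear_map.surj_fin_dim[OF linear_mapI[OF vec_vs V \<gamma>] vec_space.fin_dim])
qed

section \<open>Row spaces of matrices\<close>

text \<open>In other words, the rows of \<open>B\<close> form a basis of \<open>W\<close>;
  injectivity expresses their independence.\<close>

definition row_span :: "nat \<Rightarrow> nat \<Rightarrow> 'k::field vec set \<Rightarrow> 'k mat \<Rightarrow> bool" where
  "row_span k N W B \<longleftrightarrow> B \<in> carrier_mat k N \<and> inj_on (\<lambda>v. B\<^sup>T *\<^sub>v v) (carrier_vec k) \<and>
     W = (\<lambda>v. B\<^sup>T *\<^sub>v v) ` carrier_vec k"

lemma inj_mat_vecI:
  assumes A: "(A :: 'k::field mat) \<in> carrier_mat N k"
    and "\<And>v. v \<in> carrier_vec k \<Longrightarrow> A *\<^sub>v v = 0\<^sub>v N \<Longrightarrow> v = 0\<^sub>v k"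
  shows "inj_on (\<lambda>v. A *\<^sub>v v) (carrier_vec k)"
proof (rule inj_onI)
  fix v w assume vw: "v \<in> carrier_vec k" "w \<in> carrier_vec k" "A *\<^sub>v v = A *\<^sub>v w"
  then have "A *\<^sub>v (v - w) = 0\<^sub>v N" using A by (simp add: mult_minus_distrib_mat_vec)
  then have "v - w = 0\<^sub>v k" using assms(2) vw by simp
  then have "(v - w) $ i = 0" if "i < k" for i using that by simp
  then show "v = w" using vw by (intro eq_vecI) auto
qed

lemma inj_mat_vecD:
  assumes A: "(A :: 'k::field mat) \<in> carrier_mat N k" and inj: "inj_on (\<lambda>v. A *\<^sub>v v) (carrier_vec k)"
    and v: "v \<in> carrier_vec k" "A *\<^sub>v v = 0\<^sub>v N"
  shows "v = 0\<^sub>v k"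
proof -
  have "A *\<^sub>v 0\<^sub>v k = 0\<^sub>v N" using A by auto
  then show ?thesis using inj_onD[OF inj, of v "0\<^sub>v k"] v by simp
qed

lemma coordinatization_range:
  fixes V :: "('k::field, 'v) module"
  assumes V: "vectorspace class_ring V"
    and f: "f \<in> LinearCombinations.module_hom class_ring (module_vec TYPE('k) k) V"
    and inj: "inj_on f (carrier_vec k)"
  shows "VectorSpace.subspace class_ring (f ` carrier_vec k) V"
    "coordinatization (V\<lparr>carrier := f ` carrier_vec k\<rparr>) k f"
proof -
  interpret L: linear_map class_ring "module_vec TYPE('k) k" V f
    by (rule linear_mapI[OF vec_vs V f])
  show "VectorSpace.subspace class_ring (f ` carrier_vec k) V"
    using L.imT_is_subspace by (simp add: L.im_def)
  show "coordinatization (V\<lparr>carrier := f ` carrier_vec k\<rparr>) k f"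
    unfolding coordinatization_def using f inj by (auto simp: LinearCombinations.module_hom_def bij_betw_def)
qed

text \<open>As long as the columns do not span, adjoin one outside their span, which preserves
  injectivity. A square injective matrix has nonzero determinant.\<close>

lemma extend_to_invertible:
  assumes "(A :: 'k::field mat) \<in> carrier_mat N k" "inj_on (\<lambda>v. A *\<^sub>v v) (carrier_vec k)"
  shows "k \<le> N \<and> (\<exists>M M'. M \<in> carrier_mat N N \<and> M' \<in> carrier_mat N N \<and> M * M' = 1\<^sub>m N \<and>
    M' * M = 1\<^sub>m N \<and> (\<forall>i<N. \<forall>j<k. M $$ (i, j) = A $$ (i, j)))"
  using assms
proof (induction "N - k" arbitrary: k A)
  case (0 k A)
  \<comment> \<open>\<open>N - k = 0\<close> only says \<open>N \<le> k\<close>. The other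
    inequality compares the dimension of the image with that of \<open>K^N\<close>.\<close>
  have le: "k \<le> N"
  proof -
    interpret V: vec_space "TYPE('k)" N .
    note c = coordinatization_range[OF vec_vs mult_mat_vec_hom[OF 0(2)] 0(3)]
    show ?thesis
      using subspace_fin_dim(2)[OF vec_vs V.fin_dim c(1)]
        coordinatization_dim(2)[OF V.subspace_is_vs[OF c(1)] c(2)] V.dim_is_n by simp
  qed
  with 0 have kN: "k = N" by simp
  have "det A \<noteq> 0"
    using det_0_iff_vec_prod_zero_field[of A N] inj_mat_vecD[OF 0(2,3)] 0(2) kN by auto
  then have "A \<in> Units (ring_mat TYPE('k) N ())" using 0(2) kN by (intro det_non_zero_imp_unit) auto
  then obtain M' where "M' \<in> carrier_mat N N" "A * M' = 1\<^sub>m N" "M' * A = 1\<^sub>m N"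
    unfolding Units_def by (auto simp: ring_mat_simps)
  then show ?case using 0(2) kN by auto
next
  case (Suc d k A)
  then have kN: "k < N" by simp
  have "(\<lambda>v. A *\<^sub>v v) ` carrier_vec k \<noteq> carrier_vec N"
  proof
    interpret V: vec_space "TYPE('k)" N .
    assume eq: "(\<lambda>v. A *\<^sub>v v) ` carrier_vec k = carrier_vec N"
    have "coordinatization (module_vec TYPE('k) N) k (\<lambda>v. A *\<^sub>v v)"
      unfolding coordinatization_def using mult_mat_vec_hom[OF Suc(3)] Suc(4) eq by (simp add: bij_betw_def)
    then show False using coordinatization_dim(2)[OF vec_vs] V.dim_is_n kN by fastforce
  qed
  moreover have "(\<lambda>v. A *\<^sub>v v) ` carrier_vec k \<subseteq> carrier_vec N" using Suc(3) by auto
  ultimately obtain w where w: "w \<in> carrier_vec N" "w \<notin> (\<lambda>v. A *\<^sub>v v) ` carrier_vec k" by auto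
  define A' where "A' = mat N (Suc k) (\<lambda>(i, j). if j < k then A $$ (i, j) else w $ i)"
  have A': "A' \<in> carrier_mat N (Suc k)" by (simp add: A'_def)
  have A'v: "A' *\<^sub>v v = A *\<^sub>v vec k (\<lambda>i. v $ i) + v $ k \<cdot>\<^sub>v w" if "v \<in> carrier_vec (Suc k)" for v
    using that Suc(3) w(1) by (intro eq_vecI) (auto simp: A'_def scalar_prod_def)
  have "inj_on (\<lambda>v. A' *\<^sub>v v) (carrier_vec (Suc k))"
  proof (rule inj_mat_vecI[OF A'])
    fix v assume v: "v \<in> carrier_vec (Suc k)" "A' *\<^sub>v v = 0\<^sub>v N"
    let ?u = "vec k (\<lambda>i. v $ i)"
    have u: "?u \<in> carrier_vec k" by simp
    have Au: "A *\<^sub>v ?u \<in> carrier_vec N" using Suc(3) by simp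
    have z: "(A *\<^sub>v ?u) $ i + v $ k * w $ i = 0" if "i < N" for i
      using arg_cong[OF A'v[OF v(1)], of "\<lambda>x. x $ i"] v(2) that w(1) Au by simp
    \<comment> \<open>Otherwise one could solve for \<open>w\<close>, which would then lie in the
      image of \<open>A\<close>.\<close>
    have vk: "v $ k = 0"
    proof (rule ccontr)
      assume nz: "v $ k \<noteq> 0"
      have "w = A *\<^sub>v ((- inverse (v $ k)) \<cdot>\<^sub>v ?u)"
      proof (rule eq_vecI)
        fix i assume "i < dim_vec (A *\<^sub>v ((- inverse (v $ k)) \<cdot>\<^sub>v ?u))"
        then have i: "i < N" using Suc(3) by simp
        have "(A *\<^sub>v ((- inverse (v $ k)) \<cdot>\<^sub>v ?u)) $ i = (- inverse (v $ k)) * (A *\<^sub>v ?u) $ i"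
          using i carrier_matD[OF Suc(3)] unfolding mult_mat_vec[OF Suc(3) u] by simp
        also have "(A *\<^sub>v ?u) $ i = - (v $ k * w $ i)" using z[OF i] by (simp only: eq_neg_iff_add_eq_0)
        finally show "w $ i = (A *\<^sub>v ((- inverse (v $ k)) \<cdot>\<^sub>v ?u)) $ i" using nz by simp
      qed (use w Suc(3) in auto)
      moreover have "(- inverse (v $ k)) \<cdot>\<^sub>v ?u \<in> carrier_vec k" by simp
      ultimately show False using w(2) by blast
    qed
    have "A *\<^sub>v ?u = 0\<^sub>v N" by (rule eq_vecI) (use z vk Au Suc(3) in auto)
    then have "?u = 0\<^sub>v k" by (rule inj_mat_vecD[OF Suc(3,4) u])
    then have "?u $ i = 0" if "i < k" for i using that by simp
    then have "v $ i = 0" if "i < Suc k" for i using that vk by (cases "i = k") auto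
    then show "v = 0\<^sub>v (Suc k)" using v(1) by (intro eq_vecI) auto
  qed
  moreover have "d = N - Suc k" using Suc(2) by simp
  ultimately obtain M M' where "M \<in> carrier_mat N N" "M' \<in> carrier_mat N N" "M * M' = 1\<^sub>m N"
    "M' * M = 1\<^sub>m N" "\<forall>i<N. \<forall>j<Suc k. M $$ (i, j) = A' $$ (i, j)"
    using Suc(1)[of "Suc k" A'] A' by blast
  moreover from this have "\<forall>i<N. \<forall>j<k. M $$ (i, j) = A $$ (i, j)" by (auto simp: A'_def)
  ultimately show ?case using kN by (intro conjI exI[of _ M] exI[of _ M']) simp_all
qed

lemma row_spanD:
  assumes "row_span k N W B"
  shows "B \<in> carrier_mat k N" "B\<^sup>T \<in> carrier_mat N k" "inj_on (\<lambda>v. B\<^sup>T *\<^sub>v v) (carrier_vec k)"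
    "W = (\<lambda>v. B\<^sup>T *\<^sub>v v) ` carrier_vec k" "W \<subseteq> carrier_vec N"
proof -
  show B: "B \<in> carrier_mat k N" and "inj_on (\<lambda>v. B\<^sup>T *\<^sub>v v) (carrier_vec k)"
    and W: "W = (\<lambda>v. B\<^sup>T *\<^sub>v v) ` carrier_vec k"
    using assms unfolding row_span_def by blast+
  show BT: "B\<^sup>T \<in> carrier_mat N k" using B by simp
  show "W \<subseteq> carrier_vec N" unfolding W using BT by (intro image_subsetI) simp
qed

text \<open>Complete \<open>A\<close> to an invertible matrix and keep the upper \<open>k\<close>
  rows of the inverse.\<close>

lemma left_inverse:
  assumes A: "(A :: 'k::field mat) \<in> carrier_mat N k" and inj: "inj_on (\<lambda>v. A *\<^sub>v v) (carrier_vec k)"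
  shows "\<exists>L \<in> carrier_mat k N. L * A = 1\<^sub>m k"
proof -
  obtain M M' where M: "k \<le> N" "M \<in> carrier_mat N N" "M' \<in> carrier_mat N N" "M' * M = 1\<^sub>m N"
    "\<And>i j. i < N \<Longrightarrow> j < k \<Longrightarrow> M $$ (i, j) = A $$ (i, j)"
    using extend_to_invertible[OF A inj] by blast
  let ?L = "mat k N (\<lambda>(i, j). M' $$ (i, j))"
  have "?L * A = 1\<^sub>m k"
  proof (rule eq_matI)
    fix i j assume "i < dim_row (1\<^sub>m k :: 'k mat)" "j < dim_col (1\<^sub>m k :: 'k mat)"
    then have ij: "i < k" "j < k" "i < N" "j < N" using M(1) by auto
    have "(?L * A) $$ (i, j) = (\<Sum>r = 0..<N. M' $$ (i, r) * A $$ (r, j))"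
      using ij A by (simp add: scalar_prod_def)
    also have "\<dots> = (\<Sum>r = 0..<N. M' $$ (i, r) * M $$ (r, j))"
      using M(5) ij by (intro sum.cong) auto
    also have "\<dots> = (M' * M) $$ (i, j)" using ij M(2,3) by (simp add: scalar_prod_def)
    finally show "(?L * A) $$ (i, j) = 1\<^sub>m k $$ (i, j)" using ij M(4) by simp
  qed (use A in auto)
  then show ?thesis by (intro bexI[of _ ?L]) simp_all
qed

lemma mult_mat_unit_vec:
  assumes "A \<in> carrier_mat n k" "j < k"
  shows "(A :: 'k::field mat) *\<^sub>v unit_vec k j = col A j"
  using assms by (intro eq_vecI) auto

text \<open>Two bases of the same space are related by an invertible matrix. Its determinant is the
  common factor by which the minors of the two representing matrices differ.\<close>

lemma row_span_unique:
  assumes 1: "row_span k N W B" and 2: "row_span k' N W B'"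
  shows "k' = k" "\<exists>G \<in> carrier_mat k k. det G \<noteq> 0 \<and> B' = G * (B :: 'k::field mat)"
proof -
  note B = row_spanD[OF 1] and B' = row_spanD[OF 2]
  have vs: "vectorspace class_ring (module_vec TYPE('k) N\<lparr>carrier := W\<rparr>)"
    using vectorspace.subspace_is_vs[OF vec_vs coordinatization_range(1)[OF vec_vs mult_mat_vec_hom[OF B(2)] B(3)]]
    unfolding B(4)[symmetric] .
  show k: "k' = k"
    using coordinatization_dim(2)[OF vs, of k] coordinatization_dim(2)[OF vs, of k']
      coordinatization_range(2)[OF vec_vs mult_mat_vec_hom[OF B(2)] B(3)]
      coordinatization_range(2)[OF vec_vs mult_mat_vec_hom[OF B'(2)] B'(3)]
    unfolding B(4)[symmetric] B'(4)[symmetric] by metis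
  obtain L where L: "L \<in> carrier_mat k N" "L * B\<^sup>T = 1\<^sub>m k" using left_inverse[OF B(2,3)] by blast
  \<comment> \<open>On vectors of \<open>W\<close> the left inverse \<open>L\<close> reads off
    coordinates with respect to the rows of \<open>B\<close>; so \<open>?H\<close> holds the
    coordinates of the rows of \<open>B'\<close>.\<close>
  let ?H = "L * B'\<^sup>T"
  have H: "?H \<in> carrier_mat k k" using L B' k by auto
  have BH: "B\<^sup>T *\<^sub>v (?H *\<^sub>v v) = B'\<^sup>T *\<^sub>v v" if v: "v \<in> carrier_vec k" for v
  proof -
    have "B'\<^sup>T *\<^sub>v v \<in> (\<lambda>v. B\<^sup>T *\<^sub>v v) ` carrier_vec k"
      using v unfolding B(4)[symmetric] unfolding B'(4) k by (rule imageI)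
    then obtain u where u: "u \<in> carrier_vec k" "B'\<^sup>T *\<^sub>v v = B\<^sup>T *\<^sub>v u" by blast
    have "?H *\<^sub>v v = L *\<^sub>v (B\<^sup>T *\<^sub>v u)"
      using assoc_mult_mat_vec[OF L(1) B'(2)[unfolded k] v] u(2) by simp
    also have "\<dots> = u" using assoc_mult_mat_vec[OF L(1) B(2) u(1)] L(2) u(1) by simp
    finally show ?thesis using u(2) by simp
  qed
  have "det ?H \<noteq> 0"
  proof
    assume "det ?H = 0"
    then obtain v where v: "v \<in> carrier_vec k" "v \<noteq> 0\<^sub>v k" "?H *\<^sub>v v = 0\<^sub>v k"
      using det_0_iff_vec_prod_zero_field[OF H] by blast
    have "B\<^sup>T *\<^sub>v 0\<^sub>v k = 0\<^sub>v N" using B(2) by auto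
    then have "B'\<^sup>T *\<^sub>v v = 0\<^sub>v N" using BH[OF v(1)] v(3) by simp
    then show False using inj_mat_vecD[OF B'(2,3)[unfolded k] v(1)] v(2) by simp
  qed
  moreover have "B' = ?H\<^sup>T * B"
  proof -
    have BTH: "B\<^sup>T * ?H = B'\<^sup>T"
    proof (rule eq_matI)
      fix i j assume "i < dim_row (B'\<^sup>T)" "j < dim_col (B'\<^sup>T)"
      then have ij: "i < N" "j < k" using B'(1) k by auto
      have "col (B\<^sup>T * ?H) j = B\<^sup>T *\<^sub>v (?H *\<^sub>v unit_vec k j)"
        using col_mult2[OF B(2) H] mult_mat_unit_vec[OF H] ij by simp
      then have "col (B\<^sup>T * ?H) j = B'\<^sup>T *\<^sub>v unit_vec k j" using BH[of "unit_vec k j"] by simp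
      also have "\<dots> = col B'\<^sup>T j" using mult_mat_unit_vec[OF B'(2)[unfolded k]] ij by simp
      finally have "col (B\<^sup>T * ?H) j $ i = col B'\<^sup>T j $ i" by simp
      then show "(B\<^sup>T * ?H) $$ (i, j) = B'\<^sup>T $$ (i, j)" using ij B(2) B'(2) H k by simp
    qed (use B B' H k in auto)
    have "B' = (B\<^sup>T * ?H)\<^sup>T" unfolding BTH by simp
    then show ?thesis using transpose_mult[OF B(2) H] by simp
  qed
  ultimately show "\<exists>G \<in> carrier_mat k k. det G \<noteq> 0 \<and> B' = G * B"
    using H det_transpose[OF H] by (intro bexI[of _ "?H\<^sup>T"]) auto
qed

section \<open>Annihilators under the standard bilinear form, and their minors\<close>

definition perp :: "nat \<Rightarrow> 'k::field vec set \<Rightarrow> 'k vec set" where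
  "perp N W = {y \<in> carrier_vec N. \<forall>w\<in>W. w \<bullet> y = 0}"

lemma perp_row_span:
  assumes "row_span k N W (B :: 'k::field mat)"
  shows "perp N W = {y \<in> carrier_vec N. B *\<^sub>v y = 0\<^sub>v k}"
proof -
  note B = row_spanD[OF assms]
  have eq: "(B\<^sup>T *\<^sub>v v) \<bullet> y = v \<bullet> (B *\<^sub>v y)" if "v \<in> carrier_vec k" "y \<in> carrier_vec N" for v y
    using transpose_vec_mult_scalar[OF B(1) that(2,1)] that B(1)
    by (metis comm_scalar_prod mult_mat_vec_carrier B(2))
  show ?thesis
  proof (intro equalityI subsetI)
    fix y assume y: "y \<in> perp N W"
    then have yc: "y \<in> carrier_vec N" by (simp add: perp_def)
    have "(B *\<^sub>v y) $ r = 0" if "r < k" for r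
    proof -
      have "B\<^sup>T *\<^sub>v unit_vec k r \<in> W" unfolding B(4) by simp
      then have "unit_vec k r \<bullet> (B *\<^sub>v y) = 0" using y eq[of "unit_vec k r" y] yc by (simp add: perp_def)
      then show ?thesis using that B(1) yc by (simp add: scalar_prod_left_unit)
    qed
    then show "y \<in> {y \<in> carrier_vec N. B *\<^sub>v y = 0\<^sub>v k}" using yc B(1) by (auto intro!: eq_vecI)
  next
    fix y assume "y \<in> {y \<in> carrier_vec N. B *\<^sub>v y = 0\<^sub>v k}"
    then show "y \<in> perp N W" unfolding perp_def B(4) using eq by auto
  qed
qed

text \<open>The choice is possible by Jacobi's formula: the sign depends on \<open>I\<close> only.\<close>

definition jacobi_sign :: "nat \<Rightarrow> nat \<Rightarrow> nat set \<Rightarrow> 'k::field" where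
  "jacobi_sign k q I = (SOME s. s * s = 1 \<and> (\<forall>M M' :: 'k mat. M \<in> carrier_mat (k + q) (k + q) \<longrightarrow>
    M' \<in> carrier_mat (k + q) (k + q) \<longrightarrow> M * M' = 1\<^sub>m (k + q) \<longrightarrow>
    minor k M (pick I) = s * det M *
      minor q (mat q (k + q) (\<lambda>(r, c). M' $$ (c, k + r))) (pick ({..<k + q} - I))))"

text \<open>Complete the columns of \<open>B\<^sup>T\<close> to an invertible \<open>M\<close>. The
  last rows of its inverse annihilate the leading \<open>k\<close> columns of \<open>M\<close> and
  form a basis of the annihilator. So minors of \<open>W\<close> and of its annihilator are
  complementary minors of mutually inverse matrices, and Jacobi's formula applies with
  \<open>d\<close> the determinant of \<open>M\<^sup>T\<close>.\<close>

lemma perp_exists: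
  assumes "row_span k N W (B :: 'k::field mat)"
  shows "k \<le> N \<and> perp N (perp N W) = W \<and> (\<exists>Y d. row_span (N - k) N (perp N W) Y \<and> d \<noteq> 0 \<and>
    (\<forall>I \<subseteq> {..<N}. card I = k \<longrightarrow>
      minor k B (pick I) = d * jacobi_sign k (N - k) I * minor (N - k) Y (pick ({..<N} - I))))"
proof -
  note B = row_spanD[OF assms]
  obtain M M' where M: "k \<le> N" "M \<in> carrier_mat N N" "M' \<in> carrier_mat N N" "M * M' = 1\<^sub>m N" "M' * M = 1\<^sub>m N"
    "\<And>i j. i < N \<Longrightarrow> j < k \<Longrightarrow> M $$ (i, j) = B\<^sup>T $$ (i, j)"
    using extend_to_invertible[OF B(2,3)] by blast
  let ?q = "N - k"
  define Y where "Y = mat ?q N (\<lambda>(r, c). M' $$ (k + r, c))"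
  have Y: "Y \<in> carrier_mat ?q N" by (simp add: Y_def)
  have kN: "k + ?q = N" using M(1) by simp
  have MT: "M\<^sup>T \<in> carrier_mat N N" "M'\<^sup>T \<in> carrier_mat N N" using M by auto
  have MTM: "M\<^sup>T * M'\<^sup>T = 1\<^sub>m N" "M'\<^sup>T * M\<^sup>T = 1\<^sub>m N"
    unfolding transpose_mult[OF M(3,2), symmetric] transpose_mult[OF M(2,3), symmetric] M(4,5)
    by (rule transpose_one)+
  have inv1: "M'\<^sup>T *\<^sub>v (M\<^sup>T *\<^sub>v y) = y" and inv2: "M\<^sup>T *\<^sub>v (M'\<^sup>T *\<^sub>v y) = y"
    and inv3: "M *\<^sub>v (M' *\<^sub>v y) = y" if "y \<in> carrier_vec N" for y
    using assoc_mult_mat_vec[OF MT(2,1) that] assoc_mult_mat_vec[OF MT that]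
      assoc_mult_mat_vec[OF M(2,3) that] MTM M(4) that by simp_all
  \<comment> \<open>In the coordinates \<open>M\<^sup>T *\<^sub>v y\<close> the annihilator is cut
    out by the vanishing of the leading \<open>k\<close> entries; \<open>?z\<close> pads a vector
    with these zeros.\<close>
  let ?z = "\<lambda>z. vec N (\<lambda>i. if i < k then 0 else z $ (i - k))"
  have MTy: "(M\<^sup>T *\<^sub>v y) $ i = (B *\<^sub>v y) $ i" if "y \<in> carrier_vec N" "i < k" for y i
    using that M(1,2,6) B(1) by (auto simp: scalar_prod_def intro!: sum.cong)
  have YTz: "Y\<^sup>T *\<^sub>v z = M'\<^sup>T *\<^sub>v ?z z" if z: "z \<in> carrier_vec ?q" for z
  proof (rule eq_vecI)
    fix i assume "i < dim_vec (M'\<^sup>T *\<^sub>v ?z z)"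
    then have i: "i < N" using M(3) by simp
    have "(Y\<^sup>T *\<^sub>v z) $ i = (\<Sum>r = 0..<?q. M' $$ (k + r, i) * z $ r)"
      using i z Y by (simp add: scalar_prod_def Y_def)
    also have "\<dots> = (\<Sum>r = k..<N. M' $$ (r, i) * z $ (r - k))"
      using kN sum.shift_bounds_nat_ivl[of "\<lambda>r. M' $$ (r, i) * z $ (r - k)" 0 k ?q]
      by (simp add: add.commute)
    also have "\<dots> = (\<Sum>r = 0..<N. if r < k then 0 else M' $$ (r, i) * z $ (r - k))"
      by (intro sum.mono_neutral_cong_left) auto
    also have "\<dots> = (M'\<^sup>T *\<^sub>v ?z z) $ i"
      using i M(3) by (auto simp: scalar_prod_def intro!: sum.cong)
    finally show "(Y\<^sup>T *\<^sub>v z) $ i = (M'\<^sup>T *\<^sub>v ?z z) $ i" .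
  qed (use Y M(3) in auto)
  have perpY: "perp N W = (\<lambda>v. Y\<^sup>T *\<^sub>v v) ` carrier_vec ?q"
  proof (intro equalityI subsetI)
    fix y assume "y \<in> perp N W"
    then have y: "y \<in> carrier_vec N" "B *\<^sub>v y = 0\<^sub>v k" unfolding perp_row_span[OF assms] by auto
    let ?w = "vec ?q (\<lambda>i. (M\<^sup>T *\<^sub>v y) $ (k + i))"
    have "M\<^sup>T *\<^sub>v y = ?z ?w"
    proof (rule eq_vecI)
      fix i assume "i < dim_vec (?z ?w)"
      then have i: "i < N" by simp
      show "(M\<^sup>T *\<^sub>v y) $ i = ?z ?w $ i"
      proof (cases "i < k")
        case True
        then show ?thesis using MTy[OF y(1) True] y(2) i by simp
      next
        case False
        then have "k + (i - k) = i" "i - k < ?q" using i by auto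
        then show ?thesis using i False by simp
      qed
    qed (use M(2) in simp)
    then have "y = Y\<^sup>T *\<^sub>v ?w" using YTz[of ?w] inv1[OF y(1)] by simp
    then show "y \<in> (\<lambda>v. Y\<^sup>T *\<^sub>v v) ` carrier_vec ?q" by (rule image_eqI) simp
  next
    fix y assume "y \<in> (\<lambda>v. Y\<^sup>T *\<^sub>v v) ` carrier_vec ?q"
    then obtain z where z: "z \<in> carrier_vec ?q" "y = M'\<^sup>T *\<^sub>v ?z z" using YTz by auto
    then have yc: "y \<in> carrier_vec N" using MT by simp
    have "M\<^sup>T *\<^sub>v y = ?z z" using z inv2[of "?z z"] by simp
    then have "(B *\<^sub>v y) $ i = 0" if "i < k" for i using MTy[OF yc that] that M(1) by simp
    then have "B *\<^sub>v y = 0\<^sub>v k" using B(1) by (intro eq_vecI) auto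
    then show "y \<in> perp N W" unfolding perp_row_span[OF assms] using yc by simp
  qed
  have injY: "inj_on (\<lambda>v. Y\<^sup>T *\<^sub>v v) (carrier_vec ?q)"
  proof (rule inj_mat_vecI)
    show "Y\<^sup>T \<in> carrier_mat N ?q" using Y by simp
    fix v assume v: "v \<in> carrier_vec ?q" "Y\<^sup>T *\<^sub>v v = 0\<^sub>v N"
    have "M\<^sup>T *\<^sub>v 0\<^sub>v N = 0\<^sub>v N" using MT(1) by auto
    then have "?z v = 0\<^sub>v N" using YTz[OF v(1)] v(2) inv2[of "?z v"] by simp
    then have z: "?z v $ (k + i) = 0" if "i < ?q" for i using that by simp
    have "v $ i = 0" if "i < ?q" for i using z[OF that] that by simp
    then show "v = 0\<^sub>v ?q" using v(1) by (intro eq_vecI) auto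
  qed
  have Yspan: "row_span ?q N (perp N W) Y" unfolding row_span_def using Y injY perpY by blast
  have "perp N (perp N W) = W"
  proof (intro equalityI subsetI)
    fix x assume "x \<in> W"
    then have "w \<bullet> x = 0" if "w \<in> perp N W" for w
      using that B(5) comm_scalar_prod[of w N x] by (auto simp: perp_def)
    then show "x \<in> perp N (perp N W)" using B(5) \<open>x \<in> W\<close> unfolding perp_def[of N "perp N W"] by auto
  next
    \<comment> \<open>\<open>Y\<close> kills \<open>x\<close>, so the entries of
      \<open>M' *\<^sub>v x\<close> vanish from position \<open>k\<close> on. Multiplying by
      \<open>M\<close> exhibits \<open>x\<close> as a combination of the leading columns of
      \<open>M\<close>, that is, of the rows of \<open>B\<close>.\<close>
    fix x assume "x \<in> perp N (perp N W)"
    then have x: "x \<in> carrier_vec N" "Y *\<^sub>v x = 0\<^sub>v ?q" unfolding perp_row_span[OF Yspan] by auto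
    let ?u = "vec k (\<lambda>i. (M' *\<^sub>v x) $ i)"
    have M'x: "(M' *\<^sub>v x) $ i = 0" if "k \<le> i" "i < N" for i
    proof -
      have "(Y *\<^sub>v x) $ (i - k) = (M' *\<^sub>v x) $ i"
        using that x(1) M(3) by (auto simp: Y_def scalar_prod_def intro!: sum.cong)
      moreover have "i - k < ?q" using that by simp
      ultimately show ?thesis using x(2) by simp
    qed
    have "x = M *\<^sub>v (M' *\<^sub>v x)" using inv3[OF x(1)] ..
    also have "\<dots> = B\<^sup>T *\<^sub>v ?u"
    proof (rule eq_vecI)
      fix i assume "i < dim_vec (B\<^sup>T *\<^sub>v ?u)"
      then have i: "i < N" using B(1) by simp
      have "(M *\<^sub>v (M' *\<^sub>v x)) $ i = (\<Sum>r = 0..<N. M $$ (i, r) * (M' *\<^sub>v x) $ r)"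
        using i M(2,3) by (simp add: scalar_prod_def)
      also have "\<dots> = (\<Sum>r = 0..<k. B\<^sup>T $$ (i, r) * ?u $ r)"
        using M(1) M(6)[OF i] M'x by (intro sum.mono_neutral_cong_right) auto
      also have "\<dots> = (B\<^sup>T *\<^sub>v ?u) $ i" using i B(1) by (simp add: scalar_prod_def)
      finally show "(M *\<^sub>v (M' *\<^sub>v x)) $ i = (B\<^sup>T *\<^sub>v ?u) $ i" .
    qed (use M(2) B(1) in auto)
    finally show "x \<in> W" unfolding B(4) by (rule image_eqI) simp
  qed
  moreover have "minor k B (pick I) = det M\<^sup>T * jacobi_sign k ?q I * minor ?q Y (pick ({..<N} - I))"
    if I: "I \<subseteq> {..<N}" "card I = k" for I
  proof -
    have fin: "finite I" using I(1) finite_subset by blast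
    have "I \<subseteq> {..<k + ?q}" using I(1) kN by simp
    from someI_ex[OF minor_complementary[OF this I(2)], folded jacobi_sign_def]
    have "minor k M\<^sup>T (pick I) = jacobi_sign k ?q I * det M\<^sup>T *
      minor ?q (mat ?q (k + ?q) (\<lambda>(r, c). M'\<^sup>T $$ (c, k + r))) (pick ({..<k + ?q} - I))"
      using MT MTM(1) unfolding kN by blast
    moreover have "mat ?q N (\<lambda>(r, c). M'\<^sup>T $$ (c, k + r)) = Y"
      using M(3) kN by (intro eq_matI) (auto simp: Y_def)
    moreover have "minor k M\<^sup>T (pick I) = minor k B (pick I)"
    proof -
      have "pick I c < N" if "c < k" for c using pick_in_set_le[of c I] I that by auto
      then have "mat k k (\<lambda>(r, c). M\<^sup>T $$ (r, pick I c)) = mat k k (\<lambda>(r, c). B $$ (r, pick I c))"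
        using M(1,2,6) B(1) by (intro eq_matI) auto
      then show ?thesis by (simp add: minor_def)
    qed
    ultimately show ?thesis unfolding kN by (simp only: mult_ac)
  qed
  moreover have "det M\<^sup>T \<noteq> 0"
    using det_mult[OF MT] MTM(1) by auto
  ultimately show ?thesis using M(1) Yspan by blast
qed

lemma jacobi_sign_nz:
  assumes "I \<subseteq> {..<k + q}" "card I = k"
  shows "jacobi_sign k q I * jacobi_sign k q I = (1 :: 'k::field)"
  using someI_ex[OF minor_complementary[OF assms]] unfolding jacobi_sign_def by blast

text \<open>The matrix \<open>Y\<close> is now arbitrary; passing to it from the one constructed
  before multiplies all minors by one determinant, which is absorbed into \<open>d\<close>.\<close>

lemma perp_minor:
  assumes B: "row_span k N W (B :: 'k::field mat)" and Y: "row_span q N (perp N W) Y"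
  shows "q = N - k" "k \<le> N" "\<exists>d. d \<noteq> 0 \<and> (\<forall>I \<subseteq> {..<N}. card I = k \<longrightarrow>
    minor k B (pick I) = d * jacobi_sign k q I * minor q Y (pick ({..<N} - I)))"
proof -
  obtain Y' d where Y': "row_span (N - k) N (perp N W) Y'" and d: "d \<noteq> 0"
    and eq: "\<And>I. I \<subseteq> {..<N} \<Longrightarrow> card I = k \<Longrightarrow>
      minor k B (pick I) = d * jacobi_sign k (N - k) I * minor (N - k) Y' (pick ({..<N} - I))"
    using perp_exists[OF B] by blast
  show q: "q = N - k" by (rule row_span_unique(1)[OF Y' Y])
  show kN: "k \<le> N" using perp_exists[OF B] by blast
  obtain G where G: "G \<in> carrier_mat q q" "det G \<noteq> 0" "Y' = G * Y"
    using row_span_unique(2)[OF Y Y'] by blast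
  have "minor k B (pick I) = (d * det G) * jacobi_sign k q I * minor q Y (pick ({..<N} - I))"
    if I: "I \<subseteq> {..<N}" "card I = k" for I
  proof -
    have "card ({..<N} - I) = q" using I q by (simp add: card_Diff_subset finite_subset)
    then have "pick ({..<N} - I) c < N" if "c < q" for c
      using pick_in_set_le[of c "{..<N} - I"] that by auto
    then have "minor q Y' (pick ({..<N} - I)) = det G * minor q Y (pick ({..<N} - I))"
      unfolding G(3) by (intro minor_mult_left[OF G(1) row_spanD(1)[OF Y]])
    then show ?thesis using eq[OF I] q by (simp add: mult_ac)
  qed
  then show "\<exists>d. d \<noteq> 0 \<and> (\<forall>I \<subseteq> {..<N}. card I = k \<longrightarrow>
    minor k B (pick I) = d * jacobi_sign k q I * minor q Y (pick ({..<N} - I)))"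
    using d G(2) by (intro exI[of _ "d * det G"]) simp
qed

lemma row_span_image:
  assumes X: "row_span k M X D" and R: "(R :: 'k::field mat) \<in> carrier_mat N M"
    and inj: "inj_on (\<lambda>v. R *\<^sub>v v) (carrier_vec M)"
  shows "row_span k N ((\<lambda>v. R *\<^sub>v v) ` X) (D * R\<^sup>T)"
proof -
  note D = row_spanD[OF X]
  have T: "(D * R\<^sup>T)\<^sup>T = R * D\<^sup>T" using transpose_mult[OF D(1), of "R\<^sup>T" N] R by simp
  have v: "(R * D\<^sup>T) *\<^sub>v v = R *\<^sub>v (D\<^sup>T *\<^sub>v v)" if "v \<in> carrier_vec k" for v
    using assoc_mult_mat_vec[OF R D(2) that] .
  have "inj_on (\<lambda>v. R *\<^sub>v (D\<^sup>T *\<^sub>v v)) (carrier_vec k)"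
    using comp_inj_on[OF D(3), of "\<lambda>v. R *\<^sub>v v"] inj_on_subset[OF inj D(5)[unfolded D(4)]]
    by (simp add: comp_def)
  then have "inj_on (\<lambda>v. (D * R\<^sup>T)\<^sup>T *\<^sub>v v) (carrier_vec k)" unfolding T using v by (simp cong: inj_on_cong)
  moreover have "(\<lambda>v. R *\<^sub>v v) ` X = (\<lambda>v. (D * R\<^sup>T)\<^sup>T *\<^sub>v v) ` carrier_vec k"
    unfolding T D(4) image_image using v by (simp cong: image_cong)
  moreover have "D * R\<^sup>T \<in> carrier_mat k N" using D(1) R by simp
  ultimately show ?thesis unfolding row_span_def by simp
qed

section \<open>Vectors cut into blocks\<close>

definition block :: "(nat \<Rightarrow> nat) \<Rightarrow> nat \<Rightarrow> 'k vec \<Rightarrow> 'k vec" where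
  "block p i v = vec (p i) (\<lambda>c. v $ (offset p i + c))"

definition glue :: "nat \<Rightarrow> (nat \<Rightarrow> nat) \<Rightarrow> (nat \<Rightarrow> 'k::comm_monoid_add vec) \<Rightarrow> 'k vec" where
  "glue n p u = vec (offset p n) (\<lambda>x. \<Sum>i<n.
     if offset p i \<le> x \<and> x < offset p i + p i then u i $ (x - offset p i) else 0)"

lemma block_carrier [simp]: "block p i v \<in> carrier_vec (p i)"
  and glue_carrier [simp]: "glue n p u \<in> carrier_vec (offset p n)"
  by (simp_all add: block_def glue_def)

lemma block_glue:
  assumes i: "i < n" and u: "u i \<in> carrier_vec (p i)"
  shows "block p i (glue n p u) = u i"
proof (rule eq_vecI)
  fix c assume "c < dim_vec (u i)"
  then have c: "c < p i" using u by simp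
  have "(\<Sum>j<n. if offset p j \<le> offset p i + c \<and> offset p i + c < offset p j + p j
      then u j $ (offset p i + c - offset p j) else 0) = (\<Sum>j<n. if j = i then u i $ c else 0)"
  proof (rule sum.cong[OF refl])
    fix j
    show "(if offset p j \<le> offset p i + c \<and> offset p i + c < offset p j + p j
      then u j $ (offset p i + c - offset p j) else 0) = (if j = i then u i $ c else 0)"
      using offset_between[of p j i c] c by auto
  qed
  then show "block p i (glue n p u) $ c = u i $ c"
    using offset_less[OF i, of c p] c i by (simp add: block_def glue_def)
qed (use u in \<open>simp add: block_def\<close>)

lemma eq_vec_blocks:
  assumes "v \<in> carrier_vec (offset p n)" "w \<in> carrier_vec (offset p n)"
    and "\<And>i. i < n \<Longrightarrow> block p i v = block p i w"
  shows "v = w"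
proof (rule eq_vecI)
  fix x assume "x < dim_vec w"
  then have "x < offset p n" using assms(2) by simp
  then obtain i c where ic: "i < n" "c < p i" "x = offset p i + c" by (rule offset_cases)
  then show "v $ x = w $ x"
    using arg_cong[OF assms(3)[OF ic(1)], of "\<lambda>u. u $ c"] by (simp add: block_def)
qed (use assms in simp)

lemma sum_offset:
  "(\<Sum>x<offset k n. g x) = (\<Sum>i<n. \<Sum>r<k i. g (offset k i + r) :: 'a::comm_monoid_add)"
proof (induction n)
  case (Suc n)
  have "(\<Sum>x<a + b. g x) = (\<Sum>x<a. g x) + (\<Sum>r<b. g (a + r))" for a b
    by (induction b) (simp_all add: add.assoc)
  then show ?case using Suc by (simp add: offset_Suc)
qed simp

lemma block_block_diag:
  assumes i: "i < n" and B: "\<And>i. i < n \<Longrightarrow> B i \<in> carrier_mat (k i) (p i)"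
    and v: "v \<in> carrier_vec (offset k n)"
  shows "block p i ((block_diag n k p B)\<^sup>T *\<^sub>v v) = (B i)\<^sup>T *\<^sub>v block k i v"
proof (rule eq_vecI)
  let ?D = "block_diag n k p B"
  have D: "dim_row ?D = offset k n" "dim_col ?D = offset p n" by (simp_all add: block_diag_def)
  fix c assume "c < dim_vec ((B i)\<^sup>T *\<^sub>v block k i v)"
  then have c: "c < p i" using B[OF i] by simp
  have oc: "offset p i + c < offset p n" using offset_less[OF i] c by simp
  have "block p i (?D\<^sup>T *\<^sub>v v) $ c = (\<Sum>x<offset k n. ?D $$ (x, offset p i + c) * v $ x)"
    using c oc D v by (simp add: block_def scalar_prod_def lessThan_atLeast0)
  also have "\<dots> = (\<Sum>j<n. \<Sum>r<k j. ?D $$ (offset k j + r, offset p i + c) * v $ (offset k j + r))"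
    by (rule sum_offset)
  also have "\<dots> = (\<Sum>j<n. if j = i then (\<Sum>r<k i. B i $$ (r, c) * v $ (offset k i + r)) else 0)"
  proof (rule sum.cong[OF refl])
    fix j assume j: "j \<in> {..<n}"
    have "(\<Sum>r<k j. ?D $$ (offset k j + r, offset p i + c) * v $ (offset k j + r))
      = (\<Sum>r<k j. (if j = i then B j $$ (r, c) else 0) * v $ (offset k j + r))"
      using block_diag_index[of j n i _ k c p B] c i j by (intro sum.cong[OF refl]) simp
    then show "(\<Sum>r<k j. ?D $$ (offset k j + r, offset p i + c) * v $ (offset k j + r))
      = (if j = i then (\<Sum>r<k i. B i $$ (r, c) * v $ (offset k i + r)) else 0)" by simp
  qed
  also have "\<dots> = (\<Sum>r<k i. B i $$ (r, c) * v $ (offset k i + r))" using i by simp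
  also have "\<dots> = ((B i)\<^sup>T *\<^sub>v block k i v) $ c"
    using c B[OF i] by (simp add: block_def scalar_prod_def lessThan_atLeast0)
  finally show "block p i (?D\<^sup>T *\<^sub>v v) $ c = ((B i)\<^sup>T *\<^sub>v block k i v) $ c" .
qed (use B[OF i] in \<open>simp add: block_def\<close>)

text \<open>The transposed block diagonal matrix acts on each block by its own matrix, so
  injectivity and image can be checked block by block.\<close>

lemma row_span_blocks:
  assumes X: "\<And>i. i < n \<Longrightarrow> row_span (k i) (p i) (X i) (B i :: 'k::field mat)"
  shows "row_span (offset k n) (offset p n)
    {v \<in> carrier_vec (offset p n). \<forall>i<n. block p i v \<in> X i} (block_diag n k p B)"
proof -
  let ?D = "block_diag n k p B"
  have DT: "?D\<^sup>T \<in> carrier_mat (offset p n) (offset k n)" by simp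
  note B = row_spanD(1)[OF X]
  have bD: "block p i (?D\<^sup>T *\<^sub>v v) = (B i)\<^sup>T *\<^sub>v block k i v" if "i < n" "v \<in> carrier_vec (offset k n)" for i v
    by (rule block_block_diag[OF that(1) B that(2)])
  have inj: "inj_on (\<lambda>v. ?D\<^sup>T *\<^sub>v v) (carrier_vec (offset k n))"
  proof (rule inj_onI)
    fix v w assume vw: "v \<in> carrier_vec (offset k n)" "w \<in> carrier_vec (offset k n)" "?D\<^sup>T *\<^sub>v v = ?D\<^sup>T *\<^sub>v w"
    show "v = w"
    proof (rule eq_vec_blocks[OF vw(1,2)])
      fix i assume i: "i < n"
      have "(B i)\<^sup>T *\<^sub>v block k i v = (B i)\<^sup>T *\<^sub>v block k i w"
        using bD[OF i vw(1)] bD[OF i vw(2)] vw(3) by simp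
      then show "block k i v = block k i w"
        using inj_onD[OF row_spanD(3)[OF X[OF i]]] by simp
    qed
  qed
  have eq: "{v \<in> carrier_vec (offset p n). \<forall>i<n. block p i v \<in> X i}
      = (\<lambda>v. ?D\<^sup>T *\<^sub>v v) ` carrier_vec (offset k n)"
  proof (intro equalityI subsetI)
    fix v assume v: "v \<in> {v \<in> carrier_vec (offset p n). \<forall>i<n. block p i v \<in> X i}"
    have "\<forall>i. \<exists>u. i < n \<longrightarrow> u \<in> carrier_vec (k i) \<and> block p i v = (B i)\<^sup>T *\<^sub>v u"
    proof
      fix i
      show "\<exists>u. i < n \<longrightarrow> u \<in> carrier_vec (k i) \<and> block p i v = (B i)\<^sup>T *\<^sub>v u"
      proof (cases "i < n")
        case True
        then have "block p i v \<in> X i" using v by simp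
        then show ?thesis unfolding row_spanD(4)[OF X[OF True]] by blast
      qed simp
    qed
    then obtain u where u: "\<And>i. i < n \<Longrightarrow> u i \<in> carrier_vec (k i) \<and> block p i v = (B i)\<^sup>T *\<^sub>v u i"
      unfolding choice_iff by blast
    have "v = ?D\<^sup>T *\<^sub>v glue n k u"
    proof (rule eq_vec_blocks)
      show "?D\<^sup>T *\<^sub>v glue n k u \<in> carrier_vec (offset p n)" using DT by (rule mult_mat_vec_carrier) simp
      fix i assume i: "i < n"
      show "block p i v = block p i (?D\<^sup>T *\<^sub>v glue n k u)"
        unfolding bD[OF i glue_carrier] using block_glue[of i n u k] u[OF i] i by simp
    qed (use v in simp)
    then show "v \<in> (\<lambda>v. ?D\<^sup>T *\<^sub>v v) ` carrier_vec (offset k n)" by (rule image_eqI) simp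
  next
    fix v assume "v \<in> (\<lambda>v. ?D\<^sup>T *\<^sub>v v) ` carrier_vec (offset k n)"
    then obtain w where w: "w \<in> carrier_vec (offset k n)" "v = ?D\<^sup>T *\<^sub>v w" by blast
    have "block p i v \<in> X i" if "i < n" for i
      unfolding w(2) bD[OF that w(1)] row_spanD(4)[OF X[OF that]] by (rule imageI) simp
    moreover have "v \<in> carrier_vec (offset p n)" unfolding w(2) using DT w(1) by (rule mult_mat_vec_carrier)
    ultimately show "v \<in> {v \<in> carrier_vec (offset p n). \<forall>i<n. block p i v \<in> X i}" by simp
  qed
  show ?thesis unfolding row_span_def using inj eq block_diag_carrier by blast
qed

section \<open>Pluecker coordinates\<close>

text \<open>Moves the matrices used in \<open>grassmannian\<close> from an abstract space to
  \<open>K^N\<close>, where the facts on row spaces apply.\<close>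

lemma represents_row_span:
  fixes V :: "('k::field, 'v) module"
  assumes V: "vectorspace class_ring V" and W: "VectorSpace.subspace class_ring W V"
    and \<beta>: "coordinatization V N \<beta>" "\<And>c. c < N \<Longrightarrow> \<beta> (unit_vec N c) = bs ! c" and N: "length bs = N"
    and rep: "represents_subspace V bs W B"
  shows "row_span (vectorspace.dim class_ring (V\<lparr>carrier := W\<rparr>)) N {v \<in> carrier_vec N. \<beta> v \<in> W} B"
proof -
  interpret V: vectorspace class_ring V by (rule V)
  have WV: "W \<subseteq> carrier V" using V.is_module[OF W] by (simp add: LinearCombinations.submodule_def)
  have Wvs: "vectorspace class_ring (V\<lparr>carrier := W\<rparr>)" by (rule V.subspace_is_vs[OF W])
  obtain ws where ws: "ordered_basis (V\<lparr>carrier := W\<rparr>) ws" "B \<in> carrier_mat (length ws) N"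
    "\<forall>r<length ws. ws ! r = (\<Oplus>\<^bsub>V\<^esub>c\<in>{..<N}. B $$ (r, c) \<odot>\<^bsub>V\<^esub> bs ! c)"
    using rep unfolding represents_subspace_def N by blast
  define k where "k = length ws"
  have "\<exists>\<omega>. coordinatization (V\<lparr>carrier := W\<rparr>) k \<omega> \<and> (\<forall>r<k. \<omega> (unit_vec k r) = ws ! r)"
    using ordered_basis_coordinatization[OF Wvs ws(1)] unfolding k_def .
  then obtain \<omega> where \<omega>: "coordinatization (V\<lparr>carrier := W\<rparr>) k \<omega>" "\<And>r. r < k \<Longrightarrow> \<omega> (unit_vec k r) = ws ! r"
    by blast
  have B: "B \<in> carrier_mat k N" and BT: "B\<^sup>T \<in> carrier_mat N k" using ws(2) by (simp_all add: k_def)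
  have \<beta>h: "\<beta> \<in> LinearCombinations.module_hom class_ring (module_vec TYPE('k) N) V"
    and \<beta>i: "inj_on \<beta> (carrier_vec N)"
    using \<beta>(1) by (auto simp: coordinatization_def bij_betw_def)
  have \<omega>h: "\<omega> \<in> LinearCombinations.module_hom class_ring (module_vec TYPE('k) k) V"
    and \<omega>s: "\<omega> ` carrier_vec k = W" and \<omega>i: "inj_on \<omega> (carrier_vec k)"
    using \<omega>(1) WV by (auto simp: coordinatization_def bij_betw_def LinearCombinations.module_hom_def)
  have eq: "\<omega> v = \<beta> (B\<^sup>T *\<^sub>v v)" if "v \<in> carrier_vec k" for v
  proof (rule hom_vec_ext[OF V \<omega>h hom_comp[OF mult_mat_vec_hom[OF BT] \<beta>h] _ that])
    fix r assume r: "r < k"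
    have cr: "col B\<^sup>T r \<in> carrier_vec N" using BT by (auto simp: col_def)
    have "\<beta> (col B\<^sup>T r) = (\<Oplus>\<^bsub>V\<^esub>c\<in>{..<N}. col B\<^sup>T r $ c \<odot>\<^bsub>V\<^esub> \<beta> (unit_vec N c))"
      by (rule hom_vec_expand[OF V \<beta>h cr])
    also have "\<dots> = (\<Oplus>\<^bsub>V\<^esub>c\<in>{..<N}. B $$ (r, c) \<odot>\<^bsub>V\<^esub> bs ! c)"
    proof (rule V.finsum_cong'[OF refl])
      fix c assume "c \<in> {..<N}"
      then show "col B\<^sup>T r $ c \<odot>\<^bsub>V\<^esub> \<beta> (unit_vec N c) = B $$ (r, c) \<odot>\<^bsub>V\<^esub> bs ! c"
        using \<beta>(2) B r by simp
    next
      have "bs ! c \<in> carrier V" if "c < N" for c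
        using hom_vecD(1)[OF \<beta>h unit_vec_carrier[of N c]] \<beta>(2)[OF that] by simp
      then show "(\<lambda>c. B $$ (r, c) \<odot>\<^bsub>V\<^esub> bs ! c) \<in> {..<N} \<rightarrow> carrier V" by auto
    qed
    also have "\<dots> = ws ! r" using ws(3) r by (simp add: k_def)
    finally show "\<omega> (unit_vec k r) = \<beta> (B\<^sup>T *\<^sub>v unit_vec k r)"
      using \<omega>(2)[OF r] mult_mat_unit_vec[OF BT r] by simp
  qed
  have inj: "inj_on (\<lambda>v. B\<^sup>T *\<^sub>v v) (carrier_vec k)"
  proof (rule inj_onI)
    fix v w assume vw: "v \<in> carrier_vec k" "w \<in> carrier_vec k" "B\<^sup>T *\<^sub>v v = B\<^sup>T *\<^sub>v w"
    then show "v = w" using eq[OF vw(1)] eq[OF vw(2)] inj_onD[OF \<omega>i] by simp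
  qed
  have im: "{v \<in> carrier_vec N. \<beta> v \<in> W} = (\<lambda>v. B\<^sup>T *\<^sub>v v) ` carrier_vec k"
  proof (intro equalityI subsetI)
    fix v assume v: "v \<in> {v \<in> carrier_vec N. \<beta> v \<in> W}"
    then obtain u where u: "u \<in> carrier_vec k" "\<beta> v = \<omega> u" using \<omega>s by auto
    have "B\<^sup>T *\<^sub>v u \<in> carrier_vec N" using BT u(1) by (rule mult_mat_vec_carrier)
    then have "v = B\<^sup>T *\<^sub>v u" using inj_onD[OF \<beta>i, of v "B\<^sup>T *\<^sub>v u"] v u eq by simp
    then show "v \<in> (\<lambda>v. B\<^sup>T *\<^sub>v v) ` carrier_vec k" using u(1) by (rule image_eqI)
  next
    fix v assume "v \<in> (\<lambda>v. B\<^sup>T *\<^sub>v v) ` carrier_vec k"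
    then obtain u where u: "u \<in> carrier_vec k" "v = B\<^sup>T *\<^sub>v u" by blast
    have "v \<in> carrier_vec N" unfolding u(2) using BT u(1) by (rule mult_mat_vec_carrier)
    moreover have "\<beta> v \<in> W" unfolding u(2) eq[OF u(1), symmetric] \<omega>s[symmetric] using u(1) by (rule imageI)
    ultimately show "v \<in> {v \<in> carrier_vec N. \<beta> v \<in> W}" by simp
  qed
  have "row_span k N {v \<in> carrier_vec N. \<beta> v \<in> W} B" unfolding row_span_def using B inj im by blast
  moreover have "vectorspace.dim class_ring (V\<lparr>carrier := W\<rparr>) = k"
    by (rule coordinatization_dim(2)[OF Wvs \<omega>(1)])
  ultimately show ?thesis by simp
qed

text \<open>Provides the witness that makes the \<open>SOME\<close> in the coordinates of
  \<open>grassmannian\<close> meaningful.\<close>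

lemma represents_exists:
  fixes V :: "('k::field, 'v) module"
  assumes V: "vectorspace class_ring V" and fd: "vectorspace.fin_dim class_ring V"
    and W: "VectorSpace.subspace class_ring W V"
    and \<beta>: "coordinatization V N \<beta>" "\<And>c. c < N \<Longrightarrow> \<beta> (unit_vec N c) = bs ! c" and N: "length bs = N"
  shows "\<exists>B. represents_subspace V bs W B"
proof -
  interpret V: vectorspace class_ring V by (rule V)
  have WV: "W \<subseteq> carrier V" using V.is_module[OF W] by (simp add: LinearCombinations.submodule_def)
  have "\<exists>ws. ordered_basis (V\<lparr>carrier := W\<rparr>) ws"
    by (rule fin_dim_ordered_basis[OF V.subspace_is_vs[OF W] subspace_fin_dim(1)[OF V fd W]])
  then obtain ws where ws: "ordered_basis (V\<lparr>carrier := W\<rparr>) ws" by blast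
  interpret W: vectorspace class_ring "V\<lparr>carrier := W\<rparr>" by (rule V.subspace_is_vs[OF W])
  have wsW: "set ws \<subseteq> W" using ws by (simp add: ordered_basis_def W.basis_def)
  have \<beta>h: "\<beta> \<in> LinearCombinations.module_hom class_ring (module_vec TYPE('k) N) V"
    and \<beta>s: "\<beta> ` carrier_vec N = carrier V"
    using \<beta>(1) by (auto simp: coordinatization_def bij_betw_def)
  define x where "x r = inv_into (carrier_vec N) \<beta> (ws ! r)" for r
  have x: "x r \<in> carrier_vec N" "\<beta> (x r) = ws ! r" if "r < length ws" for r
  proof -
    have "ws ! r \<in> W" using that wsW nth_mem by blast
    then have "ws ! r \<in> \<beta> ` carrier_vec N" using WV \<beta>s by blast
    then show "x r \<in> carrier_vec N" "\<beta> (x r) = ws ! r"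
      unfolding x_def by (rule inv_into_into, rule f_inv_into_f)
  qed
  have "represents_subspace V bs W (mat (length ws) N (\<lambda>(r, c). x r $ c))"
    unfolding represents_subspace_def
  proof (intro exI conjI allI impI)
    fix r assume r: "r < length ws"
    have "ws ! r = (\<Oplus>\<^bsub>V\<^esub>c\<in>{..<N}. x r $ c \<odot>\<^bsub>V\<^esub> \<beta> (unit_vec N c))"
      using hom_vec_expand[OF V \<beta>h x(1)[OF r]] x(2)[OF r] by simp
    also have "\<dots> = (\<Oplus>\<^bsub>V\<^esub>c\<in>{..<N}. mat (length ws) N (\<lambda>(r, c). x r $ c) $$ (r, c) \<odot>\<^bsub>V\<^esub> bs ! c)"
    proof (rule V.finsum_cong'[OF refl])
      have "bs ! c \<in> carrier V" if "c < N" for c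
        using hom_vecD(1)[OF \<beta>h unit_vec_carrier[of N c]] \<beta>(2)[OF that] by simp
      then show "(\<lambda>c. mat (length ws) N (\<lambda>(r, c). x r $ c) $$ (r, c) \<odot>\<^bsub>V\<^esub> bs ! c) \<in> {..<N} \<rightarrow> carrier V"
        by auto
    qed (use \<beta>(2) r in auto)
    finally show "ws ! r = (\<Oplus>\<^bsub>V\<^esub>c\<in>{..<length bs}.
      mat (length ws) N (\<lambda>(r, c). x r $ c) $$ (r, c) \<odot>\<^bsub>V\<^esub> bs ! c)" unfolding N .
  qed (use ws N in auto)
  then show ?thesis by blast
qed

text \<open>\<beta> must be the coordinate map of the very basis picked inside
  \<open>grassmannian\<close>. As that basis depends on \<open>V\<close> alone, one \<beta> serves
  all dimensions \<open>k\<close> and all subspaces \<open>X\<close>.\<close>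

proposition grassmannian_coords:
  fixes V :: "('k::field, 'v) module"
  assumes V: "vectorspace class_ring V" and fd: "vectorspace.fin_dim class_ring V"
    and N: "N = vectorspace.dim class_ring V"
  shows "\<exists>\<beta>. coordinatization V N \<beta> \<and> (\<forall>k X.
    (X \<in> points (grassmannian k V) \<longleftrightarrow>
       X \<subseteq> carrier V \<and> (\<exists>B. row_span k N {v \<in> carrier_vec N. \<beta> v \<in> X} B)) \<and>
    (X \<in> points (grassmannian k V) \<longrightarrow> (\<exists>B. row_span k N {v \<in> carrier_vec N. \<beta> v \<in> X} B \<and>
       (\<forall>I. coords (grassmannian k V) X I =
          (if I \<subseteq> {..<N} \<and> card I = k then minor k B (pick I) else 0)))))"
proof -
  interpret V: vectorspace class_ring V by (rule V)
  define bs where "bs = (SOME bs. ordered_basis V bs)"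
  have bs: "ordered_basis V bs" unfolding bs_def by (rule someI_ex[OF fin_dim_ordered_basis[OF V fd]])
  obtain \<beta> where \<beta>': "coordinatization V (length bs) \<beta>"
    "\<forall>r<length bs. \<beta> (unit_vec (length bs) r) = bs ! r"
    using ordered_basis_coordinatization[OF V bs] by blast
  have lN: "length bs = N" unfolding N using coordinatization_dim(2)[OF V \<beta>'(1)] ..
  have \<beta>: "coordinatization V N \<beta>" "\<And>r. r < N \<Longrightarrow> \<beta> (unit_vec N r) = bs ! r"
    using \<beta>' unfolding lN by simp_all
  have \<beta>h: "\<beta> \<in> LinearCombinations.module_hom class_ring (module_vec TYPE('k) N) V"
    and \<beta>i: "inj_on \<beta> (carrier_vec N)" and \<beta>s: "\<beta> ` carrier_vec N = carrier V"
    using \<beta>(1) by (auto simp: coordinatization_def bij_betw_def)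
  have rep: "represents_subspace V bs X (SOME B. represents_subspace V bs X B)"
    if "VectorSpace.subspace class_ring X V" for X
    by (rule someI_ex[OF represents_exists[OF V fd that \<beta> lN]])
  have pts: "X \<in> points (grassmannian k V) \<longleftrightarrow> VectorSpace.subspace class_ring X V \<and>
    vectorspace.dim class_ring (V\<lparr>carrier := X\<rparr>) = k" for X k
    by (simp add: grassmannian_def Let_def)
  have "X \<in> points (grassmannian k V) \<longleftrightarrow>
    X \<subseteq> carrier V \<and> (\<exists>B. row_span k N {v \<in> carrier_vec N. \<beta> v \<in> X} B)" for k X
  proof
    assume X: "X \<in> points (grassmannian k V)"
    then have sX: "VectorSpace.subspace class_ring X V" and dX: "vectorspace.dim class_ring (V\<lparr>carrier := X\<rparr>) = k"
      unfolding pts by simp_all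
    have "X \<subseteq> carrier V" using V.is_module[OF sX] by (simp add: LinearCombinations.submodule_def)
    then show "X \<subseteq> carrier V \<and> (\<exists>B. row_span k N {v \<in> carrier_vec N. \<beta> v \<in> X} B)"
      using represents_row_span[OF V sX \<beta> lN rep[OF sX]] unfolding dX by (intro conjI exI)
  next
    assume "X \<subseteq> carrier V \<and> (\<exists>B. row_span k N {v \<in> carrier_vec N. \<beta> v \<in> X} B)"
    then obtain B where XV: "X \<subseteq> carrier V" and B: "row_span k N {v \<in> carrier_vec N. \<beta> v \<in> X} B" by blast
    note BD = row_spanD[OF B]
    have BT: "B\<^sup>T *\<^sub>v v \<in> carrier_vec N" if "v \<in> carrier_vec k" for v
      using BD(2) that by (rule mult_mat_vec_carrier)
    have "inj_on (\<lambda>v. \<beta> (B\<^sup>T *\<^sub>v v)) (carrier_vec k)"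
    proof (rule inj_onI)
      fix v w assume vw: "v \<in> carrier_vec k" "w \<in> carrier_vec k" "\<beta> (B\<^sup>T *\<^sub>v v) = \<beta> (B\<^sup>T *\<^sub>v w)"
      have "B\<^sup>T *\<^sub>v v = B\<^sup>T *\<^sub>v w" by (rule inj_onD[OF \<beta>i vw(3) BT[OF vw(1)] BT[OF vw(2)]])
      then show "v = w" by (rule inj_onD[OF BD(3) _ vw(1,2)])
    qed
    note c = coordinatization_range[OF V hom_comp[OF mult_mat_vec_hom[OF BD(2)] \<beta>h] this]
    have "X = \<beta> ` {v \<in> carrier_vec N. \<beta> v \<in> X}" using XV \<beta>s by auto
    also have "\<dots> = (\<lambda>v. \<beta> (B\<^sup>T *\<^sub>v v)) ` carrier_vec k" unfolding BD(4) image_image ..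
    finally have im: "X = (\<lambda>v. \<beta> (B\<^sup>T *\<^sub>v v)) ` carrier_vec k" .
    show "X \<in> points (grassmannian k V)"
      unfolding pts using c(1) coordinatization_dim(2)[OF V.subspace_is_vs[OF c(1)] c(2)]
      unfolding im[symmetric] by (rule conjI)
  qed
  moreover have "\<exists>B. row_span k N {v \<in> carrier_vec N. \<beta> v \<in> X} B \<and>
       (\<forall>I. coords (grassmannian k V) X I =
          (if I \<subseteq> {..<N} \<and> card I = k then minor k B (pick I) else 0))"
    if X: "X \<in> points (grassmannian k V)" for X k
  proof -
    have sX: "VectorSpace.subspace class_ring X V" and dX: "vectorspace.dim class_ring (V\<lparr>carrier := X\<rparr>) = k"
      using X unfolding pts by simp_all
    let ?B = "SOME B. represents_subspace V bs X B"
    have B: "row_span k N {v \<in> carrier_vec N. \<beta> v \<in> X} ?B"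
      using represents_row_span[OF V sX \<beta> lN rep[OF sX]] unfolding dX .
    have "coords (grassmannian k V) X I =
      (if I \<subseteq> {..<N} \<and> card I = k then minor k ?B (pick I) else 0)" for I
    proof -
      have "coords (grassmannian k V) X I =
        (if I \<subseteq> {..<N} \<and> card I = k then det (submatrix ?B UNIV I) else 0)"
        by (simp add: grassmannian_def Let_def lN bs_def[symmetric])
      then show ?thesis using det_submatrix[OF row_spanD(1)[OF B], of I] by simp
    qed
    then show ?thesis using B by blast
  qed
  ultimately show ?thesis using \<beta>(1) by blast
qed

section \<open>Left modules\<close>

context left_module
begin

lemma smult_zero_right [simp]: "a \<in> carrier R \<Longrightarrow> a \<odot>\<^bsub>M\<^esub> \<zero>\<^bsub>M\<^esub> = \<zero>\<^bsub>M\<^esub>"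
  using smult_r_distr[of a "\<zero>\<^bsub>M\<^esub>" "\<zero>\<^bsub>M\<^esub>"] smult_closed[of a "\<zero>\<^bsub>M\<^esub>"] M.add.l_cancel_one by force

lemma smult_zero_left [simp]: "x \<in> carrier M \<Longrightarrow> \<zero> \<odot>\<^bsub>M\<^esub> x = \<zero>\<^bsub>M\<^esub>"
  using smult_l_distr[of \<zero> \<zero> x] smult_closed[of \<zero> x] M.add.l_cancel_one by force

lemma smult_minus_left: 
  assumes "a \<in> carrier R" "x \<in> carrier M" 
  shows "(\<ominus> a) \<odot>\<^bsub>M\<^esub> x = \<ominus>\<^bsub>M\<^esub> (a \<odot>\<^bsub>M\<^esub> x)"
  using smult_l_distr[of "\<ominus> a" a x] assms smult_closed
  by (metis M.minus_equality R.a_inv_closed R.l_neg smult_zero_left)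

lemma minus_one_smult: "x \<in> carrier M \<Longrightarrow> (\<ominus> \<one>) \<odot>\<^bsub>M\<^esub> x = \<ominus>\<^bsub>M\<^esub> x"
  using smult_minus_left[of \<one> x] smult_one by simp

lemma smult_minus_distr:
  assumes "a \<in> carrier R" "b \<in> carrier R" "x \<in> carrier M"
  shows "(a \<ominus> b) \<odot>\<^bsub>M\<^esub> x = a \<odot>\<^bsub>M\<^esub> x \<ominus>\<^bsub>M\<^esub> b \<odot>\<^bsub>M\<^esub> x"
  using assms by (simp add: R.minus_eq M.minus_eq smult_l_distr smult_minus_left)

lemma submoduleI':
  assumes "N \<subseteq> carrier M" "\<zero>\<^bsub>M\<^esub> \<in> N" "\<And>x y. x \<in> N \<Longrightarrow> y \<in> N \<Longrightarrow> x \<oplus>\<^bsub>M\<^esub> y \<in> N"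
    "\<And>a x. a \<in> carrier R \<Longrightarrow> x \<in> N \<Longrightarrow> a \<odot>\<^bsub>M\<^esub> x \<in> N"
  shows "Module.submodule N R M"
proof (intro Module.submodule.intro subgroup.intro)
  show "inv\<^bsub>add_monoid M\<^esub> x \<in> N" if "x \<in> N" for x
    using assms(4)[of "\<ominus> \<one>" x] that assms(1) minus_one_smult[of x] by (auto simp: a_inv_def)
qed (use assms in \<open>auto simp: Module.submodule_axioms_def\<close>)

lemma submoduleD:
  assumes "Module.submodule N R M"
  shows "N \<subseteq> carrier M" "\<zero>\<^bsub>M\<^esub> \<in> N" "\<And>x y. x \<in> N \<Longrightarrow> y \<in> N \<Longrightarrow> x \<oplus>\<^bsub>M\<^esub> y \<in> N"
    "\<And>a x. a \<in> carrier R \<Longrightarrow> x \<in> N \<Longrightarrow> a \<odot>\<^bsub>M\<^esub> x \<in> N" "\<And>x. x \<in> N \<Longrightarrow> \<ominus>\<^bsub>M\<^esub> x \<in> N"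
    "subgroup N (add_monoid M)"
proof -
  interpret S: Module.submodule N R M by (rule assms)
  show "N \<subseteq> carrier M" "\<zero>\<^bsub>M\<^esub> \<in> N" "\<And>x y. x \<in> N \<Longrightarrow> y \<in> N \<Longrightarrow> x \<oplus>\<^bsub>M\<^esub> y \<in> N"
    using S.subset S.one_closed S.m_closed by auto
  show "\<And>a x. a \<in> carrier R \<Longrightarrow> x \<in> N \<Longrightarrow> a \<odot>\<^bsub>M\<^esub> x \<in> N" by (rule S.smult_closed)
  show "\<And>x. x \<in> N \<Longrightarrow> \<ominus>\<^bsub>M\<^esub> x \<in> N" using S.m_inv_closed by (simp add: a_inv_def)
  show "subgroup N (add_monoid M)" by unfold_locales
qed

lemma smult_finsum:
  assumes "finite I" "e \<in> I \<rightarrow> carrier R" "x \<in> carrier M"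
  shows "(finsum R e I) \<odot>\<^bsub>M\<^esub> x = (\<Oplus>\<^bsub>M\<^esub>i\<in>I. e i \<odot>\<^bsub>M\<^esub> x)"
  using assms
proof (induction I)
  case (insert i I)
  then have e: "e \<in> I \<rightarrow> carrier R" "e i \<in> carrier R" by auto
  then have "(\<lambda>i. e i \<odot>\<^bsub>M\<^esub> x) \<in> I \<rightarrow> carrier M" using insert.prems smult_closed by auto
  then show ?case using insert e by (simp add: smult_l_distr smult_closed)
qed simp

end

lemma left_moduleI':
  assumes "ring R" "abelian_group M"
    "\<And>a x. a \<in> carrier R \<Longrightarrow> x \<in> carrier M \<Longrightarrow> a \<odot>\<^bsub>M\<^esub> x \<in> carrier M"
    "\<And>a b x. a \<in> carrier R \<Longrightarrow> b \<in> carrier R \<Longrightarrow> x \<in> carrier M \<Longrightarrow>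
      (a \<oplus>\<^bsub>R\<^esub> b) \<odot>\<^bsub>M\<^esub> x = a \<odot>\<^bsub>M\<^esub> x \<oplus>\<^bsub>M\<^esub> b \<odot>\<^bsub>M\<^esub> x"
    "\<And>a x y. a \<in> carrier R \<Longrightarrow> x \<in> carrier M \<Longrightarrow> y \<in> carrier M \<Longrightarrow>
      a \<odot>\<^bsub>M\<^esub> (x \<oplus>\<^bsub>M\<^esub> y) = a \<odot>\<^bsub>M\<^esub> x \<oplus>\<^bsub>M\<^esub> a \<odot>\<^bsub>M\<^esub> y"
    "\<And>a b x. a \<in> carrier R \<Longrightarrow> b \<in> carrier R \<Longrightarrow> x \<in> carrier M \<Longrightarrow>
      (a \<otimes>\<^bsub>R\<^esub> b) \<odot>\<^bsub>M\<^esub> x = a \<odot>\<^bsub>M\<^esub> (b \<odot>\<^bsub>M\<^esub> x)"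
    "\<And>x. x \<in> carrier M \<Longrightarrow> \<one>\<^bsub>R\<^esub> \<odot>\<^bsub>M\<^esub> x = x"
  shows "left_module R M"
  using assms unfolding left_module_def left_module_axioms_def by blast

text \<open>All module axioms are equations, hence inherited by surjective images.\<close>

lemma left_module_image:
  assumes M: "left_module R M" and \<pi>: "\<pi> ` carrier M = carrier Q" "\<zero>\<^bsub>Q\<^esub> = \<pi> \<zero>\<^bsub>M\<^esub>"
    and add: "\<And>x y. x \<in> carrier M \<Longrightarrow> y \<in> carrier M \<Longrightarrow> \<pi> x \<oplus>\<^bsub>Q\<^esub> \<pi> y = \<pi> (x \<oplus>\<^bsub>M\<^esub> y)"
    and smult: "\<And>a x. a \<in> carrier R \<Longrightarrow> x \<in> carrier M \<Longrightarrow> a \<odot>\<^bsub>Q\<^esub> \<pi> x = \<pi> (a \<odot>\<^bsub>M\<^esub> x)"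
  shows "left_module R Q"
proof -
  interpret M: left_module R M by (rule M)
  have *: "P y" if "y \<in> carrier Q" "\<And>x. x \<in> carrier M \<Longrightarrow> P (\<pi> x)" for P y
  proof -
    have "y \<in> \<pi> ` carrier M" using that(1) \<pi>(1) by simp
    then obtain x where x: "x \<in> carrier M" "y = \<pi> x" by blast
    show ?thesis unfolding x(2) by (rule that(2)[OF x(1)])
  qed
  show ?thesis
  proof (rule left_moduleI')
    show "ring R" by unfold_locales
    show "abelian_group Q"
    proof (rule abelian_groupI)
      show "x \<oplus>\<^bsub>Q\<^esub> y \<in> carrier Q" if "x \<in> carrier Q" "y \<in> carrier Q" for x y
        using that(1) by (rule *) (rule *[OF that(2)], use add \<pi>(1) M.a_closed in auto)
      show "\<zero>\<^bsub>Q\<^esub> \<in> carrier Q" using \<pi> M.M.zero_closed by blast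
      show "x \<oplus>\<^bsub>Q\<^esub> y \<oplus>\<^bsub>Q\<^esub> z = x \<oplus>\<^bsub>Q\<^esub> (y \<oplus>\<^bsub>Q\<^esub> z)" if "x \<in> carrier Q" "y \<in> carrier Q" "z \<in> carrier Q" for x y z
        by (rule *[OF that(1)], rule *[OF that(2)], rule *[OF that(3)]) (simp add: add M.M.a_assoc)
      show "x \<oplus>\<^bsub>Q\<^esub> y = y \<oplus>\<^bsub>Q\<^esub> x" if "x \<in> carrier Q" "y \<in> carrier Q" for x y
        by (rule *[OF that(1)], rule *[OF that(2)]) (simp add: add M.M.a_comm)
      show "\<zero>\<^bsub>Q\<^esub> \<oplus>\<^bsub>Q\<^esub> x = x" if "x \<in> carrier Q" for x
        by (rule *[OF that(1)]) (simp add: add \<pi>)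
      show "\<exists>y\<in>carrier Q. y \<oplus>\<^bsub>Q\<^esub> x = \<zero>\<^bsub>Q\<^esub>" if "x \<in> carrier Q" for x
      proof (rule *[OF that])
        fix x assume x: "x \<in> carrier M"
        then have "\<pi> (\<ominus>\<^bsub>M\<^esub> x) \<in> carrier Q" using \<pi>(1) by auto
        moreover have "\<pi> (\<ominus>\<^bsub>M\<^esub> x) \<oplus>\<^bsub>Q\<^esub> \<pi> x = \<zero>\<^bsub>Q\<^esub>" using x by (simp add: add M.M.l_neg \<pi>)
        ultimately show "\<exists>y\<in>carrier Q. y \<oplus>\<^bsub>Q\<^esub> \<pi> x = \<zero>\<^bsub>Q\<^esub>" by blast
      qed
    qed
    show "a \<odot>\<^bsub>Q\<^esub> x \<in> carrier Q" if "a \<in> carrier R" "x \<in> carrier Q" for a x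
      by (rule *[OF that(2)]) (use smult \<pi>(1) M.smult_closed that(1) in auto)
    show "(a \<oplus>\<^bsub>R\<^esub> b) \<odot>\<^bsub>Q\<^esub> x = a \<odot>\<^bsub>Q\<^esub> x \<oplus>\<^bsub>Q\<^esub> b \<odot>\<^bsub>Q\<^esub> x" if "a \<in> carrier R" "b \<in> carrier R" "x \<in> carrier Q" for a b x
      by (rule *[OF that(3)]) (use that in \<open>simp add: smult add M.smult_closed M.smult_l_distr\<close>)
    show "a \<odot>\<^bsub>Q\<^esub> (x \<oplus>\<^bsub>Q\<^esub> y) = a \<odot>\<^bsub>Q\<^esub> x \<oplus>\<^bsub>Q\<^esub> a \<odot>\<^bsub>Q\<^esub> y" if "a \<in> carrier R" "x \<in> carrier Q" "y \<in> carrier Q" for a x y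
      by (rule *[OF that(2)], rule *[OF that(3)]) (use that in \<open>simp add: smult add M.smult_closed M.smult_r_distr\<close>)
    show "(a \<otimes>\<^bsub>R\<^esub> b) \<odot>\<^bsub>Q\<^esub> x = a \<odot>\<^bsub>Q\<^esub> (b \<odot>\<^bsub>Q\<^esub> x)" if "a \<in> carrier R" "b \<in> carrier R" "x \<in> carrier Q" for a b x
      by (rule *[OF that(3)]) (use that in \<open>simp add: smult M.smult_closed M.smult_assoc\<close>)
    show "\<one>\<^bsub>R\<^esub> \<odot>\<^bsub>Q\<^esub> x = x" if "x \<in> carrier Q" for x
      by (rule *[OF that]) (simp add: smult M.smult_one)
  qed
qed

lemma submodule_left_module:
  assumes M: "left_module R (M :: ('a, 'm) module)" and N: "Module.submodule N R M"
  shows "left_module R (M\<lparr>carrier := N\<rparr>)"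
proof -
  interpret M: left_module R M by (rule M)
  note N = M.submoduleD[OF N]
  note c = subsetD[OF N(1)]
  show ?thesis
  proof (rule left_moduleI')
    show "ring R" by unfold_locales
    show "abelian_group (M\<lparr>carrier := N\<rparr>)"
    proof (rule abelian_groupI)
      show "\<exists>y\<in>carrier (M\<lparr>carrier := N\<rparr>). y \<oplus>\<^bsub>M\<lparr>carrier := N\<rparr>\<^esub> x = \<zero>\<^bsub>M\<lparr>carrier := N\<rparr>\<^esub>"
        if "x \<in> carrier (M\<lparr>carrier := N\<rparr>)" for x
        using that N(5)[of x] c M.M.l_neg[of x] by (intro bexI[of _ "\<ominus>\<^bsub>M\<^esub> x"]) auto
    qed (use N c M.M.a_assoc M.M.a_comm in auto)
  qed (use N c in \<open>auto simp: M.smult_l_distr M.smult_r_distr M.smult_assoc M.smult_one\<close>)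
qed

lemma module_homD:
  assumes "f \<in> LinearCombinations.module_hom R M N"
  shows "x \<in> carrier M \<Longrightarrow> f x \<in> carrier N"
    "x \<in> carrier M \<Longrightarrow> y \<in> carrier M \<Longrightarrow> f (x \<oplus>\<^bsub>M\<^esub> y) = f x \<oplus>\<^bsub>N\<^esub> f y"
    "a \<in> carrier R \<Longrightarrow> x \<in> carrier M \<Longrightarrow> f (a \<odot>\<^bsub>M\<^esub> x) = a \<odot>\<^bsub>N\<^esub> f x"
  using assms by (auto simp: LinearCombinations.module_hom_def)

lemma module_homI:
  assumes "\<And>x. x \<in> carrier M \<Longrightarrow> f x \<in> carrier N"
    "\<And>x y. x \<in> carrier M \<Longrightarrow> y \<in> carrier M \<Longrightarrow> f (x \<oplus>\<^bsub>M\<^esub> y) = f x \<oplus>\<^bsub>N\<^esub> f y"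
    "\<And>a x. a \<in> carrier R \<Longrightarrow> x \<in> carrier M \<Longrightarrow> f (a \<odot>\<^bsub>M\<^esub> x) = a \<odot>\<^bsub>N\<^esub> f x"
  shows "f \<in> LinearCombinations.module_hom R M N"
  using assms by (auto simp: LinearCombinations.module_hom_def)

lemma module_hom_zero:
  assumes "left_module R M" "left_module R N" "f \<in> LinearCombinations.module_hom R M N"
  shows "f \<zero>\<^bsub>M\<^esub> = \<zero>\<^bsub>N\<^esub>"
proof -
  interpret M: left_module R M by (rule assms)
  interpret N: left_module R N by (rule assms)
  have "f (\<zero>\<^bsub>R\<^esub> \<odot>\<^bsub>M\<^esub> \<zero>\<^bsub>M\<^esub>) = \<zero>\<^bsub>R\<^esub> \<odot>\<^bsub>N\<^esub> f \<zero>\<^bsub>M\<^esub>"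
    by (rule module_homD(3)[OF assms(3)]) auto
  then show ?thesis using module_homD(1)[OF assms(3), of "\<zero>\<^bsub>M\<^esub>"] by simp
qed

lemma kernel_submodule:
  assumes "left_module R M" "left_module R N" "f \<in> LinearCombinations.module_hom R M N"
  shows "Module.submodule {x \<in> carrier M. f x = \<zero>\<^bsub>N\<^esub>} R M"
proof -
  interpret M: left_module R M by (rule assms)
  interpret N: left_module R N by (rule assms)
  show ?thesis
    using module_homD[OF assms(3)] module_hom_zero[OF assms]
    by (intro M.submoduleI') (auto simp: M.smult_closed)
qed

lemma preimage_submodule:
  assumes "left_module R M" "left_module R N" "f \<in> LinearCombinations.module_hom R M N"
    and X: "Module.submodule X R N"
  shows "Module.submodule {x \<in> carrier M. f x \<in> X} R M"
proof -
  interpret M: left_module R M by (rule assms)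
  interpret N: left_module R N by (rule assms)
  note X = N.submoduleD[OF X]
  show ?thesis
    using module_homD[OF assms(3)] module_hom_zero[OF assms(1-3)] X
    by (intro M.submoduleI') (auto simp: M.smult_closed)
qed

text \<open>Scalar multiplication on cosets is a union over all representatives. The cosets united
  here coincide because \<open>N\<close> is stable under the ring, and the coset projection then
  carries the module axioms over.\<close>

lemma quotient_module_props:
  fixes M :: "('a, 'm) module"
  assumes M: "left_module R M" and N: "Module.submodule N R M"
  defines "\<pi> \<equiv> \<lambda>x. N +>\<^bsub>M\<^esub> x"
  shows "left_module R (quotient_module M N)"
    "\<pi> \<in> LinearCombinations.module_hom R M (quotient_module M N)"
    "\<pi> ` carrier M = carrier (quotient_module M N)"
    "\<And>x. x \<in> carrier M \<Longrightarrow> \<pi> x = \<zero>\<^bsub>quotient_module M N\<^esub> \<longleftrightarrow> x \<in> N"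
proof -
  interpret M: left_module R M by (rule M)
  note N = M.submoduleD[OF N]
  interpret S: abelian_subgroup N M
    by (rule abelian_subgroupI3[OF _ M.M.abelian_group_axioms]) (simp add: additive_subgroup_def N(6))
  have sub: "subgroup N (add_monoid M)" by (rule N(6))
  have smult: "a \<odot>\<^bsub>quotient_module M N\<^esub> \<pi> x = \<pi> (a \<odot>\<^bsub>M\<^esub> x)" if a: "a \<in> carrier R" and x: "x \<in> carrier M" for a x
  proof -
    have "N +>\<^bsub>M\<^esub> (a \<odot>\<^bsub>M\<^esub> y) = N +>\<^bsub>M\<^esub> (a \<odot>\<^bsub>M\<^esub> x)" if y: "y \<in> N +>\<^bsub>M\<^esub> x" for y
    proof -
      obtain h where h: "h \<in> N" "y = h \<oplus>\<^bsub>M\<^esub> x" using y by (auto simp: a_r_coset_def')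
      have "a \<odot>\<^bsub>M\<^esub> y = a \<odot>\<^bsub>M\<^esub> h \<oplus>\<^bsub>M\<^esub> a \<odot>\<^bsub>M\<^esub> x" using h x a N(1) M.smult_r_distr by auto
      then have "a \<odot>\<^bsub>M\<^esub> y \<in> N +>\<^bsub>M\<^esub> (a \<odot>\<^bsub>M\<^esub> x)" using N(4)[OF a h(1)] by (auto simp: a_r_coset_def')
      then show ?thesis using M.M.a_repr_independence[OF _ M.smult_closed[OF a x] sub] by simp
    qed
    moreover have "x \<in> N +>\<^bsub>M\<^esub> x" by (rule S.a_rcos_self[OF x])
    ultimately have "(\<Union>y\<in>N +>\<^bsub>M\<^esub> x. N +>\<^bsub>M\<^esub> (a \<odot>\<^bsub>M\<^esub> y)) = N +>\<^bsub>M\<^esub> (a \<odot>\<^bsub>M\<^esub> x)" by blast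
    then show ?thesis by (simp add: quotient_module_def \<pi>_def)
  qed
  have add: "\<pi> x \<oplus>\<^bsub>quotient_module M N\<^esub> \<pi> y = \<pi> (x \<oplus>\<^bsub>M\<^esub> y)" if "x \<in> carrier M" "y \<in> carrier M" for x y
    using S.a_rcos_sum[OF that] by (simp add: quotient_module_def \<pi>_def)
  show im: "\<pi> ` carrier M = carrier (quotient_module M N)"
    by (auto simp: quotient_module_def \<pi>_def A_RCOSETS_def')
  have zero: "\<zero>\<^bsub>quotient_module M N\<^esub> = \<pi> \<zero>\<^bsub>M\<^esub>"
    using M.M.a_coset_add_zero[OF N(1)] by (simp add: quotient_module_def \<pi>_def)
  show "left_module R (quotient_module M N)" by (rule left_module_image[OF M im zero add smult])
  show "\<pi> \<in> LinearCombinations.module_hom R M (quotient_module M N)"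
    using im add smult by (intro module_homI) auto
  show "\<pi> x = \<zero>\<^bsub>quotient_module M N\<^esub> \<longleftrightarrow> x \<in> N" if "x \<in> carrier M" for x
    using M.M.a_coset_join1[OF _ that sub] M.M.a_coset_join2[OF that sub]
    by (auto simp: quotient_module_def \<pi>_def)
qed

text \<open>Submodules of the quotient pull back to submodules between \<open>N\<close> and
  \<open>M\<close>, of which there are only two.\<close>

lemma simple_quotient:
  fixes M :: "('a, 'm) module"
  assumes M: "left_module R M" and N: "Module.submodule N R M" "N \<noteq> carrier M"
    and max: "\<And>X. Module.submodule X R M \<Longrightarrow> N \<subseteq> X \<Longrightarrow> X = N \<or> X = carrier M"
  shows "simple_module R (quotient_module M N)"
proof -
  interpret M: left_module R M by (rule M)
  let ?Q = "quotient_module M N" and ?\<pi> = "\<lambda>x. N +>\<^bsub>M\<^esub> x"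
  note Q = quotient_module_props[OF M N(1)]
  interpret Q: left_module R ?Q by (rule Q(1))
  have NM: "N \<subseteq> carrier M" using M.submoduleD[OF N(1)] by simp
  have "carrier ?Q \<noteq> {\<zero>\<^bsub>?Q\<^esub>}"
  proof
    assume "carrier ?Q = {\<zero>\<^bsub>?Q\<^esub>}"
    have "carrier M \<subseteq> N"
    proof
      fix x assume x: "x \<in> carrier M"
      then have "?\<pi> x \<in> carrier ?Q" unfolding Q(3)[symmetric] by (rule imageI)
      then have "?\<pi> x = \<zero>\<^bsub>?Q\<^esub>" using \<open>carrier ?Q = {\<zero>\<^bsub>?Q\<^esub>}\<close> by simp
      then show "x \<in> N" using Q(4)[OF x] by simp
    qed
    then show False using NM N(2) by blast
  qed
  moreover have "X = {\<zero>\<^bsub>?Q\<^esub>} \<or> X = carrier ?Q" if X: "Module.submodule X R ?Q" for X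
  proof -
    note XD = Q.submoduleD[OF X]
    let ?X' = "{x \<in> carrier M. ?\<pi> x \<in> X}"
    have "Module.submodule ?X' R M" by (rule preimage_submodule[OF M Q(1,2) X])
    moreover have "N \<subseteq> ?X'"
    proof
      fix x assume "x \<in> N"
      then show "x \<in> ?X'" using NM Q(4)[of x] XD(2) by auto
    qed
    ultimately consider "?X' = N" | "?X' = carrier M" using max by blast
    then show ?thesis
    proof cases
      case 1
      have "X \<subseteq> {\<zero>\<^bsub>?Q\<^esub>}"
      proof
        fix y assume y: "y \<in> X"
        then have "y \<in> ?\<pi> ` carrier M" unfolding Q(3) by (rule subsetD[OF XD(1)])
        then obtain x where x: "x \<in> carrier M" "y = ?\<pi> x" by blast
        then have "x \<in> ?X'" using y by simp
        then have "x \<in> N" unfolding 1 .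
        then show "y \<in> {\<zero>\<^bsub>?Q\<^esub>}" using Q(4)[OF x(1)] x(2) by simp
      qed
      then show ?thesis using XD(2) by blast
    next
      case 2
      have "carrier ?Q \<subseteq> X" unfolding Q(3)[symmetric] using 2 by blast
      then have "X = carrier ?Q" using XD(1) by (intro equalityI)
      then show ?thesis ..
    qed
  qed
  ultimately show ?thesis unfolding simple_module_def using Q(1) by blast
qed

lemma regular_left_module: "ring R \<Longrightarrow> left_module R (regular_module R)"
proof -
  assume "ring R"
  then interpret ring R .
  show ?thesis
    by (rule left_moduleI'[OF ring_axioms])
      (auto simp: regular_module_def l_distr r_distr m_assoc l_neg intro!: abelian_groupI a_assoc a_comm)
qed

section \<open>Modules over a finite dimensional algebra as vector spaces\<close>

context fd_algebra
begin

abbreviation scal :: "'k \<Rightarrow> 'a" where "scal c \<equiv> c \<odot>\<^bsub>A\<^esub> \<one>"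

lemma vs_smult:
  shows vs_smult_closed: "x \<in> carrier A \<Longrightarrow> c \<odot>\<^bsub>A\<^esub> x \<in> carrier A"
    and vs_smult_l_distr: "x \<in> carrier A \<Longrightarrow> (c + d) \<odot>\<^bsub>A\<^esub> x = c \<odot>\<^bsub>A\<^esub> x \<oplus> d \<odot>\<^bsub>A\<^esub> x"
    and vs_smult_r_distr: "x \<in> carrier A \<Longrightarrow> y \<in> carrier A \<Longrightarrow> c \<odot>\<^bsub>A\<^esub> (x \<oplus> y) = c \<odot>\<^bsub>A\<^esub> x \<oplus> c \<odot>\<^bsub>A\<^esub> y"
    and vs_smult_assoc: "x \<in> carrier A \<Longrightarrow> (c * d) \<odot>\<^bsub>A\<^esub> x = c \<odot>\<^bsub>A\<^esub> (d \<odot>\<^bsub>A\<^esub> x)"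
    and vs_smult_one: "x \<in> carrier A \<Longrightarrow> 1 \<odot>\<^bsub>A\<^esub> x = x"
    and vs_smult_zero: "x \<in> carrier A \<Longrightarrow> 0 \<odot>\<^bsub>A\<^esub> x = \<zero>"
proof -
  interpret VS: vectorspace class_ring A by (rule vectorspace)
  show "x \<in> carrier A \<Longrightarrow> c \<odot>\<^bsub>A\<^esub> x \<in> carrier A" by (rule VS.smult_closed) simp_all
  show "x \<in> carrier A \<Longrightarrow> (c + d) \<odot>\<^bsub>A\<^esub> x = c \<odot>\<^bsub>A\<^esub> x \<oplus> d \<odot>\<^bsub>A\<^esub> x"
    using VS.smult_l_distr[of c d x] by simp
  show "x \<in> carrier A \<Longrightarrow> y \<in> carrier A \<Longrightarrow> c \<odot>\<^bsub>A\<^esub> (x \<oplus> y) = c \<odot>\<^bsub>A\<^esub> x \<oplus> c \<odot>\<^bsub>A\<^esub> y"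
    using VS.smult_r_distr[of c x y] by simp
  show "x \<in> carrier A \<Longrightarrow> (c * d) \<odot>\<^bsub>A\<^esub> x = c \<odot>\<^bsub>A\<^esub> (d \<odot>\<^bsub>A\<^esub> x)"
    using VS.smult_assoc1[of c d x] by simp
  show "x \<in> carrier A \<Longrightarrow> 1 \<odot>\<^bsub>A\<^esub> x = x" using VS.smult_one[of x] by simp
  show "x \<in> carrier A \<Longrightarrow> 0 \<odot>\<^bsub>A\<^esub> x = \<zero>" using VS.lmult_0[of x] by simp
qed

lemma scal_closed [simp]: "scal c \<in> carrier A"
  by (rule vs_smult_closed) (rule one_closed)

lemma scal_mult_left: "x \<in> carrier A \<Longrightarrow> scal c \<otimes> x = c \<odot>\<^bsub>A\<^esub> x"
  using smult_mult_left[OF one_closed, of x c] l_one[of x] by simp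

lemma scal_mult_right: "x \<in> carrier A \<Longrightarrow> x \<otimes> scal c = c \<odot>\<^bsub>A\<^esub> x"
  using smult_mult_right[OF _ one_closed, of x c] r_one[of x] by simp

lemma scal_add: "scal (c + d) = scal c \<oplus> scal d"
  by (rule vs_smult_l_distr) (rule one_closed)

lemma scal_mult: "scal (c * d) = scal c \<otimes> scal d"
  unfolding scal_mult_left[OF scal_closed] by (rule vs_smult_assoc) (rule one_closed)

lemma scal_one: "scal 1 = \<one>"
  by (rule vs_smult_one) (rule one_closed)

lemma scal_zero: "scal 0 = \<zero>"
  by (rule vs_smult_zero) (rule one_closed)

lemma restrict_scalars_sel [simp]:
  "carrier (restrict_scalars A M) = carrier M" "zero (restrict_scalars A M) = zero M"
  "add (restrict_scalars A M) = add M" "smult (restrict_scalars A M) c x = scal c \<odot>\<^bsub>M\<^esub> x"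
  by (simp_all add: restrict_scalars_def)

lemma restrict_scalars_update:
  "restrict_scalars A (M\<lparr>carrier := N\<rparr>) = (restrict_scalars A M)\<lparr>carrier := N\<rparr>"
  by (simp add: restrict_scalars_def)

lemma restrict_scalars_vectorspace:
  assumes "left_module A M"
  shows "vectorspace class_ring (restrict_scalars A M)"
proof -
  interpret M: left_module A M by (rule assms)
  have "abelian_group (restrict_scalars A M)"
  proof (rule abelian_groupI)
    show "x \<oplus>\<^bsub>restrict_scalars A M\<^esub> y \<oplus>\<^bsub>restrict_scalars A M\<^esub> z
        = x \<oplus>\<^bsub>restrict_scalars A M\<^esub> (y \<oplus>\<^bsub>restrict_scalars A M\<^esub> z)"
      if "x \<in> carrier (restrict_scalars A M)" "y \<in> carrier (restrict_scalars A M)"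
        "z \<in> carrier (restrict_scalars A M)" for x y z
      using M.M.a_assoc[of x y z] that by simp
    show "x \<oplus>\<^bsub>restrict_scalars A M\<^esub> y = y \<oplus>\<^bsub>restrict_scalars A M\<^esub> x"
      if "x \<in> carrier (restrict_scalars A M)" "y \<in> carrier (restrict_scalars A M)" for x y
      using M.M.a_comm[of x y] that by simp
    show "\<exists>y\<in>carrier (restrict_scalars A M). y \<oplus>\<^bsub>restrict_scalars A M\<^esub> x = \<zero>\<^bsub>restrict_scalars A M\<^esub>"
      if "x \<in> carrier (restrict_scalars A M)" for x
      using that M.M.l_neg[of x] by (intro bexI[of _ "\<ominus>\<^bsub>M\<^esub> x"]) auto
  qed auto
  then have "Module.module class_ring (restrict_scalars A M)"
    by (intro Module.moduleI)
      (auto simp: class_cring.cring_axioms class_cring.is_cring M.smult_closed scal_add M.smult_l_distr M.smult_r_distr scal_mult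
        M.smult_assoc scal_one M.smult_one)
  then show ?thesis by (simp add: vectorspace_def class_field)
qed

end

lemma carrier_vec_zero: "carrier_vec 0 = {0\<^sub>v 0}"
  by (auto intro!: eq_vecI)

lemma dim_zero_space:
  fixes V :: "('k::field, 'v) module"
  assumes V: "vectorspace class_ring V" and z: "carrier V = {\<zero>\<^bsub>V\<^esub>}"
  shows "vectorspace.fin_dim class_ring V" "vectorspace.dim class_ring V = 0"
proof -
  interpret V: vectorspace class_ring V by (rule V)
  have c: "coordinatization V 0 (\<lambda>_. \<zero>\<^bsub>V\<^esub>)"
    unfolding coordinatization_def z bij_betw_def carrier_vec_zero
    by (auto intro!: hom_vecI simp: inj_on_def)
  show "vectorspace.fin_dim class_ring V" "vectorspace.dim class_ring V = 0"
    using coordinatization_dim[OF V c] by simp_all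
qed

lemma dim_zero_imp:
  fixes V :: "('k::field, 'v) module"
  assumes V: "vectorspace class_ring V" and fd: "vectorspace.fin_dim class_ring V"
    and d: "vectorspace.dim class_ring V = 0"
  shows "carrier V = {\<zero>\<^bsub>V\<^esub>}"
proof -
  interpret V: vectorspace class_ring V by (rule V)
  obtain \<beta> where "coordinatization V 0 \<beta>" using fin_dim_coordinatization[OF V fd] d by auto
  then have "carrier V = {\<beta> (0\<^sub>v 0)}" by (simp add: coordinatization_def bij_betw_def carrier_vec_zero)
  then have "\<And>x y. x \<in> carrier V \<Longrightarrow> y \<in> carrier V \<Longrightarrow> x = y" by auto
  then show ?thesis using V.zero_closed by blast
qed

lemma quotient_kernel:
  assumes "left_module R (M :: ('a, 'm) module)" "Module.submodule N R M"
  shows "{x \<in> carrier M. N +>\<^bsub>M\<^esub> x = \<zero>\<^bsub>quotient_module M N\<^esub>} = N"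
proof -
  have "N \<subseteq> carrier M" using left_module.submoduleD(1)[OF assms] .
  then show ?thesis using quotient_module_props(4)[OF assms] by blast
qed

lemma submodule_of_submodule:
  assumes M: "left_module R (M :: ('a, 'm) module)" and X: "Module.submodule X R M"
  shows "Module.submodule Y R (M\<lparr>carrier := X\<rparr>) \<longleftrightarrow> Module.submodule Y R M \<and> Y \<subseteq> X"
proof -
  interpret M: left_module R M by (rule M)
  interpret X: left_module R "M\<lparr>carrier := X\<rparr>" by (rule submodule_left_module[OF M X])
  have XM: "X \<subseteq> carrier M" by (rule M.submoduleD(1)[OF X])
  show ?thesis
  proof (intro iffI conjI)
    assume Y: "Module.submodule Y R (M\<lparr>carrier := X\<rparr>)"
    note D = X.submoduleD[OF Y]
    show "Y \<subseteq> X" using D(1) by simp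
    then show "Module.submodule Y R M" using D(2-4) XM by (intro M.submoduleI') auto
  next
    assume Y: "Module.submodule Y R M \<and> Y \<subseteq> X"
    note D = M.submoduleD[OF conjunct1[OF Y]]
    show "Module.submodule Y R (M\<lparr>carrier := X\<rparr>)" using D(2-4) Y by (intro X.submoduleI') auto
  qed
qed

section \<open>Multiplicities measured by idempotents, and composition series\<close>

context fd_algebra
begin

text \<open>For idempotent \<open>e\<close> this is the subspace \<open>e M\<close>.\<close>

definition fix_space :: "'a \<Rightarrow> ('a, 'm) module \<Rightarrow> 'm set" where
  "fix_space e M = {x \<in> carrier M. e \<odot>\<^bsub>M\<^esub> x = x}"

text \<open>For a primitive idempotent \<open>e\<close> of a basic algebra, this turns out to be the multiplicity in \<open>M\<close>
  of the simple module on which \<open>e\<close> acts nontrivially; for \<open>e = \<one>\<close> it is the dimension.\<close>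

definition mult_dim :: "'a \<Rightarrow> ('a, 'm) module \<Rightarrow> nat" where
  "mult_dim e M = vectorspace.dim class_ring ((restrict_scalars A M)\<lparr>carrier := fix_space e M\<rparr>)"

definition fdm :: "('a, 'm) module \<Rightarrow> bool" where
  "fdm M \<longleftrightarrow> vectorspace.fin_dim class_ring (restrict_scalars A M)"

lemma restrict_subspaceI:
  assumes M: "left_module A M" and "X \<subseteq> carrier M" "\<zero>\<^bsub>M\<^esub> \<in> X"
    "\<And>x y. x \<in> X \<Longrightarrow> y \<in> X \<Longrightarrow> x \<oplus>\<^bsub>M\<^esub> y \<in> X" "\<And>c x. x \<in> X \<Longrightarrow> scal c \<odot>\<^bsub>M\<^esub> x \<in> X"
  shows "VectorSpace.subspace class_ring X (restrict_scalars A M)"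
proof -
  have vs: "vectorspace class_ring (restrict_scalars A M)" by (rule restrict_scalars_vectorspace[OF M])
  then have "Module.module class_ring (restrict_scalars A M)" by (simp add: vectorspace_def)
  then have "LinearCombinations.submodule class_ring X (restrict_scalars A M)"
    using assms(2-5) by (simp add: LinearCombinations.submodule_def)
  then show ?thesis using vs by (simp add: VectorSpace.subspace_def)
qed

lemma submodule_subspace:
  assumes M: "left_module A M" and N: "Module.submodule N A M"
  shows "VectorSpace.subspace class_ring N (restrict_scalars A M)"
  using left_module.submoduleD[OF M N] by (intro restrict_subspaceI[OF M]) auto

lemma module_hom_restrict:
  assumes "left_module A M" "f \<in> LinearCombinations.module_hom A M N"
  shows "f \<in> LinearCombinations.module_hom class_ring (restrict_scalars A M) (restrict_scalars A N)"
  using module_homD[OF assms(2)] by (intro module_homI) auto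

lemma scal_commute_smult:
  assumes M: "left_module A M" and a: "a \<in> carrier A" and x: "x \<in> carrier M"
  shows "a \<odot>\<^bsub>M\<^esub> (scal c \<odot>\<^bsub>M\<^esub> x) = scal c \<odot>\<^bsub>M\<^esub> (a \<odot>\<^bsub>M\<^esub> x)"
proof -
  interpret M: left_module A M by (rule M)
  show ?thesis using M.smult_assoc[OF a scal_closed x, of c] M.smult_assoc[OF scal_closed a x, of c]
    scal_mult_left[OF a, of c] scal_mult_right[OF a, of c] by simp
qed

lemma fix_space_subspace:
  assumes M: "left_module A M" and e: "e \<in> carrier A"
  shows "VectorSpace.subspace class_ring (fix_space e M) (restrict_scalars A M)"
proof -
  interpret M: left_module A M by (rule M)
  show ?thesis unfolding fix_space_def
    using e M.smult_r_distr M.smult_closed scal_commute_smult[OF M e] by (intro restrict_subspaceI[OF M]) auto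
qed

lemma fix_vectorspace:
  assumes M: "left_module A M" and e: "e \<in> carrier A"
  shows "vectorspace class_ring ((restrict_scalars A M)\<lparr>carrier := fix_space e M\<rparr>)"
  by (rule vectorspace.subspace_is_vs[OF restrict_scalars_vectorspace[OF M] fix_space_subspace[OF M e]])

lemma fix_space_one:
  assumes "left_module A M" shows "fix_space \<one> M = carrier M"
  using left_module.smult_one[OF assms] by (auto simp: fix_space_def)

lemma mult_dim_one:
  assumes "left_module A M" shows "mult_dim \<one> M = vectorspace.dim class_ring (restrict_scalars A M)"
  unfolding mult_dim_def fix_space_one[OF assms] by (simp add: restrict_scalars_def)

text \<open>Taking \<open>e M\<close> is an exact functor: if \<open>x\<close> maps to a vector
  fixed by \<open>e\<close>, then so does \<open>e x\<close>, which is itself fixed. Rank-nullity on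
  the fixed spaces gives additivity.\<close>

lemma mult_exact:
  assumes M: "left_module A M" and M': "left_module A M'"
    and g: "g \<in> LinearCombinations.module_hom A M M'" and surj: "g ` carrier M = carrier M'"
    and fd: "fdm M" and e: "e \<in> carrier A" "e \<otimes> e = e"
  shows "mult_dim e M = mult_dim e (M\<lparr>carrier := {x \<in> carrier M. g x = \<zero>\<^bsub>M'\<^esub>}\<rparr>) + mult_dim e M'"
proof -
  interpret M: left_module A M by (rule M)
  interpret M': left_module A M' by (rule M')
  let ?V = "(restrict_scalars A M)\<lparr>carrier := fix_space e M\<rparr>"
  let ?W = "(restrict_scalars A M')\<lparr>carrier := fix_space e M'\<rparr>"
  note gD = module_homD[OF g]
  have fdV: "vectorspace.fin_dim class_ring ?V"
    by (rule subspace_fin_dim(1)[OF restrict_scalars_vectorspace[OF M] fd[unfolded fdm_def] fix_space_subspace[OF M e(1)]])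
  have hom: "g \<in> LinearCombinations.module_hom class_ring ?V ?W"
  proof (rule module_homI)
    fix x assume "x \<in> carrier ?V"
    then have x: "x \<in> carrier M" "e \<odot>\<^bsub>M\<^esub> x = x" by (auto simp: fix_space_def)
    then have "e \<odot>\<^bsub>M'\<^esub> g x = g x" using gD(3)[OF e(1) x(1)] by simp
    then show "g x \<in> carrier ?W" using gD(1)[OF x(1)] by (simp add: fix_space_def)
  qed (auto simp: fix_space_def gD)
  have im: "g ` carrier ?V = carrier ?W"
  proof (intro equalityI subsetI)
    fix y assume "y \<in> g ` carrier ?V"
    then show "y \<in> carrier ?W" using module_homD(1)[OF hom] by blast
  next
    fix y assume "y \<in> carrier ?W"
    then have y: "y \<in> carrier M'" "e \<odot>\<^bsub>M'\<^esub> y = y" by (auto simp: fix_space_def)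
    then have "y \<in> g ` carrier M" using surj by simp
    then obtain x where x: "x \<in> carrier M" "y = g x" by blast
    have "e \<odot>\<^bsub>M\<^esub> (e \<odot>\<^bsub>M\<^esub> x) = e \<odot>\<^bsub>M\<^esub> x" using M.smult_assoc[OF e(1) e(1) x(1)] e(2) by simp
    then have "e \<odot>\<^bsub>M\<^esub> x \<in> carrier ?V" using M.smult_closed[OF e(1) x(1)] by (simp add: fix_space_def)
    moreover have "y = g (e \<odot>\<^bsub>M\<^esub> x)" using gD(3)[OF e(1) x(1)] y(2) x(2) by simp
    ultimately show "y \<in> g ` carrier ?V" by (rule rev_image_eqI)
  qed
  have "{x \<in> carrier ?V. g x = \<zero>\<^bsub>?W\<^esub>} = fix_space e (M\<lparr>carrier := {x \<in> carrier M. g x = \<zero>\<^bsub>M'\<^esub>}\<rparr>)"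
    by (auto simp: fix_space_def)
  then show ?thesis
    using dim_exact(2)[OF fix_vectorspace[OF M e(1)] fix_vectorspace[OF M' e(1)] fdV hom im]
    by (simp add: mult_dim_def restrict_scalars_update)
qed

lemma fdm_image:
  assumes M: "left_module A M" and M': "left_module A M'"
    and g: "g \<in> LinearCombinations.module_hom A M M'" and surj: "g ` carrier M = carrier M'" and fd: "fdm M"
  shows "fdm M'"
  using dim_exact(1)[OF restrict_scalars_vectorspace[OF M] restrict_scalars_vectorspace[OF M']
      fd[unfolded fdm_def] module_hom_restrict[OF M g]] surj by (simp add: fdm_def)

lemma fdm_extension:
  assumes M: "left_module A M" and M': "left_module A M'"
    and g: "g \<in> LinearCombinations.module_hom A M M'" and surj: "g ` carrier M = carrier M'"
    and "fdm (M\<lparr>carrier := {x \<in> carrier M. g x = \<zero>\<^bsub>M'\<^esub>}\<rparr>)" "fdm M'"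
  shows "fdm M"
  using fin_dim_extension[OF restrict_scalars_vectorspace[OF M] restrict_scalars_vectorspace[OF M']
      module_hom_restrict[OF M g]] surj assms(5,6) by (simp add: fdm_def restrict_scalars_update)

lemma fdm_submodule:
  assumes M: "left_module A M" and "fdm M" "Module.submodule N A M"
  shows "fdm (M\<lparr>carrier := N\<rparr>)"
  using subspace_fin_dim(1)[OF restrict_scalars_vectorspace[OF M] _ submodule_subspace[OF M assms(3)]]
    assms(2) by (simp add: fdm_def restrict_scalars_update)

lemma fdm_quotient:
  assumes M: "left_module A M" and N: "Module.submodule N A M" and fd: "fdm M"
  shows "fdm (quotient_module M N)"
  by (rule fdm_image[OF M quotient_module_props(1,2,3)[OF M N] fd])

lemma mult_quotient:
  assumes M: "left_module A M" and N: "Module.submodule N A M" and fd: "fdm M"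
    and e: "e \<in> carrier A" "e \<otimes> e = e"
  shows "mult_dim e M = mult_dim e (M\<lparr>carrier := N\<rparr>) + mult_dim e (quotient_module M N)"
  using mult_exact[OF M quotient_module_props(1,2,3)[OF M N] fd e] unfolding quotient_kernel[OF M N] .

lemma zero_fix:
  assumes M: "left_module A M" and z: "carrier M = {\<zero>\<^bsub>M\<^esub>}" and e: "e \<in> carrier A"
  shows "fdm M" "mult_dim e M = 0"
proof -
  interpret M: left_module A M by (rule M)
  show "fdm M" unfolding fdm_def using z by (intro dim_zero_space(1)[OF restrict_scalars_vectorspace[OF M]]) simp
  have "fix_space e M \<subseteq> {\<zero>\<^bsub>M\<^esub>}" unfolding z[symmetric] fix_space_def by blast
  moreover have "\<zero>\<^bsub>M\<^esub> \<in> fix_space e M" unfolding fix_space_def using M.smult_zero_right[OF e] M.M.zero_closed by blast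
  ultimately have "fix_space e M = {\<zero>\<^bsub>M\<^esub>}" by blast
  then show "mult_dim e M = 0" unfolding mult_dim_def
    by (intro dim_zero_space(2)[OF fix_vectorspace[OF M e]]) simp
qed

text \<open>Additivity is applied along the filtration. Finite dimension of the terms is obtained on
  the way from that of the factors.\<close>

lemma mult_chain:
  assumes M: "left_module A M" and N0: "N 0 = {\<zero>\<^bsub>M\<^esub>}"
    and sub: "\<And>j. j \<le> l \<Longrightarrow> Module.submodule (N j) A M"
    and inc: "\<And>j. j < l \<Longrightarrow> N j \<subseteq> N (Suc j)"
    and fd: "\<And>j. j < l \<Longrightarrow> fdm (quotient_module (M\<lparr>carrier := N (Suc j)\<rparr>) (N j))"
    and e: "e \<in> carrier A" "e \<otimes> e = e"
  shows "fdm (M\<lparr>carrier := N l\<rparr>) \<and> mult_dim e (M\<lparr>carrier := N l\<rparr>)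
    = (\<Sum>j<l. mult_dim e (quotient_module (M\<lparr>carrier := N (Suc j)\<rparr>) (N j)))"
  using sub inc fd
proof (induction l)
  case 0
  have "left_module A (M\<lparr>carrier := N 0\<rparr>)" using submodule_left_module[OF M 0(1)] by simp
  then show ?case using zero_fix[of "M\<lparr>carrier := N 0\<rparr>" e] N0 e by simp
next
  case (Suc l)
  have IH: "fdm (M\<lparr>carrier := N l\<rparr>)" "mult_dim e (M\<lparr>carrier := N l\<rparr>)
    = (\<Sum>j<l. mult_dim e (quotient_module (M\<lparr>carrier := N (Suc j)\<rparr>) (N j)))"
    using Suc.IH Suc.prems by simp_all
  let ?X = "M\<lparr>carrier := N (Suc l)\<rparr>"
  have X: "left_module A ?X" using submodule_left_module[OF M] Suc.prems(1) by simp
  have N: "Module.submodule (N l) A ?X"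
    using submodule_of_submodule[OF M Suc.prems(1)[of "Suc l"]] Suc.prems(1)[of l] Suc.prems(2)[of l] by simp
  have fdQ: "fdm (quotient_module ?X (N l))" using Suc.prems(3)[of l] by simp
  have fdX: "fdm ?X"
    using fdm_extension[OF X quotient_module_props(1,2,3)[OF X N]] IH(1) fdQ
    unfolding quotient_kernel[OF X N] by simp
  show ?case using fdX mult_quotient[OF X N fdX e] IH(2) by simp
qed

text \<open>A quotient of dimension 0 is trivial. Since \<open>mult_dim \<one>\<close> is the
  dimension, this is the measure for the induction below.\<close>

lemma proper_submodule_dim:
  assumes M: "left_module A M" and fd: "fdm M" and N: "Module.submodule N A M" "N \<noteq> carrier M"
  shows "mult_dim \<one> (M\<lparr>carrier := N\<rparr>) < mult_dim \<one> M"
proof (rule ccontr)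
  assume "\<not> ?thesis"
  then have z: "mult_dim \<one> (quotient_module M N) = 0"
    using mult_quotient[OF M N(1) fd, of \<one>] by simp
  note Q = quotient_module_props[OF M N(1)]
  have "carrier (quotient_module M N) = {\<zero>\<^bsub>quotient_module M N\<^esub>}"
    using dim_zero_imp[OF restrict_scalars_vectorspace[OF Q(1)]] fdm_quotient[OF M N(1) fd] z
    unfolding mult_dim_one[OF Q(1)] fdm_def by simp
  then have "carrier M \<subseteq> N"
  proof (intro subsetI)
    fix x assume eq: "carrier (quotient_module M N) = {\<zero>\<^bsub>quotient_module M N\<^esub>}" and x: "x \<in> carrier M"
    have "N +>\<^bsub>M\<^esub> x \<in> carrier (quotient_module M N)" unfolding Q(3)[symmetric] using x by (rule imageI)
    then show "x \<in> N" using eq Q(4)[OF x] by simp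
  qed
  then show False using N(2) left_module.submoduleD(1)[OF M N(1)] by simp
qed

text \<open>Among the proper submodules of \<open>X\<close> take one of largest dimension. It is
  maximal, so the quotient is simple, and induction supplies a series below it.\<close>

lemma composition_series_exists:
  assumes M: "left_module A M" and fd: "fdm M" and X: "Module.submodule X A M"
  shows "\<exists>(l::nat) N. N 0 = {\<zero>\<^bsub>M\<^esub>} \<and> N l = X \<and> (\<forall>j\<le>l. Module.submodule (N j) A M) \<and>
    (\<forall>j<l. N j \<subseteq> N (Suc j) \<and> simple_module A (quotient_module (M\<lparr>carrier := N (Suc j)\<rparr>) (N j)))"
  using X
proof (induction "mult_dim \<one> (M\<lparr>carrier := X\<rparr>)" arbitrary: X rule: less_induct)
  case (less X)
  interpret M: left_module A M by (rule M)
  have zero: "Module.submodule {\<zero>\<^bsub>M\<^esub>} A M" by (rule M.submoduleI') auto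
  show ?case
  proof (cases "X = {\<zero>\<^bsub>M\<^esub>}")
    case True
    then show ?thesis using zero by (intro exI[of _ "0::nat"] exI[of _ "\<lambda>_. X"]) simp
  next
    case False
    let ?P = "\<lambda>Y. Module.submodule Y A M \<and> Y \<subseteq> X \<and> Y \<noteq> X"
    have Xm: "left_module A (M\<lparr>carrier := X\<rparr>)" by (rule submodule_left_module[OF M less.prems])
    have fdX: "fdm (M\<lparr>carrier := X\<rparr>)" by (rule fdm_submodule[OF M fd less.prems])
    have lt: "mult_dim \<one> (M\<lparr>carrier := Y\<rparr>) < mult_dim \<one> (M\<lparr>carrier := Z\<rparr>)"
      if "Module.submodule Y A M" "Module.submodule Z A M" "Y \<subseteq> Z" "Y \<noteq> Z" for Y Z
    proof -
      have "Module.submodule Y A (M\<lparr>carrier := Z\<rparr>)" using submodule_of_submodule[OF M that(2)] that by simp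
      then show ?thesis
        using proper_submodule_dim[OF submodule_left_module[OF M that(2)] fdm_submodule[OF M fd that(2)], of Y] that(4)
        by simp
    qed
    have P0: "?P {\<zero>\<^bsub>M\<^esub>}" using zero False M.submoduleD(2)[OF less.prems] by auto
    have "\<forall>Y. ?P Y \<longrightarrow> mult_dim \<one> (M\<lparr>carrier := Y\<rparr>) < mult_dim \<one> (M\<lparr>carrier := X\<rparr>)"
      by (intro allI impI lt[OF _ less.prems]) simp_all
    from ex_has_greatest_nat[of ?P, OF P0 this]
    obtain Y where Y': "?P Y \<and> (\<forall>Z. ?P Z \<longrightarrow>
        mult_dim \<one> (M\<lparr>carrier := Z\<rparr>) \<le> mult_dim \<one> (M\<lparr>carrier := Y\<rparr>))" ..
    then have Y: "?P Y" by (rule conjunct1)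
    from Y' have "\<forall>Z. ?P Z \<longrightarrow> mult_dim \<one> (M\<lparr>carrier := Z\<rparr>) \<le> mult_dim \<one> (M\<lparr>carrier := Y\<rparr>)"
      by (rule conjunct2)
    then have max: "\<And>Z. ?P Z \<Longrightarrow> mult_dim \<one> (M\<lparr>carrier := Z\<rparr>) \<le> mult_dim \<one> (M\<lparr>carrier := Y\<rparr>)"
      by simp
    have YX: "Module.submodule Y A (M\<lparr>carrier := X\<rparr>)" using submodule_of_submodule[OF M less.prems] Y by simp
    have simple: "simple_module A (quotient_module (M\<lparr>carrier := X\<rparr>) Y)"
    proof (rule simple_quotient[OF Xm YX])
      show "Y \<noteq> carrier (M\<lparr>carrier := X\<rparr>)" using Y by simp
      fix Z assume Z: "Module.submodule Z A (M\<lparr>carrier := X\<rparr>)" "Y \<subseteq> Z"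
      then have Z': "Module.submodule Z A M" "Z \<subseteq> X" using submodule_of_submodule[OF M less.prems] by simp_all
      show "Z = Y \<or> Z = carrier (M\<lparr>carrier := X\<rparr>)"
      proof (rule ccontr)
        assume "\<not> ?thesis"
        then have "?P Z" "Y \<noteq> Z" using Z' by auto
        then show False using max[of Z] lt[of Y Z] Y Z(2) Z'(1) by simp
      qed
    qed
    have "mult_dim \<one> (M\<lparr>carrier := Y\<rparr>) < mult_dim \<one> (M\<lparr>carrier := X\<rparr>)"
      using lt[of Y X] Y less.prems by simp
    from less.hyps[OF this conjunct1[OF Y]]
    obtain l N where N: "N 0 = {\<zero>\<^bsub>M\<^esub>}" "N l = Y" "\<forall>j\<le>l. Module.submodule (N j) A M"
      "\<forall>j<l. N j \<subseteq> N (Suc j) \<and> simple_module A (quotient_module (M\<lparr>carrier := N (Suc j)\<rparr>) (N j))" by blast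
    let ?N = "\<lambda>j. if j \<le> l then N j else X"
    show ?thesis
    proof (intro exI conjI allI impI)
      show "?N 0 = {\<zero>\<^bsub>M\<^esub>}" "?N (Suc l) = X" using N(1) by simp_all
      show "Module.submodule (?N j) A M" for j using N(3) less.prems by simp
      fix j assume "j < Suc l"
      then consider "j < l" | "j = l" by linarith
      then have "?N j \<subseteq> ?N (Suc j) \<and> simple_module A (quotient_module (M\<lparr>carrier := ?N (Suc j)\<rparr>) (?N j))"
      proof cases
        case 1 then show ?thesis using N(4) by simp
      next
        case 2 then show ?thesis using N(2) Y simple by simp
      qed
      then show "?N j \<subseteq> ?N (Suc j)" "simple_module A (quotient_module (M\<lparr>carrier := ?N (Suc j)\<rparr>) (?N j))"
        by blast+
    qed
  qed
qed

end

text \<open>Fixes a choice of the idempotents that \<open>basic_ring\<close> provides, over an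
  algebraically closed field, where the characters \<open>chi\<close> exist.\<close>

locale basic_fd_algebra = fd_algebra A
  for A :: "('k::alg_closed_field, 'a) module" (structure) +
  fixes m :: nat and e :: "nat \<Rightarrow> 'a"
  assumes primitive: "\<And>i. i < m \<Longrightarrow> primitive_idempotent A (e i)"
    and orthogonal: "\<And>i j. i < m \<Longrightarrow> j < m \<Longrightarrow> i \<noteq> j \<Longrightarrow> e i \<otimes> e j = \<zero>"
    and sum_e: "finsum A e {..<m} = \<one>"
    and not_iso: "\<And>i j. i < m \<Longrightarrow> j < m \<Longrightarrow> i \<noteq> j \<Longrightarrow>
      \<not> module_iso A (principal_module A (e i)) (principal_module A (e j))"

context fd_algebra
begin

section \<open>Evaluation of polynomials in a corner ring\<close>

text \<open>The corner ring \<open>u A u\<close> has unit \<open>u\<close>, so constants are evaluated to multiples of \<open>u\<close>.\<close>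

definition corner_eval :: "'a \<Rightarrow> 'a \<Rightarrow> 'k poly \<Rightarrow> 'a" where
  "corner_eval u b p = fold_coeffs (\<lambda>c x. c \<odot>\<^bsub>A\<^esub> u \<oplus> b \<otimes> x) p \<zero>"

lemma corner_eval_0 [simp]: "corner_eval u b 0 = \<zero>"
  by (simp add: corner_eval_def)

lemma vs_smult_zero_right: "c \<odot>\<^bsub>A\<^esub> \<zero> = \<zero>"
  using scal_mult_left[OF zero_closed, of c] by (simp add: r_null)

lemma corner_eval_pCons:
  assumes "u \<in> carrier A" "b \<in> carrier A"
  shows "corner_eval u b (pCons c p) = c \<odot>\<^bsub>A\<^esub> u \<oplus> b \<otimes> corner_eval u b p"
  using assms by (cases "pCons c p = 0") (auto simp: corner_eval_def vs_smult_zero fold_coeffs_pCons_eq)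

context
  fixes u b
  assumes u: "u \<in> carrier A" "u \<otimes> u = u" and b: "b \<in> carrier A" "u \<otimes> b = b" "b \<otimes> u = b"
begin

abbreviation "ev \<equiv> corner_eval u b"

lemma ev_closed [simp]: "ev p \<in> carrier A"
  by (induction p) (use u b in \<open>auto simp: corner_eval_pCons vs_smult_closed\<close>)

lemma ev_add: "ev (p + q) = ev p \<oplus> ev q"
proof (induction p q rule: poly_induct2)
  case (pCons c p d q)
  have "ev (pCons c p + pCons d q) = (c + d) \<odot>\<^bsub>A\<^esub> u \<oplus> b \<otimes> (ev p \<oplus> ev q)"
    using pCons u b by (simp add: corner_eval_pCons)
  then show ?case
    using u b by (simp add: corner_eval_pCons vs_smult_l_distr r_distr vs_smult_closed a_ac)
qed simp

lemma ev_smult: "ev (Polynomial.smult c p) = c \<odot>\<^bsub>A\<^esub> ev p"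
proof (induction p)
  case (pCons d p)
  have "ev (Polynomial.smult c (pCons d p)) = (c * d) \<odot>\<^bsub>A\<^esub> u \<oplus> b \<otimes> (c \<odot>\<^bsub>A\<^esub> ev p)"
    using pCons u b by (simp add: corner_eval_pCons)
  then show ?case
    using u b by (simp add: corner_eval_pCons vs_smult_r_distr vs_smult_assoc vs_smult_closed smult_mult_right[symmetric])
qed (simp add: vs_smult_zero_right)

lemma ev_left: "u \<otimes> ev p = ev p"
proof (induction p)
  case (pCons c p)
  then show ?case using u b
    by (simp add: corner_eval_pCons r_distr vs_smult_closed smult_mult_right[symmetric] m_assoc[symmetric])
qed (use u in simp)

lemma ev_mult: "ev (p * q) = ev p \<otimes> ev q"
proof (induction p)
  case (pCons c p)
  have "ev (pCons c p * q) = c \<odot>\<^bsub>A\<^esub> ev q \<oplus> b \<otimes> (ev p \<otimes> ev q)"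
    using pCons u b by (simp add: ev_add ev_smult corner_eval_pCons vs_smult_zero)
  also have "c \<odot>\<^bsub>A\<^esub> ev q = (c \<odot>\<^bsub>A\<^esub> u) \<otimes> ev q"
    using u ev_left by (simp add: smult_mult_left[symmetric])
  finally show ?case using u b by (simp add: corner_eval_pCons l_distr vs_smult_closed m_assoc)
qed simp

lemma ev_one: "ev 1 = u"
  using u b by (simp add: one_pCons corner_eval_pCons vs_smult_one)

lemma ev_commute: "ev p \<otimes> ev q = ev q \<otimes> ev p"
  unfolding ev_mult[symmetric] by (simp add: mult.commute)

lemma ev_X: "ev [:0, 1:] = b"
  using u b by (simp add: corner_eval_pCons vs_smult_one vs_smult_zero)

lemma ev_neg: "ev (- p) = \<ominus> ev p"
proof -
  have "ev (- p) \<oplus> ev p = \<zero>" unfolding ev_add[symmetric] by simp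
  then show ?thesis using minus_equality[of "ev (- p)" "ev p"] by simp
qed

text \<open>An element that fixes a nonzero vector cannot be nilpotent; this selects the invertible
  case of the dichotomy below.\<close>

lemma ev_power_act:
  assumes M: "left_module A M" and x: "x \<in> carrier M" "u \<odot>\<^bsub>M\<^esub> x = x" "b \<odot>\<^bsub>M\<^esub> x = x"
  shows "ev ([:0, 1:] ^ r) \<odot>\<^bsub>M\<^esub> x = x"
proof (induction r)
  case 0 then show ?case using x by (simp add: ev_one)
next
  case (Suc r)
  interpret M: left_module A M by (rule M)
  show ?case using M.smult_assoc[OF b(1) ev_closed x(1), of "[:0, 1:] ^ r"] Suc x
    by (simp only: power_Suc ev_mult ev_X)
qed

text \<open>The powers of \<open>b\<close> with exponents up to the dimension of the algebra are one
  too many to be linearly independent. The relation is found as two distinct coefficient vectors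
  with equal images.\<close>

lemma annihilating_poly: "\<exists>p. p \<noteq> 0 \<and> ev p = \<zero>"
proof -
  let ?d = "vectorspace.dim class_ring A"
  let ?n = "Suc ?d"
  obtain \<alpha> where \<alpha>: "\<alpha> \<in> LinearCombinations.module_hom class_ring (module_vec TYPE('k) ?n) A"
    "\<And>c. c < ?n \<Longrightarrow> \<alpha> (unit_vec ?n c) = ev (monom 1 c)"
    using vec_family_hom[OF vectorspace, of ?n "\<lambda>c. ev (monom 1 c)"] by auto
  have "\<not> inj_on \<alpha> (carrier_vec ?n)"
  proof
    assume "inj_on \<alpha> (carrier_vec ?n)"
    note c = coordinatization_range[OF vectorspace \<alpha>(1) this]
    have "?n \<le> ?d"
      using subspace_fin_dim(2)[OF vectorspace fin_dim c(1)]
        coordinatization_dim(2)[OF vectorspace.subspace_is_vs[OF vectorspace c(1)] c(2)] by simp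
    then show False by simp
  qed
  then obtain v w where vw: "v \<in> carrier_vec ?n" "w \<in> carrier_vec ?n" "v \<noteq> w" "\<alpha> v = \<alpha> w"
    unfolding inj_on_def by blast
  define pol where "pol v = (\<Sum>c<?n. monom (v $ c) c)" for v :: "'k vec"
  have fs: "ev (\<Sum>c<j. monom (v $ c) c) = (\<Oplus>c\<in>{..<j}. v $ c \<odot>\<^bsub>A\<^esub> ev (monom 1 c))" for j v
  proof (induction j)
    case (Suc j)
    have "ev (monom (v $ j) j) = v $ j \<odot>\<^bsub>A\<^esub> ev (monom 1 j)"
      unfolding ev_smult[symmetric] by (simp add: smult_monom)
    then show ?case using Suc by (simp add: lessThan_Suc ev_add vs_smult_closed finsum_insert add.m_comm a_comm)
  qed simp
  have ev_pol: "ev (pol v) = \<alpha> v" if "v \<in> carrier_vec ?n" for v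
  proof -
    have "\<alpha> v = (\<Oplus>c\<in>{..<?n}. v $ c \<odot>\<^bsub>A\<^esub> \<alpha> (unit_vec ?n c))"
      by (rule hom_vec_expand[OF vectorspace \<alpha>(1) that])
    also have "\<dots> = (\<Oplus>c\<in>{..<?n}. v $ c \<odot>\<^bsub>A\<^esub> ev (monom 1 c))"
      using \<alpha>(2) by (intro finsum_cong') (auto simp: vs_smult_closed)
    finally show ?thesis unfolding pol_def fs ..
  qed
  have coeff: "coeff (pol v) c = v $ c" if "c < ?n" for v c
    using that by (simp add: pol_def coeff_sum)
  have "pol v - pol w \<noteq> 0"
  proof
    assume "pol v - pol w = 0"
    then have "v $ c = w $ c" if "c < ?n" for c using coeff[OF that, of v] coeff[OF that, of w] by simp
    then show False using vw by (auto intro: eq_vecI)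
  qed
  moreover have "ev (pol v - pol w) = \<zero>"
  proof -
    have "ev (pol v - pol w) = ev (pol v) \<oplus> ev (- pol w)" unfolding ev_add[symmetric] by simp
    also have "\<dots> = ev (pol w) \<oplus> \<ominus> ev (pol w)"
      unfolding ev_neg ev_pol[OF vw(1)] vw(4) ev_pol[OF vw(2)] ..
    also have "\<dots> = \<zero>" by (rule r_neg[OF ev_closed])
    finally show ?thesis .
  qed
  ultimately show ?thesis by blast
qed

text \<open>Fitting's lemma: writing an annihilating polynomial as \<open>X^k (1 - t)\<close> with \<open>X\<close> dividing \<open>t\<close>,
  the element \<open>t^k\<close> evaluates to an idempotent.\<close>

lemma nilpotent_or_unit:
  assumes prim: "primitive_idempotent A u"
  shows "(\<exists>r. ev ([:0, 1:] ^ r) = \<zero>) \<or> (\<exists>q. b \<otimes> ev q = u)"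
proof -
  obtain p where p: "p \<noteq> 0" "ev p = \<zero>" using annihilating_poly by blast
  define X where "X = [:0, 1 :: 'k:]"
  obtain k q where kq: "p = X ^ k * q" "coeff q 0 \<noteq> 0"
  proof -
    from order_decomp[OF p(1), of 0] obtain q where q: "p = [:- 0, 1:] ^ order 0 p * q" "\<not> [:- 0, 1:] dvd q" by blast
    have "coeff q 0 \<noteq> 0" using q(2) by (simp add: dvd_iff_poly_eq_0 poly_0_coeff_0 poly_eq_0_iff_dvd)
    then show ?thesis using q(1) that[of "order 0 p" q] by (simp add: X_def)
  qed
  define c where "c = coeff q 0"
  define t where "t = 1 - Polynomial.smult (inverse c) q"
  have "coeff t 0 = 0" using kq(2) by (simp add: t_def c_def)
  then obtain s where "t = pCons 0 s" by (cases t) auto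
  then have s: "t = X * s" by (simp add: X_def)
  have z: "ev (X ^ k * (1 - t) * f) = \<zero>" for f
  proof -
    have "X ^ k * (1 - t) * f = Polynomial.smult (inverse c) f * p" unfolding kq(1) t_def by (simp add: ac_simps)
    then show ?thesis using p(2) by (simp add: ev_mult ev_smult vs_smult_zero_right)
  qed
  \<comment> \<open>Modulo \<open>p\<close> the power \<open>X ^ k\<close> is unchanged by
    multiplication with \<open>t\<close>, hence with any \<open>t ^ j\<close>. As
    \<open>t ^ k\<close> is divisible by \<open>X ^ k\<close>, it equals its own square modulo
    \<open>p\<close>.\<close>
  have Xk: "ev (X ^ k * f) = ev (X ^ k * t * f)" for f
  proof -
    have "X ^ k * f = X ^ k * (1 - t) * f + X ^ k * t * f" by (simp add: algebra_simps)
    then show ?thesis using z[of f] by (simp add: ev_add)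
  qed
  have Xkt: "ev (X ^ k * f) = ev (X ^ k * t ^ j * f)" for j f
  proof (induction j)
    case (Suc j)
    have "ev (X ^ k * (t ^ j * f)) = ev (X ^ k * t * (t ^ j * f))" by (rule Xk)
    then show ?case using Suc by (simp add: ac_simps)
  qed simp
  let ?f = "ev (t ^ k)"
  have tk: "t ^ k = X ^ k * s ^ k" by (simp add: s power_mult_distrib)
  have "?f \<otimes> ?f = ev (X ^ k * t ^ k * s ^ k)" unfolding ev_mult[symmetric] by (simp add: tk ac_simps)
  also have "\<dots> = ?f" using Xkt[of "s ^ k" k] by (simp add: tk)
  finally have ff: "?f \<otimes> ?f = ?f" .
  have idf: "idempotent A ?f" using ff by (simp add: idempotent_def)
  let ?g = "ev (1 - t ^ k)"
  have fg: "?f \<otimes> ?g = \<zero>"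
  proof -
    have "ev (t ^ k * t ^ k) \<oplus> ev (t ^ k * (1 - t ^ k)) = ev (t ^ k)"
      unfolding ev_add[symmetric] by (simp add: algebra_simps)
    then have "?f \<oplus> ?f \<otimes> ?g = ?f" unfolding ev_mult ff .
    then show ?thesis using add.l_cancel_one[of ?f "?f \<otimes> ?g"] by simp
  qed
  have gf: "?g \<otimes> ?f = \<zero>" using fg ev_commute by simp
  have sum: "u = ?f \<oplus> ?g" unfolding ev_add[symmetric] by (simp add: ev_one)
  have "?g \<otimes> ?g = ?g"
  proof -
    have "ev ((1 - t ^ k) * (1 - t ^ k)) \<oplus> ev (t ^ k * (1 - t ^ k)) = ev (1 - t ^ k)"
      unfolding ev_add[symmetric] by (simp add: algebra_simps)
    then show ?thesis unfolding ev_mult fg by simp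
  qed
  then have "idempotent A ?g" by (simp add: idempotent_def)
  \<comment> \<open>Primitivity of \<open>u\<close> leaves two cases. If \<open>?f\<close> vanishes,
    so does the value of \<open>X ^ k\<close>, which is absorbed by \<open>t ^ k\<close>:
    \<open>b\<close> is nilpotent. If \<open>?f\<close> is \<open>u\<close>, the factor
    \<open>X\<close> of \<open>t\<close> makes \<open>b\<close> invertible.\<close>
  then have "?f = \<zero> \<or> ?g = \<zero>" using prim idf fg gf sum unfolding primitive_idempotent_def by blast
  then show ?thesis
  proof
    assume f0: "?f = \<zero>"
    have "ev (X ^ k) = ev (X ^ k) \<otimes> ?f" using Xkt[of 1 k] by (simp add: ev_mult)
    then show ?thesis using f0 by (auto simp: X_def)
  next
    assume "?g = \<zero>"
    then have fu: "?f = u" using sum by simp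
    show ?thesis
    proof (cases k)
      \<comment> \<open>Here \<open>t ^ k\<close> is 1 and has no factor \<open>X\<close> to offer.
        But then 1 and \<open>t\<close> agree modulo \<open>p\<close>, which provides one.\<close>
      case 0
      have "ev 1 = ev t" using Xk[of 1] 0 by simp
      then have "ev X \<otimes> ev s = u" unfolding s ev_mult[symmetric] ev_one ..
      then have "b \<otimes> ev s = u" unfolding X_def ev_X .
      then show ?thesis by blast
    next
      case (Suc k')
      have "t ^ k = X * (s * t ^ k')" using Suc by (simp add: s)
      then have "ev X \<otimes> ev (s * t ^ k') = u" using fu unfolding ev_mult[symmetric] by simp
      then have "b \<otimes> ev (s * t ^ k') = u" unfolding X_def ev_X .
      then show ?thesis by blast
    qed
  qed
qed

end

end

section \<open>Simple modules over a basic algebra\<close>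

text \<open>The multiples of \<open>y\<close> form a submodule, nonzero because it contains
  \<open>y\<close>.\<close>

lemma simple_cyclic:
  assumes S: "simple_module R S" and y: "y \<in> carrier S" "y \<noteq> \<zero>\<^bsub>S\<^esub>" and z: "z \<in> carrier S"
  shows "\<exists>a \<in> carrier R. a \<odot>\<^bsub>S\<^esub> y = z"
proof -
  interpret S: left_module R S using S by (simp add: simple_module_def)
  let ?N = "(\<lambda>a. a \<odot>\<^bsub>S\<^esub> y) ` carrier R"
  have "Module.submodule ?N R S"
  proof (rule S.submoduleI')
    show "?N \<subseteq> carrier S" using S.smult_closed y by blast
    show "\<zero>\<^bsub>S\<^esub> \<in> ?N" using S.smult_zero_left[OF y(1)] S.R.zero_closed by (metis imageI)
    fix u v assume "u \<in> ?N" "v \<in> ?N"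
    then obtain a b where ab: "a \<in> carrier R" "b \<in> carrier R" "u = a \<odot>\<^bsub>S\<^esub> y" "v = b \<odot>\<^bsub>S\<^esub> y" by blast
    then have "u \<oplus>\<^bsub>S\<^esub> v = (a \<oplus>\<^bsub>R\<^esub> b) \<odot>\<^bsub>S\<^esub> y" using S.smult_l_distr y by simp
    then show "u \<oplus>\<^bsub>S\<^esub> v \<in> ?N" using ab by blast
  next
    fix a u assume a: "a \<in> carrier R" and "u \<in> ?N"
    then obtain b where b: "b \<in> carrier R" "u = b \<odot>\<^bsub>S\<^esub> y" by blast
    then have "a \<odot>\<^bsub>S\<^esub> u = (a \<otimes>\<^bsub>R\<^esub> b) \<odot>\<^bsub>S\<^esub> y" using S.smult_assoc a y by simp
    then show "a \<odot>\<^bsub>S\<^esub> u \<in> ?N" using a b by blast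
  qed
  moreover have "y \<in> ?N" using S.smult_one[OF y(1)] S.R.one_closed by (metis imageI)
  then have "?N \<noteq> {\<zero>\<^bsub>S\<^esub>}" using y(2) by blast
  ultimately have "?N = carrier S" using S unfolding simple_module_def by blast
  then have "z \<in> ?N" using z by simp
  then show ?thesis by blast
qed

context basic_fd_algebra
begin

lemma e_props:
  assumes "j < m" shows "e j \<in> carrier A" "e j \<otimes> e j = e j" "e j \<noteq> \<zero>"
  using primitive[OF assms] by (auto simp: primitive_idempotent_def idempotent_def)

text \<open>Over an algebraically closed field, \<open>e\<^sub>j a e\<^sub>j\<close> is nilpotent up to a multiple of \<open>e\<^sub>j\<close>, which
  gives the character by which \<open>A\<close> acts on the \<open>j\<close>-th simple module.\<close>

definition chi :: "nat \<Rightarrow> 'a \<Rightarrow> 'k" where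
  "chi j a = (SOME c. \<exists>r. corner_eval (e j) (e j \<otimes> a \<otimes> e j \<ominus> c \<odot>\<^bsub>A\<^esub> e j) ([:0, 1:] ^ r) = \<zero>)"

lemma corner_minus:
  fixes c :: 'k
  assumes j: "j < m" and a: "a \<in> carrier A"
  defines "b \<equiv> e j \<otimes> a \<otimes> e j \<ominus> c \<odot>\<^bsub>A\<^esub> e j"
  shows "b \<in> carrier A" "e j \<otimes> b = b" "b \<otimes> e j = b"
proof -
  note E = e_props[OF j]
  have ce: "c \<odot>\<^bsub>A\<^esub> e j \<in> carrier A" using E by (simp add: vs_smult_closed)
  show "b \<in> carrier A" unfolding b_def using E a ce by simp
  have "e j \<otimes> (c \<odot>\<^bsub>A\<^esub> e j) = c \<odot>\<^bsub>A\<^esub> e j" "(c \<odot>\<^bsub>A\<^esub> e j) \<otimes> e j = c \<odot>\<^bsub>A\<^esub> e j"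
    using E by (simp_all add: smult_mult_left[symmetric] smult_mult_right[symmetric])
  moreover have "e j \<otimes> (e j \<otimes> a \<otimes> e j) = e j \<otimes> a \<otimes> e j" "(e j \<otimes> a \<otimes> e j) \<otimes> e j = e j \<otimes> a \<otimes> e j"
    using E a by (simp_all add: m_assoc[symmetric]) (simp add: m_assoc)
  ultimately show "e j \<otimes> b = b" "b \<otimes> e j = b"
    unfolding b_def a_minus_def using E a ce by (simp_all add: r_distr l_distr r_minus l_minus)
qed

text \<open>If \<open>e j a e j - c e j\<close> were invertible in the corner for every
  \<open>c\<close>, the linear factors of an annihilating polynomial could be cancelled one at a
  time until a nonzero multiple of \<open>e j\<close> vanished. So some difference is not
  invertible, and by the dichotomy it is nilpotent.\<close>

lemma chi_nilpotent:
  assumes j: "j < m" and a: "a \<in> carrier A"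
  shows "\<exists>r. corner_eval (e j) (e j \<otimes> a \<otimes> e j \<ominus> chi j a \<odot>\<^bsub>A\<^esub> e j) ([:0, 1:] ^ r) = \<zero>"
proof -
  let ?u = "e j" and ?a = "e j \<otimes> a \<otimes> e j"
  let ?b = "\<lambda>c. ?a \<ominus> c \<odot>\<^bsub>A\<^esub> ?u"
  note E = e_props[OF j] and C = corner_minus[OF j a]
  have a0: "?b 0 = ?a" using E a by (simp add: vs_smult_zero a_minus_def)
  note C0 = C[of 0, unfolded a0]
  have "\<exists>c. \<not> (\<exists>q. ?b c \<otimes> corner_eval ?u (?b c) q = ?u)"
    if "p \<noteq> 0" "corner_eval ?u ?a p = \<zero>" for p
    using that
  proof (induction "degree p" arbitrary: p rule: less_induct)
    case (less p)
    note ev = E(1,2) C0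
    show ?case
    proof (cases "degree p = 0")
      case True
      then obtain c where c: "p = [:c:]" by (rule degree_eq_zeroE)
      then have "c \<noteq> 0" using less.prems by auto
      have "c \<odot>\<^bsub>A\<^esub> ?u = \<zero>" using less.prems(2) E C0 by (simp add: c corner_eval_pCons vs_smult_closed)
      then have "inverse c \<odot>\<^bsub>A\<^esub> (c \<odot>\<^bsub>A\<^esub> ?u) = \<zero>" by (simp add: vs_smult_zero_right)
      then have "?u = \<zero>" using vs_smult_assoc[OF E(1), of "inverse c" c] \<open>c \<noteq> 0\<close> vs_smult_one[OF E(1)] by simp
      then show ?thesis using E(3) by simp
    next
      case False
      then obtain c where "poly p c = 0" using alg_closed_imp_poly_has_root[of p] by auto
      then obtain q where q: "p = [:- c, 1:] * q" unfolding poly_eq_0_iff_dvd by (rule dvdE)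
      have qn: "q \<noteq> 0" using less.prems(1) q by auto
      have "degree p = degree [:- c, 1:] + degree q" unfolding q by (rule degree_mult_eq) (use qn in simp_all)
      then have q0: "q \<noteq> 0" "degree q < degree p" using qn by simp_all
      show ?thesis
      proof (rule ccontr)
        assume "\<not> ?thesis"
        then obtain y where y: "?b c \<otimes> corner_eval ?u (?b c) y = ?u" by blast
        let ?y = "corner_eval ?u (?b c) y"
        have yc: "?y \<in> carrier A" by (rule ev_closed[OF E(1,2) C])
        have yb: "?y \<otimes> ?b c = ?u"
          using y ev_commute[OF E(1,2) C, where p = "[:0, 1:]" and q = y] unfolding ev_X[OF E(1,2) C] by simp
        have lin: "corner_eval ?u ?a [:- c, 1:] = ?b c"
        proof -
          have "(- c) \<odot>\<^bsub>A\<^esub> ?u \<oplus> c \<odot>\<^bsub>A\<^esub> ?u = \<zero>"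
            unfolding vs_smult_l_distr[OF E(1), symmetric] using vs_smult_zero[OF E(1)] by simp
          then have "(- c) \<odot>\<^bsub>A\<^esub> ?u = \<ominus> (c \<odot>\<^bsub>A\<^esub> ?u)"
            using minus_equality[of "(- c) \<odot>\<^bsub>A\<^esub> ?u" "c \<odot>\<^bsub>A\<^esub> ?u"] E vs_smult_closed by simp
          then show ?thesis using E C0 vs_smult_closed[OF E(1), of c]
            by (simp add: corner_eval_pCons vs_smult_one vs_smult_zero a_minus_def a_comm)
        qed
        have evq: "corner_eval ?u ?a q \<in> carrier A" by (rule ev_closed[OF ev])
        have "corner_eval ?u ?a q = (?y \<otimes> ?b c) \<otimes> corner_eval ?u ?a q"
          unfolding yb by (rule ev_left[OF ev, symmetric])
        also have "\<dots> = ?y \<otimes> (?b c \<otimes> corner_eval ?u ?a q)" by (rule m_assoc[OF yc C(1) evq])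
        also have "?b c \<otimes> corner_eval ?u ?a q = corner_eval ?u ?a p"
          unfolding q ev_mult[OF ev] lin ..
        finally have "corner_eval ?u ?a q = \<zero>" using less.prems(2) yc by simp
        from less.hyps[OF q0(2,1) this] \<open>\<not> ?thesis\<close> show False by blast
      qed
    qed
  qed
  moreover obtain p where "p \<noteq> 0" "corner_eval ?u ?a p = \<zero>" using annihilating_poly[OF E(1,2) C0] by blast
  ultimately obtain c where "\<not> (\<exists>q. ?b c \<otimes> corner_eval ?u (?b c) q = ?u)" by blast
  then have "\<exists>r. corner_eval ?u (?b c) ([:0, 1:] ^ r) = \<zero>"
    using nilpotent_or_unit[OF E(1,2) C primitive[OF j]] by blast
  then have "\<exists>c. \<exists>r. corner_eval ?u (?b c) ([:0, 1:] ^ r) = \<zero>" by blast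
  then show ?thesis unfolding chi_def by (rule someI_ex)
qed

text \<open>Powers of \<open>g\<close> also fix \<open>x\<close>, so \<open>g\<close> is not
  nilpotent and must be a unit of the corner ring.\<close>

lemma unit_of_fixing:
  assumes j: "j < m" and S: "left_module A S" and x: "x \<in> carrier S" "x \<noteq> \<zero>\<^bsub>S\<^esub>"
    and g: "g \<in> carrier A" "e j \<otimes> g = g" "g \<otimes> e j = g" "g \<odot>\<^bsub>S\<^esub> x = x"
  shows "\<exists>y \<in> carrier A. g \<otimes> y = e j \<and> y \<otimes> g = e j"
proof -
  interpret S: left_module A S by (rule S)
  note E = e_props[OF j]
  have ex: "e j \<odot>\<^bsub>S\<^esub> x = x"
    using S.smult_assoc[OF E(1) g(1) x(1)] g(2,4) by simp
  have "corner_eval (e j) g ([:0, 1:] ^ r) \<noteq> \<zero>" for r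
    using ev_power_act[OF E(1,2) g(1-3) S x(1) ex g(4), of r] x by auto
  then obtain q where q: "g \<otimes> corner_eval (e j) g q = e j"
    using nilpotent_or_unit[OF E(1,2) g(1-3) primitive[OF j]] by blast
  moreover have "corner_eval (e j) g q \<otimes> g = e j"
    using q ev_commute[OF E(1,2) g(1-3), of "[:0, 1:]" q] unfolding ev_X[OF E(1,2) g(1-3)] by simp
  ultimately show ?thesis using ev_closed[OF E(1,2) g(1-3)] by blast
qed

text \<open>If \<open>b x\<close> were nonzero, some \<open>a\<close> would carry it back to
  \<open>x\<close>. Then \<open>e j a b\<close> fixes \<open>x\<close> and is a unit of the corner,
  so \<open>b\<close> can be cancelled from the left, and a vanishing power of \<open>b\<close> of
  least exponent could be shortened.\<close>

lemma nilpotent_act: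
  assumes j: "j < m" and S: "simple_module A S" and x: "x \<in> carrier S" "e j \<odot>\<^bsub>S\<^esub> x = x"
    and b: "b \<in> carrier A" "e j \<otimes> b = b" "b \<otimes> e j = b"
    and nil: "\<exists>r. corner_eval (e j) b ([:0, 1:] ^ r) = \<zero>"
  shows "b \<odot>\<^bsub>S\<^esub> x = \<zero>\<^bsub>S\<^esub>"
proof (rule ccontr)
  assume bx: "b \<odot>\<^bsub>S\<^esub> x \<noteq> \<zero>\<^bsub>S\<^esub>"
  have Sm: "left_module A S" using S by (simp add: simple_module_def)
  interpret S: left_module A S by (rule Sm)
  note E = e_props[OF j]
  have x0: "x \<noteq> \<zero>\<^bsub>S\<^esub>" using bx b(1) by auto
  obtain a where a: "a \<in> carrier A" "a \<odot>\<^bsub>S\<^esub> (b \<odot>\<^bsub>S\<^esub> x) = x"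
    using simple_cyclic[OF S S.smult_closed[OF b(1) x(1)] bx x(1)] by blast
  let ?g = "e j \<otimes> a \<otimes> b"
  have g: "?g \<in> carrier A" "e j \<otimes> ?g = ?g" "?g \<otimes> e j = ?g"
    using E a b by (simp_all add: m_assoc[symmetric]) (simp add: m_assoc)
  have gx: "?g \<odot>\<^bsub>S\<^esub> x = x"
    using E a b x by (simp add: S.smult_assoc S.smult_closed)
  obtain y where y: "y \<in> carrier A" "y \<otimes> ?g = e j" using unit_of_fixing[OF j Sm x(1) x0 g gx] by blast
  let ?P = "\<lambda>r. corner_eval (e j) b ([:0, 1:] ^ r) = \<zero>"
  define r where "r = (LEAST r. ?P r)"
  have r: "?P r" unfolding r_def by (rule LeastI_ex[OF nil])
  have "r \<noteq> 0"
  proof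
    assume "r = 0" then have "e j = \<zero>" using r ev_one[OF E(1,2) b] by simp
    then show False using E(3) by simp
  qed
  then obtain r' where r': "r = Suc r'" by (cases r) auto
  let ?B = "corner_eval (e j) b ([:0, 1:] ^ r')"
  have B: "?B \<in> carrier A" by (rule ev_closed[OF E(1,2) b])
  have bB: "b \<otimes> ?B = \<zero>" using r unfolding r' power_Suc ev_mult[OF E(1,2) b] ev_X[OF E(1,2) b] .
  have "?B = (y \<otimes> ?g) \<otimes> ?B" unfolding y(2) by (rule ev_left[OF E(1,2) b, symmetric])
  also have "\<dots> = y \<otimes> (e j \<otimes> a \<otimes> (b \<otimes> ?B))" using y(1) E a b B by (simp add: m_assoc)
  also have "\<dots> = \<zero>" using bB y(1) E a by simp
  finally have "?P r'" .
  then have "r \<le> r'" unfolding r_def by (rule Least_le)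
  then show False using r' by simp
qed

text \<open>In the corner, \<open>a\<close> is \<open>chi j a\<close> times \<open>e j\<close> plus
  a nilpotent element, and the nilpotent part kills the vectors fixed by \<open>e j\<close>.\<close>

lemma corner_act:
  assumes j: "j < m" and S: "simple_module A S" and x: "x \<in> carrier S" "e j \<odot>\<^bsub>S\<^esub> x = x" and a: "a \<in> carrier A"
  shows "e j \<odot>\<^bsub>S\<^esub> (a \<odot>\<^bsub>S\<^esub> x) = scal (chi j a) \<odot>\<^bsub>S\<^esub> x"
proof -
  interpret S: left_module A S using S by (simp add: simple_module_def)
  note E = e_props[OF j]
  let ?c = "chi j a"
  have ce: "?c \<odot>\<^bsub>A\<^esub> e j \<in> carrier A" using E by (simp add: vs_smult_closed)
  have eae: "e j \<otimes> a \<otimes> e j \<in> carrier A" using E a by simp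
  have "(e j \<otimes> a \<otimes> e j \<ominus> ?c \<odot>\<^bsub>A\<^esub> e j) \<odot>\<^bsub>S\<^esub> x = \<zero>\<^bsub>S\<^esub>"
    by (rule nilpotent_act[OF j S x corner_minus[OF j a] chi_nilpotent[OF j a]])
  then have "(e j \<otimes> a \<otimes> e j) \<odot>\<^bsub>S\<^esub> x = (?c \<odot>\<^bsub>A\<^esub> e j) \<odot>\<^bsub>S\<^esub> x"
    unfolding S.smult_minus_distr[OF eae ce x(1)]
    using S.M.minus_equality[of "(e j \<otimes> a \<otimes> e j) \<odot>\<^bsub>S\<^esub> x" "\<ominus>\<^bsub>S\<^esub> ((?c \<odot>\<^bsub>A\<^esub> e j) \<odot>\<^bsub>S\<^esub> x)"]
      S.smult_closed[OF eae x(1)] S.smult_closed[OF ce x(1)] by (simp add: S.M.minus_eq)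
  moreover have "(e j \<otimes> a \<otimes> e j) \<odot>\<^bsub>S\<^esub> x = e j \<odot>\<^bsub>S\<^esub> (a \<odot>\<^bsub>S\<^esub> x)"
    using E a x by (simp add: S.smult_assoc S.smult_closed)
  moreover have "(?c \<odot>\<^bsub>A\<^esub> e j) \<odot>\<^bsub>S\<^esub> x = scal ?c \<odot>\<^bsub>S\<^esub> x"
    unfolding scal_mult_left[OF E(1), symmetric] S.smult_assoc[OF scal_closed E(1) x(1)] x(2) ..
  ultimately show ?thesis by simp
qed

text \<open>If \<open>e\<^sub>i S\<close> and \<open>e\<^sub>j S\<close> are both nonzero, then right multiplication by a suitable element of
  \<open>e\<^sub>i A e\<^sub>j\<close> is an isomorphism \<open>A e\<^sub>i \<rightarrow> A e\<^sub>j\<close>.\<close>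

lemma simple_one_idempotent:
  assumes ij: "i < m" "j < m" "i \<noteq> j" and S: "simple_module A S"
    and x: "x \<in> carrier S" "e i \<odot>\<^bsub>S\<^esub> x = x" "x \<noteq> \<zero>\<^bsub>S\<^esub>"
    and y: "y \<in> carrier S" "e j \<odot>\<^bsub>S\<^esub> y = y" "y \<noteq> \<zero>\<^bsub>S\<^esub>"
  shows False
proof -
  have Sm: "left_module A S" using S by (simp add: simple_module_def)
  interpret S: left_module A S by (rule Sm)
  note Ei = e_props[OF ij(1)] and Ej = e_props[OF ij(2)]
  obtain a0 b0 where ab0: "a0 \<in> carrier A" "a0 \<odot>\<^bsub>S\<^esub> x = y" "b0 \<in> carrier A" "b0 \<odot>\<^bsub>S\<^esub> y = x"
    using simple_cyclic[OF S x(1,3) y(1)] simple_cyclic[OF S y(1,3) x(1)] by blast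
  define a b where "a = e j \<otimes> a0 \<otimes> e i" and "b = e i \<otimes> b0 \<otimes> e j"
  have a: "a \<in> carrier A" "e j \<otimes> a = a" "a \<otimes> e i = a" and b: "b \<in> carrier A" "e i \<otimes> b = b" "b \<otimes> e j = b"
    unfolding a_def b_def using Ei Ej ab0 by (simp_all add: m_assoc) (simp_all add: m_assoc[symmetric])
  have ax: "a \<odot>\<^bsub>S\<^esub> x = y" and bY: "b \<odot>\<^bsub>S\<^esub> y = x"
    unfolding a_def b_def using Ei Ej ab0 x y by (simp_all add: S.smult_assoc S.smult_closed)
  have ba: "b \<otimes> a \<in> carrier A" "e i \<otimes> (b \<otimes> a) = b \<otimes> a" "(b \<otimes> a) \<otimes> e i = b \<otimes> a" "(b \<otimes> a) \<odot>\<^bsub>S\<^esub> x = x"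
    using m_assoc[OF Ei(1) b(1) a(1)] m_assoc[OF b(1) a(1) Ei(1)] S.smult_assoc[OF b(1) a(1) x(1)]
      a b ax bY by simp_all
  have ab: "a \<otimes> b \<in> carrier A" "e j \<otimes> (a \<otimes> b) = a \<otimes> b" "(a \<otimes> b) \<otimes> e j = a \<otimes> b" "(a \<otimes> b) \<odot>\<^bsub>S\<^esub> y = y"
    using m_assoc[OF Ej(1) a(1) b(1)] m_assoc[OF a(1) b(1) Ej(1)] S.smult_assoc[OF a(1) b(1) y(1)]
      a b ax bY by simp_all
  \<comment> \<open>\<open>b \<otimes> a\<close> fixes \<open>x\<close> and
    \<open>a \<otimes> b\<close> fixes \<open>y\<close>, so both are units of their corner rings.
    The former gives injectivity and the latter surjectivity of right multiplication by
    \<open>b\<close>.\<close>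
  obtain u where u: "u \<in> carrier A" "(b \<otimes> a) \<otimes> u = e i" using unit_of_fixing[OF ij(1) Sm x(1,3) ba] by blast
  obtain w where w: "w \<in> carrier A" "w \<otimes> (a \<otimes> b) = e j" using unit_of_fixing[OF ij(2) Sm y(1,3) ab] by blast
  let ?P = "\<lambda>i. principal_module A (e i)"
  have carr: "carrier (?P i) = {r \<otimes> e i | r. r \<in> carrier A}" for i
    by (simp add: principal_module_def)
  have ops: "r \<oplus>\<^bsub>?P i\<^esub> s = r \<oplus> s" "r \<odot>\<^bsub>?P i\<^esub> s = r \<otimes> s" for r s i
    by (simp_all add: principal_module_def regular_module_def)
  have Pi: "r \<in> carrier A" "r \<otimes> e i = r" if "r \<in> carrier (?P i)" for r
    using that Ei unfolding carr by (auto simp: m_assoc)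
  have hom: "(\<lambda>r. r \<otimes> b) \<in> LinearCombinations.module_hom A (?P i) (?P j)"
  proof (rule module_homI)
    fix r assume "r \<in> carrier (?P i)"
    then have "r \<otimes> b = (r \<otimes> b) \<otimes> e j" using Pi(1) b Ej by (simp add: m_assoc)
    then show "r \<otimes> b \<in> carrier (?P j)" unfolding carr using Pi(1)[OF \<open>r \<in> carrier (?P i)\<close>] b(1) by blast
  qed (use Pi b in \<open>simp_all add: ops l_distr m_assoc\<close>)
  have "bij_betw (\<lambda>r. r \<otimes> b) (carrier (?P i)) (carrier (?P j))"
    unfolding bij_betw_def
  proof
    show "inj_on (\<lambda>r. r \<otimes> b) (carrier (?P i))"
    proof (rule inj_onI)
      fix r s assume rs: "r \<in> carrier (?P i)" "s \<in> carrier (?P i)" "r \<otimes> b = s \<otimes> b"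
      have "r' \<otimes> e i = ((r' \<otimes> b) \<otimes> a) \<otimes> u" if "r' \<in> carrier A" for r'
        unfolding u(2)[symmetric] using that a b u(1) by (simp add: m_assoc)
      from this[OF Pi(1)[OF rs(1)]] this[OF Pi(1)[OF rs(2)]] show "r = s"
        unfolding Pi(2)[OF rs(1)] Pi(2)[OF rs(2)] rs(3) by simp
    qed
    show "(\<lambda>r. r \<otimes> b) ` carrier (?P i) = carrier (?P j)"
    proof (intro equalityI subsetI)
      fix s assume "s \<in> (\<lambda>r. r \<otimes> b) ` carrier (?P i)"
      then show "s \<in> carrier (?P j)" using module_homD(1)[OF hom] by blast
    next
      fix s assume "s \<in> carrier (?P j)"
      then obtain r where r: "r \<in> carrier A" "s = r \<otimes> e j" unfolding carr by blast
      let ?t = "r \<otimes> w \<otimes> a"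
      have "s = ?t \<otimes> b" unfolding r(2) w(2)[symmetric] using r w(1) a b by (simp add: m_assoc)
      moreover have "?t = ?t \<otimes> e i" using r w(1) a Ei by (simp add: m_assoc)
      then have "?t \<in> carrier (?P i)" unfolding carr using r w(1) a(1) by blast
      ultimately show "s \<in> (\<lambda>r. r \<otimes> b) ` carrier (?P i)" by (rule image_eqI)
    qed
  qed
  then have "module_iso A (?P i) (?P j)" unfolding module_iso_def using hom by blast
  then show False using not_iso[OF ij] by simp
qed

text \<open>Basicness shows in \<open>e j\<close> acting as the identity rather than merely
  nontrivially: every vector is then an eigenvector of the whole algebra.\<close>

definition has_type :: "nat \<Rightarrow> ('a, 's) module \<Rightarrow> bool" where
  "has_type j S \<longleftrightarrow> j < m \<and> (\<forall>x\<in>carrier S. e j \<odot>\<^bsub>S\<^esub> x = x \<and>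
     (\<forall>a\<in>carrier A. a \<odot>\<^bsub>S\<^esub> x = scal (chi j a) \<odot>\<^bsub>S\<^esub> x))"

lemma sum_e_act:
  assumes "left_module A S" and x: "x \<in> carrier S"
  shows "x = (\<Oplus>\<^bsub>S\<^esub>i\<in>{..<m}. e i \<odot>\<^bsub>S\<^esub> x)"
proof -
  interpret S: left_module A S by (rule assms)
  have "e \<in> {..<m} \<rightarrow> carrier A" using e_props by auto
  from S.smult_finsum[OF _ this x] show ?thesis using S.smult_one[OF x] by (simp add: sum_e)
qed

text \<open>The idempotents sum to 1, so one of them acts nontrivially, and by
  \<open>simple_one_idempotent\<close> no other does. That one therefore acts as the identity, and
  \<open>corner_act\<close> describes the action of the whole algebra.\<close>

lemma simple_has_type:
  assumes S: "simple_module A S"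
  shows "\<exists>j. has_type j S"
proof -
  have Sm: "left_module A S" using S by (simp add: simple_module_def)
  interpret S: left_module A S by (rule Sm)
  have "carrier S \<noteq> {\<zero>\<^bsub>S\<^esub>}" using S by (simp add: simple_module_def)
  then obtain x where x: "x \<in> carrier S" "x \<noteq> \<zero>\<^bsub>S\<^esub>" using S.M.zero_closed by blast
  have "\<exists>j<m. e j \<odot>\<^bsub>S\<^esub> x \<noteq> \<zero>\<^bsub>S\<^esub>"
  proof (rule ccontr)
    assume "\<not> ?thesis"
    then have "(\<Oplus>\<^bsub>S\<^esub>i\<in>{..<m}. e i \<odot>\<^bsub>S\<^esub> x) = (\<Oplus>\<^bsub>S\<^esub>i\<in>{..<m}. \<zero>\<^bsub>S\<^esub>)"
      by (intro S.M.finsum_cong') auto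
    then show False using sum_e_act[OF Sm x(1)] x(2) by simp
  qed
  then obtain j where j: "j < m" "e j \<odot>\<^bsub>S\<^esub> x \<noteq> \<zero>\<^bsub>S\<^esub>" by blast
  have idem: "e i \<odot>\<^bsub>S\<^esub> (e i \<odot>\<^bsub>S\<^esub> y) = e i \<odot>\<^bsub>S\<^esub> y" "e i \<odot>\<^bsub>S\<^esub> y \<in> carrier S"
    if "i < m" "y \<in> carrier S" for i y
    using S.smult_assoc[of "e i" "e i" y] S.smult_closed[of "e i" y] e_props[OF that(1)] that(2) by simp_all
  have other: "e i \<odot>\<^bsub>S\<^esub> y = \<zero>\<^bsub>S\<^esub>" if "i < m" "i \<noteq> j" "y \<in> carrier S" for i y
  proof (rule ccontr)
    assume "e i \<odot>\<^bsub>S\<^esub> y \<noteq> \<zero>\<^bsub>S\<^esub>"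
    from simple_one_idempotent[OF that(1) j(1) that(2) S idem(2,1)[OF that(1,3)] this idem(2,1)[OF j(1) x(1)] j(2)]
    show False .
  qed
  have fixed: "e j \<odot>\<^bsub>S\<^esub> y = y" if y: "y \<in> carrier S" for y
  proof -
    have "y = (\<Oplus>\<^bsub>S\<^esub>i\<in>{..<m}. e i \<odot>\<^bsub>S\<^esub> y)" by (rule sum_e_act[OF Sm y])
    also have "\<dots> = (\<Oplus>\<^bsub>S\<^esub>i\<in>{..<m}. if j = i then e i \<odot>\<^bsub>S\<^esub> y else \<zero>\<^bsub>S\<^esub>)"
      using other[OF _ _ y] idem(2)[OF _ y] by (intro S.M.finsum_cong') auto
    also have "\<dots> = e j \<odot>\<^bsub>S\<^esub> y"
      using S.M.finsum_singleton[of j "{..<m}" "\<lambda>i. e i \<odot>\<^bsub>S\<^esub> y"] j(1) idem(2)[OF _ y] by auto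
    finally show ?thesis ..
  qed
  have "a \<odot>\<^bsub>S\<^esub> y = scal (chi j a) \<odot>\<^bsub>S\<^esub> y" if "y \<in> carrier S" "a \<in> carrier A" for y a
    using corner_act[OF j(1) S that(1) fixed[OF that(1)] that(2)] fixed[OF S.smult_closed[OF that(2,1)]] by simp
  then show ?thesis unfolding has_type_def using j(1) fixed by blast
qed

end

lemma subspace_row_span:
  assumes X: "VectorSpace.subspace class_ring X (module_vec TYPE('k::field) N)"
  shows "\<exists>k B. row_span k N X (B :: 'k mat)"
proof -
  interpret V: vec_space "TYPE('k)" N .
  have vs: "vectorspace class_ring (module_vec TYPE('k) N\<lparr>carrier := X\<rparr>)" by (rule V.subspace_is_vs[OF X])
  have XV: "X \<subseteq> carrier_vec N" using V.is_module[OF X] by (simp add: LinearCombinations.submodule_def)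
  obtain k \<omega> where \<omega>: "coordinatization (module_vec TYPE('k) N\<lparr>carrier := X\<rparr>) k \<omega>"
    using fin_dim_coordinatization[OF vs subspace_fin_dim(1)[OF vec_vs V.fin_dim X]] by blast
  have h: "\<omega> \<in> LinearCombinations.module_hom class_ring (module_vec TYPE('k) k) (module_vec TYPE('k) N)"
    and s: "\<omega> ` carrier_vec k = X" and i: "inj_on \<omega> (carrier_vec k)"
    using \<omega> XV by (auto simp: coordinatization_def bij_betw_def LinearCombinations.module_hom_def module_vec_simps)
  have "\<exists>M \<in> carrier_mat N k. \<forall>v \<in> carrier_vec k. \<omega> v = M *\<^sub>v v"
    by (rule hom_vec_matrix[OF h]) blast
  then obtain M where M: "M \<in> carrier_mat N k" "\<And>v. v \<in> carrier_vec k \<Longrightarrow> \<omega> v = M *\<^sub>v v"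
    by blast
  have "inj_on (\<lambda>v. M *\<^sub>v v) (carrier_vec k)" using i M(2) by (simp cong: inj_on_cong)
  moreover have "X = (\<lambda>v. M *\<^sub>v v) ` carrier_vec k" using s M(2) by (simp cong: image_cong)
  ultimately have "row_span k N X M\<^sup>T" unfolding row_span_def using M(1) by simp
  then show ?thesis by blast
qed

section \<open>The Jacobson radical and isomorphism classes of simple modules\<close>

context fd_algebra
begin

lemma scal_smult_cancel:
  assumes S: "left_module A S" and x: "x \<in> carrier S" "x \<noteq> \<zero>\<^bsub>S\<^esub>" and eq: "scal c \<odot>\<^bsub>S\<^esub> x = scal d \<odot>\<^bsub>S\<^esub> x"
  shows "c = d"
proof (rule ccontr)
  interpret S: left_module A S by (rule S)
  assume "c \<noteq> d"
  then have nz: "inverse (c - d) * (c - d) = 1" by simp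
  have "scal (c - d) \<odot>\<^bsub>S\<^esub> x \<oplus>\<^bsub>S\<^esub> scal d \<odot>\<^bsub>S\<^esub> x = scal d \<odot>\<^bsub>S\<^esub> x"
    using S.smult_l_distr[OF scal_closed scal_closed x(1), of "c - d" d] eq by (simp add: scal_add[symmetric])
  then have "scal (c - d) \<odot>\<^bsub>S\<^esub> x = \<zero>\<^bsub>S\<^esub>"
    using S.M.add.r_cancel_one[of "scal d \<odot>\<^bsub>S\<^esub> x" "scal (c - d) \<odot>\<^bsub>S\<^esub> x"] S.smult_closed[OF scal_closed x(1)] by simp
  then have "scal (inverse (c - d)) \<odot>\<^bsub>S\<^esub> (scal (c - d) \<odot>\<^bsub>S\<^esub> x) = \<zero>\<^bsub>S\<^esub>" by simp
  then have "scal (inverse (c - d) * (c - d)) \<odot>\<^bsub>S\<^esub> x = \<zero>\<^bsub>S\<^esub>"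
    unfolding scal_mult S.smult_assoc[OF scal_closed scal_closed x(1)] .
  then show False using x S.smult_one by (simp add: nz scal_one)
qed

lemma jacobson_left_ideal:
  assumes "a \<in> carrier A" "b \<in> jacobson_radical A"
  shows "a \<otimes> b \<in> jacobson_radical A"
proof -
  have rm: "left_module A (regular_module A)" by (rule regular_left_module) unfold_locales
  have bA: "b \<in> carrier A" and bI: "\<And>I. maximal_left_ideal I A \<Longrightarrow> b \<in> I"
    using assms(2) by (auto simp: jacobson_radical_def)
  have "a \<otimes> b \<in> I" if I: "maximal_left_ideal I A" for I
  proof -
    have "Module.submodule I A (regular_module A)" using I by (simp add: maximal_left_ideal_def)
    from left_module.submoduleD(4)[OF rm this assms(1) bI[OF I]]
    show ?thesis by (simp add: regular_module_def)
  qed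
  then show ?thesis unfolding jacobson_radical_def using assms(1) bA by auto
qed

text \<open>The annihilator of a nonzero vector of a simple module is a maximal left ideal, and the
  radical lies in all of these.\<close>

lemma jacobson_kills_simple:
  assumes S: "simple_module A S" and x: "x \<in> carrier S" and b: "b \<in> jacobson_radical A"
  shows "b \<odot>\<^bsub>S\<^esub> x = \<zero>\<^bsub>S\<^esub>"
proof (cases "x = \<zero>\<^bsub>S\<^esub>")
  have Sm: "left_module A S" using S by (simp add: simple_module_def)
  interpret S: left_module A S by (rule Sm)
  have bA: "b \<in> carrier A" using b by (simp add: jacobson_radical_def)
  case True
  then show ?thesis using bA by simp
next
  case False
  have Sm: "left_module A S" using S by (simp add: simple_module_def)
  interpret S: left_module A S by (rule Sm)
  have rm: "left_module A (regular_module A)" by (rule regular_left_module) unfold_locales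
  interpret R: left_module A "regular_module A" by (rule rm)
  have sel: "carrier (regular_module A) = carrier A" "\<zero>\<^bsub>regular_module A\<^esub> = \<zero>"
    "c \<oplus>\<^bsub>regular_module A\<^esub> d = c \<oplus> d" "c \<odot>\<^bsub>regular_module A\<^esub> d = c \<otimes> d" for c d
    by (simp_all add: regular_module_def)
  let ?I = "{a \<in> carrier A. a \<odot>\<^bsub>S\<^esub> x = \<zero>\<^bsub>S\<^esub>}"
  have "maximal_left_ideal ?I A"
    unfolding maximal_left_ideal_def
  proof (intro conjI allI impI)
    show "Module.submodule ?I A (regular_module A)"
      using x by (intro R.submoduleI') (auto simp: sel S.smult_l_distr S.smult_assoc)
    have "\<one> \<notin> ?I" using S.smult_one[OF x] False by simp
    then show "?I \<noteq> carrier A" by blast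
    fix I' assume I': "Module.submodule I' A (regular_module A) \<and> ?I \<subseteq> I'"
    note D = R.submoduleD[OF conjunct1[OF I'], unfolded sel]
    show "I' = ?I \<or> I' = carrier A"
    proof (cases "I' \<subseteq> ?I")
      case True then show ?thesis using I' by blast
    next
      case nsub: False
      then obtain c where c: "c \<in> I'" "c \<notin> ?I" by blast
      have cA: "c \<in> carrier A" using c(1) D(1) by blast
      have "c \<odot>\<^bsub>S\<^esub> x \<noteq> \<zero>\<^bsub>S\<^esub>" using c(2) cA by simp
      then obtain a where a: "a \<in> carrier A" "a \<odot>\<^bsub>S\<^esub> (c \<odot>\<^bsub>S\<^esub> x) = x"
        using simple_cyclic[OF S S.smult_closed[OF cA x] _ x] by blast
      have ac: "a \<otimes> c \<in> carrier A" using a(1) cA by simp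
      have acI: "a \<otimes> c \<in> I'" using D(4)[OF a(1) c(1)] .
      \<comment> \<open>\<open>1 - a c\<close> kills \<open>x\<close> and so lies in the
        annihilator; adding \<open>a c\<close>, which lies in the larger ideal, puts 1 into that
        ideal.\<close>
      have "(\<one> \<ominus> a \<otimes> c) \<odot>\<^bsub>S\<^esub> x = x \<ominus>\<^bsub>S\<^esub> x"
        using S.smult_minus_distr[OF one_closed ac x] S.smult_one[OF x] S.smult_assoc[OF a(1) cA x] a(2) by simp
      then have "\<one> \<ominus> a \<otimes> c \<in> ?I" using x ac by (simp add: S.M.minus_eq S.M.r_neg)
      then have "\<one> \<ominus> a \<otimes> c \<in> I'" using I' by blast
      then have "(\<one> \<ominus> a \<otimes> c) \<oplus> a \<otimes> c \<in> I'" by (rule D(3)[OF _ acI])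
      then have one: "\<one> \<in> I'" using ac by (simp add: a_minus_def a_assoc l_neg)
      have "carrier A \<subseteq> I'"
      proof
        fix y assume "y \<in> carrier A"
        then show "y \<in> I'" using D(4)[OF _ one, of y] by simp
      qed
      then show ?thesis using D(1) by blast
    qed
  qed
  then have "b \<in> ?I" using b unfolding jacobson_radical_def by blast
  then show ?thesis by simp
qed

end

context basic_fd_algebra
begin

lemma has_typeD:
  assumes "has_type j S" "x \<in> carrier S"
  shows "j < m" "e j \<odot>\<^bsub>S\<^esub> x = x" "a \<in> carrier A \<Longrightarrow> a \<odot>\<^bsub>S\<^esub> x = scal (chi j a) \<odot>\<^bsub>S\<^esub> x"
  using assms unfolding has_type_def by blast+

lemma other_idempotent_zero:
  assumes S: "left_module A S" and j: "has_type j S" and i: "i < m" "i \<noteq> j" and x: "x \<in> carrier S"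
  shows "e i \<odot>\<^bsub>S\<^esub> x = \<zero>\<^bsub>S\<^esub>"
proof -
  interpret S: left_module A S by (rule S)
  have jm: "j < m" and ejx: "e j \<odot>\<^bsub>S\<^esub> x = x" using has_typeD[OF j x] by blast+
  have "e i \<odot>\<^bsub>S\<^esub> x = (e i \<otimes> e j) \<odot>\<^bsub>S\<^esub> x"
    using S.smult_assoc[OF e_props(1)[OF i(1)] e_props(1)[OF jm] x] ejx by simp
  then show ?thesis using orthogonal[OF i(1) jm i(2)] x by simp
qed

text \<open>A simple module is cyclic, and the algebra acts on it by scalars, so it is a
  line.\<close>

lemma type_scalar:
  assumes S: "simple_module A S" and j: "has_type j S" and x: "x \<in> carrier S" "x \<noteq> \<zero>\<^bsub>S\<^esub>" and z: "z \<in> carrier S"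
  shows "\<exists>c. z = scal c \<odot>\<^bsub>S\<^esub> x"
proof -
  obtain a where a: "a \<in> carrier A" "a \<odot>\<^bsub>S\<^esub> x = z" using simple_cyclic[OF S x z] by blast
  from this(1) have "a \<odot>\<^bsub>S\<^esub> x = scal (chi j a) \<odot>\<^bsub>S\<^esub> x"
    by (rule has_typeD(3)[OF j x(1)])
  then have "z = scal (chi j a) \<odot>\<^bsub>S\<^esub> x" using a(2) by simp
  then show ?thesis ..
qed

lemma type_coordinatization:
  assumes S: "simple_module A S" and j: "has_type j S" and x: "x \<in> carrier S" "x \<noteq> \<zero>\<^bsub>S\<^esub>"
  shows "coordinatization (restrict_scalars A S) 1 (\<lambda>v. scal (v $ 0) \<odot>\<^bsub>S\<^esub> x)"
proof -
  have Sm: "left_module A S" using S by (simp add: simple_module_def)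
  interpret S: left_module A S by (rule Sm)
  have "(\<lambda>v. scal (v $ 0) \<odot>\<^bsub>S\<^esub> x) \<in> LinearCombinations.module_hom class_ring (module_vec TYPE('k) 1) (restrict_scalars A S)"
    using S.smult_closed[OF scal_closed x(1)] S.smult_l_distr[OF scal_closed scal_closed x(1)]
      S.smult_assoc[OF scal_closed scal_closed x(1)]
    by (intro hom_vecI) (auto simp: scal_add scal_mult)
  moreover have "inj_on (\<lambda>v. scal (v $ 0) \<odot>\<^bsub>S\<^esub> x) (carrier_vec 1)"
  proof (rule inj_onI)
    fix v w :: "'k vec" assume vw: "v \<in> carrier_vec 1" "w \<in> carrier_vec 1" "scal (v $ 0) \<odot>\<^bsub>S\<^esub> x = scal (w $ 0) \<odot>\<^bsub>S\<^esub> x"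
    have "v $ 0 = w $ 0" by (rule scal_smult_cancel[OF Sm x vw(3)])
    then show "v = w" using vw(1,2) by (intro eq_vecI) auto
  qed
  moreover have "(\<lambda>v. scal (v $ 0) \<odot>\<^bsub>S\<^esub> x) ` carrier_vec 1 = carrier S"
  proof (intro equalityI subsetI)
    fix z assume "z \<in> carrier S"
    then obtain c where "z = scal c \<odot>\<^bsub>S\<^esub> x" using type_scalar[OF S j x] by blast
    then show "z \<in> (\<lambda>v. scal (v $ 0) \<odot>\<^bsub>S\<^esub> x) ` carrier_vec 1"
      by (intro image_eqI[of _ _ "vec 1 (\<lambda>_. c)"]) auto
  next
    fix z assume "z \<in> (\<lambda>v. scal (v $ 0) \<odot>\<^bsub>S\<^esub> x) ` carrier_vec 1"
    then show "z \<in> carrier S" using S.smult_closed[OF scal_closed x(1)] by blast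
  qed
  ultimately show ?thesis by (simp add: coordinatization_def bij_betw_def)
qed

lemma simple_nonzero:
  assumes "simple_module A S" shows "\<exists>x \<in> carrier S. x \<noteq> \<zero>\<^bsub>S\<^esub>"
proof -
  have Sm: "left_module A S" using assms by (simp add: simple_module_def)
  interpret S: left_module A S by (rule Sm)
  have "carrier S \<noteq> {\<zero>\<^bsub>S\<^esub>}" using assms by (simp add: simple_module_def)
  then show ?thesis using S.M.zero_closed by blast
qed

text \<open>Both modules are lines on which the algebra acts by the same character, so matching
  multiples of two nonzero vectors is an isomorphism.\<close>

lemma same_type_iso:
  assumes S: "simple_module A S" "has_type j S" and S': "simple_module A S'" "has_type j S'"
  shows "module_iso A S S'"
proof -
  have Sm: "left_module A S" and Sm': "left_module A S'" using S S' by (simp_all add: simple_module_def)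
  interpret S: left_module A S by (rule Sm)
  interpret S': left_module A S' by (rule Sm')
  obtain x where x: "x \<in> carrier S" "x \<noteq> \<zero>\<^bsub>S\<^esub>" using simple_nonzero[OF S(1)] by blast
  obtain y where y: "y \<in> carrier S'" "y \<noteq> \<zero>\<^bsub>S'\<^esub>" using simple_nonzero[OF S'(1)] by blast
  define f where "f z = scal (SOME c. z = scal c \<odot>\<^bsub>S\<^esub> x) \<odot>\<^bsub>S'\<^esub> y" for z
  have f: "f (scal c \<odot>\<^bsub>S\<^esub> x) = scal c \<odot>\<^bsub>S'\<^esub> y" for c
  proof -
    have "scal c \<odot>\<^bsub>S\<^esub> x = scal (SOME d. scal c \<odot>\<^bsub>S\<^esub> x = scal d \<odot>\<^bsub>S\<^esub> x) \<odot>\<^bsub>S\<^esub> x"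
      by (rule someI[of "\<lambda>d. scal c \<odot>\<^bsub>S\<^esub> x = scal d \<odot>\<^bsub>S\<^esub> x" c]) (rule refl)
    from scal_smult_cancel[OF Sm x this] show ?thesis unfolding f_def by simp
  qed
  have gen: "\<exists>c. z = scal c \<odot>\<^bsub>S\<^esub> x" if "z \<in> carrier S" for z by (rule type_scalar[OF S x that])
  have hom: "f \<in> LinearCombinations.module_hom A S S'"
  proof (rule module_homI)
    fix z assume "z \<in> carrier S"
    then obtain c where "z = scal c \<odot>\<^bsub>S\<^esub> x" using gen by blast
    then show "f z \<in> carrier S'" using S'.smult_closed[OF scal_closed y(1)] by (simp add: f)
  next
    fix z w assume "z \<in> carrier S" "w \<in> carrier S"
    then obtain c d where cd: "z = scal c \<odot>\<^bsub>S\<^esub> x" "w = scal d \<odot>\<^bsub>S\<^esub> x" using gen by blast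
    have "z \<oplus>\<^bsub>S\<^esub> w = scal (c + d) \<odot>\<^bsub>S\<^esub> x"
      unfolding cd scal_add S.smult_l_distr[OF scal_closed scal_closed x(1)] ..
    then show "f (z \<oplus>\<^bsub>S\<^esub> w) = f z \<oplus>\<^bsub>S'\<^esub> f w"
      using S'.smult_l_distr[OF scal_closed scal_closed y(1), of c d] cd f by (simp add: scal_add[symmetric])
  next
    fix a z assume a: "a \<in> carrier A" and z: "z \<in> carrier S"
    then obtain c where c: "z = scal c \<odot>\<^bsub>S\<^esub> x" using gen by blast
    have sc: "scal c \<odot>\<^bsub>S'\<^esub> y \<in> carrier S'" using S'.smult_closed[OF scal_closed y(1)] .
    have "a \<odot>\<^bsub>S\<^esub> z = scal (chi j a) \<odot>\<^bsub>S\<^esub> z" by (rule has_typeD(3)[OF S(2) z a])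
    also have "\<dots> = scal (chi j a * c) \<odot>\<^bsub>S\<^esub> x"
      unfolding c scal_mult S.smult_assoc[OF scal_closed scal_closed x(1)] ..
    finally have "f (a \<odot>\<^bsub>S\<^esub> z) = scal (chi j a * c) \<odot>\<^bsub>S'\<^esub> y" using f by simp
    also have "\<dots> = scal (chi j a) \<odot>\<^bsub>S'\<^esub> (scal c \<odot>\<^bsub>S'\<^esub> y)"
      unfolding scal_mult S'.smult_assoc[OF scal_closed scal_closed y(1)] ..
    also have "\<dots> = a \<odot>\<^bsub>S'\<^esub> (scal c \<odot>\<^bsub>S'\<^esub> y)" by (rule has_typeD(3)[OF S'(2) sc a, symmetric])
    finally show "f (a \<odot>\<^bsub>S\<^esub> z) = a \<odot>\<^bsub>S'\<^esub> f z" using c f by simp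
  qed
  have "bij_betw f (carrier S) (carrier S')"
    unfolding bij_betw_def
  proof
    show "inj_on f (carrier S)"
    proof (rule inj_onI)
      fix z w assume zw: "z \<in> carrier S" "w \<in> carrier S" "f z = f w"
      then obtain c d where cd: "z = scal c \<odot>\<^bsub>S\<^esub> x" "w = scal d \<odot>\<^bsub>S\<^esub> x" using gen by blast
      have "c = d" using scal_smult_cancel[OF Sm' y, of c d] zw(3) unfolding cd f by blast
      then show "z = w" using cd by simp
    qed
    show "f ` carrier S = carrier S'"
    proof (intro equalityI subsetI)
      fix z assume "z \<in> f ` carrier S" then show "z \<in> carrier S'" using module_homD(1)[OF hom] by blast
    next
      fix z assume "z \<in> carrier S'"
      then obtain c where "z = scal c \<odot>\<^bsub>S'\<^esub> y" using type_scalar[OF S' y] by blast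
      then have "z = f (scal c \<odot>\<^bsub>S\<^esub> x)" using f by simp
      then show "z \<in> f ` carrier S" using imageI[OF S.smult_closed[OF scal_closed x(1)], of f c] by simp
    qed
  qed
  then show ?thesis unfolding module_iso_def using hom by blast
qed

text \<open>\<open>e j\<close> acts as the identity on \<open>S\<close> but, for a different type,
  as zero on \<open>S'\<close>.\<close>

lemma iso_same_type:
  assumes S: "simple_module A S" "has_type j S" and S': "simple_module A S'" "has_type j' S'"
    and iso: "module_iso A S S'"
  shows "j = j'"
proof (rule ccontr)
  assume ne: "j \<noteq> j'"
  have Sm: "left_module A S" and Sm': "left_module A S'" using S S' by (simp_all add: simple_module_def)
  interpret S: left_module A S by (rule Sm)
  obtain f where f: "f \<in> LinearCombinations.module_hom A S S'" "bij_betw f (carrier S) (carrier S')"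
    using iso[unfolded module_iso_def] by (rule bexE)
  obtain x where x: "x \<in> carrier S" "x \<noteq> \<zero>\<^bsub>S\<^esub>" using simple_nonzero[OF S(1)] by blast
  have jm: "j < m" and ex: "e j \<odot>\<^bsub>S\<^esub> x = x" using has_typeD[OF S(2) x(1)] by blast+
  have "f x = e j \<odot>\<^bsub>S'\<^esub> f x" using module_homD(3)[OF f(1) e_props(1)[OF jm] x(1)] ex by simp
  also have "\<dots> = \<zero>\<^bsub>S'\<^esub>" by (rule other_idempotent_zero[OF Sm' S'(2) jm ne module_homD(1)[OF f(1) x(1)]])
  also have "\<dots> = f \<zero>\<^bsub>S\<^esub>" using module_hom_zero[OF Sm Sm' f(1)] ..
  finally show False using f(2) x by (auto simp: bij_betw_def inj_on_def)
qed

lemma mult_simple: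
  assumes S: "simple_module A S" "has_type j S" and i: "i < m"
  shows "fdm S" "mult_dim (e i) S = (if i = j then 1 else 0)"
proof -
  have Sm: "left_module A S" using S by (simp add: simple_module_def)
  interpret S: left_module A S by (rule Sm)
  obtain x where x: "x \<in> carrier S" "x \<noteq> \<zero>\<^bsub>S\<^esub>" using simple_nonzero[OF S(1)] by blast
  note c = type_coordinatization[OF S x]
  note vs = restrict_scalars_vectorspace[OF Sm]
  show "fdm S" unfolding fdm_def by (rule coordinatization_dim(1)[OF vs c])
  show "mult_dim (e i) S = (if i = j then 1 else 0)"
  proof (cases "i = j")
    case True
    then have "fix_space (e i) S = carrier S" using has_typeD(2)[OF S(2)] unfolding fix_space_def by blast
    then have "mult_dim (e i) S = vectorspace.dim class_ring (restrict_scalars A S)"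
      by (simp add: mult_dim_def restrict_scalars_def)
    then show ?thesis using coordinatization_dim(2)[OF vs c] True by simp
  next
    case False
    have "fix_space (e i) S = {\<zero>\<^bsub>S\<^esub>}"
    proof (intro equalityI subsetI)
      fix z assume "z \<in> fix_space (e i) S"
      then have "z \<in> carrier S" "e i \<odot>\<^bsub>S\<^esub> z = z" by (simp_all add: fix_space_def)
      then show "z \<in> {\<zero>\<^bsub>S\<^esub>}" using other_idempotent_zero[OF Sm S(2) i False, of z] by simp
    next
      fix z assume "z \<in> {\<zero>\<^bsub>S\<^esub>}"
      then show "z \<in> fix_space (e i) S"
        using S.smult_zero_right[OF e_props(1)[OF i]] by (simp add: fix_space_def)
    qed
    then have "mult_dim (e i) S = 0" unfolding mult_dim_def
      by (intro dim_zero_space(2)[OF fix_vectorspace[OF Sm e_props(1)[OF i]]]) simp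
    then show ?thesis using False by simp
  qed
qed

text \<open>The quotient of the algebra by a maximal left ideal \<open>I\<close> is simple; if
  \<open>b\<close> kills the class of 1 there, then \<open>b\<close> lies in \<open>I\<close>.
  Elements of this quotient are cosets, whence the type of the modules quantified over.\<close>

lemma jacobson_radicalI:
  assumes b: "b \<in> carrier A"
    and kill: "\<forall>(Q :: ('a, 'a set) module). simple_module A Q \<longrightarrow> (\<forall>z\<in>carrier Q. b \<odot>\<^bsub>Q\<^esub> z = \<zero>\<^bsub>Q\<^esub>)"
  shows "b \<in> jacobson_radical A"
proof -
  have rm: "left_module A (regular_module A)" by (rule regular_left_module) unfold_locales
  have cr: "carrier (regular_module A) = carrier A" by (simp add: regular_module_def)
  have sr: "x \<odot>\<^bsub>regular_module A\<^esub> y = x \<otimes> y" for x y by (simp add: regular_module_def)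
  have "b \<in> I" if I: "maximal_left_ideal I A" for I
  proof -
    have sub: "Module.submodule I A (regular_module A)" "I \<noteq> carrier (regular_module A)"
      using I unfolding maximal_left_ideal_def cr by simp_all
    have mx: "\<forall>X. Module.submodule X A (regular_module A) \<and> I \<subseteq> X \<longrightarrow> X = I \<or> X = carrier A"
      using I unfolding maximal_left_ideal_def by (elim conjE)
    have simple: "simple_module A (quotient_module (regular_module A) I)"
    proof (rule simple_quotient[OF rm sub])
      fix X assume "Module.submodule X A (regular_module A)" "I \<subseteq> X"
      then have "X = I \<or> X = carrier A" using mx by simp
      then show "X = I \<or> X = carrier (regular_module A)" unfolding cr .
    qed
    note Q = quotient_module_props[OF rm sub(1)]
    have one: "\<one> \<in> carrier (regular_module A)" and bR: "b \<in> carrier (regular_module A)"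
      unfolding cr by (rule one_closed, rule b)
    have "I +>\<^bsub>regular_module A\<^esub> (b \<odot>\<^bsub>regular_module A\<^esub> \<one>) =
      b \<odot>\<^bsub>quotient_module (regular_module A) I\<^esub> (I +>\<^bsub>regular_module A\<^esub> \<one>)"
      by (rule module_homD(3)[OF Q(2) b one])
    also have "\<dots> = \<zero>\<^bsub>quotient_module (regular_module A) I\<^esub>"
      by (rule bspec[OF mp[OF spec[OF kill] simple] module_homD(1)[OF Q(2) one]])
    finally have "I +>\<^bsub>regular_module A\<^esub> b = \<zero>\<^bsub>quotient_module (regular_module A) I\<^esub>"
      unfolding sr r_one[OF b] .
    then show ?thesis by (rule iffD1[OF Q(4)[OF bR]])
  qed
  then show ?thesis unfolding jacobson_radical_def using b by blast
qed

text \<open>The difference acts as zero on every simple module: on those of type \<open>j\<close> by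
  the definition of the character, on the others because \<open>e j\<close> does.\<close>

lemma radical_element:
  assumes j: "j < m" and a: "a \<in> carrier A"
  shows "a \<otimes> e j \<ominus> chi j a \<odot>\<^bsub>A\<^esub> e j \<in> jacobson_radical A"
proof -
  note E = e_props[OF j]
  let ?b = "a \<otimes> e j \<ominus> chi j a \<odot>\<^bsub>A\<^esub> e j"
  have ce: "chi j a \<odot>\<^bsub>A\<^esub> e j \<in> carrier A" using E by (simp add: vs_smult_closed)
  have bA: "?b \<in> carrier A" using a E ce by simp
  have kill: "?b \<odot>\<^bsub>Q\<^esub> z = \<zero>\<^bsub>Q\<^esub>" if Q: "simple_module A Q" and z: "z \<in> carrier Q" for Q :: "('a, 'a set) module" and z
  proof -
    have Qm: "left_module A Q" using Q by (simp add: simple_module_def)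
    interpret Q: left_module A Q by (rule Qm)
    obtain i where i: "has_type i Q" using simple_has_type[OF Q] by blast
    have ejz: "e j \<odot>\<^bsub>Q\<^esub> z \<in> carrier Q" using Q.smult_closed[OF E(1) z] .
    have eq: "a \<odot>\<^bsub>Q\<^esub> (e j \<odot>\<^bsub>Q\<^esub> z) = scal (chi j a) \<odot>\<^bsub>Q\<^esub> (e j \<odot>\<^bsub>Q\<^esub> z)"
    proof (cases "j = i")
      case True
      then have "has_type j Q" using i by (rule ssubst)
      then show ?thesis by (rule has_typeD(3)[OF _ ejz a])
    next
      case False
      then show ?thesis using other_idempotent_zero[OF Qm i j False z] a by simp
    qed
    have "?b \<odot>\<^bsub>Q\<^esub> z = (a \<otimes> e j) \<odot>\<^bsub>Q\<^esub> z \<ominus>\<^bsub>Q\<^esub> (scal (chi j a) \<otimes> e j) \<odot>\<^bsub>Q\<^esub> z"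
      using Q.smult_minus_distr[of "a \<otimes> e j" "chi j a \<odot>\<^bsub>A\<^esub> e j" z] a E ce z scal_mult_left[OF E(1)] by simp
    also have "\<dots> = \<zero>\<^bsub>Q\<^esub>"
      using Q.smult_assoc[OF a E(1) z] Q.smult_assoc[OF scal_closed E(1) z] eq Q.smult_closed[OF scal_closed ejz]
      by (simp add: Q.M.minus_eq Q.M.r_neg)
    finally show ?thesis .
  qed
  show ?thesis by (rule jacobson_radicalI[OF bA]) (use kill in blast)
qed

end

section \<open>The radical of a module\<close>

context left_module
begin

lemma submodule_finsum:
  assumes N: "Module.submodule N R M" and g: "\<And>i. i < (k::nat) \<Longrightarrow> g i \<in> N"
  shows "(\<Oplus>\<^bsub>M\<^esub>i\<in>{..<k}. g i) \<in> N"
  using g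
proof (induction k)
  case 0
  then show ?case using submoduleD(2)[OF N] by simp
next
  case (Suc k)
  have mem: "g \<in> {..<k} \<rightarrow> carrier M" "g k \<in> carrier M" using Suc.prems submoduleD(1)[OF N] by auto
  have "(\<Oplus>\<^bsub>M\<^esub>i\<in>{..<Suc k}. g i) = g k \<oplus>\<^bsub>M\<^esub> (\<Oplus>\<^bsub>M\<^esub>i\<in>{..<k}. g i)"
    unfolding lessThan_Suc by (rule M.finsum_insert[OF _ _ mem]) simp_all
  then show ?case using submoduleD(3)[OF N] Suc by simp
qed

end

context fd_algebra
begin

lemma ideal_smult_subset:
  assumes M: "left_module A M" and X: "Module.submodule X A M" and gen: "\<And>a x. a \<in> I \<Longrightarrow> x \<in> carrier M \<Longrightarrow> a \<odot>\<^bsub>M\<^esub> x \<in> X"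
  shows "ideal_smult I M \<subseteq> X"
proof -
  interpret left_module A M by (rule M)
  have "{a \<odot>\<^bsub>M\<^esub> x | a x. a \<in> I \<and> x \<in> carrier M} \<subseteq> X"
  proof
    fix y assume "y \<in> {a \<odot>\<^bsub>M\<^esub> x | a x. a \<in> I \<and> x \<in> carrier M}"
    then obtain a x where "y = a \<odot>\<^bsub>M\<^esub> x" "a \<in> I" "x \<in> carrier M" by blast
    then show "y \<in> X" using gen by simp
  qed
  then show ?thesis unfolding ideal_smult_def by (rule group.generate_subgroup_incl[OF M.a_group _ submoduleD(6)[OF X]])
qed

lemma ideal_smult_mem: "a \<in> I \<Longrightarrow> x \<in> carrier M \<Longrightarrow> a \<odot>\<^bsub>M\<^esub> x \<in> ideal_smult I M"
  unfolding ideal_smult_def by (rule generate.incl) blast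

lemma ideal_smult_submodule:
  assumes M: "left_module A M" and I: "I \<subseteq> carrier A" "\<And>a b. a \<in> carrier A \<Longrightarrow> b \<in> I \<Longrightarrow> a \<otimes> b \<in> I"
  shows "Module.submodule (ideal_smult I M) A M"
proof -
  interpret left_module A M by (rule M)
  let ?G = "{a \<odot>\<^bsub>M\<^esub> x | a x. a \<in> I \<and> x \<in> carrier M}"
  have G: "?G \<subseteq> carrier M"
  proof
    fix y assume "y \<in> ?G"
    then obtain a x where "y = a \<odot>\<^bsub>M\<^esub> x" "a \<in> I" "x \<in> carrier M" by blast
    then show "y \<in> carrier M" using smult_closed I(1) by blast
  qed
  have sub: "ideal_smult I M \<subseteq> carrier M"
    unfolding ideal_smult_def using group.generate_incl[OF M.a_group, of ?G] G by simp
  have smult: "a \<odot>\<^bsub>M\<^esub> x \<in> ideal_smult I M" if a: "a \<in> carrier A" and x: "x \<in> ideal_smult I M" for a x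
    using x[unfolded ideal_smult_def]
  proof (induction rule: generate.induct)
    case one
    show ?case using a generate.one[of "add_monoid M" ?G] by (simp add: ideal_smult_def)
  next
    case (incl h)
    then obtain b y where h: "h = b \<odot>\<^bsub>M\<^esub> y" "b \<in> I" "y \<in> carrier M" by blast
    have "a \<odot>\<^bsub>M\<^esub> h = (a \<otimes> b) \<odot>\<^bsub>M\<^esub> y" unfolding h(1) using smult_assoc[OF a _ h(3)] I(1) h(2) by force
    then show ?case using ideal_smult_mem[OF I(2)[OF a h(2)] h(3)] by simp
  next
    case (inv h)
    then obtain b y where h: "h = b \<odot>\<^bsub>M\<^esub> y" "b \<in> I" "y \<in> carrier M" by blast
    have bR: "b \<in> carrier A" using I(1) h(2) by blast
    have hM: "h \<in> carrier M" unfolding h(1) by (rule smult_closed[OF bR h(3)])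
    have "inv\<^bsub>add_monoid M\<^esub> h = (\<ominus> \<one>) \<odot>\<^bsub>M\<^esub> h" unfolding minus_one_smult[OF hM] by (simp add: a_inv_def)
    also have "a \<odot>\<^bsub>M\<^esub> \<dots> = (a \<otimes> \<ominus> \<one> \<otimes> b) \<odot>\<^bsub>M\<^esub> y"
      unfolding h(1) using a bR h(3) smult_assoc[of "a \<otimes> \<ominus> \<one>" b y] smult_assoc[of a "\<ominus> \<one>" "b \<odot>\<^bsub>M\<^esub> y"]
        smult_closed[OF bR h(3)] by simp
    finally show ?case using ideal_smult_mem[OF I(2)[of "a \<otimes> \<ominus> \<one>" b] h(3)] a h(2) by simp
  next
    case (eng h1 h2)
    have "h1 \<in> carrier M" "h2 \<in> carrier M" using eng(1,2) sub unfolding ideal_smult_def by blast+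
    then show ?case
      using smult_r_distr[OF a] generate.eng[of _ "add_monoid M" ?G] eng(3,4) by (simp add: ideal_smult_def)
  qed
  show ?thesis
  proof (rule submoduleI'[OF sub _ _ smult])
    show "\<zero>\<^bsub>M\<^esub> \<in> ideal_smult I M" using generate.one[of "add_monoid M" ?G] by (simp add: ideal_smult_def)
    show "x \<oplus>\<^bsub>M\<^esub> y \<in> ideal_smult I M" if "x \<in> ideal_smult I M" "y \<in> ideal_smult I M" for x y
      using that generate.eng[of _ "add_monoid M" ?G] by (simp add: ideal_smult_def)
  qed
qed

end

context basic_fd_algebra
begin

lemma radical_submodule: "left_module A M \<Longrightarrow> Module.submodule (ideal_smult (jacobson_radical A) M) A M"
  by (rule ideal_smult_submodule[OF _ _ jacobson_left_ideal]) (simp_all add: jacobson_radical_def)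

text \<open>Modulo its radical, a module behaves like a semisimple one: on \<open>e i M\<close> the
  algebra acts by the character \<open>chi i\<close>, as \<open>radical_element\<close>
  shows.\<close>

lemma radical_act:
  assumes M: "left_module A M" and i: "i < m" and y: "y \<in> carrier M" "e i \<odot>\<^bsub>M\<^esub> y = y" and a: "a \<in> carrier A"
  shows "\<exists>r \<in> ideal_smult (jacobson_radical A) M. a \<odot>\<^bsub>M\<^esub> y = r \<oplus>\<^bsub>M\<^esub> scal (chi i a) \<odot>\<^bsub>M\<^esub> y"
proof
  interpret M: left_module A M by (rule M)
  note E = e_props[OF i]
  define b where "b = a \<otimes> e i"
  define c where "c = scal (chi i a) \<otimes> e i"
  have bc: "b \<in> carrier A" "c \<in> carrier A" using a E by (simp_all add: b_def c_def)
  have J: "b \<ominus> c \<in> jacobson_radical A"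
    using radical_element[OF i a] unfolding b_def c_def scal_mult_left[OF E(1)] .
  show "(b \<ominus> c) \<odot>\<^bsub>M\<^esub> y \<in> ideal_smult (jacobson_radical A) M" by (rule ideal_smult_mem[OF J y(1)])
  have "b \<odot>\<^bsub>M\<^esub> y = a \<odot>\<^bsub>M\<^esub> y" unfolding b_def M.smult_assoc[OF a E(1) y(1)] y(2) ..
  moreover have "c \<odot>\<^bsub>M\<^esub> y = scal (chi i a) \<odot>\<^bsub>M\<^esub> y" unfolding c_def M.smult_assoc[OF scal_closed E(1) y(1)] y(2) ..
  moreover have "(b \<ominus> c) \<odot>\<^bsub>M\<^esub> y \<oplus>\<^bsub>M\<^esub> c \<odot>\<^bsub>M\<^esub> y = b \<odot>\<^bsub>M\<^esub> y"
    unfolding M.smult_minus_distr[OF bc y(1)]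
    using M.smult_closed[OF bc(1) y(1)] M.smult_closed[OF bc(2) y(1)]
    by (simp add: M.M.minus_eq M.M.a_assoc M.M.l_neg)
  ultimately show "a \<odot>\<^bsub>M\<^esub> y = (b \<ominus> c) \<odot>\<^bsub>M\<^esub> y \<oplus>\<^bsub>M\<^esub> scal (chi i a) \<odot>\<^bsub>M\<^esub> y" by simp
qed

text \<open>\<open>x\<close> is the sum of its components \<open>e i x\<close>, so membership may be
  tested on vectors fixed by a single idempotent.\<close>

lemma submodule_of_parts:
  assumes M: "left_module A M" and N: "Module.submodule N A M" and x: "x \<in> carrier M"
    and "\<And>i. i < m \<Longrightarrow> e i \<odot>\<^bsub>M\<^esub> x \<in> N"
  shows "x \<in> N"
  using left_module.submodule_finsum[OF M N, of m "\<lambda>i. e i \<odot>\<^bsub>M\<^esub> x"] assms(4) sum_e_act[OF M x] by simp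

text \<open>Modulo the radical, a vector fixed by some \<open>e i\<close> spans a submodule.\<close>

lemma add_line_submodule:
  assumes M: "left_module A M" and X: "Module.submodule X A M" "ideal_smult (jacobson_radical A) M \<subseteq> X"
    and i: "i < m" and y: "y \<in> carrier M" "e i \<odot>\<^bsub>M\<^esub> y = y"
  shows "Module.submodule {x \<oplus>\<^bsub>M\<^esub> scal c \<odot>\<^bsub>M\<^esub> y | x c. x \<in> X} A M"
proof -
  interpret M: left_module A M by (rule M)
  note XD = M.submoduleD[OF X(1)]
  have sy: "scal c \<odot>\<^bsub>M\<^esub> y \<in> carrier M" for c by (rule M.smult_closed[OF scal_closed y(1)])
  have XM: "x \<in> X \<Longrightarrow> x \<in> carrier M" for x using XD(1) by blast
  show ?thesis
  proof (rule M.submoduleI')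
    show "{x \<oplus>\<^bsub>M\<^esub> scal c \<odot>\<^bsub>M\<^esub> y | x c. x \<in> X} \<subseteq> carrier M" using XM sy by blast
    have "\<zero>\<^bsub>M\<^esub> = \<zero>\<^bsub>M\<^esub> \<oplus>\<^bsub>M\<^esub> scal 0 \<odot>\<^bsub>M\<^esub> y" using y(1) by (simp add: scal_zero)
    then show "\<zero>\<^bsub>M\<^esub> \<in> {x \<oplus>\<^bsub>M\<^esub> scal c \<odot>\<^bsub>M\<^esub> y | x c. x \<in> X}" using XD(2) by blast
  next
    fix v w assume "v \<in> {x \<oplus>\<^bsub>M\<^esub> scal c \<odot>\<^bsub>M\<^esub> y | x c. x \<in> X}" "w \<in> {x \<oplus>\<^bsub>M\<^esub> scal c \<odot>\<^bsub>M\<^esub> y | x c. x \<in> X}"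
    then obtain x c x' c' where v: "v = x \<oplus>\<^bsub>M\<^esub> scal c \<odot>\<^bsub>M\<^esub> y" "x \<in> X" and w: "w = x' \<oplus>\<^bsub>M\<^esub> scal c' \<odot>\<^bsub>M\<^esub> y" "x' \<in> X" by blast
    have "v \<oplus>\<^bsub>M\<^esub> w = (x \<oplus>\<^bsub>M\<^esub> x') \<oplus>\<^bsub>M\<^esub> (scal c \<odot>\<^bsub>M\<^esub> y \<oplus>\<^bsub>M\<^esub> scal c' \<odot>\<^bsub>M\<^esub> y)"
      unfolding v w using XM[OF v(2)] XM[OF w(2)] sy by (simp add: M.M.a_ac)
    also have "\<dots> = (x \<oplus>\<^bsub>M\<^esub> x') \<oplus>\<^bsub>M\<^esub> scal (c + c') \<odot>\<^bsub>M\<^esub> y"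
      unfolding scal_add M.smult_l_distr[OF scal_closed scal_closed y(1)] ..
    finally show "v \<oplus>\<^bsub>M\<^esub> w \<in> {x \<oplus>\<^bsub>M\<^esub> scal c \<odot>\<^bsub>M\<^esub> y | x c. x \<in> X}" using XD(3)[OF v(2) w(2)] by blast
  next
    fix a v assume a: "a \<in> carrier A" and "v \<in> {x \<oplus>\<^bsub>M\<^esub> scal c \<odot>\<^bsub>M\<^esub> y | x c. x \<in> X}"
    then obtain x c where v: "v = x \<oplus>\<^bsub>M\<^esub> scal c \<odot>\<^bsub>M\<^esub> y" "x \<in> X" by blast
    obtain r where r: "r \<in> X" "a \<odot>\<^bsub>M\<^esub> y = r \<oplus>\<^bsub>M\<^esub> scal (chi i a) \<odot>\<^bsub>M\<^esub> y"
      using radical_act[OF M i y a] X(2) by blast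
    have ax: "a \<odot>\<^bsub>M\<^esub> x \<in> X" by (rule XD(4)[OF a v(2)])
    have cr: "scal c \<odot>\<^bsub>M\<^esub> r \<in> X" by (rule XD(4)[OF scal_closed r(1)])
    have "a \<odot>\<^bsub>M\<^esub> v = a \<odot>\<^bsub>M\<^esub> x \<oplus>\<^bsub>M\<^esub> scal c \<odot>\<^bsub>M\<^esub> (a \<odot>\<^bsub>M\<^esub> y)"
      unfolding v(1) M.smult_r_distr[OF a XM[OF v(2)] sy] scal_commute_smult[OF M a y(1)] ..
    also have "scal c \<odot>\<^bsub>M\<^esub> (a \<odot>\<^bsub>M\<^esub> y) = scal c \<odot>\<^bsub>M\<^esub> r \<oplus>\<^bsub>M\<^esub> scal (c * chi i a) \<odot>\<^bsub>M\<^esub> y"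
      unfolding r(2) M.smult_r_distr[OF scal_closed XM[OF r(1)] sy] scal_mult
        M.smult_assoc[OF scal_closed scal_closed y(1)] ..
    also have "a \<odot>\<^bsub>M\<^esub> x \<oplus>\<^bsub>M\<^esub> \<dots> = (a \<odot>\<^bsub>M\<^esub> x \<oplus>\<^bsub>M\<^esub> scal c \<odot>\<^bsub>M\<^esub> r) \<oplus>\<^bsub>M\<^esub> scal (c * chi i a) \<odot>\<^bsub>M\<^esub> y"
      using XM[OF ax] XM[OF cr] sy by (simp add: M.M.a_assoc)
    finally show "a \<odot>\<^bsub>M\<^esub> v \<in> {x \<oplus>\<^bsub>M\<^esub> scal c \<odot>\<^bsub>M\<^esub> y | x c. x \<in> X}" using XD(3)[OF ax cr] by blast
  qed
qed

text \<open>If some \<open>z\<close> in the superfluous submodule, fixed by an idempotent, avoided the radical, then a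
  submodule \<open>X\<close> maximal among those containing the radical but not \<open>z\<close> would satisfy \<open>P = X + K z\<close>.\<close>

lemma superfluous_subset_radical:
  assumes P: "left_module A P" and K: "superfluous A P K"
  shows "K \<subseteq> ideal_smult (jacobson_radical A) P"
proof (rule subsetI, rule ccontr)
  let ?JP = "ideal_smult (jacobson_radical A) P"
  interpret P: left_module A P by (rule P)
  fix z0 assume z0: "z0 \<in> K" "z0 \<notin> ?JP"
  have JP: "Module.submodule ?JP A P" by (rule radical_submodule[OF P])
  have Ks: "Module.submodule K A P" using K by (simp add: superfluous_def)
  note KD = P.submoduleD[OF Ks]
  obtain j where j: "j < m" "e j \<odot>\<^bsub>P\<^esub> z0 \<notin> ?JP" using submodule_of_parts[OF P JP] z0 KD(1) by blast
  define z where "z = e j \<odot>\<^bsub>P\<^esub> z0"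
  have zK: "z \<in> K" unfolding z_def by (rule KD(4)[OF e_props(1)[OF j(1)] z0(1)])
  then have zP: "z \<in> carrier P" using KD(1) by blast
  have zJ: "z \<notin> ?JP" using j(2) by (simp add: z_def)
  have z0P: "z0 \<in> carrier P" using z0(1) KD(1) by blast
  have ez: "e j \<odot>\<^bsub>P\<^esub> z = z"
    unfolding z_def P.smult_assoc[OF e_props(1)[OF j(1)] e_props(1)[OF j(1)] z0P, symmetric] e_props(2)[OF j(1)] ..
  \<comment> \<open>Zorn's lemma and not a dimension count: finite dimension of \<open>P\<close> is
    deduced only later, and from this inclusion.\<close>
  let ?F = "{X. Module.submodule X A P \<and> ?JP \<subseteq> X \<and> z \<notin> X}"
  have ne: "?F \<noteq> {}" using JP zJ by blast
  have chain: "\<Union>C \<in> ?F" if C: "C \<noteq> {}" "subset.chain ?F C" for C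
  proof -
    have sub: "X \<in> C \<Longrightarrow> Module.submodule X A P \<and> ?JP \<subseteq> X \<and> z \<notin> X" for X
      using C(2) unfolding subset.chain_def by blast
    have lin: "X \<in> C \<Longrightarrow> Y \<in> C \<Longrightarrow> X \<subseteq> Y \<or> Y \<subseteq> X" for X Y
      using C(2) unfolding subset.chain_def by blast
    have "Module.submodule (\<Union>C) A P"
    proof (rule P.submoduleI')
      show "\<Union>C \<subseteq> carrier P" using P.submoduleD(1) sub by blast
      show "\<zero>\<^bsub>P\<^esub> \<in> \<Union>C" using P.submoduleD(2) sub C(1) by blast
    next
      fix x y assume "x \<in> \<Union>C" "y \<in> \<Union>C"
      then obtain X Y where "X \<in> C" "Y \<in> C" "x \<in> X" "y \<in> Y" by blast
      then obtain Z where Z: "Z \<in> C" "x \<in> Z" "y \<in> Z" using lin by blast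
      then have "x \<oplus>\<^bsub>P\<^esub> y \<in> Z" using P.submoduleD(3) sub by simp
      then show "x \<oplus>\<^bsub>P\<^esub> y \<in> \<Union>C" using Z(1) by blast
    next
      fix a x assume a: "a \<in> carrier A" and "x \<in> \<Union>C"
      then obtain X where X: "X \<in> C" "x \<in> X" by blast
      then have "a \<odot>\<^bsub>P\<^esub> x \<in> X" using P.submoduleD(4) sub a by simp
      then show "a \<odot>\<^bsub>P\<^esub> x \<in> \<Union>C" using X(1) by blast
    qed
    moreover have "?JP \<subseteq> \<Union>C" "z \<notin> \<Union>C" using sub C(1) by blast+
    ultimately show ?thesis by simp
  qed
  obtain X where X: "X \<in> ?F" and mx: "\<forall>Y\<in>?F. X \<subseteq> Y \<longrightarrow> Y = X"
    using subset_Zorn_nonempty[OF ne chain] by blast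
  have Xs: "Module.submodule X A P" and JX: "?JP \<subseteq> X" and zX: "z \<notin> X" using X by simp_all
  note XD = P.submoduleD[OF Xs]
  let ?Y = "{x \<oplus>\<^bsub>P\<^esub> scal c \<odot>\<^bsub>P\<^esub> z | x c. x \<in> X}"
  have Ys: "Module.submodule ?Y A P" by (rule add_line_submodule[OF P Xs JX j(1) zP ez])
  have XY: "x \<in> ?Y" if x: "x \<in> X" for x
  proof -
    have "x \<in> carrier P" using x XD(1) by blast
    then have "x = x \<oplus>\<^bsub>P\<^esub> scal 0 \<odot>\<^bsub>P\<^esub> z" using zP by (simp add: scal_zero)
    then show ?thesis using x by blast
  qed
  have part: "e i \<odot>\<^bsub>P\<^esub> y \<in> ?Y" if i: "i < m" and y: "y \<in> carrier P" for i y
  proof (cases "e i \<odot>\<^bsub>P\<^esub> y \<in> X")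
    case False
    define y' where "y' = e i \<odot>\<^bsub>P\<^esub> y"
    have y'P: "y' \<in> carrier P" unfolding y'_def by (rule P.smult_closed[OF e_props(1)[OF i] y])
    have ey': "e i \<odot>\<^bsub>P\<^esub> y' = y'"
      unfolding y'_def P.smult_assoc[OF e_props(1)[OF i] e_props(1)[OF i] y, symmetric] e_props(2)[OF i] ..
    let ?Z = "{x \<oplus>\<^bsub>P\<^esub> scal c \<odot>\<^bsub>P\<^esub> y' | x c. x \<in> X}"
    have Zs: "Module.submodule ?Z A P" by (rule add_line_submodule[OF P Xs JX i y'P ey'])
    have XZ: "X \<subseteq> ?Z"
    proof
      fix x assume x: "x \<in> X"
      then have "x \<in> carrier P" using XD(1) by blast
      then have "x = x \<oplus>\<^bsub>P\<^esub> scal 0 \<odot>\<^bsub>P\<^esub> y'" using y'P by (simp add: scal_zero)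
      then show "x \<in> ?Z" using x by blast
    qed
    have "y' = \<zero>\<^bsub>P\<^esub> \<oplus>\<^bsub>P\<^esub> scal 1 \<odot>\<^bsub>P\<^esub> y'" using y'P P.smult_one[OF y'P] by (simp add: scal_one)
    then have "y' \<in> ?Z" using XD(2) by blast
    moreover have "y' \<notin> X" using False by (simp add: y'_def)
    ultimately have "?Z \<noteq> X" by blast
    \<comment> \<open>By maximality of \<open>X\<close> the larger submodule \<open>?Z\<close>
      contains \<open>z\<close>. The coefficient of \<open>y'\<close> in \<open>z\<close> is
      nonzero, as \<open>z\<close> is not in \<open>X\<close>; solving for \<open>y'\<close> places
      it in \<open>X\<close> plus the line of \<open>z\<close>.\<close>
    then have "?Z \<notin> ?F" using mx XZ by blast
    then have "z \<in> ?Z" using Zs XZ JX by blast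
    then obtain x c where zc: "z = x \<oplus>\<^bsub>P\<^esub> scal c \<odot>\<^bsub>P\<^esub> y'" "x \<in> X" by blast
    have xP: "x \<in> carrier P" using zc(2) XD(1) by blast
    have c0: "c \<noteq> 0"
    proof
      assume "c = 0"
      then have "z = x" using zc(1) y'P xP by (simp add: scal_zero)
      then show False using zc(2) zX by simp
    qed
    have sy: "scal c \<odot>\<^bsub>P\<^esub> y' \<in> carrier P" by (rule P.smult_closed[OF scal_closed y'P])
    have mxX: "\<ominus>\<^bsub>P\<^esub> x \<in> X" by (rule XD(5)[OF zc(2)])
    have "scal c \<odot>\<^bsub>P\<^esub> y' = \<ominus>\<^bsub>P\<^esub> x \<oplus>\<^bsub>P\<^esub> z"
      unfolding zc(1) using xP sy by (simp add: P.M.a_assoc[symmetric] P.M.l_neg)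
    then have "scal (inverse c) \<odot>\<^bsub>P\<^esub> (scal c \<odot>\<^bsub>P\<^esub> y') = scal (inverse c) \<odot>\<^bsub>P\<^esub> (\<ominus>\<^bsub>P\<^esub> x) \<oplus>\<^bsub>P\<^esub> scal (inverse c) \<odot>\<^bsub>P\<^esub> z"
      using P.smult_r_distr[OF scal_closed _ zP, of "\<ominus>\<^bsub>P\<^esub> x" "inverse c"] xP by simp
    moreover have "scal (inverse c) \<odot>\<^bsub>P\<^esub> (scal c \<odot>\<^bsub>P\<^esub> y') = y'"
      unfolding P.smult_assoc[OF scal_closed scal_closed y'P, symmetric] scal_mult[symmetric]
      using c0 P.smult_one[OF y'P] by (simp add: scal_one)
    ultimately show ?thesis using XD(4)[OF scal_closed mxX, of "inverse c"] unfolding y'_def by auto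
  qed (rule XY)
  have all: "carrier P \<subseteq> ?Y" using submodule_of_parts[OF P Ys] part by blast
  have "K <+>\<^bsub>P\<^esub> X = carrier P"
  proof (intro equalityI subsetI)
    fix y assume "y \<in> K <+>\<^bsub>P\<^esub> X"
    then obtain k x where "y = k \<oplus>\<^bsub>P\<^esub> x" "k \<in> K" "x \<in> X" unfolding set_add_def' by blast
    then show "y \<in> carrier P" using KD(1) XD(1) by blast
  next
    fix y assume "y \<in> carrier P"
    then obtain x c where y: "y = x \<oplus>\<^bsub>P\<^esub> scal c \<odot>\<^bsub>P\<^esub> z" "x \<in> X" using all by blast
    have cz: "scal c \<odot>\<^bsub>P\<^esub> z \<in> K" by (rule KD(4)[OF scal_closed zK])
    have "y = scal c \<odot>\<^bsub>P\<^esub> z \<oplus>\<^bsub>P\<^esub> x" unfolding y(1) using y(2) cz XD(1) KD(1) by (intro P.M.a_comm) blast+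
    then show "y \<in> K <+>\<^bsub>P\<^esub> X" unfolding set_add_def' using cz y(2) by blast
  qed
  then have "X = carrier P" using K Xs unfolding superfluous_def by blast
  then show False using zX zP by simp
qed

end

section \<open>Semisimple modules in coordinates\<close>

lemma smult_zero_vec [simp]: "c \<cdot>\<^sub>v 0\<^sub>v k = (0\<^sub>v k :: 'k::semiring_0 vec)"
  by (intro eq_vecI) auto

lemma zero_smult_vec: "v \<in> carrier_vec k \<Longrightarrow> 0 \<cdot>\<^sub>v v = (0\<^sub>v k :: 'k::semiring_0 vec)"
  by (intro eq_vecI) auto

lemma row_span_closed:
  assumes "row_span k N W (B :: 'k::field mat)"
  shows "0\<^sub>v N \<in> W" "v \<in> W \<Longrightarrow> w \<in> W \<Longrightarrow> v + w \<in> W" "v \<in> W \<Longrightarrow> c \<cdot>\<^sub>v v \<in> W"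
proof -
  note B = row_spanD[OF assms]
  have "B\<^sup>T *\<^sub>v (0 \<cdot>\<^sub>v 0\<^sub>v k) = 0 \<cdot>\<^sub>v (B\<^sup>T *\<^sub>v 0\<^sub>v k)" by (rule mult_mat_vec[OF B(2) zero_carrier_vec])
  also have "\<dots> = 0\<^sub>v N" by (rule zero_smult_vec[OF mult_mat_vec_carrier[OF B(2) zero_carrier_vec]])
  finally have "0\<^sub>v N = B\<^sup>T *\<^sub>v 0\<^sub>v k" by simp
  then show "0\<^sub>v N \<in> W" unfolding B(4) using zero_carrier_vec by (rule image_eqI)
next
  note B = row_spanD[OF assms]
  assume "v \<in> W" "w \<in> W"
  then obtain x y where xy: "x \<in> carrier_vec k" "y \<in> carrier_vec k" "v = B\<^sup>T *\<^sub>v x" "w = B\<^sup>T *\<^sub>v y"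
    unfolding B(4) by blast
  then have "v + w = B\<^sup>T *\<^sub>v (x + y)" using B(2) by (simp add: mult_add_distrib_mat_vec)
  moreover have "x + y \<in> carrier_vec k" using xy by simp
  ultimately show "v + w \<in> W" unfolding B(4) by blast
next
  note B = row_spanD[OF assms]
  assume "v \<in> W"
  then obtain x where x: "x \<in> carrier_vec k" "v = B\<^sup>T *\<^sub>v x" unfolding B(4) by blast
  then have "c \<cdot>\<^sub>v v = B\<^sup>T *\<^sub>v (c \<cdot>\<^sub>v x)" using B(2) by (simp add: mult_mat_vec)
  moreover have "c \<cdot>\<^sub>v x \<in> carrier_vec k" using x by simp
  ultimately show "c \<cdot>\<^sub>v v \<in> W" unfolding B(4) by blast
qed

lemma block_add:
  assumes "i < n" "v \<in> carrier_vec (offset p n)" "w \<in> carrier_vec (offset p n)"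
  shows "block p i (v + w) = block p i v + block p i w"
  using assms offset_less[OF assms(1)] by (intro eq_vecI) (auto simp: block_def)

lemma block_smult:
  assumes "i < n" "v \<in> carrier_vec (offset p n)"
  shows "block p i (c \<cdot>\<^sub>v v) = c \<cdot>\<^sub>v block p i v"
  using assms offset_less[OF assms(1)] by (intro eq_vecI) (auto simp: block_def)

lemma block_zero: "i < n \<Longrightarrow> block p i (0\<^sub>v (offset p n)) = (0\<^sub>v (p i) :: 'k::zero vec)"
  using offset_less[of i n _ p] by (intro eq_vecI) (auto simp: block_def)

definition emb :: "nat \<Rightarrow> (nat \<Rightarrow> nat) \<Rightarrow> nat \<Rightarrow> 'k::comm_monoid_add vec \<Rightarrow> 'k vec" where
  "emb n p i w = glue n p (\<lambda>j. if j = i then w else 0\<^sub>v (p j))"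

lemma emb_carrier [simp]: "emb n p i w \<in> carrier_vec (offset p n)"
  by (simp add: emb_def)

lemma block_emb:
  assumes "j < n" "w \<in> carrier_vec (p i)"
  shows "block p j (emb n p i w) = (if j = i then w else 0\<^sub>v (p j))"
  unfolding emb_def by (rule block_glue[OF assms(1)]) (use assms(2) in simp)

lemma block_emb_same:
  assumes "i < n" "w \<in> carrier_vec (p i)"
  shows "block p i (emb n p i w) = w"
  using block_emb[of i n w p i] assms by simp

lemma emb_hom:
  assumes i: "i < n"
  shows "emb n p i \<in> LinearCombinations.module_hom class_ring
    (module_vec TYPE('k::field) (p i)) (module_vec TYPE('k) (offset p n))"
proof (rule hom_vecI)
  fix v w :: "'k vec" assume vw: "v \<in> carrier_vec (p i)" "w \<in> carrier_vec (p i)"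
  have "emb n p i (v + w) = emb n p i v + emb n p i w"
  proof (rule eq_vec_blocks)
    fix j assume j: "j < n"
    show "block p j (emb n p i (v + w)) = block p j (emb n p i v + emb n p i w)"
      unfolding block_add[OF j emb_carrier emb_carrier] using vw by (simp add: block_emb[OF j])
  qed simp_all
  then show "emb n p i (v + w) = emb n p i v \<oplus>\<^bsub>module_vec TYPE('k) (offset p n)\<^esub> emb n p i w"
    by (simp add: module_vec_simps)
next
  fix c and v :: "'k vec" assume v: "v \<in> carrier_vec (p i)"
  have "emb n p i (c \<cdot>\<^sub>v v) = c \<cdot>\<^sub>v emb n p i v"
  proof (rule eq_vec_blocks)
    fix j assume j: "j < n"
    show "block p j (emb n p i (c \<cdot>\<^sub>v v)) = block p j (c \<cdot>\<^sub>v emb n p i v)"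
      unfolding block_smult[OF j emb_carrier] using v by (simp add: block_emb[OF j])
  qed simp_all
  then show "emb n p i (c \<cdot>\<^sub>v v) = c \<odot>\<^bsub>module_vec TYPE('k) (offset p n)\<^esub> emb n p i v"
    by (simp add: module_vec_simps)
qed simp

text \<open>\<sigma> matches the numbering of the simple modules with that of the idempotents:
  \<open>e (\<sigma> i)\<close> acts as the identity on \<open>S i\<close>. Injectivity of \<sigma>
  separates the blocks below.\<close>

locale typed_simples = basic_fd_algebra A m e
  for A :: "('k::alg_closed_field, 'a) module" (structure) and m e +
  fixes n :: nat and S :: "nat \<Rightarrow> ('a, 's) module" and \<sigma> :: "nat \<Rightarrow> nat"
  assumes simple_S: "\<And>i. i < n \<Longrightarrow> simple_module A (S i)"
    and type_S: "\<And>i. i < n \<Longrightarrow> has_type (\<sigma> i) (S i)"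
    and inj_type: "\<And>i j. i < n \<Longrightarrow> j < n \<Longrightarrow> \<sigma> i = \<sigma> j \<Longrightarrow> i = j"
begin

lemma S_module: "i < n \<Longrightarrow> left_module A (S i)"
  using simple_S by (simp add: simple_module_def)

lemma type_less: "i < n \<Longrightarrow> \<sigma> i < m"
  using type_S unfolding has_type_def by blast

lemma mult_simple_iso:
  assumes Q: "simple_module A Q" and i: "i < n"
  shows "mult_dim (e (\<sigma> i)) Q = (if module_iso A Q (S i) then 1 else 0)"
proof -
  obtain j where j: "has_type j Q" using simple_has_type[OF Q] by blast
  have "module_iso A Q (S i) \<longleftrightarrow> \<sigma> i = j"
  proof
    assume "module_iso A Q (S i)"
    then show "\<sigma> i = j" using iso_same_type[OF Q j simple_S[OF i] type_S[OF i]] by simp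
  next
    assume "\<sigma> i = j"
    then have "has_type (\<sigma> i) Q" using j by (rule ssubst)
    then show "module_iso A Q (S i)" by (rule same_type_iso[OF Q _ simple_S[OF i] type_S[OF i]])
  qed
  then show ?thesis using mult_simple(2)[OF Q j type_less[OF i]] by simp
qed

text \<open>Each simple factor contributes 1 or 0 to the fixed space of
  \<open>e (\<sigma> i)\<close>, according to whether it is isomorphic to \<open>S i\<close>;
  additivity then counts the factors.\<close>

lemma composition_mult:
  assumes M: "left_module A M" and N0: "N 0 = {\<zero>\<^bsub>M\<^esub>}" and Nl: "N (l::nat) = carrier M"
    and sub: "\<forall>j\<le>l. Module.submodule (N j) A M"
    and step: "\<forall>j<l. N j \<subseteq> N (Suc j) \<and> simple_module A (quotient_module (M\<lparr>carrier := N (Suc j)\<rparr>) (N j))"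
  shows "fdm M" "\<forall>i<n. mult_dim (e (\<sigma> i)) M =
    card {j. j < l \<and> module_iso A (quotient_module (M\<lparr>carrier := N (Suc j)\<rparr>) (N j)) (S i)}"
proof -
  let ?Q = "\<lambda>j. quotient_module (M\<lparr>carrier := N (Suc j)\<rparr>) (N j)"
  have simple: "simple_module A (?Q j)" if "j < l" for j using step that by blast
  have fdQ: "fdm (?Q j)" if j: "j < l" for j
  proof -
    obtain i where i: "has_type i (?Q j)" using simple_has_type[OF simple[OF j]] by blast
    have "i < m" using i unfolding has_type_def by blast
    then show ?thesis by (rule mult_simple(1)[OF simple[OF j] i])
  qed
  have chain: "fdm M \<and> mult_dim u M = (\<Sum>j<l. mult_dim u (?Q j))" if u: "u \<in> carrier A" "u \<otimes> u = u" for u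
  proof -
    have "fdm (M\<lparr>carrier := N l\<rparr>) \<and> mult_dim u (M\<lparr>carrier := N l\<rparr>) = (\<Sum>j<l. mult_dim u (?Q j))"
    proof (rule mult_chain[OF M N0 _ _ fdQ u])
      show "Module.submodule (N j) A M" if "j \<le> l" for j using sub that by blast
      show "N j \<subseteq> N (Suc j)" if "j < l" for j using step that by blast
    qed
    then show ?thesis unfolding Nl by simp
  qed
  show "fdm M" using chain[OF one_closed] by simp
  show "\<forall>i<n. mult_dim (e (\<sigma> i)) M = card {j. j < l \<and> module_iso A (?Q j) (S i)}"
  proof (intro allI impI)
    fix i assume i: "i < n"
    note E = e_props[OF type_less[OF i]]
    have cnt: "(\<Sum>j<l. if P j then 1 else 0) = card {j. j < l \<and> P j}" for P
      by (simp add: sum.If_cases Collect_conj_eq lessThan_def)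
    have "mult_dim (e (\<sigma> i)) M = (\<Sum>j<l. mult_dim (e (\<sigma> i)) (?Q j))" using chain[OF E(1,2)] by simp
    also have "\<dots> = (\<Sum>j<l. if module_iso A (?Q j) (S i) then 1 else 0)"
      by (rule sum.cong[OF refl]) (use mult_simple_iso[OF simple i] in simp)
    finally show "mult_dim (e (\<sigma> i)) M = card {j. j < l \<and> module_iso A (?Q j) (S i)}" unfolding cnt .
  qed
qed

text \<open>This trades the existential over composition series for dimensions of subspaces: along
  any series the count is \<open>mult_dim\<close>, and finite dimension provides some series for the
  converse.\<close>

lemma dimension_vector_iff:
  assumes M: "left_module A M"
  shows "has_dimension_vector A n S M d \<longleftrightarrow> fdm M \<and> (\<forall>i<n. d i = mult_dim (e (\<sigma> i)) M)"
proof
  assume "has_dimension_vector A n S M d"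
  then obtain l N where N: "N 0 = {\<zero>\<^bsub>M\<^esub>}" "N (l::nat) = carrier M" "\<forall>j\<le>l. Module.submodule (N j) A M"
    "\<forall>j<l. N j \<subseteq> N (Suc j) \<and> simple_module A (quotient_module (M\<lparr>carrier := N (Suc j)\<rparr>) (N j))"
    "\<forall>i<n. d i = card {j. j < l \<and> module_iso A (quotient_module (M\<lparr>carrier := N (Suc j)\<rparr>) (N j)) (S i)}"
    unfolding has_dimension_vector_def by (elim exE conjE)
  show "fdm M \<and> (\<forall>i<n. d i = mult_dim (e (\<sigma> i)) M)"
    using composition_mult[of M N l, OF M N(1-4)] N(5) by simp
next
  assume fd: "fdm M \<and> (\<forall>i<n. d i = mult_dim (e (\<sigma> i)) M)"
  interpret M: left_module A M by (rule M)
  have top: "Module.submodule (carrier M) A M"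
    by (rule M.submoduleI') (simp_all add: M.smult_closed)
  obtain l N where N: "N 0 = {\<zero>\<^bsub>M\<^esub>}" "N (l::nat) = carrier M" "\<forall>j\<le>l. Module.submodule (N j) A M"
    "\<forall>j<l. N j \<subseteq> N (Suc j) \<and> simple_module A (quotient_module (M\<lparr>carrier := N (Suc j)\<rparr>) (N j))"
    using composition_series_exists[OF M conjunct1[OF fd] top] by (elim exE conjE)
  have "\<forall>i<n. d i = card {j. j < l \<and> module_iso A (quotient_module (M\<lparr>carrier := N (Suc j)\<rparr>) (N j)) (S i)}"
    using composition_mult(2)[of M N l, OF M N(1-4)] conjunct2[OF fd] by simp
  then show "has_dimension_vector A n S M d"
    unfolding has_dimension_vector_def using N by (intro exI[of _ l] exI[of _ N] conjI)
qed

text \<open>\<open>chi\<close> is defined by nilpotency inside the algebra; its values become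
  accessible by evaluating on one nonzero vector of \<open>S i\<close>.\<close>

lemma chi_eq:
  assumes i: "i < n" and a: "a \<in> carrier A" and x: "x \<in> carrier (S i)" "x \<noteq> \<zero>\<^bsub>S i\<^esub>"
    and eq: "a \<odot>\<^bsub>S i\<^esub> x = scal c \<odot>\<^bsub>S i\<^esub> x"
  shows "chi (\<sigma> i) a = c"
proof (rule scal_smult_cancel[OF S_module[OF i] x])
  show "scal (chi (\<sigma> i) a) \<odot>\<^bsub>S i\<^esub> x = scal c \<odot>\<^bsub>S i\<^esub> x"
    using has_typeD(3)[OF type_S[OF i] x(1) a] eq by (rule trans[OF sym])
qed

lemma chi_delta:
  assumes i: "i < n" and j: "j < n"
  shows "chi (\<sigma> j) (e (\<sigma> i)) = (if j = i then 1 else 0)"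
proof -
  interpret S: left_module A "S j" by (rule S_module[OF j])
  obtain x where x: "x \<in> carrier (S j)" "x \<noteq> \<zero>\<^bsub>S j\<^esub>" using simple_nonzero[OF simple_S[OF j]] by blast
  show ?thesis
  proof (rule chi_eq[OF j e_props(1)[OF type_less[OF i]] x], cases "j = i")
    case True
    then show "e (\<sigma> i) \<odot>\<^bsub>S j\<^esub> x = scal (if j = i then 1 else 0) \<odot>\<^bsub>S j\<^esub> x"
      using has_typeD(2)[OF type_S[OF j] x(1)] S.smult_one[OF x(1)] by (simp add: scal_one)
  next
    case False
    then have "\<sigma> i \<noteq> \<sigma> j" using inj_type[OF i j] by blast
    then have "e (\<sigma> i) \<odot>\<^bsub>S j\<^esub> x = \<zero>\<^bsub>S j\<^esub>"
      by (rule other_idempotent_zero[OF S_module[OF j] type_S[OF j] type_less[OF i] _ x(1)])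
    then show "e (\<sigma> i) \<odot>\<^bsub>S j\<^esub> x = scal (if j = i then 1 else 0) \<odot>\<^bsub>S j\<^esub> x"
      using False x(1) by (simp add: scal_zero)
  qed
qed

lemma chi_scal:
  assumes i: "i < n" shows "chi (\<sigma> i) (scal c) = c"
proof -
  obtain x where x: "x \<in> carrier (S i)" "x \<noteq> \<zero>\<^bsub>S i\<^esub>" using simple_nonzero[OF simple_S[OF i]] by blast
  show ?thesis by (rule chi_eq[OF i scal_closed x refl])
qed

text \<open>The action of the algebra on the direct sum of the \<open>S i\<close>, taken
  \<open>p i\<close> times each, in coordinates.\<close>

definition act :: "(nat \<Rightarrow> nat) \<Rightarrow> 'a \<Rightarrow> 'k vec \<Rightarrow> 'k vec" where
  "act p a v = glue n p (\<lambda>i. chi (\<sigma> i) a \<cdot>\<^sub>v block p i v)"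

lemma act_carrier [simp]: "act p a v \<in> carrier_vec (offset p n)"
  by (simp add: act_def)

lemma block_act: "i < n \<Longrightarrow> block p i (act p a v) = chi (\<sigma> i) a \<cdot>\<^sub>v block p i v"
  unfolding act_def by (rule block_glue) simp_all

lemma act_scal:
  assumes v: "v \<in> carrier_vec (offset p n)" shows "act p (scal c) v = c \<cdot>\<^sub>v v"
proof (rule eq_vec_blocks)
  show "block p i (act p (scal c) v) = block p i (c \<cdot>\<^sub>v v)" if i: "i < n" for i
    unfolding block_act[OF i] chi_scal[OF i] block_smult[OF i v] ..
qed (use v in simp_all)

lemma act_idempotent:
  assumes i: "i < n" and v: "v \<in> carrier_vec (offset p n)"
  shows "act p (e (\<sigma> i)) v = emb n p i (block p i v)"
proof (rule eq_vec_blocks)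
  fix j assume j: "j < n"
  show "block p j (act p (e (\<sigma> i)) v) = block p j (emb n p i (block p i v))"
    unfolding block_act[OF j] chi_delta[OF i j]
    by (simp add: block_emb[OF j] zero_smult_vec[OF block_carrier])
qed simp_all

text \<open>An isomorphism of \<open>M\<close> with this model of a semisimple module, given as a
  coordinate map that respects the actions.\<close>

definition graded :: "('a, 'm) module \<Rightarrow> (nat \<Rightarrow> nat) \<Rightarrow> ('k vec \<Rightarrow> 'm) \<Rightarrow> bool" where
  "graded M p \<gamma> \<longleftrightarrow> coordinatization (restrict_scalars A M) (offset p n) \<gamma> \<and>
     (\<forall>a\<in>carrier A. \<forall>v\<in>carrier_vec (offset p n). a \<odot>\<^bsub>M\<^esub> \<gamma> v = \<gamma> (act p a v))"

lemma gradedD: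
  assumes "graded M p \<gamma>"
  shows "coordinatization (restrict_scalars A M) (offset p n) \<gamma>"
    "\<gamma> \<in> LinearCombinations.module_hom class_ring (module_vec TYPE('k) (offset p n)) (restrict_scalars A M)"
    "inj_on \<gamma> (carrier_vec (offset p n))" "\<gamma> ` carrier_vec (offset p n) = carrier M"
    "v \<in> carrier_vec (offset p n) \<Longrightarrow> \<gamma> v \<in> carrier M"
    "v \<in> carrier_vec (offset p n) \<Longrightarrow> w \<in> carrier_vec (offset p n) \<Longrightarrow> \<gamma> (v + w) = \<gamma> v \<oplus>\<^bsub>M\<^esub> \<gamma> w"
    "a \<in> carrier A \<Longrightarrow> v \<in> carrier_vec (offset p n) \<Longrightarrow> a \<odot>\<^bsub>M\<^esub> \<gamma> v = \<gamma> (act p a v)"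
proof -
  show c: "coordinatization (restrict_scalars A M) (offset p n) \<gamma>" using assms by (simp add: graded_def)
  then show h: "\<gamma> \<in> LinearCombinations.module_hom class_ring (module_vec TYPE('k) (offset p n)) (restrict_scalars A M)"
    and "inj_on \<gamma> (carrier_vec (offset p n))" and i: "\<gamma> ` carrier_vec (offset p n) = carrier M"
    by (simp_all add: coordinatization_def bij_betw_def)
  show "v \<in> carrier_vec (offset p n) \<Longrightarrow> \<gamma> v \<in> carrier M" using i by blast
  show "v \<in> carrier_vec (offset p n) \<Longrightarrow> w \<in> carrier_vec (offset p n) \<Longrightarrow> \<gamma> (v + w) = \<gamma> v \<oplus>\<^bsub>M\<^esub> \<gamma> w"
    using hom_vecD(2)[OF h] by simp
  show "a \<in> carrier A \<Longrightarrow> v \<in> carrier_vec (offset p n) \<Longrightarrow> a \<odot>\<^bsub>M\<^esub> \<gamma> v = \<gamma> (act p a v)"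
    using assms by (simp add: graded_def)
qed

text \<open>Compatibility with scalars is part of compatibility with the action, because the field
  acts through the algebra and \<open>act_scal\<close> holds in the model.\<close>

lemma gradedI:
  assumes M: "left_module A M" and b: "bij_betw \<gamma> (carrier_vec (offset p n)) (carrier M)"
    and add: "\<And>v w. v \<in> carrier_vec (offset p n) \<Longrightarrow> w \<in> carrier_vec (offset p n) \<Longrightarrow> \<gamma> (v + w) = \<gamma> v \<oplus>\<^bsub>M\<^esub> \<gamma> w"
    and act: "\<And>a v. a \<in> carrier A \<Longrightarrow> v \<in> carrier_vec (offset p n) \<Longrightarrow> \<gamma> (act p a v) = a \<odot>\<^bsub>M\<^esub> \<gamma> v"
  shows "graded M p \<gamma>"
proof -
  have "\<gamma> \<in> LinearCombinations.module_hom class_ring (module_vec TYPE('k) (offset p n)) (restrict_scalars A M)"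
  proof (rule hom_vecI)
    show "\<gamma> v \<in> carrier (restrict_scalars A M)" if "v \<in> carrier_vec (offset p n)" for v
      using bij_betw_apply[OF b that] by simp
    show "\<gamma> (v + w) = \<gamma> v \<oplus>\<^bsub>restrict_scalars A M\<^esub> \<gamma> w"
      if "v \<in> carrier_vec (offset p n)" "w \<in> carrier_vec (offset p n)" for v w using add[OF that] by simp
    show "\<gamma> (c \<cdot>\<^sub>v v) = c \<odot>\<^bsub>restrict_scalars A M\<^esub> \<gamma> v" if v: "v \<in> carrier_vec (offset p n)" for c v
      using act[OF scal_closed v, of c] unfolding act_scal[OF v] by simp
  qed
  then show ?thesis unfolding graded_def coordinatization_def using b act by simp
qed

text \<open>Choose a nonzero vector in each line \<open>S i\<close>. \<open>F\<close> takes
  coordinates to multiples of these vectors, and the given isomorphism carries the result back to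
  \<open>M\<close>.\<close>

lemma semisimple_graded:
  assumes M: "left_module A M" and iso: "module_iso A M (semisimple_sum n S p)"
  shows "\<exists>\<gamma>. graded M p \<gamma>"
proof -
  let ?N = "semisimple_sum n S p" and ?I = "{(i, j). i < n \<and> j < p i}"
  obtain f where f: "f \<in> LinearCombinations.module_hom A M ?N" and bij: "bij_betw f (carrier M) (carrier ?N)"
    using iso unfolding module_iso_def by (elim bexE)
  interpret M: left_module A M by (rule M)
  have "\<forall>i. \<exists>x. i < n \<longrightarrow> x \<in> carrier (S i) \<and> x \<noteq> \<zero>\<^bsub>S i\<^esub>" using simple_nonzero[OF simple_S] by blast
  then obtain s where "\<forall>i. i < n \<longrightarrow> s i \<in> carrier (S i) \<and> s i \<noteq> \<zero>\<^bsub>S i\<^esub>" by (rule choice[THEN exE])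
  then have s: "i < n \<Longrightarrow> s i \<in> carrier (S i)" "i < n \<Longrightarrow> s i \<noteq> \<zero>\<^bsub>S i\<^esub>" for i by simp_all
  have sc: "i < n \<Longrightarrow> scal c \<odot>\<^bsub>S i\<^esub> s i \<in> carrier (S i)" for i c
    using left_module.smult_closed[OF S_module scal_closed s(1)] .
  define F where "F v = (\<lambda>q\<in>?I. scal (v $ (offset p (fst q) + snd q)) \<odot>\<^bsub>S (fst q)\<^esub> s (fst q))" for v
  have cN: "carrier ?N = (\<Pi>\<^sub>E q\<in>?I. carrier (S (fst q)))"
    by (simp add: semisimple_sum_def direct_sum_def case_prod_beta)
  have aN: "x \<oplus>\<^bsub>?N\<^esub> y = (\<lambda>q\<in>?I. x q \<oplus>\<^bsub>S (fst q)\<^esub> y q)" for x y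
    by (simp add: semisimple_sum_def direct_sum_def case_prod_beta)
  have sN: "a \<odot>\<^bsub>?N\<^esub> x = (\<lambda>q\<in>?I. a \<odot>\<^bsub>S (fst q)\<^esub> x q)" for a x
    by (simp add: semisimple_sum_def direct_sum_def case_prod_beta)
  have FN: "F v \<in> carrier ?N" for v unfolding cN F_def using sc by auto
  have F_at: "F v (i, j) = scal (v $ (offset p i + j)) \<odot>\<^bsub>S i\<^esub> s i" if "i < n" "j < p i" for v i j
    using that by (simp add: F_def)
  have Fadd: "F (v + w) = F v \<oplus>\<^bsub>?N\<^esub> F w" if vw: "v \<in> carrier_vec (offset p n)" "w \<in> carrier_vec (offset p n)" for v w
    unfolding aN
  proof (rule ext, goal_cases)
    case (1 q)
    obtain i j where q: "q = (i, j)" by (cases q)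
    show ?case
    proof (cases "i < n \<and> j < p i")
      case True
      then have l: "offset p i + j < offset p n" using offset_less by blast
      have "scal (v $ (offset p i + j) + w $ (offset p i + j)) \<odot>\<^bsub>S i\<^esub> s i =
        scal (v $ (offset p i + j)) \<odot>\<^bsub>S i\<^esub> s i \<oplus>\<^bsub>S i\<^esub> scal (w $ (offset p i + j)) \<odot>\<^bsub>S i\<^esub> s i"
        unfolding scal_add using left_module.smult_l_distr[OF S_module scal_closed scal_closed s(1)] True by simp
      then show ?thesis using True vw l q by (simp add: F_at)
    qed (auto simp: q F_def)
  qed
  have Fact: "F (act p a v) = a \<odot>\<^bsub>?N\<^esub> F v" if a: "a \<in> carrier A" and v: "v \<in> carrier_vec (offset p n)" for a v
    unfolding sN
  proof (rule ext, goal_cases)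
    case (1 q)
    obtain i j where q: "q = (i, j)" by (cases q)
    show ?case
    proof (cases "i < n \<and> j < p i")
      case True
      then have i: "i < n" and j: "j < p i" by simp_all
      have "act p a v $ (offset p i + j) = block p i (act p a v) $ j" using j by (simp add: block_def)
      also have "\<dots> = chi (\<sigma> i) a * v $ (offset p i + j)" unfolding block_act[OF i] using j by (simp add: block_def)
      finally have 1: "act p a v $ (offset p i + j) = chi (\<sigma> i) a * v $ (offset p i + j)" .
      have "scal (chi (\<sigma> i) a * v $ (offset p i + j)) \<odot>\<^bsub>S i\<^esub> s i
        = scal (chi (\<sigma> i) a) \<odot>\<^bsub>S i\<^esub> (scal (v $ (offset p i + j)) \<odot>\<^bsub>S i\<^esub> s i)"
        unfolding scal_mult left_module.smult_assoc[OF S_module[OF i] scal_closed scal_closed s(1)[OF i]] ..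
      also have "\<dots> = a \<odot>\<^bsub>S i\<^esub> (scal (v $ (offset p i + j)) \<odot>\<^bsub>S i\<^esub> s i)"
        by (rule has_typeD(3)[OF type_S[OF i] sc[OF i] a, symmetric])
      finally show ?thesis using i j q by (simp add: F_at 1)
    qed (auto simp: q F_def)
  qed
  have Finj: "inj_on F (carrier_vec (offset p n))"
  proof (rule inj_onI)
    fix v w assume vw: "v \<in> carrier_vec (offset p n)" "w \<in> carrier_vec (offset p n)" and eq: "F v = F w"
    show "v = w"
    proof (rule eq_vecI)
      fix x assume "x < dim_vec w"
      then have "x < offset p n" using vw by simp
      then obtain i j where ij: "i < n" "j < p i" "x = offset p i + j" by (rule offset_cases)
      have "F v (i, j) = F w (i, j)" using eq by simp
      then show "v $ x = w $ x" unfolding F_at[OF ij(1,2)] ij(3)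
        by (rule scal_smult_cancel[OF S_module[OF ij(1)] s[OF ij(1)]])
    qed (use vw in simp)
  qed
  have Fsurj: "\<exists>v \<in> carrier_vec (offset p n). F v = y" if y: "y \<in> carrier ?N" for y
  proof -
    have "\<forall>q. \<exists>c. q \<in> ?I \<longrightarrow> y q = scal c \<odot>\<^bsub>S (fst q)\<^esub> s (fst q)"
    proof
      fix q show "\<exists>c. q \<in> ?I \<longrightarrow> y q = scal c \<odot>\<^bsub>S (fst q)\<^esub> s (fst q)"
      proof (cases "q \<in> ?I")
        case True
        then have q: "fst q < n" by auto
        have "y q \<in> carrier (S (fst q))" using y True unfolding cN by (rule PiE_mem)
        then show ?thesis using type_scalar[OF simple_S[OF q] type_S[OF q] s[OF q]] by blast
      qed blast
    qed
    then obtain c where c: "\<forall>q. q \<in> ?I \<longrightarrow> y q = scal (c q) \<odot>\<^bsub>S (fst q)\<^esub> s (fst q)" by (rule choice[THEN exE])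
    let ?v = "glue n p (\<lambda>i. vec (p i) (\<lambda>j. c (i, j)))"
    have "F ?v = y"
    proof
      fix q :: "nat \<times> nat"
      obtain i j where q: "q = (i, j)" by (cases q)
      show "F ?v q = y q"
      proof (cases "i < n \<and> j < p i")
        case True
        then have i: "i < n" and j: "j < p i" by simp_all
        have "?v $ (offset p i + j) = block p i ?v $ j" using j by (simp add: block_def)
        also have "\<dots> = c (i, j)" using block_glue[OF i, of "\<lambda>i. vec (p i) (\<lambda>j. c (i, j))"] j by simp
        finally show ?thesis using c i j q by (simp add: F_at)
      next
        case False
        then have "q \<notin> ?I" by (simp add: q)
        then show ?thesis using PiE_arb[OF y[unfolded cN]] unfolding F_def restrict_def by simp
      qed
    qed
    then show ?thesis by (intro bexI[of _ ?v]) simp_all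
  qed
  define g where "g = inv_into (carrier M) f"
  have fim: "f ` carrier M = carrier ?N" by (rule bij_betw_imp_surj_on[OF bij])
  have gM: "g y \<in> carrier M" if "y \<in> carrier ?N" for y
    unfolding g_def by (rule inv_into_into) (unfold fim, rule that)
  have fg: "f (g y) = y" if "y \<in> carrier ?N" for y
    unfolding g_def by (rule f_inv_into_f) (unfold fim, rule that)
  have inj: "x = y" if "x \<in> carrier M" "y \<in> carrier M" "f x = f y" for x y
    by (rule inj_onD[OF bij_betw_imp_inj_on[OF bij] that(3,1,2)])
  have "graded M p (\<lambda>v. g (F v))"
  proof (rule gradedI[OF M])
    show "bij_betw (\<lambda>v. g (F v)) (carrier_vec (offset p n)) (carrier M)"
      unfolding bij_betw_def
    proof
      show "inj_on (\<lambda>v. g (F v)) (carrier_vec (offset p n))"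
      proof (rule inj_onI)
        fix v w assume vw: "v \<in> carrier_vec (offset p n)" "w \<in> carrier_vec (offset p n)" "g (F v) = g (F w)"
        have "f (g (F v)) = f (g (F w))" by (rule arg_cong[OF vw(3)])
        then have "F v = F w" unfolding fg[OF FN] .
        then show "v = w" by (rule inj_onD[OF Finj _ vw(1,2)])
      qed
      show "(\<lambda>v. g (F v)) ` carrier_vec (offset p n) = carrier M"
      proof (intro equalityI subsetI)
        fix x assume "x \<in> (\<lambda>v. g (F v)) ` carrier_vec (offset p n)"
        then obtain v where "x = g (F v)" by (rule imageE)
        then show "x \<in> carrier M" using gM[OF FN] by simp
      next
        fix x assume x: "x \<in> carrier M"
        have fx: "f x \<in> carrier ?N" by (rule module_homD(1)[OF f x])
        obtain v where v: "v \<in> carrier_vec (offset p n)" "F v = f x" using Fsurj[OF fx] by blast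
        have x': "x = g (F v)" unfolding v(2) by (rule inj[OF x gM[OF fx] fg[OF fx, symmetric]])
        show "x \<in> (\<lambda>v. g (F v)) ` carrier_vec (offset p n)" unfolding x' using v(1) by (rule imageI)
      qed
    qed
  next
    fix v w :: "'k vec" assume vw: "v \<in> carrier_vec (offset p n)" "w \<in> carrier_vec (offset p n)"
    show "g (F (v + w)) = g (F v) \<oplus>\<^bsub>M\<^esub> g (F w)"
    proof (rule inj[OF gM[OF FN] M.M.add.m_closed[OF gM[OF FN] gM[OF FN]]])
      show "f (g (F (v + w))) = f (g (F v) \<oplus>\<^bsub>M\<^esub> g (F w))"
        unfolding module_homD(2)[OF f gM[OF FN] gM[OF FN]] fg[OF FN] by (rule Fadd[OF vw])
    qed
  next
    fix a and v :: "'k vec" assume a: "a \<in> carrier A" and v: "v \<in> carrier_vec (offset p n)"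
    show "g (F (act p a v)) = a \<odot>\<^bsub>M\<^esub> g (F v)"
    proof (rule inj[OF gM[OF FN] M.smult_closed[OF a gM[OF FN]]])
      show "f (g (F (act p a v))) = f (a \<odot>\<^bsub>M\<^esub> g (F v))"
        unfolding module_homD(3)[OF f a gM[OF FN]] fg[OF FN] by (rule Fact[OF a v])
    qed
  qed
  then show ?thesis by blast
qed

text \<open>Stability holds because the algebra scales each block. The idempotent
  \<open>e (\<sigma> i)\<close> projects onto block \<open>i\<close>, so its fixed space in
  \<open>C\<close> is a copy of \<open>X i\<close>, of dimension \<open>k i\<close>.\<close>

lemma graded_sub:
  assumes M: "left_module A M" and g: "graded M p \<gamma>"
    and X: "\<And>i. i < n \<Longrightarrow> row_span (k i) (p i) (X i) (B i)"
  defines "C \<equiv> \<gamma> ` {v \<in> carrier_vec (offset p n). \<forall>i<n. block p i v \<in> X i}"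
  shows "Module.submodule C A M" "\<And>i. i < n \<Longrightarrow> mult_dim (e (\<sigma> i)) (M\<lparr>carrier := C\<rparr>) = k i"
proof -
  interpret M: left_module A M by (rule M)
  let ?W = "{v \<in> carrier_vec (offset p n). \<forall>i<n. block p i v \<in> X i}"
  note gD = gradedD[OF g]
  note Xc = row_span_closed[OF X]
  have "row_span (offset k n) (offset p n) ?W (block_diag n k p B)" by (rule row_span_blocks) (rule X)
  note Wc = row_span_closed[OF this]
  show sub: "Module.submodule C A M"
  proof (rule M.submoduleI')
    show "C \<subseteq> carrier M" unfolding C_def using gD(5) by blast
    have "\<gamma> (0\<^sub>v (offset p n)) = \<gamma> (0 \<cdot>\<^sub>v 0\<^sub>v (offset p n))" by simp
    also have "\<dots> = scal 0 \<odot>\<^bsub>M\<^esub> \<gamma> (0\<^sub>v (offset p n))" using hom_vecD(3)[OF gD(2) zero_carrier_vec, of 0] by simp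
    also have "\<dots> = \<zero>\<^bsub>M\<^esub>" unfolding scal_zero by (rule M.smult_zero_left[OF gD(5)[OF zero_carrier_vec]])
    finally have "\<zero>\<^bsub>M\<^esub> = \<gamma> (0\<^sub>v (offset p n))" ..
    then show "\<zero>\<^bsub>M\<^esub> \<in> C" unfolding C_def by (rule image_eqI) (rule Wc(1))
  next
    fix x y assume "x \<in> C" "y \<in> C"
    then obtain v w where v: "v \<in> ?W" "x = \<gamma> v" and w: "w \<in> ?W" "y = \<gamma> w" unfolding C_def by blast
    have "x \<oplus>\<^bsub>M\<^esub> y = \<gamma> (v + w)" using v w gD(6)[of v w] by simp
    then show "x \<oplus>\<^bsub>M\<^esub> y \<in> C" unfolding C_def by (rule image_eqI) (rule Wc(2)[OF v(1) w(1)])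
  next
    fix a x assume a: "a \<in> carrier A" and "x \<in> C"
    then obtain v where v: "v \<in> carrier_vec (offset p n)" "\<forall>i<n. block p i v \<in> X i" "x = \<gamma> v" unfolding C_def by blast
    have "act p a v \<in> ?W" using Xc(3) v(2) by (simp add: block_act)
    then have "\<gamma> (act p a v) \<in> C" unfolding C_def by (rule imageI)
    then show "a \<odot>\<^bsub>M\<^esub> x \<in> C" unfolding v(3) gD(7)[OF a v(1)] .
  qed
  fix i assume i: "i < n"
  note E = e_props[OF type_less[OF i]]
  note Bi = row_spanD[OF X[OF i]]
  note bes = block_emb_same[OF i, where p = p]
  let ?h = "\<lambda>u. \<gamma> (emb n p i ((B i)\<^sup>T *\<^sub>v u))"
  have Bu: "(B i)\<^sup>T *\<^sub>v u \<in> carrier_vec (p i)" if "u \<in> carrier_vec (k i)" for u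
    using mult_mat_vec_carrier[OF Bi(2) that] .
  have hom: "?h \<in> LinearCombinations.module_hom class_ring (module_vec TYPE('k) (k i)) (restrict_scalars A M)"
    by (rule hom_comp[OF mult_mat_vec_hom[OF Bi(2)] hom_comp[OF emb_hom[OF i] gD(2)]])
  have inj: "inj_on ?h (carrier_vec (k i))"
  proof (rule inj_onI)
    fix u w assume uw: "u \<in> carrier_vec (k i)" "w \<in> carrier_vec (k i)" and eq: "?h u = ?h w"
    have "emb n p i ((B i)\<^sup>T *\<^sub>v u) = emb n p i ((B i)\<^sup>T *\<^sub>v w)" by (rule inj_onD[OF gD(3) eq]) simp_all
    then have "block p i (emb n p i ((B i)\<^sup>T *\<^sub>v u)) = block p i (emb n p i ((B i)\<^sup>T *\<^sub>v w))" by simp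
    then have "(B i)\<^sup>T *\<^sub>v u = (B i)\<^sup>T *\<^sub>v w" unfolding bes[OF Bu[OF uw(1)]] bes[OF Bu[OF uw(2)]] .
    then show "u = w" using inj_onD[OF Bi(3) _ uw] by simp
  qed
  have fix_eq: "fix_space (e (\<sigma> i)) (M\<lparr>carrier := C\<rparr>) = ?h ` carrier_vec (k i)"
  proof (intro equalityI subsetI)
    fix x assume "x \<in> fix_space (e (\<sigma> i)) (M\<lparr>carrier := C\<rparr>)"
    then have x: "x \<in> C" "e (\<sigma> i) \<odot>\<^bsub>M\<^esub> x = x" by (simp_all add: fix_space_def)
    obtain v where v: "v \<in> carrier_vec (offset p n)" "\<forall>i<n. block p i v \<in> X i" "x = \<gamma> v"
      using x(1) unfolding C_def by blast
    have "x = \<gamma> (emb n p i (block p i v))"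
      using x(2) unfolding v(3) gD(7)[OF E(1) v(1)] act_idempotent[OF i v(1)] by (rule sym)
    moreover have "block p i v \<in> X i" using v(2) i by blast
    then obtain u where "u \<in> carrier_vec (k i)" "block p i v = (B i)\<^sup>T *\<^sub>v u" unfolding Bi(4) by blast
    ultimately show "x \<in> ?h ` carrier_vec (k i)" by (intro image_eqI[of _ _ u]) simp_all
  next
    fix x assume "x \<in> ?h ` carrier_vec (k i)"
    then obtain u where u: "u \<in> carrier_vec (k i)" "x = ?h u" by blast
    have "(B i)\<^sup>T *\<^sub>v u \<in> X i" unfolding Bi(4) using u(1) by (rule imageI)
    then have "emb n p i ((B i)\<^sup>T *\<^sub>v u) \<in> ?W" using Xc(1) Bu[OF u(1)] by (simp add: block_emb)
    then have "x \<in> C" unfolding C_def u(2) by (rule imageI)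
    moreover have "e (\<sigma> i) \<odot>\<^bsub>M\<^esub> x = x"
      unfolding u(2) gD(7)[OF E(1) emb_carrier] act_idempotent[OF i emb_carrier] bes[OF Bu[OF u(1)]] ..
    ultimately show "x \<in> fix_space (e (\<sigma> i)) (M\<lparr>carrier := C\<rparr>)" by (simp add: fix_space_def)
  qed
  note vsM = restrict_scalars_vectorspace[OF M]
  note co = coordinatization_range(2)[OF vsM hom inj]
  have vsF: "vectorspace class_ring ((restrict_scalars A M)\<lparr>carrier := ?h ` carrier_vec (k i)\<rparr>)"
    using fix_vectorspace[OF submodule_left_module[OF M sub] E(1)] unfolding fix_eq by (simp add: restrict_scalars_update)
  show "mult_dim (e (\<sigma> i)) (M\<lparr>carrier := C\<rparr>) = k i"
    unfolding mult_dim_def fix_eq using coordinatization_dim(2)[OF vsF co] by (simp add: restrict_scalars_update)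
qed

lemma graded_dims:
  assumes M: "left_module A M" and g: "graded M p \<gamma>"
  shows "fdm M" "\<And>i. i < n \<Longrightarrow> mult_dim (e (\<sigma> i)) M = p i"
proof -
  show "fdm M" unfolding fdm_def
    by (rule coordinatization_dim(1)[OF restrict_scalars_vectorspace[OF M] gradedD(1)[OF g]])
  fix i assume i: "i < n"
  \<comment> \<open>The whole module is the case in which every block is the full space, with the
    identity as representing matrix.\<close>
  have rs: "row_span (p i) (p i) (carrier_vec (p i)) (1\<^sub>m (p i) :: 'k mat)" for i
    unfolding row_span_def by (auto intro!: inj_onI image_eqI)
  have C: "\<gamma> ` {v \<in> carrier_vec (offset p n). \<forall>i<n. block p i v \<in> carrier_vec (p i)} = carrier M"
    using gradedD(4)[OF g] by simp
  show "mult_dim (e (\<sigma> i)) M = p i"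
    using graded_sub(2)[OF M g rs i] unfolding C by simp
qed

text \<open>A submodule contains, with every vector, its components under the idempotents, which are
  its blocks. Hence it is the sum of its intersections with the blocks.\<close>

lemma graded_decomposition:
  assumes M: "left_module A M" and g: "graded M p \<gamma>" and C: "Module.submodule C A M"
  shows "\<exists>k X B. (\<forall>i<n. row_span (k i) (p i) (X i) (B i)) \<and>
    C = \<gamma> ` {v \<in> carrier_vec (offset p n). \<forall>i<n. block p i v \<in> X i}"
proof -
  interpret M: left_module A M by (rule M)
  note gD = gradedD[OF g]
  note CD = M.submoduleD[OF C]
  define X where "X i = {w \<in> carrier_vec (p i). \<gamma> (emb n p i w) \<in> C}" for i
  have g0: "\<gamma> (0\<^sub>v (offset p n)) = \<zero>\<^bsub>M\<^esub>"
  proof -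
    have "\<gamma> (0\<^sub>v (offset p n)) = \<gamma> (0 \<cdot>\<^sub>v 0\<^sub>v (offset p n))" by simp
    also have "\<dots> = scal 0 \<odot>\<^bsub>M\<^esub> \<gamma> (0\<^sub>v (offset p n))" using hom_vecD(3)[OF gD(2) zero_carrier_vec, of 0] by simp
    finally show ?thesis unfolding scal_zero M.smult_zero_left[OF gD(5)[OF zero_carrier_vec]] .
  qed
  have "\<exists>k B. row_span k (p i) (X i) B" if i: "i < n" for i
  proof (rule subspace_row_span)
    have h: "(\<lambda>w. \<gamma> (emb n p i w)) \<in> LinearCombinations.module_hom class_ring (module_vec TYPE('k) (p i)) (restrict_scalars A M)"
      by (rule hom_comp[OF emb_hom[OF i] gD(2)])
    note hD = hom_vecD[OF h]
    have vs: "vectorspace class_ring (module_vec TYPE('k) (p i))" by (rule vec_vs)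
    then have "Module.module class_ring (module_vec TYPE('k) (p i))" by (simp add: vectorspace_def)
    moreover have "0\<^sub>v (p i) \<in> X i"
    proof -
      have "emb n p i (0\<^sub>v (p i)) = (0\<^sub>v (offset p n) :: 'k vec)"
        by (rule eq_vec_blocks[of _ p n]) (simp_all add: block_emb block_zero)
      then show ?thesis unfolding X_def using g0 CD(2) by simp
    qed
    moreover have "v + w \<in> X i" if "v \<in> X i" "w \<in> X i" for v w
      using that hD(2)[of v w] CD(3) by (simp add: X_def)
    moreover have "c \<cdot>\<^sub>v v \<in> X i" if "v \<in> X i" for c v
      using that hD(3)[of v c] CD(4)[OF scal_closed] by (simp add: X_def)
    moreover have "X i \<subseteq> carrier_vec (p i)" by (auto simp: X_def)
    ultimately have "LinearCombinations.submodule class_ring (X i) (module_vec TYPE('k) (p i))"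
      by (simp add: LinearCombinations.submodule_def module_vec_simps)
    then show "VectorSpace.subspace class_ring (X i) (module_vec TYPE('k) (p i))"
      using vs by (simp add: VectorSpace.subspace_def)
  qed
  then have "\<forall>i. \<exists>kB. i < n \<longrightarrow> row_span (fst kB) (p i) (X i) (snd kB)" by force
  then obtain kB where kB: "\<forall>i. i < n \<longrightarrow> row_span (fst (kB i)) (p i) (X i) (snd (kB i))" by (rule choice[THEN exE])
  have "C = \<gamma> ` {v \<in> carrier_vec (offset p n). \<forall>i<n. block p i v \<in> X i}"
  proof (intro equalityI subsetI)
    fix x assume x: "x \<in> C"
    then have "x \<in> \<gamma> ` carrier_vec (offset p n)" using CD(1) gD(4) by blast
    then obtain v where v: "v \<in> carrier_vec (offset p n)" "x = \<gamma> v" by blast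
    have "block p i v \<in> X i" if i: "i < n" for i
    proof -
      have "\<gamma> (emb n p i (block p i v)) = e (\<sigma> i) \<odot>\<^bsub>M\<^esub> x"
        unfolding v(2) gD(7)[OF e_props(1)[OF type_less[OF i]] v(1)] act_idempotent[OF i v(1)] ..
      then show ?thesis unfolding X_def using CD(4)[OF e_props(1)[OF type_less[OF i]] x] by simp
    qed
    then show "x \<in> \<gamma> ` {v \<in> carrier_vec (offset p n). \<forall>i<n. block p i v \<in> X i}" using v by blast
  next
    fix x assume "x \<in> \<gamma> ` {v \<in> carrier_vec (offset p n). \<forall>i<n. block p i v \<in> X i}"
    then obtain v where v: "v \<in> carrier_vec (offset p n)" "\<forall>i<n. block p i v \<in> X i" "x = \<gamma> v" by blast
    \<comment> \<open>\<open>?t r\<close> keeps the leading \<open>r\<close> blocks of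
      \<open>v\<close> and replaces the rest by zero; membership in \<open>C\<close> is extended by
      one block at a time.\<close>
    let ?t = "\<lambda>r. glue n p (\<lambda>i. if i < r then block p i v else 0\<^sub>v (p i))"
    have bt: "block p i (?t r) = (if i < r then block p i v else 0\<^sub>v (p i))" if "i < n" for i r
      by (rule block_glue[OF that]) simp
    have "\<gamma> (?t r) \<in> C" if "r \<le> n" for r
      using that
    proof (induction r)
      case 0
      have "?t 0 = 0\<^sub>v (offset p n)"
      proof (rule eq_vec_blocks[of _ p n])
        show "block p i (?t 0) = block p i (0\<^sub>v (offset p n))" if "i < n" for i
          unfolding bt[OF that] block_zero[OF that] by simp
      qed simp_all
      then show ?case using g0 CD(2) by simp
    next
      case (Suc r)
      have "?t (Suc r) = ?t r + emb n p r (block p r v)"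
      proof (rule eq_vec_blocks)
        fix i assume i: "i < n"
        show "block p i (?t (Suc r)) = block p i (?t r + emb n p r (block p r v))"
          unfolding block_add[OF i glue_carrier emb_carrier] bt[OF i] block_emb[OF i block_carrier]
          by (auto simp: less_Suc_eq)
      qed simp_all
      then have "\<gamma> (?t (Suc r)) = \<gamma> (?t r) \<oplus>\<^bsub>M\<^esub> \<gamma> (emb n p r (block p r v))" using gD(6) by simp
      moreover have "block p r v \<in> X r" using v(2) Suc.prems by simp
      then have "\<gamma> (emb n p r (block p r v)) \<in> C" unfolding X_def by blast
      moreover have "\<gamma> (?t r) \<in> C" using Suc by simp
      ultimately show ?case using CD(3) by simp
    qed
    moreover have "?t n = v"
    proof (rule eq_vec_blocks[of _ p n])
      show "block p i (?t n) = block p i v" if "i < n" for i unfolding bt[OF that] using that by simp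
    qed (use v(1) in simp_all)
    ultimately show "x \<in> C" using v(3) by force
  qed
  then show ?thesis using kB by (intro exI[of _ "fst \<circ> kB"] exI[of _ X] exI[of _ "snd \<circ> kB"]) simp
qed

end

section \<open>Products of Grassmannians\<close>

text \<open>Defined on all index sets, with value 0 on unsuitable ones, so that it coincides with
  \<open>coords\<close> as a function and forms can be evaluated at it.\<close>

definition pluecker :: "nat \<Rightarrow> nat \<Rightarrow> 'k::field mat \<Rightarrow> nat set \<Rightarrow> 'k" where
  "pluecker k N B I = (if I \<subseteq> {..<N} \<and> card I = k then minor k B (pick I) else 0)"

lemma minor_pluecker:
  assumes g: "g \<in> index_maps k N"
  shows "\<exists>s. \<forall>B :: 'k::field mat. minor k B g = s * pluecker k N B (g ` {0..<k})"
proof (cases "inj_on g {0..<k}")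
  case True
  obtain s where s: "\<forall>B :: 'k mat. minor k B g = s * minor k B (pick (g ` {0..<k}))" using minor_pick[of k g] by (rule exE)
  have sub: "g ` {0..<k} \<subseteq> {..<N}" using g by (auto simp: index_maps_def)
  have card: "card (g ` {0..<k}) = k" using card_image[OF True] by simp
  have "pluecker k N B (g ` {0..<k}) = minor k B (pick (g ` {0..<k}))" for B :: "'k mat"
    unfolding pluecker_def using sub card by simp
  then show ?thesis using s by (intro exI[of _ s]) simp
next
  case False
  then show ?thesis by (intro exI[of _ 0]) (simp add: minor_not_inj[OF False])
qed

text \<open>By the Cauchy-Binet expansion the minor is linear in the Pluecker coordinates of
  \<open>B\<close>, with coefficients determined by \<open>Q\<close> and \<open>f\<close> alone. The
  form is therefore the same for all \<open>B\<close>.\<close>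

lemma minor_mult_form:
  assumes Q: "Q \<in> carrier_mat N N'" and f: "\<And>c. c < k \<Longrightarrow> f c < N'"
  shows "\<exists>l \<in> forms 1. \<forall>B \<in> carrier_mat k N. minor k (B * Q) f = l (pluecker k N (B :: 'k::field mat))"
proof -
  have "\<forall>g. \<exists>s. g \<in> index_maps k N \<longrightarrow> (\<forall>B :: 'k mat. minor k B g = s * pluecker k N B (g ` {0..<k}))"
    using minor_pluecker by blast
  then obtain s where s: "\<forall>g. g \<in> index_maps k N \<longrightarrow> (\<forall>B :: 'k mat. minor k B g = s g * pluecker k N B (g ` {0..<k}))"
    by (rule choice[THEN exE])
  let ?l = "\<lambda>x. \<Sum>g\<in>index_maps k N. (\<Prod>c = 0..<k. Q $$ (g c, f c)) * (s g * x (g ` {0..<k}))"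
  have "?l \<in> forms 1"
    by (intro forms_sum forms_cmult forms_var)
  moreover have "minor k (B * Q) f = ?l (pluecker k N B)" if B: "B \<in> carrier_mat k N" for B
  proof -
    have "minor k (B * Q) f = (\<Sum>g\<in>index_maps k N. (\<Prod>c = 0..<k. Q $$ (g c, f c)) * minor k B g)"
      using B Q f by (rule minor_mult_right)
    also have "\<dots> = ?l (pluecker k N B)" by (rule sum.cong[OF refl]) (use s in simp)
    finally show ?thesis .
  qed
  ultimately show ?thesis by (intro bexI[of _ ?l]) blast+
qed

text \<open>\<open>B i\<close> and \<open>Y i\<close> represent a subspace of \<open>K^(p i)\<close> and its annihilator, whose minors are
  complementary up to sign and the factor \<open>d i\<close>; the rows of \<open>B'\<close> span the image of the direct
  sum of the former under \<open>R\<close>.\<close>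

definition minor_data where
  "minor_data n k p q R B Y d G B' \<longleftrightarrow> (\<forall>i<n. B i \<in> carrier_mat (k i) (p i)) \<and>
     (\<forall>i<n. d i \<noteq> 0 \<and> (\<forall>I \<subseteq> {..<p i}. card I = k i \<longrightarrow> minor (k i) (B i) (pick I)
        = d i * jacobi_sign (k i) (q i) I * minor (q i) (Y i) (pick ({..<p i} - I)))) \<and>
     G \<in> carrier_mat (offset k n) (offset k n) \<and> det G \<noteq> 0 \<and> B' = G * (block_diag n k p B * (R :: 'k::field mat)\<^sup>T)"

text \<open>The left inverse \<open>L\<close> undoes the embedding \<open>R\<close>, so that
  \<open>B' * L\<^sup>T\<close> is the block diagonal matrix up to the base change \<open>G\<close>.
  A suitable minor of it is the product of the minors of the blocks, which Jacobi's formula converts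
  into minors of the annihilators. An unsuitable index gives a coordinate that is identically
  0.\<close>

lemma product_coords_form:
  assumes kq: "\<And>i. i < n \<Longrightarrow> k i + q i = p i"
    and R: "R \<in> carrier_mat N (offset p n)" and L: "L \<in> carrier_mat (offset p n) N" "L * R = 1\<^sub>m (offset p n)"
  shows "\<exists>l \<in> forms 1. \<forall>B Y d G B'. minor_data n k p q R B Y d G B' \<longrightarrow>
    (\<Prod>i<n. pluecker (q i) (p i) (Y i) (J i)) =
    (\<Prod>i<n. inverse (d i)) * inverse (det G) * l (pluecker (offset k n) N (B' :: 'k::field mat))"
proof (cases "\<forall>i<n. J i \<subseteq> {..<p i} \<and> card (J i) = q i")
  case False
  then obtain i where "i < n" "\<not> (J i \<subseteq> {..<p i} \<and> card (J i) = q i)" by blast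
  then have "(\<Prod>i<n. pluecker (q i) (p i) (Y i) (J i)) = 0" for Y :: "nat \<Rightarrow> 'k mat"
    by (intro prod_zero bexI[of _ i]) (auto simp: pluecker_def)
  then show ?thesis by (intro bexI[of _ "\<lambda>x. 0"]) (simp_all add: forms_zero)
next
  case True
  let ?K = "offset k n" and ?M = "offset p n"
  define I where "I i = {..<p i} - J i" for i
  have I: "I i \<subseteq> {..<p i}" "card (I i) = k i" "{..<p i} - I i = J i" if i: "i < n" for i
  proof -
    show "I i \<subseteq> {..<p i}" by (auto simp: I_def)
    have "card (I i) = p i - q i"
      unfolding I_def using card_Diff_subset[of "J i" "{..<p i}"] True i finite_subset[of "J i" "{..<p i}"] by simp
    then show "card (I i) = k i" using kq[OF i] by simp
    show "{..<p i} - I i = J i" unfolding I_def using True i by blast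
  qed
  \<comment> \<open>\<open>f\<close> lists, in block order, the columns that each \<open>I i\<close>
    occupies within the \<open>i\<close>-th block; \<open>glue\<close> serves to define it
    piecewise.\<close>
  define f where "f c = glue n k (\<lambda>i. vec (k i) (\<lambda>r. offset p i + pick (I i) r)) $ c" for c
  have f: "f (offset k i + r) = offset p i + pick (I i) r" if i: "i < n" and r: "r < k i" for i r
  proof -
    have "f (offset k i + r) = block k i (glue n k (\<lambda>i. vec (k i) (\<lambda>r. offset p i + pick (I i) r))) $ r"
      using r by (simp add: f_def block_def)
    also have "\<dots> = offset p i + pick (I i) r"
      using block_glue[OF i, of "\<lambda>i. vec (k i) (\<lambda>r. offset p i + pick (I i) r)"] r by simp
    finally show ?thesis .
  qed
  have h: "pick (I i) r < p i" if i: "i < n" and r: "r < k i" for i r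
    using pick_in_set_le[of r "I i"] I(1,2)[OF i] r by auto
  have fM: "f c < ?M" if c: "c < ?K" for c
  proof -
    obtain i r where ir: "i < n" "r < k i" "c = offset k i + r" using c by (rule offset_cases)
    show ?thesis unfolding ir(3) f[OF ir(1,2)] by (rule offset_less[of i n "pick (I i) r" p, OF ir(1) h[OF ir(1,2)]])
  qed
  obtain l where l: "l \<in> forms 1" "\<forall>B \<in> carrier_mat ?K N. minor ?K (B * L\<^sup>T) f = l (pluecker ?K N B)"
    using minor_mult_form[of "L\<^sup>T" N ?M ?K f] L(1) fM by auto
  let ?s = "\<Prod>i<n. jacobi_sign (k i) (q i) (I i) :: 'k"
  have "(\<Prod>i<n. pluecker (q i) (p i) (Y i) (J i)) =
    (\<Prod>i<n. inverse (d i)) * inverse (det G) * (?s * l (pluecker ?K N B'))"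
    if D: "minor_data n k p q R B Y d G B'" for B Y d G and B' :: "'k mat"
  proof -
    have DB: "\<And>i. i < n \<Longrightarrow> B i \<in> carrier_mat (k i) (p i)" and DG: "G \<in> carrier_mat ?K ?K" "det G \<noteq> 0"
      and DB': "B' = G * (block_diag n k p B * R\<^sup>T)" and Dd: "\<And>i. i < n \<Longrightarrow> d i \<noteq> 0"
      and Dm: "\<And>i. i < n \<Longrightarrow> minor (k i) (B i) (pick (I i)) = d i * jacobi_sign (k i) (q i) (I i) * minor (q i) (Y i) (pick (J i))"
      using D I unfolding minor_data_def by auto
    let ?D = "block_diag n k p B"
    have D': "?D \<in> carrier_mat ?K ?M" by simp
    have RT: "R\<^sup>T \<in> carrier_mat ?M N" and LT: "L\<^sup>T \<in> carrier_mat N ?M" using R L by simp_all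
    have DR: "?D * R\<^sup>T \<in> carrier_mat ?K N" by (rule mult_carrier_mat[OF D' RT])
    have B'c: "B' \<in> carrier_mat ?K N" unfolding DB' by (rule mult_carrier_mat[OF DG(1) DR])
    have "R\<^sup>T * L\<^sup>T = 1\<^sub>m ?M" using transpose_mult[OF L(1) R] L(2) by simp
    then have "B' * L\<^sup>T = G * ?D"
      unfolding DB' assoc_mult_mat[OF DG(1) DR LT] assoc_mult_mat[OF D' RT LT] using right_mult_one_mat[OF D'] by simp
    then have "l (pluecker ?K N B') = minor ?K (G * ?D) f" using l(2) B'c by metis
    also have "\<dots> = det G * minor ?K ?D f" by (rule minor_mult_left[OF DG(1) D' fM])
    also have "minor ?K ?D f = (\<Prod>i<n. minor (k i) (B i) (pick (I i)))"
      by (rule minor_block_diag[of n k "\<lambda>i. pick (I i)" p f, OF h f])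
    finally have m: "inverse (det G) * l (pluecker ?K N B') = (\<Prod>i<n. minor (k i) (B i) (pick (I i)))"
      using DG(2) by simp
    have "pluecker (q i) (p i) (Y i) (J i) =
      inverse (d i) * jacobi_sign (k i) (q i) (I i) * minor (k i) (B i) (pick (I i))" if i: "i < n" for i
    proof -
      have "jacobi_sign (k i) (q i) (I i) * jacobi_sign (k i) (q i) (I i) = (1 :: 'k)"
        using I(1,2)[OF i] by (intro jacobi_sign_nz) (simp_all add: kq[OF i])
      then have "inverse (d i) * jacobi_sign (k i) (q i) (I i) * minor (k i) (B i) (pick (I i)) = minor (q i) (Y i) (pick (J i))"
        unfolding Dm[OF i] using Dd[OF i] by (simp add: field_simps)
      then show ?thesis using True i by (simp add: pluecker_def)
    qed
    then have "(\<Prod>i<n. pluecker (q i) (p i) (Y i) (J i)) =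
      (\<Prod>i<n. inverse (d i) * jacobi_sign (k i) (q i) (I i) * minor (k i) (B i) (pick (I i)))"
      by (intro prod.cong) simp_all
    also have "\<dots> = (\<Prod>i<n. inverse (d i)) * ?s * (inverse (det G) * l (pluecker ?K N B'))"
      unfolding m by (simp add: prod.distrib)
    finally show ?thesis by (simp add: mult_ac)
  qed
  then show ?thesis using forms_cmult[OF l(1), of ?s] by (intro bexI[of _ "\<lambda>x. ?s * l x"]) blast+
qed

text \<open>Expand the minor by Cauchy-Binet in \<open>R\<close>. Each minor of the block diagonal
  matrix is either identically 0 or, up to sign, a product of minors of the blocks; by Jacobi's
  formula the latter is one Segre coordinate times a factor shared by all terms.\<close>

lemma subspace_coords_form:
  assumes kq: "\<And>i. i < n \<Longrightarrow> k i + q i = p i" and R: "R \<in> carrier_mat N (offset p n)"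
  shows "\<exists>l \<in> forms 1. \<forall>B Y d G B'. minor_data n k p q R B Y d G B' \<longrightarrow>
    pluecker (offset k n) N (B' :: 'k::field mat) I = (\<Prod>i<n. d i) * det G *
      l (\<lambda>J. if J \<in> extensional {..<n} then \<Prod>i<n. pluecker (q i) (p i) (Y i) (J i) else 0)"
proof (cases "I \<subseteq> {..<N} \<and> card I = offset k n")
  case False
  then show ?thesis by (intro bexI[of _ "\<lambda>x. 0"]) (auto simp: forms_zero pluecker_def)
next
  case True
  let ?K = "offset k n" and ?M = "offset p n"
  let ?z = "\<lambda>Y J. if J \<in> extensional {..<n} then \<Prod>i<n. pluecker (q i) (p i) (Y i :: 'k mat) (J i) else 0"
  have RT: "R\<^sup>T \<in> carrier_mat ?M N" using R by simp
  have fN: "pick I c < N" if "c < ?K" for c using pick_in_set_le[of c I] True that by auto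
  have ex: "\<exists>l \<in> forms 1. \<forall>B Y d G B'. minor_data n k p q R B Y d G B' \<longrightarrow>
    minor ?K (block_diag n k p B) g = (\<Prod>i<n. d i) * l (?z Y)" if g: "g \<in> index_maps ?K ?M" for g
  proof -
    let ?R = "g ` {0..<?K}"
    obtain s where s: "\<forall>B :: 'k mat. minor ?K B g = s * pluecker ?K ?M B ?R" using minor_pluecker[OF g] by (rule exE)
    show ?thesis
    proof (cases "?R \<subseteq> {..<?M} \<and> card ?R = ?K")
      case False
      have "minor ?K B g = 0" for B :: "'k mat" using s unfolding pluecker_def if_not_P[OF False] by simp
      then show ?thesis by (intro bexI[of _ "\<lambda>x. 0"]) (simp_all add: forms_zero)
    next
      case RM: True
      define Ri where "Ri i = {c. c < p i \<and> offset p i + c \<in> ?R}" for i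
      obtain s' where s': "\<forall>B :: nat \<Rightarrow> 'k mat. minor ?K (block_diag n k p B) (pick ?R) =
        s' * (if \<forall>i<n. card (Ri i) = k i then \<Prod>i<n. minor (k i) (B i) (pick (Ri i)) else 0)"
        using minor_block_diag_pick[OF conjunct1[OF RM] conjunct2[OF RM]] unfolding Ri_def by (rule exE)
      have D: "minor ?K (block_diag n k p B) g =
        s * (s' * (if \<forall>i<n. card (Ri i) = k i then \<Prod>i<n. minor (k i) (B i) (pick (Ri i)) else 0))" for B :: "nat \<Rightarrow> 'k mat"
        using s s' RM by (simp add: pluecker_def)
      show ?thesis
      proof (cases "\<forall>i<n. card (Ri i) = k i")
        case False
        have "minor ?K (block_diag n k p B) g = 0" for B :: "nat \<Rightarrow> 'k mat" using D[of B] unfolding if_not_P[OF False] by simp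
        then show ?thesis by (intro bexI[of _ "\<lambda>x. 0"]) (simp_all add: forms_zero)
      next
        case cards: True
        \<comment> \<open>Restricted to \<open>{..<n}\<close>, since Segre coordinates are supported
          on extensional index families.\<close>
        define J where "J = (\<lambda>i\<in>{..<n}. {..<p i} - Ri i)"
        let ?s = "\<Prod>i<n. jacobi_sign (k i) (q i) (Ri i) :: 'k"
        have RiP: "Ri i \<subseteq> {..<p i}" for i by (auto simp: Ri_def)
        have J: "J i \<subseteq> {..<p i}" "card (J i) = q i" "J i = {..<p i} - Ri i" if i: "i < n" for i
        proof -
          show "J i = {..<p i} - Ri i" using i by (simp add: J_def)
          then show "J i \<subseteq> {..<p i}" "card (J i) = q i"
            using card_Diff_subset[of "Ri i" "{..<p i}"] RiP[of i] finite_subset[OF RiP[of i]] cards i kq[OF i] by auto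
        qed
        have "minor ?K (block_diag n k p B) g = (\<Prod>i<n. d i) * (s * s' * ?s * ?z Y J)"
          if dat: "minor_data n k p q R B Y d G B'" for B Y d G and B' :: "'k mat"
        proof -
          have "minor (k i) (B i) (pick (Ri i)) = d i * (jacobi_sign (k i) (q i) (Ri i) * pluecker (q i) (p i) (Y i) (J i))" if i: "i < n" for i
          proof -
            have "minor (k i) (B i) (pick (Ri i)) = d i * jacobi_sign (k i) (q i) (Ri i) * minor (q i) (Y i) (pick ({..<p i} - Ri i))"
              using dat i RiP[of i] cards unfolding minor_data_def by simp
            then show ?thesis using J[OF i] by (simp add: pluecker_def mult.assoc)
          qed
          then have "(\<Prod>i<n. minor (k i) (B i) (pick (Ri i))) = (\<Prod>i<n. d i) * (?s * (\<Prod>i<n. pluecker (q i) (p i) (Y i) (J i)))"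
            by (simp add: prod.distrib)
          moreover have "J \<in> extensional {..<n}" by (simp add: J_def)
          ultimately show ?thesis using D cards by (simp add: mult_ac)
        qed
        moreover have "(\<lambda>x. s * s' * ?s * x J) \<in> forms 1" by (intro forms_cmult forms_var)
        ultimately show ?thesis by (intro bexI[of _ "\<lambda>x. s * s' * ?s * x J"]) blast+
      qed
    qed
  qed
  have "\<forall>g. \<exists>l. g \<in> index_maps ?K ?M \<longrightarrow> l \<in> forms 1 \<and> (\<forall>B Y d G B'. minor_data n k p q R B Y d G B' \<longrightarrow>
    minor ?K (block_diag n k p B) g = (\<Prod>i<n. d i) * l (?z Y))" using ex by blast
  then obtain l where "\<forall>g. g \<in> index_maps ?K ?M \<longrightarrow> l g \<in> forms 1 \<and> (\<forall>B Y d G B'. minor_data n k p q R B Y d G B' \<longrightarrow>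
    minor ?K (block_diag n k p B) g = (\<Prod>i<n. d i) * l g (?z Y))" by (rule choice[THEN exE])
  then have l1: "\<And>g. g \<in> index_maps ?K ?M \<Longrightarrow> l g \<in> forms 1"
    and l2: "\<And>g B Y d G B'. g \<in> index_maps ?K ?M \<Longrightarrow> minor_data n k p q R B Y d G B' \<Longrightarrow>
      minor ?K (block_diag n k p B) g = (\<Prod>i<n. d i) * l g (?z Y)" by blast+
  let ?l = "\<lambda>x. \<Sum>g\<in>index_maps ?K ?M. (\<Prod>c = 0..<?K. R\<^sup>T $$ (g c, pick I c)) * l g x"
  have "?l \<in> forms 1" by (intro forms_sum forms_cmult l1)
  moreover have "pluecker ?K N B' I = (\<Prod>i<n. d i) * det G * ?l (?z Y)"
    if dat: "minor_data n k p q R B Y d G B'" for B Y d G and B' :: "'k mat"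
  proof -
    have G: "G \<in> carrier_mat ?K ?K" and B': "B' = G * (block_diag n k p B * R\<^sup>T)"
      using dat unfolding minor_data_def by simp_all
    have D: "block_diag n k p B \<in> carrier_mat ?K ?M" by simp
    have "pluecker ?K N B' I = minor ?K B' (pick I)" using True by (simp add: pluecker_def)
    also have "\<dots> = det G * minor ?K (block_diag n k p B * R\<^sup>T) (pick I)"
      unfolding B' by (rule minor_mult_left[OF G mult_carrier_mat[OF D RT] fN])
    also have "minor ?K (block_diag n k p B * R\<^sup>T) (pick I) =
      (\<Sum>g\<in>index_maps ?K ?M. (\<Prod>c = 0..<?K. R\<^sup>T $$ (g c, pick I c)) * minor ?K (block_diag n k p B) g)"
      by (rule minor_mult_right[OF D RT fN])
    also have "\<dots> = (\<Sum>g\<in>index_maps ?K ?M. (\<Prod>i<n. d i) * ((\<Prod>c = 0..<?K. R\<^sup>T $$ (g c, pick I c)) * l g (?z Y)))"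
      by (rule sum.cong[OF refl]) (simp add: l2[OF _ dat])
    also have "\<dots> = (\<Prod>i<n. d i) * ?l (?z Y)" by (rule sum_distrib_left[symmetric])
    finally show ?thesis by (simp add: mult_ac)
  qed
  ultimately show ?thesis by (intro bexI[of _ ?l]) blast+
qed

text \<open>\<open>R\<close> is the matrix of \<gamma> relative to the coordinates \<beta>, in which
  the Pluecker coordinates are taken.\<close>

lemma transition_matrix:
  fixes V :: "('k::field, 'v) module"
  assumes V: "vectorspace class_ring V" and \<beta>: "coordinatization V N \<beta>"
    and \<gamma>: "\<gamma> \<in> LinearCombinations.module_hom class_ring (module_vec TYPE('k) M) V"
    and inj: "inj_on \<gamma> (carrier_vec M)"
  shows "\<exists>R \<in> carrier_mat N M. inj_on (\<lambda>v. R *\<^sub>v v) (carrier_vec M) \<and> (\<forall>v \<in> carrier_vec M. \<beta> (R *\<^sub>v v) = \<gamma> v)"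
proof -
  have h: "\<beta> \<in> LinearCombinations.module_hom class_ring (module_vec TYPE('k) N) V" and b: "\<beta> ` carrier_vec N = carrier V"
    using \<beta> by (simp_all add: coordinatization_def bij_betw_def)
  have "\<forall>c. \<exists>x. c < M \<longrightarrow> x \<in> carrier_vec N \<and> \<beta> x = \<gamma> (unit_vec M c)"
  proof
    fix c show "\<exists>x. c < M \<longrightarrow> x \<in> carrier_vec N \<and> \<beta> x = \<gamma> (unit_vec M c)"
    proof (cases "c < M")
      case True
      have "\<gamma> (unit_vec M c) \<in> \<beta> ` carrier_vec N" unfolding b by (rule hom_vecD(1)[OF \<gamma>]) simp
      then show ?thesis by auto
    qed blast
  qed
  then obtain x where x: "\<forall>c. c < M \<longrightarrow> x c \<in> carrier_vec N \<and> \<beta> (x c) = \<gamma> (unit_vec M c)" by (rule choice[THEN exE])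
  define R where "R = mat N M (\<lambda>(r, c). x c $ r)"
  have R: "R \<in> carrier_mat N M" by (simp add: R_def)
  have col: "R *\<^sub>v unit_vec M c = x c" if "c < M" for c
    unfolding mult_mat_unit_vec[OF R that] using x that by (intro eq_vecI) (auto simp: R_def)
  have eq: "\<beta> (R *\<^sub>v v) = \<gamma> v" if v: "v \<in> carrier_vec M" for v
    by (rule hom_vec_ext[OF V hom_comp[OF mult_mat_vec_hom[OF R] h] \<gamma> _ v]) (use x in \<open>simp add: col\<close>)
  have "inj_on (\<lambda>v. R *\<^sub>v v) (carrier_vec M)"
  proof (rule inj_onI)
    fix v w assume vw: "v \<in> carrier_vec M" "w \<in> carrier_vec M" "R *\<^sub>v v = R *\<^sub>v w"
    have "\<gamma> v = \<gamma> w" unfolding eq[OF vw(1), symmetric] eq[OF vw(2), symmetric] vw(3) ..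
    then show "v = w" by (rule inj_onD[OF inj _ vw(1,2)])
  qed
  then show ?thesis using R eq by blast
qed

lemma variety_iso_empty:
  fixes X :: "('x, 'v, 'k::field) pvariety" and Y :: "('y, 'w, 'k) pvariety"
  assumes "points X = {}" "points Y = {}"
  shows "X \<cong>\<^sub>v\<^sub>a\<^sub>r Y"
proof -
  have 1: "variety_morphism X Y undefined"
    by (rule variety_morphism_linear[where L = "\<lambda>w x. 0" and lam = "\<lambda>x. 1"]) (simp_all add: assms forms_zero)
  have 2: "variety_morphism Y X undefined"
    by (rule variety_morphism_linear[where L = "\<lambda>w x. 0" and lam = "\<lambda>x. 1"]) (simp_all add: assms forms_zero)
  show ?thesis unfolding variety_iso_def using 1 2
    by (intro exI[of _ undefined] conjI) (simp_all add: assms)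
qed

text \<open>Packages what \<open>grassmannian_coords\<close> yields, so that points and coordinates
  of a Grassmannian can be handled without knowing the basis chosen in its definition.\<close>

definition pluecker_frame :: "('k::field, 'v) module \<Rightarrow> nat \<Rightarrow> ('k vec \<Rightarrow> 'v) \<Rightarrow> bool" where
  "pluecker_frame V N \<beta> \<longleftrightarrow> coordinatization V N \<beta> \<and> (\<forall>k X.
     (X \<in> points (grassmannian k V) \<longleftrightarrow>
       X \<subseteq> carrier V \<and> (\<exists>B. row_span k N {v \<in> carrier_vec N. \<beta> v \<in> X} B)) \<and>
     (X \<in> points (grassmannian k V) \<longrightarrow>
       (\<exists>B. row_span k N {v \<in> carrier_vec N. \<beta> v \<in> X} B \<and> coords (grassmannian k V) X = pluecker k N B)))"

lemma pluecker_frame_exists: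
  fixes V :: "('k::field, 'v) module"
  assumes "vectorspace class_ring V" "vectorspace.fin_dim class_ring V" "N = vectorspace.dim class_ring V"
  shows "\<exists>\<beta>. pluecker_frame V N \<beta>"
  using grassmannian_coords[OF assms] unfolding pluecker_frame_def fun_eq_iff pluecker_def .

lemma pluecker_frameD:
  assumes "pluecker_frame V N \<beta>"
  shows "coordinatization V N \<beta>"
    "X \<in> points (grassmannian k V) \<longleftrightarrow>
       X \<subseteq> carrier V \<and> (\<exists>B. row_span k N {v \<in> carrier_vec N. \<beta> v \<in> X} B)"
    "X \<in> points (grassmannian k V) \<Longrightarrow>
       \<exists>B. row_span k N {v \<in> carrier_vec N. \<beta> v \<in> X} B \<and> coords (grassmannian k V) X = pluecker k N B"
  using assms unfolding pluecker_frame_def by simp_all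

lemma pluecker_frame_vec: "\<exists>\<beta>. pluecker_frame (module_vec TYPE('k::field) N) N \<beta>"
proof -
  interpret V: vec_space "TYPE('k)" N .
  show ?thesis by (rule pluecker_frame_exists[OF vec_vs V.fin_dim V.dim_is_n[symmetric]])
qed

lemma grassmannian_vec_le:
  assumes "X \<in> points (grassmannian k (module_vec TYPE('k::field) N))"
  shows "k \<le> N"
proof -
  obtain \<beta> where "pluecker_frame (module_vec TYPE('k) N) N \<beta>" using pluecker_frame_vec by (rule exE)
  from pluecker_frameD(3)[OF this assms] obtain B where "row_span k N {v \<in> carrier_vec N. \<beta> v \<in> X} B" by blast
  from conjunct1[OF perp_exists[OF this]] show ?thesis .
qed

lemma coordinatization_preimage:
  assumes "coordinatization U N b" "S \<subseteq> carrier_vec N"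
  shows "{v \<in> carrier_vec N. b v \<in> b ` S} = S"
proof -
  have "inj_on b (carrier_vec N)" using assms(1) by (simp add: coordinatization_def bij_betw_def)
  from inj_on_image_mem_iff[OF this _ assms(2)] show ?thesis using assms(2) by auto
qed

lemma coordinatization_image_preimage:
  assumes "coordinatization U N b" "Z \<subseteq> carrier U"
  shows "b ` {v \<in> carrier_vec N. b v \<in> Z} = Z"
proof -
  have "b ` carrier_vec N = carrier U" using assms(1) by (simp add: coordinatization_def bij_betw_def)
  then show ?thesis using assms(2) by (intro equalityI subsetI) force+
qed

text \<open>A subspace \<open>\<gamma> (\<Oplus>\<^sub>i W i)\<close> with \<open>dim W i = k i\<close> is sent to the annihilators of the \<open>W i\<close>, whose dimension is
  \<open>q i\<close>; up to sign this permutes the Pluecker coordinates.\<close>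

proposition grass_product_iso:
  fixes V :: "('k::field, 'v) module" and X :: "('v set, nat set, 'k) pvariety"
  assumes V: "vectorspace class_ring V" and fd: "vectorspace.fin_dim class_ring V"
    and \<gamma>: "\<gamma> \<in> LinearCombinations.module_hom class_ring (module_vec TYPE('k) (offset p n)) V"
    and inj: "inj_on \<gamma> (carrier_vec (offset p n))"
    and kq: "\<And>i. i < n \<Longrightarrow> k i + q i = p i"
    and pts: "\<And>C. C \<in> points X \<longleftrightarrow> C \<in> points (grassmannian (offset k n) V) \<and>
      (\<exists>W B. (\<forall>i<n. row_span (k i) (p i) (W i) (B i)) \<and>
        C = \<gamma> ` {v \<in> carrier_vec (offset p n). \<forall>i<n. block p i v \<in> W i})"
    and crd: "coords X = coords (grassmannian (offset k n) V)"
  shows "X \<cong>\<^sub>v\<^sub>a\<^sub>r product_variety n (\<lambda>i. grassmannian (q i) (module_vec TYPE('k) (p i)))"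
proof -
  let ?K = "offset k n" and ?M = "offset p n"
  let ?G = "\<lambda>i. grassmannian (q i) (module_vec TYPE('k) (p i))"
  let ?Y = "product_variety n ?G"
  define N where "N = vectorspace.dim class_ring V"
  obtain \<beta> where \<beta>: "pluecker_frame V N \<beta>" using pluecker_frame_exists[OF V fd N_def] by (rule exE)
  note \<beta>D = pluecker_frameD[OF \<beta>]
  have "\<forall>i. \<exists>b. pluecker_frame (module_vec TYPE('k) (p i)) (p i) b" by (intro allI pluecker_frame_vec)
  then obtain b where "\<forall>i. pluecker_frame (module_vec TYPE('k) (p i)) (p i) (b i)" by (rule choice[THEN exE])
  then have b: "pluecker_frame (module_vec TYPE('k) (p i)) (p i) (b i)" for i by (rule spec)
  note bD = pluecker_frameD[OF b]
  obtain R where R: "R \<in> carrier_mat N ?M" and Rinj: "inj_on (\<lambda>v. R *\<^sub>v v) (carrier_vec ?M)"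
    and R\<gamma>': "\<forall>v \<in> carrier_vec ?M. \<beta> (R *\<^sub>v v) = \<gamma> v"
    using transition_matrix[OF V \<beta>D(1) \<gamma> inj] by (elim bexE conjE)
  note R\<gamma> = bspec[OF R\<gamma>']
  obtain L where L: "L \<in> carrier_mat ?M N" "L * R = 1\<^sub>m ?M" using left_inverse[OF R Rinj] by (elim bexE)
  \<comment> \<open>\<open>D\<close> assembles a subspace from its blocks, and \<open>T\<close>
    recovers the blocks. The maps \<phi> and \<psi> combine them with annihilators and with the
    coordinate maps \<open>b i\<close> of the individual factors.\<close>
  define D where "D W = \<gamma> ` {v \<in> carrier_vec ?M. \<forall>i<n. block p i v \<in> W i}" for W :: "nat \<Rightarrow> 'k vec set"
  define T where "T C i = {block p i v | v. v \<in> carrier_vec ?M \<and> \<gamma> v \<in> C}" for C i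
  define \<phi> where "\<phi> C = (\<lambda>i\<in>{..<n}. b i ` perp (p i) (T C i))" for C
  define \<psi> where "\<psi> Z = D (\<lambda>i. perp (p i) {w \<in> carrier_vec (p i). b i w \<in> Z i})" for Z
  have perpc: "perp r W \<subseteq> carrier_vec r" for r and W :: "'k vec set" by (auto simp: perp_def)
  have D_cong: "D W = D W'" if "\<And>i. i < n \<Longrightarrow> W i = W' i" for W W'
    unfolding D_def using that by simp
  have T_D: "T (D W) i = W i" if rs: "\<And>i. i < n \<Longrightarrow> row_span (k i) (p i) (W i) (B i)" and i: "i < n" for W B i
  proof (intro equalityI subsetI)
    fix x assume "x \<in> T (D W) i"
    then obtain v where v: "x = block p i v" "v \<in> carrier_vec ?M" "\<gamma> v \<in> D W" unfolding T_def by blast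
    then obtain w where w: "w \<in> carrier_vec ?M" "\<forall>i<n. block p i w \<in> W i" "\<gamma> v = \<gamma> w" unfolding D_def by blast
    have "v = w" by (rule inj_onD[OF inj w(3) v(2) w(1)])
    then show "x \<in> W i" using v(1) w(2) i by simp
  next
    fix w assume w: "w \<in> W i"
    have wc: "w \<in> carrier_vec (p i)" using w row_spanD(5)[OF rs[OF i]] by blast
    have "block p j (emb n p i w) \<in> W j" if j: "j < n" for j
      unfolding block_emb[of j n w p i, OF j wc] using w row_span_closed(1)[OF rs[OF j]] by simp
    then have g: "\<gamma> (emb n p i w) \<in> D W" unfolding D_def by (intro imageI) simp
    show "w \<in> T (D W) i" unfolding T_def
      by (intro CollectI exI[of _ "emb n p i w"] conjI emb_carrier g block_emb_same[of i n w p, OF i wc, symmetric])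
  qed
  have D_carrier: "D W \<subseteq> carrier V" for W unfolding D_def using hom_vecD(1)[OF \<gamma>] by blast
  have D_span: "row_span ?K N {v \<in> carrier_vec N. \<beta> v \<in> D W} (block_diag n k p B * R\<^sup>T)"
    if rs: "\<And>i. i < n \<Longrightarrow> row_span (k i) (p i) (W i) (B i)" for W B
  proof -
    let ?S = "{v \<in> carrier_vec ?M. \<forall>i<n. block p i v \<in> W i}"
    have "row_span ?K ?M ?S (block_diag n k p B)" by (rule row_span_blocks) (rule rs)
    from row_span_image[OF this R Rinj]
    have rsi: "row_span ?K N ((\<lambda>v. R *\<^sub>v v) ` ?S) (block_diag n k p B * R\<^sup>T)" .
    have S: "(\<lambda>v. R *\<^sub>v v) ` ?S \<subseteq> carrier_vec N" by (rule row_spanD(5)[OF rsi])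
    have "\<beta> ` (\<lambda>v. R *\<^sub>v v) ` ?S = D W" unfolding D_def image_image by (rule image_cong[OF refl]) (simp add: R\<gamma>)
    then show ?thesis using coordinatization_preimage[OF \<beta>D(1) S] rsi by simp
  qed
  have D_point: "D W \<in> points X" if rs: "\<And>i. i < n \<Longrightarrow> row_span (k i) (p i) (W i) (B i)" for W B
  proof -
    have "D W \<in> points (grassmannian ?K V)" unfolding \<beta>D(2) using D_carrier D_span[of W B, OF rs] by blast
    moreover have "\<forall>i<n. row_span (k i) (p i) (W i) (B i)" using rs by simp
    ultimately show ?thesis unfolding pts D_def by blast
  qed
  \<comment> \<open>All matrices belonging to one point are produced together, because the scalar
    factors in both directions must refer to the same \<open>d\<close> and \<open>G\<close>.\<close>
  have main: "\<exists>B Y d G B'. minor_data n k p q R B Y d G B' \<and> coords X C = pluecker ?K N B' \<and>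
      coords ?Y (\<phi> C) = (\<lambda>J. if J \<in> extensional {..<n} then \<Prod>i<n. pluecker (q i) (p i) (Y i) (J i) else 0) \<and>
      \<phi> C \<in> points ?Y \<and> \<psi> (\<phi> C) = C" if C: "C \<in> points X" for C
  proof -
    have Cg: "C \<in> points (grassmannian ?K V)" using C unfolding pts by (rule conjunct1)
    obtain W B where rs': "\<forall>i<n. row_span (k i) (p i) (W i) (B i)" and CD: "C = D W"
      using C unfolding pts D_def by blast
    have rs: "row_span (k i) (p i) (W i) (B i)" if "i < n" for i using rs' that by simp
    have TC: "T C i = W i" if "i < n" for i unfolding CD by (rule T_D[OF rs that])
    have \<phi>i: "\<phi> C i = b i ` perp (p i) (W i)" if i: "i < n" for i using i TC[OF i] by (simp add: \<phi>_def)
    have pre: "{w \<in> carrier_vec (p i). b i w \<in> \<phi> C i} = perp (p i) (W i)" if i: "i < n" for i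
      unfolding \<phi>i[OF i] by (rule coordinatization_preimage[OF bD(1) perpc])
    have point: "\<phi> C i \<in> points (?G i)" if i: "i < n" for i
    proof -
      obtain Y where Y: "row_span (p i - k i) (p i) (perp (p i) (W i)) Y" using perp_exists[OF rs[OF i]] by blast
      have "p i - k i = q i" using kq[OF i] by simp
      then have "row_span (q i) (p i) {w \<in> carrier_vec (p i). b i w \<in> \<phi> C i} Y" unfolding pre[OF i] using Y by simp
      moreover have "b i ` carrier_vec (p i) = carrier (module_vec TYPE('k) (p i))"
        using bD(1)[of i] unfolding coordinatization_def bij_betw_def by blast
      then have "\<phi> C i \<subseteq> carrier (module_vec TYPE('k) (p i))" unfolding \<phi>i[OF i] using perpc by blast
      ultimately show ?thesis unfolding bD(2) by blast
    qed
    have "\<forall>i. \<exists>Y. i < n \<longrightarrow> row_span (q i) (p i) (perp (p i) (W i)) Y \<and> coords (?G i) (\<phi> C i) = pluecker (q i) (p i) Y"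
      using bD(3)[OF point] pre by fastforce
    then obtain Y where Y: "\<forall>i. i < n \<longrightarrow> row_span (q i) (p i) (perp (p i) (W i)) (Y i) \<and> coords (?G i) (\<phi> C i) = pluecker (q i) (p i) (Y i)"
      by (rule choice[THEN exE])
    have "\<forall>i. \<exists>d. i < n \<longrightarrow> d \<noteq> 0 \<and> (\<forall>I \<subseteq> {..<p i}. card I = k i \<longrightarrow> minor (k i) (B i) (pick I)
        = d * jacobi_sign (k i) (q i) I * minor (q i) (Y i) (pick ({..<p i} - I)))"
    proof
      fix i show "\<exists>d. i < n \<longrightarrow> d \<noteq> 0 \<and> (\<forall>I \<subseteq> {..<p i}. card I = k i \<longrightarrow> minor (k i) (B i) (pick I)
        = d * jacobi_sign (k i) (q i) I * minor (q i) (Y i) (pick ({..<p i} - I)))"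
      proof (cases "i < n")
        case True
        then have "row_span (q i) (p i) (perp (p i) (W i)) (Y i)" using Y by simp
        from perp_minor(3)[OF rs[OF True] this] show ?thesis using True by simp
      qed simp
    qed
    then obtain d where d: "\<forall>i. i < n \<longrightarrow> d i \<noteq> 0 \<and> (\<forall>I \<subseteq> {..<p i}. card I = k i \<longrightarrow> minor (k i) (B i) (pick I)
        = d i * jacobi_sign (k i) (q i) I * minor (q i) (Y i) (pick ({..<p i} - I)))" by (rule choice[THEN exE])
    obtain B' where B': "row_span ?K N {v \<in> carrier_vec N. \<beta> v \<in> C} B'" "coords (grassmannian ?K V) C = pluecker ?K N B'"
      using \<beta>D(3)[OF Cg] by (elim exE conjE)
    have "row_span ?K N {v \<in> carrier_vec N. \<beta> v \<in> C} (block_diag n k p B * R\<^sup>T)"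
      unfolding CD using rs by (rule D_span)
    from row_span_unique(2)[OF this B'(1)] obtain G where G: "G \<in> carrier_mat ?K ?K" "det G \<noteq> 0"
      "B' = G * (block_diag n k p B * R\<^sup>T)" by blast
    have "minor_data n k p q R B Y d G B'"
      unfolding minor_data_def using G d row_spanD(1)[OF rs] by simp
    moreover have "coords X C = pluecker ?K N B'" unfolding crd by (rule B'(2))
    moreover have "coords ?Y (\<phi> C) = (\<lambda>J. if J \<in> extensional {..<n} then \<Prod>i<n. pluecker (q i) (p i) (Y i) (J i) else 0)"
    proof
      fix J
      have "(\<Prod>i<n. coords (?G i) (\<phi> C i) (J i)) = (\<Prod>i<n. pluecker (q i) (p i) (Y i) (J i))"
        using Y by (intro prod.cong) simp_all
      then show "coords ?Y (\<phi> C) J = (if J \<in> extensional {..<n} then \<Prod>i<n. pluecker (q i) (p i) (Y i) (J i) else 0)"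
        by (simp add: product_variety_def)
    qed
    moreover have "\<phi> C \<in> (\<Pi>\<^sub>E i\<in>{..<n}. points (?G i))"
      using point by (intro PiE_I) (simp_all add: \<phi>_def)
    then have "\<phi> C \<in> points ?Y" by (simp add: product_variety_def)
    moreover have "\<psi> (\<phi> C) = C"
      unfolding \<psi>_def CD[symmetric]
    proof -
      have "perp (p i) {w \<in> carrier_vec (p i). b i w \<in> \<phi> C i} = W i" if i: "i < n" for i
        unfolding pre[OF i] using perp_exists[OF rs[OF i]] by blast
      then have "D (\<lambda>i. perp (p i) {w \<in> carrier_vec (p i). b i w \<in> \<phi> C i}) = D W" by (rule D_cong)
      then show "D (\<lambda>i. perp (p i) {w \<in> carrier_vec (p i). b i w \<in> \<phi> C i}) = C" unfolding CD .
    qed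
    ultimately show ?thesis by (intro exI conjI)
  qed
  have inverse_point: "\<psi> y \<in> points X \<and> \<phi> (\<psi> y) = y" if y: "y \<in> points ?Y" for y
  proof -
    have yE: "y \<in> (\<Pi>\<^sub>E i\<in>{..<n}. points (?G i))" using y by (simp add: product_variety_def)
    have yi: "y i \<in> points (?G i)" if "i < n" for i using PiE_mem[OF yE] that by simp
    define Z where "Z i = {w \<in> carrier_vec (p i). b i w \<in> y i}" for i
    have "\<exists>B0. row_span (q i) (p i) (Z i) B0" if i: "i < n" for i
      using yi[OF i] unfolding bD(2) Z_def by (rule conjunct2)
    then have Zp: "\<exists>B. row_span (k i) (p i) (perp (p i) (Z i)) B \<and> perp (p i) (perp (p i) (Z i)) = Z i" if i: "i < n" for i
    proof -
      obtain B0 where B0: "row_span (q i) (p i) (Z i) B0" using \<open>\<And>i. i < n \<Longrightarrow> \<exists>B0. row_span (q i) (p i) (Z i) B0\<close>[OF i] by blast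
      have "p i - q i = k i" using kq[OF i] by simp
      then show ?thesis using perp_exists[OF B0] by auto
    qed
    then have "\<forall>i. \<exists>B. i < n \<longrightarrow> row_span (k i) (p i) (perp (p i) (Z i)) B" by blast
    then obtain B where "\<forall>i. i < n \<longrightarrow> row_span (k i) (p i) (perp (p i) (Z i)) (B i)" by (rule choice[THEN exE])
    then have B: "row_span (k i) (p i) (perp (p i) (Z i)) (B i)" if "i < n" for i using that by simp
    have \<psi>y: "\<psi> y = D (\<lambda>i. perp (p i) (Z i))" by (simp add: \<psi>_def Z_def)
    have "\<psi> y \<in> points X" unfolding \<psi>y using B by (rule D_point)
    moreover have "\<phi> (\<psi> y) = y"
    proof
      fix i
      show "\<phi> (\<psi> y) i = y i"
      proof (cases "i < n")
        case True
        have "\<phi> (\<psi> y) i = b i ` perp (p i) (T (\<psi> y) i)" using True by (simp add: \<phi>_def)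
        also have "T (\<psi> y) i = perp (p i) (Z i)" unfolding \<psi>y by (rule T_D[OF B True])
        also have "perp (p i) (perp (p i) (Z i)) = Z i" using Zp[OF True] by blast
        also have "b i ` Z i = y i"
        proof -
          have "y i \<subseteq> carrier (module_vec TYPE('k) (p i))" using yi[OF True] unfolding bD(2) by (rule conjunct1)
          then show ?thesis unfolding Z_def by (rule coordinatization_image_preimage[OF bD(1)])
        qed
        finally show ?thesis .
      next
        case False
        then show ?thesis using PiE_arb[OF yE, of i] by (simp add: \<phi>_def)
      qed
    qed
    ultimately show ?thesis ..
  qed
  \<comment> \<open>For each coordinate the form is fixed here once for all points; the dependence
    on the point sits in the scalars made of \<open>d\<close> and \<open>G\<close>, which are the
    same for all coordinates.\<close>
  define fw where "fw J l \<longleftrightarrow> (\<forall>B Y d G B'. minor_data n k p q R B Y d G B' \<longrightarrow>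
    (\<Prod>i<n. pluecker (q i) (p i) (Y i) (J i)) =
    (\<Prod>i<n. inverse (d i)) * inverse (det G) * l (pluecker ?K N B'))" for J and l :: "(nat set \<Rightarrow> 'k) \<Rightarrow> 'k"
  define bw where "bw I l \<longleftrightarrow> (\<forall>B Y d G B'. minor_data n k p q R B Y d G B' \<longrightarrow>
    pluecker ?K N B' I = (\<Prod>i<n. d i) * det G *
      l (\<lambda>J. if J \<in> extensional {..<n} then \<Prod>i<n. pluecker (q i) (p i) (Y i) (J i) else 0))"
    for I and l :: "((nat \<Rightarrow> nat set) \<Rightarrow> 'k) \<Rightarrow> 'k"
  have "\<exists>l\<in>forms 1. fw J l" for J unfolding fw_def by (rule product_coords_form[OF kq R L])
  then have "\<forall>J. \<exists>l. l \<in> forms 1 \<and> fw J l" by blast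
  then obtain l where l: "\<forall>J. l J \<in> forms 1 \<and> fw J (l J)" by (rule choice[THEN exE])
  have "\<exists>l\<in>forms 1. bw I l" for I unfolding bw_def by (rule subspace_coords_form[OF kq R])
  then have "\<forall>I. \<exists>l. l \<in> forms 1 \<and> bw I l" by blast
  then obtain l' where l': "\<forall>I. l' I \<in> forms 1 \<and> bw I (l' I)" by (rule choice[THEN exE])
  have nz: "(\<Prod>i<n. d i) \<noteq> 0" "(\<Prod>i<n. inverse (d i)) \<noteq> 0" "det G \<noteq> 0"
    if "minor_data n k p q R B Y d G B'" for B Y d G B'
    using that unfolding minor_data_def by auto
  \<comment> \<open>At index families that are not extensional the Segre coordinate is 0 by
    definition, so the form there must be the zero form.\<close>
  define f where "f J = (if J \<in> extensional {..<n} then l J else (\<lambda>x. 0))" for J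
  have "\<forall>C. \<exists>c. C \<in> points X \<longrightarrow> c \<noteq> 0 \<and> (\<forall>J. coords ?Y (\<phi> C) J = c * f J (coords X C))"
  proof
    fix C show "\<exists>c. C \<in> points X \<longrightarrow> c \<noteq> 0 \<and> (\<forall>J. coords ?Y (\<phi> C) J = c * f J (coords X C))"
    proof (cases "C \<in> points X")
      case True
      obtain B Y d G B' where dat: "minor_data n k p q R B Y d G B'" "coords X C = pluecker ?K N B'"
        "coords ?Y (\<phi> C) = (\<lambda>J. if J \<in> extensional {..<n} then \<Prod>i<n. pluecker (q i) (p i) (Y i) (J i) else 0)"
        using main[OF True] by (elim exE conjE)
      have "coords ?Y (\<phi> C) J = (\<Prod>i<n. inverse (d i)) * inverse (det G) * f J (coords X C)" for J
        unfolding dat(2,3) f_def using l dat(1) unfolding fw_def by simp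
      moreover have "(\<Prod>i<n. inverse (d i)) * inverse (det G) \<noteq> 0" using nz[OF dat(1)] by simp
      ultimately show ?thesis by blast
    qed blast
  qed
  then obtain c where c: "\<forall>C. C \<in> points X \<longrightarrow> c C \<noteq> 0 \<and> (\<forall>J. coords ?Y (\<phi> C) J = c C * f J (coords X C))"
    by (rule choice[THEN exE])
  have "variety_morphism X ?Y \<phi>"
  proof (rule variety_morphism_linear[where L = f and lam = c])
    show "\<phi> C \<in> points ?Y" if "C \<in> points X" for C using main[OF that] by (elim exE conjE)
    show "f J \<in> forms 1" for J using l by (simp add: f_def forms_zero)
  qed (use c in simp_all)
  moreover have "\<forall>y. \<exists>c. y \<in> points ?Y \<longrightarrow> c \<noteq> 0 \<and> (\<forall>I. coords X (\<psi> y) I = c * l' I (coords ?Y y))"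
  proof
    fix y show "\<exists>c. y \<in> points ?Y \<longrightarrow> c \<noteq> 0 \<and> (\<forall>I. coords X (\<psi> y) I = c * l' I (coords ?Y y))"
    proof (cases "y \<in> points ?Y")
      case True
      \<comment> \<open>The data for \<open>\<psi> y\<close> come from \<open>main\<close>; the
        coordinates of \<open>y\<close> enter because \<phi> takes \<open>\<psi> y\<close> back to
        \<open>y\<close>.\<close>
      note bk = inverse_point[OF True]
      obtain B Y d G B' where dat: "minor_data n k p q R B Y d G B'" "coords X (\<psi> y) = pluecker ?K N B'"
        "coords ?Y (\<phi> (\<psi> y)) = (\<lambda>J. if J \<in> extensional {..<n} then \<Prod>i<n. pluecker (q i) (p i) (Y i) (J i) else 0)"
        using main[OF conjunct1[OF bk]] by (elim exE conjE)
      have "coords X (\<psi> y) I = (\<Prod>i<n. d i) * det G * l' I (coords ?Y (\<phi> (\<psi> y)))" for I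
        unfolding dat(2,3) using l' dat(1) unfolding bw_def by simp
      then have "coords X (\<psi> y) I = (\<Prod>i<n. d i) * det G * l' I (coords ?Y y)" for I
        unfolding conjunct2[OF bk] .
      moreover have "(\<Prod>i<n. d i) * det G \<noteq> 0" using nz[OF dat(1)] by simp
      ultimately show ?thesis by blast
    qed blast
  qed
  then obtain c' where c': "\<forall>y. y \<in> points ?Y \<longrightarrow> c' y \<noteq> 0 \<and> (\<forall>I. coords X (\<psi> y) I = c' y * l' I (coords ?Y y))"
    by (rule choice[THEN exE])
  have "variety_morphism ?Y X \<psi>"
  proof (rule variety_morphism_linear[where L = l' and lam = c'])
    show "\<psi> y \<in> points X" if "y \<in> points ?Y" for y using inverse_point[OF that] by (rule conjunct1)
    show "l' I \<in> forms 1" for I using l' by simp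
  qed (use c' in simp_all)
  moreover have "\<psi> (\<phi> C) = C" if "C \<in> points X" for C using main[OF that] by (elim exE conjE)
  moreover have "\<phi> (\<psi> y) = y" if "y \<in> points ?Y" for y using inverse_point[OF that] by (rule conjunct2)
  ultimately show ?thesis unfolding variety_iso_def by (intro exI[of _ \<phi>] exI[of _ \<psi>] conjI ballI)
qed

section \<open>Submodules of the radical of a projective cover\<close>

lemma module_iso_trans:
  assumes "module_iso R M N" "module_iso R N Q"
  shows "module_iso R M Q"
proof -
  obtain f where f: "f \<in> LinearCombinations.module_hom R M N" "bij_betw f (carrier M) (carrier N)"
    using assms(1) unfolding module_iso_def by (elim bexE)
  obtain g where g: "g \<in> LinearCombinations.module_hom R N Q" "bij_betw g (carrier N) (carrier Q)"
    using assms(2) unfolding module_iso_def by (elim bexE)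
  show ?thesis unfolding module_iso_def
  proof (rule bexI)
    show "bij_betw (\<lambda>x. g (f x)) (carrier M) (carrier Q)" using bij_betw_trans[OF f(2) g(2)] unfolding comp_def .
    show "(\<lambda>x. g (f x)) \<in> LinearCombinations.module_hom R M Q" by (rule hom_comp[OF f(1) g(1)])
  qed
qed

context typed_simples
begin

text \<open>The radical kills every \<open>S i\<close>, so all the characters vanish on it.\<close>

lemma radical_kills_graded:
  assumes M: "left_module A M" and g: "graded M p \<gamma>" and a: "a \<in> jacobson_radical A" and x: "x \<in> carrier M"
  shows "a \<odot>\<^bsub>M\<^esub> x = \<zero>\<^bsub>M\<^esub>"
proof -
  interpret M: left_module A M by (rule M)
  note gD = gradedD[OF g]
  have aA: "a \<in> carrier A" using a by (simp add: jacobson_radical_def)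
  have "x \<in> \<gamma> ` carrier_vec (offset p n)" unfolding gD(4) by (rule x)
  then obtain v where v: "x = \<gamma> v" "v \<in> carrier_vec (offset p n)" by (rule imageE)
  have chi0: "chi (\<sigma> i) a = 0" if i: "i < n" for i
  proof -
    interpret S: left_module A "S i" by (rule S_module[OF i])
    obtain y where y: "y \<in> carrier (S i)" "y \<noteq> \<zero>\<^bsub>S i\<^esub>" using simple_nonzero[OF simple_S[OF i]] by (elim bexE)
    show ?thesis
      by (rule chi_eq[OF i aA y]) (simp add: jacobson_kills_simple[OF simple_S[OF i] y(1) a] scal_zero y(1))
  qed
  have "act p a v = act p (scal 0) v"
    by (rule eq_vec_blocks[of _ p n]) (simp_all add: block_act chi0 chi_scal)
  then have "a \<odot>\<^bsub>M\<^esub> x = scal 0 \<odot>\<^bsub>M\<^esub> x"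
    unfolding v(1) gD(7)[OF aA v(2)] gD(7)[OF scal_closed v(2)] by (rule arg_cong)
  then show ?thesis using x by (simp add: scal_zero)
qed

text \<open>The top of the realizing module \<open>M\<close> is a quotient of \<open>M\<close> in
  which \<open>S i\<close> has multiplicity \<open>t i\<close>. Hence the truncated difference
  \<open>d i - t i\<close> is an honest one.\<close>

lemma realizable_le:
  fixes T :: "('a, 't) module"
  assumes "realizable A n S T d" and T: "module_iso A T (semisimple_sum n S t)" and i: "i < n"
  shows "t i \<le> d i"
proof -
  obtain M :: "('a, 'k vec) module" where M: "left_module A M"
    and iso: "module_iso A (quotient_module M (ideal_smult (jacobson_radical A) M)) T"
    and dv: "has_dimension_vector A n S M d"
    using assms(1) unfolding realizable_def by (elim exE conjE)
  note J = radical_submodule[OF M]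
  note Q = quotient_module_props(1)[OF M J]
  obtain \<gamma> where \<gamma>: "graded (quotient_module M (ideal_smult (jacobson_radical A) M)) t \<gamma>"
    using semisimple_graded[OF Q module_iso_trans[OF iso T]] by (rule exE)
  note E = e_props[OF type_less[OF i]]
  have dm: "fdm M" "d i = mult_dim (e (\<sigma> i)) M" using dv i unfolding dimension_vector_iff[OF M] by simp_all
  show ?thesis using mult_quotient[OF M J dm(1) E(1,2)] graded_dims(2)[OF Q \<gamma> i] dm(2) by simp
qed

lemma graded_dim:
  assumes M: "left_module A M" and g: "graded M p \<gamma>"
  shows "mult_dim \<one> M = offset p n"
  unfolding mult_dim_one[OF M] by (rule coordinatization_dim(2)[OF restrict_scalars_vectorspace[OF M] gradedD(1)[OF g]])

lemma projective_cover_dims: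
  assumes cover: "projective_cover A P T" and T: "left_module A T" "module_iso A T (semisimple_sum n S t)"
    and g: "graded (P\<lparr>carrier := ideal_smult (jacobson_radical A) P\<rparr>) p \<gamma>"
  shows "fdm P" "vectorspace.dim class_ring (restrict_scalars A P) = offset p n + offset t n"
    "\<And>i. i < n \<Longrightarrow> mult_dim (e (\<sigma> i)) P = p i + t i"
proof -
  let ?J = "ideal_smult (jacobson_radical A) P"
  have P: "left_module A P" using cover by (simp add: projective_cover_def projective_module_def)
  obtain f where f: "f \<in> LinearCombinations.module_hom A P T" "f ` carrier P = carrier T"
    and sup: "superfluous A P {x \<in> carrier P. f x = \<zero>\<^bsub>T\<^esub>}"
    using cover unfolding projective_cover_def by (elim conjE bexE)
  obtain \<delta> where \<delta>: "graded T t \<delta>" using semisimple_graded[OF T] by (rule exE)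
  have J: "left_module A (P\<lparr>carrier := ?J\<rparr>)" by (rule submodule_left_module[OF P radical_submodule[OF P]])
  have ker: "{x \<in> carrier P. f x = \<zero>\<^bsub>T\<^esub>} = ?J"
  proof (rule equalityI)
    show "{x \<in> carrier P. f x = \<zero>\<^bsub>T\<^esub>} \<subseteq> ?J" by (rule superfluous_subset_radical[OF P sup])
    show "?J \<subseteq> {x \<in> carrier P. f x = \<zero>\<^bsub>T\<^esub>}"
    proof (rule ideal_smult_subset[OF P kernel_submodule[OF P T(1) f(1)]])
      fix a x assume a: "a \<in> jacobson_radical A" and x: "x \<in> carrier P"
      have aA: "a \<in> carrier A" using a by (simp add: jacobson_radical_def)
      have "f (a \<odot>\<^bsub>P\<^esub> x) = a \<odot>\<^bsub>T\<^esub> f x" by (rule module_homD(3)[OF f(1) aA x])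
      also have "\<dots> = \<zero>\<^bsub>T\<^esub>" by (rule radical_kills_graded[OF T(1) \<delta> a module_homD(1)[OF f(1) x]])
      finally show "a \<odot>\<^bsub>P\<^esub> x \<in> {x \<in> carrier P. f x = \<zero>\<^bsub>T\<^esub>}"
        using left_module.smult_closed[OF P aA x] by simp
    qed
  qed
  show fdP: "fdm P"
    using fdm_extension[OF P T(1) f] graded_dims(1)[OF J g] graded_dims(1)[OF T(1) \<delta>] unfolding ker by simp
  note me = mult_exact[OF P T(1) f fdP, unfolded ker]
  show "vectorspace.dim class_ring (restrict_scalars A P) = offset p n + offset t n"
    using me[of \<one>] unfolding graded_dim[OF J g] graded_dim[OF T(1) \<delta>] mult_dim_one[OF P] by simp
  show "mult_dim (e (\<sigma> i)) P = p i + t i" if i: "i < n" for i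
    using me[OF e_props(1,2)[OF type_less[OF i]]] graded_dims(2)[OF J g i] graded_dims(2)[OF T(1) \<delta> i] by simp
qed

text \<open>By additivity the multiplicity of \<open>S i\<close> in \<open>P/C\<close> is
  \<open>p i + t i - k i\<close>, where \<open>k i\<close> is the dimension of the
  \<open>i\<close>-th block of \<open>C\<close>. The condition on the dimension vector is written
  additively to keep clear of truncated subtraction.\<close>

lemma grass_top_points:
  assumes P: "left_module A P" and fdP: "fdm P"
    and g: "graded (P\<lparr>carrier := ideal_smult (jacobson_radical A) P\<rparr>) p \<gamma>"
    and mP: "\<And>i. i < n \<Longrightarrow> mult_dim (e (\<sigma> i)) P = p i + t i" and td: "\<And>i. i < n \<Longrightarrow> t i \<le> d i"
  shows "C \<in> points (grass_top_dim A n S P d) \<longleftrightarrow>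
    C \<in> points (grassmannian (vectorspace.dim class_ring (restrict_scalars A P) - offset d n) (restrict_scalars A P)) \<and>
    (\<exists>k X B. (\<forall>i<n. k i + (d i - t i) = p i) \<and> (\<forall>i<n. row_span (k i) (p i) (X i) (B i)) \<and>
      C = \<gamma> ` {v \<in> carrier_vec (offset p n). \<forall>i<n. block p i v \<in> X i})"
proof -
  let ?J = "ideal_smult (jacobson_radical A) P"
  let ?G = "grassmannian (vectorspace.dim class_ring (restrict_scalars A P) - offset d n) (restrict_scalars A P)"
  note Js = radical_submodule[OF P]
  have J: "left_module A (P\<lparr>carrier := ?J\<rparr>)" by (rule submodule_left_module[OF P Js])
  note sub = submodule_of_submodule[OF P Js]
  have pts: "C \<in> points (grass_top_dim A n S P d) \<longleftrightarrow> C \<in> points ?G \<and>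
    Module.submodule C A (P\<lparr>carrier := ?J\<rparr>) \<and> has_dimension_vector A n S (quotient_module P C) d"
    unfolding sub by (simp add: grass_top_dim_def Let_def offset_def conj_assoc)
  have dims: "has_dimension_vector A n S (quotient_module P C) d \<longleftrightarrow> (\<forall>i<n. k i + (d i - t i) = p i)"
    if C: "Module.submodule C A (P\<lparr>carrier := ?J\<rparr>)" and rs: "\<forall>i<n. row_span (k i) (p i) (X i) (B i)"
      and CX: "C = \<gamma> ` {v \<in> carrier_vec (offset p n). \<forall>i<n. block p i v \<in> X i}" for k X B
  proof -
    have CP: "Module.submodule C A P" using C unfolding sub by (rule conjunct1)
    note Q = quotient_module_props(1)[OF P CP]
    have eq: "p i + t i = k i + mult_dim (e (\<sigma> i)) (quotient_module P C)" if i: "i < n" for i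
    proof -
      have "mult_dim (e (\<sigma> i)) (P\<lparr>carrier := ?J\<rparr>\<lparr>carrier := C\<rparr>) = k i"
        unfolding CX by (rule graded_sub(2)[where B = B, OF J g _ i]) (use rs in simp)
      then show ?thesis
        using mult_quotient[OF P CP fdP e_props(1,2)[OF type_less[OF i]]] mP[OF i] by simp
    qed
    have "d i = mult_dim (e (\<sigma> i)) (quotient_module P C) \<longleftrightarrow> k i + (d i - t i) = p i" if "i < n" for i
      using td[OF that] eq[OF that] by arith
    then show ?thesis unfolding dimension_vector_iff[OF Q] using fdm_quotient[OF P CP fdP] by simp
  qed
  show ?thesis unfolding pts
  proof (intro conj_cong refl iffI)
    assume "Module.submodule C A (P\<lparr>carrier := ?J\<rparr>) \<and> has_dimension_vector A n S (quotient_module P C) d"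
    then have C: "Module.submodule C A (P\<lparr>carrier := ?J\<rparr>)" and dv: "has_dimension_vector A n S (quotient_module P C) d"
      by (rule conjunct1, rule conjunct2)
    obtain k X B where rs: "\<forall>i<n. row_span (k i) (p i) (X i) (B i)"
      and CX: "C = \<gamma> ` {v \<in> carrier_vec (offset p n). \<forall>i<n. block p i v \<in> X i}"
      using graded_decomposition[OF J g C] by (elim exE conjE)
    show "\<exists>k X B. (\<forall>i<n. k i + (d i - t i) = p i) \<and> (\<forall>i<n. row_span (k i) (p i) (X i) (B i)) \<and>
      C = \<gamma> ` {v \<in> carrier_vec (offset p n). \<forall>i<n. block p i v \<in> X i}"
      by (intro exI[of _ k] exI[of _ X] exI[of _ B] conjI iffD1[OF dims[OF C rs CX] dv] rs CX)
  next
    assume "\<exists>k X B. (\<forall>i<n. k i + (d i - t i) = p i) \<and> (\<forall>i<n. row_span (k i) (p i) (X i) (B i)) \<and>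
      C = \<gamma> ` {v \<in> carrier_vec (offset p n). \<forall>i<n. block p i v \<in> X i}"
    then obtain k X B where kq: "\<forall>i<n. k i + (d i - t i) = p i" and rs: "\<forall>i<n. row_span (k i) (p i) (X i) (B i)"
      and CX: "C = \<gamma> ` {v \<in> carrier_vec (offset p n). \<forall>i<n. block p i v \<in> X i}" by (elim exE conjE)
    have C: "Module.submodule C A (P\<lparr>carrier := ?J\<rparr>)"
      unfolding CX by (rule graded_sub(1)[where B = B and k = k, OF J g]) (use rs in simp)
    show "Module.submodule C A (P\<lparr>carrier := ?J\<rparr>) \<and> has_dimension_vector A n S (quotient_module P C) d"
      by (intro conjI C iffD2[OF dims[OF C rs CX] kq])
  qed
qed

lemma grass_top_iso:
  assumes T: "left_module A T" "module_iso A T (semisimple_sum n S t)" and real: "realizable A n S T d"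
    and cover: "projective_cover A P T"
    and iso: "module_iso A (P\<lparr>carrier := ideal_smult (jacobson_radical A) P\<rparr>) (semisimple_sum n S p)"
  shows "grass_top_dim A n S P d
    \<cong>\<^sub>v\<^sub>a\<^sub>r product_variety n (\<lambda>i. grassmannian (d i - t i) (module_vec TYPE('k) (p i)))"
proof -
  let ?J = "ideal_smult (jacobson_radical A) P" and ?V = "restrict_scalars A P"
  let ?G = "\<lambda>i. grassmannian (d i - t i) (module_vec TYPE('k) (p i))"
  have P: "left_module A P" using cover by (simp add: projective_cover_def projective_module_def)
  note Js = radical_submodule[OF P]
  have JP: "?J \<subseteq> carrier P" by (rule left_module.submoduleD(1)[OF P Js])
  have J: "left_module A (P\<lparr>carrier := ?J\<rparr>)" by (rule submodule_left_module[OF P Js])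
  obtain \<gamma> where g: "graded (P\<lparr>carrier := ?J\<rparr>) p \<gamma>" using semisimple_graded[OF J iso] by (rule exE)
  note cd = projective_cover_dims[OF cover T g]
  have td: "t i \<le> d i" if "i < n" for i by (rule realizable_le[OF real T(2) that])
  have pts: "C \<in> points (grass_top_dim A n S P d) \<longleftrightarrow>
    C \<in> points (grassmannian (vectorspace.dim class_ring ?V - offset d n) ?V) \<and>
    (\<exists>k X B. (\<forall>i<n. k i + (d i - t i) = p i) \<and> (\<forall>i<n. row_span (k i) (p i) (X i) (B i)) \<and>
      C = \<gamma> ` {v \<in> carrier_vec (offset p n). \<forall>i<n. block p i v \<in> X i})" for C
    by (rule grass_top_points[where t = t and d = d and p = p, OF P cd(1) g]) (erule cd(3), erule td)
  show ?thesis
  proof (cases "\<forall>i<n. d i - t i \<le> p i")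
    \<comment> \<open>Some factor is a Grassmannian of subspaces larger than the ambient space, and
      no \<open>k j\<close> can solve the dimension condition: both varieties are empty.\<close>
    case False
    then obtain j where j: "j < n" "\<not> d j - t j \<le> p j" by blast
    show ?thesis
    proof (rule variety_iso_empty)
      have "C \<notin> points (grass_top_dim A n S P d)" for C
      proof
        assume "C \<in> points (grass_top_dim A n S P d)"
        then have "\<exists>k X B. (\<forall>i<n. k i + (d i - t i) = p i) \<and> (\<forall>i<n. row_span (k i) (p i) (X i) (B i)) \<and>
          C = \<gamma> ` {v \<in> carrier_vec (offset p n). \<forall>i<n. block p i v \<in> X i}" unfolding pts by (rule conjunct2)
        then obtain k where "\<forall>i<n. k i + (d i - t i) = p i" by (elim exE conjE)
        then have "k j + (d j - t j) = p j" using j(1) by simp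
        then show False using j(2) by simp
      qed
      then show "points (grass_top_dim A n S P d) = {}" by blast
      have "y \<notin> points (product_variety n ?G)" for y
      proof
        assume "y \<in> points (product_variety n ?G)"
        then have "y \<in> (\<Pi>\<^sub>E i\<in>{..<n}. points (?G i))" by (simp add: product_variety_def)
        then have "y j \<in> points (?G j)" by (rule PiE_mem) (simp add: j(1))
        from grassmannian_vec_le[OF this] show False using j(2) by simp
      qed
      then show "points (product_variety n ?G) = {}" by blast
    qed
  next
    case True
    define k where "k i = p i - (d i - t i)" for i
    have kq: "k i + (d i - t i) = p i" if "i < n" for i using True that by (simp add: k_def)
    have kd: "k i + d i = p i + t i" if "i < n" for i using kq[OF that] td[OF that] by simp
    \<comment> \<open>The ambient dimension in \<open>grass_top_dim\<close> is thus the sum of the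
      block dimensions, as \<open>grass_product_iso\<close> expects.\<close>
    have "offset k n + offset d n = offset p n + offset t n"
      unfolding offset_def sum.distrib[symmetric] by (rule sum.cong) (simp_all add: kd)
    then have K: "vectorspace.dim class_ring ?V - offset d n = offset k n" using cd(2) by simp
    show ?thesis
    proof (rule grass_product_iso[where V = ?V and \<gamma> = \<gamma> and k = k])
      show "vectorspace class_ring ?V" by (rule restrict_scalars_vectorspace[OF P])
      show "vectorspace.fin_dim class_ring ?V" using cd(1) by (simp add: fdm_def)
      show "\<gamma> \<in> LinearCombinations.module_hom class_ring (module_vec TYPE('k) (offset p n)) ?V"
      proof (rule hom_vecI)
        show "\<gamma> v \<in> carrier ?V" if "v \<in> carrier_vec (offset p n)" for v
          using subsetD[OF JP] gradedD(5)[OF g that] by simp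
        show "\<gamma> (v + w) = \<gamma> v \<oplus>\<^bsub>?V\<^esub> \<gamma> w" if "v \<in> carrier_vec (offset p n)" "w \<in> carrier_vec (offset p n)" for v w
          using gradedD(6)[OF g that] by simp
        show "\<gamma> (c \<cdot>\<^sub>v v) = c \<odot>\<^bsub>?V\<^esub> \<gamma> v" if "v \<in> carrier_vec (offset p n)" for c v
          using hom_vecD(3)[OF gradedD(2)[OF g] that, of c] by simp
      qed
      show "inj_on \<gamma> (carrier_vec (offset p n))" by (rule gradedD(3)[OF g])
      show "coords (grass_top_dim A n S P d) = coords (grassmannian (offset k n) ?V)"
        unfolding K[symmetric] by (simp add: grass_top_dim_def Let_def offset_def)
      fix C
      have eq: "(\<exists>k' X B. (\<forall>i<n. k' i + (d i - t i) = p i) \<and> (\<forall>i<n. row_span (k' i) (p i) (X i) (B i)) \<and>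
          C = \<gamma> ` {v \<in> carrier_vec (offset p n). \<forall>i<n. block p i v \<in> X i}) \<longleftrightarrow>
        (\<exists>X B. (\<forall>i<n. row_span (k i) (p i) (X i) (B i)) \<and>
          C = \<gamma> ` {v \<in> carrier_vec (offset p n). \<forall>i<n. block p i v \<in> X i})"
      proof (rule iffI, goal_cases)
        case 1
        then obtain k' X B where k': "\<forall>i<n. k' i + (d i - t i) = p i" and rs: "\<forall>i<n. row_span (k' i) (p i) (X i) (B i)"
          and C: "C = \<gamma> ` {v \<in> carrier_vec (offset p n). \<forall>i<n. block p i v \<in> X i}" by (elim exE conjE)
        have "k' i = k i" if i: "i < n" for i
        proof -
          have "k' i + (d i - t i) = p i" using k' i by simp
          then show ?thesis using kq[OF i] by linarith
        qed
        then have "\<forall>i<n. row_span (k i) (p i) (X i) (B i)" using rs by simp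
        then show ?case using C by (intro exI conjI)
      next
        case 2
        then obtain X B where rs: "\<forall>i<n. row_span (k i) (p i) (X i) (B i)"
          and C: "C = \<gamma> ` {v \<in> carrier_vec (offset p n). \<forall>i<n. block p i v \<in> X i}" by (elim exE conjE)
        have "\<forall>i<n. k i + (d i - t i) = p i" using kq by simp
        then show ?case using rs C by (intro exI conjI)
      qed
      show "C \<in> points (grass_top_dim A n S P d) \<longleftrightarrow> C \<in> points (grassmannian (offset k n) ?V) \<and>
        (\<exists>X B. (\<forall>i<n. row_span (k i) (p i) (X i) (B i)) \<and>
          C = \<gamma> ` {v \<in> carrier_vec (offset p n). \<forall>i<n. block p i v \<in> X i})"
        unfolding pts K eq ..
    qed (rule kq)
  qed
qed

end

theorem mainTheorem12:
  fixes \<Lambda> :: "('k::alg_closed_field, 'a) module"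
    and S :: "nat \<Rightarrow> ('a, 's) module"
    and T :: "('a, 't) module"
    and P :: "('a, 'p) module"
    and n :: nat
    and t d p :: "nat \<Rightarrow> nat"
  assumes "fd_algebra \<Lambda>"
    and "basic_ring \<Lambda>"
    and "ideal_prod \<Lambda> (jacobson_radical \<Lambda>) (jacobson_radical \<Lambda>) = {\<zero>\<^bsub>\<Lambda>\<^esub>}"
    and "simples_up_to_iso \<Lambda> n S"
    and "left_module \<Lambda> T"
    and "module_iso \<Lambda> T (semisimple_sum n S t)"
    and "realizable \<Lambda> n S T d"
    and "projective_cover \<Lambda> P T"
    and "module_iso \<Lambda> (P\<lparr>carrier := ideal_smult (jacobson_radical \<Lambda>) P\<rparr>) (semisimple_sum n S p)"
  shows "grass_top_dim \<Lambda> n S P d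
    \<cong>\<^sub>v\<^sub>a\<^sub>r product_variety n (\<lambda>i. grassmannian (d i - t i) (module_vec TYPE('k) (p i)))"
proof -
  obtain m e where e: "\<forall>i<(m::nat). primitive_idempotent \<Lambda> (e i)"
    "\<forall>i<m. \<forall>j<m. i \<noteq> j \<longrightarrow> e i \<otimes>\<^bsub>\<Lambda>\<^esub> e j = \<zero>\<^bsub>\<Lambda>\<^esub>" "finsum \<Lambda> e {..<m} = \<one>\<^bsub>\<Lambda>\<^esub>"
    "\<forall>i<m. \<forall>j<m. i \<noteq> j \<longrightarrow> \<not> module_iso \<Lambda> (principal_module \<Lambda> (e i)) (principal_module \<Lambda> (e j))"
    using assms(2) unfolding basic_ring_def by (elim exE conjE)
  interpret basic_fd_algebra \<Lambda> m e
    by (intro basic_fd_algebra.intro basic_fd_algebra_axioms.intro assms(1)) (use e in simp_all)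
  have simple: "simple_module \<Lambda> (S i)" if "i < n" for i using assms(4) that by (simp add: simples_up_to_iso_def)
  \<comment> \<open>The modules \<open>S i\<close> are pairwise non-isomorphic, and simple modules
    of equal type are isomorphic; so the types chosen here are distinct.\<close>
  have "\<exists>j. i < n \<longrightarrow> has_type j (S i)" for i
    by (cases "i < n") (use simple_has_type[OF simple, of i] in simp_all)
  then have "\<forall>i. \<exists>j. i < n \<longrightarrow> has_type j (S i)" by (rule allI)
  then obtain \<sigma> where "\<forall>i. i < n \<longrightarrow> has_type (\<sigma> i) (S i)" by (rule choice[THEN exE])
  then have \<sigma>: "has_type (\<sigma> i) (S i)" if "i < n" for i using that by simp
  interpret typed_simples \<Lambda> m e n S \<sigma>
  proof (intro typed_simples.intro typed_simples_axioms.intro basic_fd_algebra_axioms)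
    show "simple_module \<Lambda> (S i)" if "i < n" for i by (rule simple[OF that])
    show "has_type (\<sigma> i) (S i)" if "i < n" for i by (rule \<sigma>[OF that])
    show "i = j" if ij: "i < n" "j < n" "\<sigma> i = \<sigma> j" for i j
    proof (rule ccontr)
      assume "i \<noteq> j"
      then have "\<not> module_iso \<Lambda> (S i) (S j)" using assms(4) ij(1,2) by (simp add: simples_up_to_iso_def)
      moreover have "has_type (\<sigma> i) (S j)" unfolding ij(3) by (rule \<sigma>[OF ij(2)])
      ultimately show False using same_type_iso[OF simple[OF ij(1)] \<sigma>[OF ij(1)] simple[OF ij(2)]] by simp
    qed
  qed
  show ?thesis by (rule grass_top_iso[OF assms(5-9)])
qed

end
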